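(* For positive integers $m>n$, the tableaux algebra $\mathcal{T}_{n,m}$ is a flat degeneration of $\bigoplus_{\underline a}\Gamma(SL_m/Q_{n,m},L^{\underline a})$.
   Context: Let $\mathbb{K}$ be an algebraically closed field of characteristic zero. A semistandard Young tableau of partition shape $\lambda$ is a filling of the Ferrers diagram of $\lambda$ (English notation) with positive integers, strictly increasing down columns and weakly increasing from left to right along rows. For positive integers $m\ge n$, $\mathrm{SSYT}_m^n$ denotes the set of all semistandard Young tableaux of all partition shapes with at most $n$ rows and with entries in $\{1,\dots,m\}$ (including the empty tableau $\emptyset$). For $T$ of shape $\lambda$ and $T'$ of shape $\mu$, $T\star T'$ is the semistandard Young tableau of shape $\lambda+\mu$ obtained by horizontally concatenating the rows of $T$ and $T'$ and sorting the entries in each row in weakly increasing order. $(\mathrm{SSYT}_m^n,\star,\emptyset)$ is a commutative monoid, and the tableaux algebra $\mathcal{T}_{n,m}$ is its monoid algebra over $\mathbb{K}$. For $1\le k<m$ let $P_k\subset SL_m$ (over $\mathbb{K}$) be the maximal parabolic subgroup of block upper triangular matrices $(M_{i,j})$ with $M_{i,j}=0$ for all $k<i\le m$, $1\le j\le k$. For $n<m$ let $Q_{n,m}=\bigcap_{k=1}^nP_k$, so $SL_m/Q_{n,m}$ is the partial flag variety $\{0\subsetneq V_1\subsetneq\cdots\subsetneq V_n\subsetneq\mathbb{K}^m\mid\dim V_i=i\}$. Let $L_k$ be the ample generator of $\mathrm{Pic}(SL_m/P_k)$ (pulled back to $SL_m/Q_{n,m}$), and for $\underline a=(a_1,\dots,a_n)\in\mathbb{Z}_{\ge0}^n$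 let $L^{\underline a}=L_1^{a_1}\otimes\cdots\otimes L_n^{a_n}$. The direct sum of global sections runs over $\underline a\in\mathbb{Z}_{\ge0}^n$ and is a $\mathbb{K}$-algebra under multiplication of sections. Given a one-parameter flat family, the special fiber is called a flat degeneration of the generic fiber. *)

theory Defs
  imports
    "HOL-Analysis.Abstract_Topology"
    "HOL-Library.Poly_Mapping"
    "HOL-Computational_Algebra.Fraction_Field"
    "HOL-Algebra.UnivPoly"
    "HOL-Algebra.Generated_Rings"
    "HOL-Algebra.Algebraic_Closure_Type"
    "Jordan_Normal_Form.Determinant"
begin

section \<open>The tableaux algebra\<close>

text \<open>A tableau is the list of its rows, from top to bottom; entries start at 1.\<close>

definition SSYT :: "nat \<Rightarrow> nat \<Rightarrow> nat list list set" where
  "SSYT n m = {T. length T \<le> n \<and>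
     (\<forall>r\<in>set T. r \<noteq> [] \<and> sorted r \<and> set r \<subseteq> {1..m}) \<and>
     (\<forall>i. Suc i < length T \<longrightarrow>
        length (T ! Suc i) \<le> length (T ! i) \<and>
        (\<forall>j < length (T ! Suc i). T ! i ! j < T ! Suc i ! j))}"

definition tableau_row :: "nat list list \<Rightarrow> nat \<Rightarrow> nat list" where
  "tableau_row T i = (if i < length T then T ! i else [])"

definition star :: "nat list list \<Rightarrow> nat list list \<Rightarrow> nat list list" where
  "star T T' = map (\<lambda>i. sort (tableau_row T i @ tableau_row T' i)) [0..<max (length T) (length T')]"

definition SSYT_monoid :: "nat \<Rightarrow> nat \<Rightarrow> nat list list monoid" where
  "SSYT_monoid n m = \<lparr>carrier = SSYT n m, monoid.mult = star, one = []\<rparr>"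

definition monoid_algebra :: "'x monoid \<Rightarrow> ('a::field, 'x \<Rightarrow>\<^sub>0 'a) module" where
  "monoid_algebra G = \<lparr>
     carrier = {f. Poly_Mapping.keys f \<subseteq> carrier G},
     monoid.mult = (\<lambda>f g. \<Sum>x\<in>Poly_Mapping.keys f. \<Sum>y\<in>Poly_Mapping.keys g.
               Poly_Mapping.single (x \<otimes>\<^bsub>G\<^esub> y) (Poly_Mapping.lookup f x * Poly_Mapping.lookup g y)),
     one = Poly_Mapping.single \<one>\<^bsub>G\<^esub> 1,
     ring.zero = 0,
     ring.add = (+),
     module.smult = (\<lambda>c. Poly_Mapping.map ((*) c))\<rparr>"

definition tableaux_algebra :: "nat \<Rightarrow> nat \<Rightarrow> ('a::field, nat list list \<Rightarrow>\<^sub>0 'a) module" where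
  "tableaux_algebra n m = monoid_algebra (SSYT_monoid n m)"


section \<open>Varieties as spaces with functions\<close>

text \<open>
  A variety over the algebraically closed field \<open>'a\<close> is given by its set of closed points with the
  Zariski topology and, for each open \<open>U\<close>, the regular functions on \<open>U\<close>.  Functions are total in
  HOL: whether \<open>f\<close> belongs to \<open>regular Y U\<close> depends only on the values of \<open>f\<close> on \<open>U\<close>.
\<close>

record ('p, 'a) variety =
  zariski :: "'p topology"
  regular :: "'p set \<Rightarrow> ('p \<Rightarrow> 'a) set"

inductive_set polynomial_functions :: "('p \<Rightarrow> 'a::field) set \<Rightarrow> ('p \<Rightarrow> 'a) set"
  for coords where
  const: "(\<lambda>_. c) \<in> polynomial_functions coords"
| coord: "f \<in> coords \<Longrightarrow> f \<in> polynomial_functions coords"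
| add: "f \<in> polynomial_functions coords \<Longrightarrow> g \<in> polynomial_functions coords \<Longrightarrow>
    (\<lambda>x. f x + g x) \<in> polynomial_functions coords"
| mult: "f \<in> polynomial_functions coords \<Longrightarrow> g \<in> polynomial_functions coords \<Longrightarrow>
    (\<lambda>x. f x * g x) \<in> polynomial_functions coords"

text \<open>The structure induced on a closed subset \<open>Y\<close> of an affine space with coordinate functions
  \<open>coords\<close>: regular functions are locally quotients of polynomials.\<close>

definition zariski_topology :: "'p set \<Rightarrow> ('p \<Rightarrow> 'a::field) set \<Rightarrow> 'p topology" where
  "zariski_topology Y coords =
     topology_generated_by {{x\<in>Y. p x \<noteq> 0} |p. p \<in> polynomial_functions coords}"

definition affine_variety :: "'p set \<Rightarrow> ('p \<Rightarrow> 'a::field) set \<Rightarrow> ('p, 'a) variety" where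
  "affine_variety Y coords = \<lparr>
     zariski = zariski_topology Y coords,
     regular = (\<lambda>U. {f. \<forall>x\<in>U. \<exists>V. openin (zariski_topology Y coords) V \<and> x \<in> V \<and> V \<subseteq> U \<and>
        (\<exists>p\<in>polynomial_functions coords. \<exists>q\<in>polynomial_functions coords.
           \<forall>y\<in>V. q y \<noteq> 0 \<and> f y = p y / q y)})\<rparr>"

definition vec_coords :: "nat \<Rightarrow> ('a vec \<Rightarrow> 'a::field) set" where
  "vec_coords N = {\<lambda>v. v $ i |i. i < N}"

text \<open>An open subset is affine if, with the induced structure, it is isomorphic to a closed subset
  \<open>Z\<close> of some affine space.\<close>

definition affine_open :: "('p, 'a::field) variety \<Rightarrow> 'p set \<Rightarrow> bool" where
  "affine_open Y U \<longleftrightarrow> openin (zariski Y) U \<and>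
     (\<exists>N Z \<phi>. closedin (zariski (affine_variety (carrier_vec N) (vec_coords N))) Z \<and>
        homeomorphic_map (subtopology (zariski Y) U) (zariski (affine_variety Z (vec_coords N))) \<phi> \<and>
        (\<forall>V f. openin (zariski (affine_variety Z (vec_coords N))) V \<longrightarrow>
           (f \<in> regular (affine_variety Z (vec_coords N)) V \<longleftrightarrow>
            f \<circ> \<phi> \<in> regular Y {x\<in>U. \<phi> x \<in> V})))"


section \<open>Line bundles\<close>

text \<open>
  A line bundle is given by trivialisations over an open cover and its transition functions.  A
  section over \<open>Y\<close> is a family of regular functions \<open>s i\<close> on \<open>chart L i\<close> with
  \<open>s i = transition L i j * s j\<close> on overlaps.
\<close>

record ('i, 'p, 'a) line_bundle =
  chart :: "'i \<Rightarrow> 'p set"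
  transition :: "'i \<Rightarrow> 'i \<Rightarrow> 'p \<Rightarrow> 'a"

definition is_line_bundle :: "('p, 'a::field) variety \<Rightarrow> ('i, 'p, 'a) line_bundle \<Rightarrow> bool" where
  "is_line_bundle Y L \<longleftrightarrow>
     (\<forall>i. openin (zariski Y) (chart L i)) \<and> (\<Union>i. chart L i) = topspace (zariski Y) \<and>
     (\<forall>i j. transition L i j \<in> regular Y (chart L i \<inter> chart L j)) \<and>
     (\<forall>i j. \<forall>x\<in>chart L i \<inter> chart L j. transition L i j x \<noteq> 0) \<and>
     (\<forall>i j k. \<forall>x\<in>chart L i \<inter> chart L j \<inter> chart L k.
        transition L i j x * transition L j k x = transition L i k x)"

text \<open>An isomorphism is a family of units \<open>h i a\<close> on \<open>chart L i \<inter> chart M a\<close>, sending a section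
  \<open>t\<close> of \<open>M\<close> to the section \<open>s\<close> of \<open>L\<close> with \<open>s i = h i a * t a\<close>.\<close>

definition isomorphic_bundles ::
  "('p, 'a::field) variety \<Rightarrow> ('i, 'p, 'a) line_bundle \<Rightarrow> ('j, 'p, 'a) line_bundle \<Rightarrow> bool" where
  "isomorphic_bundles Y L M \<longleftrightarrow>
     (\<exists>h. (\<forall>i a. h i a \<in> regular Y (chart L i \<inter> chart M a)) \<and>
          (\<forall>i a. \<forall>x\<in>chart L i \<inter> chart M a. h i a x \<noteq> 0) \<and>
          (\<forall>i j a b. \<forall>x\<in>chart L i \<inter> chart L j \<inter> chart M a \<inter> chart M b.
             h i a x * transition M a b x = transition L i j x * h j b x))"

definition bundle_power :: "('i, 'p, 'a::field) line_bundle \<Rightarrow> int \<Rightarrow> ('i, 'p, 'a) line_bundle" where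
  "bundle_power L d = \<lparr>chart = chart L, transition = (\<lambda>i j x. transition L i j x powi d)\<rparr>"

definition bundle_pullback ::
  "('q, 'a) variety \<Rightarrow> ('q \<Rightarrow> 'p) \<Rightarrow> ('i, 'p, 'a) line_bundle \<Rightarrow> ('i, 'q, 'a) line_bundle" where
  "bundle_pullback Y \<phi> L = \<lparr>
     chart = (\<lambda>i. {y \<in> topspace (zariski Y). \<phi> y \<in> chart L i}),
     transition = (\<lambda>i j y. transition L i j (\<phi> y))\<rparr>"

text \<open>\<open>L\<^sub>1\<^bsup>a\<^sub>1\<^esup> \<otimes> \<dots> \<otimes> L\<^sub>n\<^bsup>a\<^sub>n\<^esup>\<close>, trivialised over the intersections of one chart of each
  \<open>L\<^sub>k\<close>; only the values of the index \<open>\<iota>\<close> on \<open>{1..n}\<close> matter.  Assumes \<open>n > 0\<close>.\<close>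

definition bundle_monomial ::
  "nat \<Rightarrow> (nat \<Rightarrow> ('i, 'p, 'a::field) line_bundle) \<Rightarrow> (nat \<Rightarrow> nat) \<Rightarrow> (nat \<Rightarrow> 'i, 'p, 'a) line_bundle"
where
  "bundle_monomial n L a = \<lparr>
     chart = (\<lambda>\<iota>. \<Inter>k\<in>{1..n}. chart (L k) (\<iota> k)),
     transition = (\<lambda>\<iota> \<kappa> x. \<Prod>k\<in>{1..n}. transition (L k) (\<iota> k) (\<kappa> k) x ^ a k)\<rparr>"

text \<open>The local functions of a section are normalised to be zero outside their chart, so that
  sections are equal iff they are equal in HOL.\<close>

definition global_sections ::
  "('p, 'a::field) variety \<Rightarrow> ('i, 'p, 'a) line_bundle \<Rightarrow> ('i \<Rightarrow> 'p \<Rightarrow> 'a) set" where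
  "global_sections Y L = {s.
     (\<forall>i. s i \<in> regular Y (chart L i)) \<and>
     (\<forall>i x. x \<notin> chart L i \<longrightarrow> s i x = 0) \<and>
     (\<forall>i j. \<forall>x\<in>chart L i \<inter> chart L j. s i x = transition L i j x * s j x)}"

definition nonvanishing_locus ::
  "('i, 'p, 'a::field) line_bundle \<Rightarrow> ('i \<Rightarrow> 'p \<Rightarrow> 'a) \<Rightarrow> 'p set" where
  "nonvanishing_locus L s = {x. \<exists>i. x \<in> chart L i \<and> s i x \<noteq> 0}"

definition ample :: "('p, 'a::field) variety \<Rightarrow> ('i, 'p, 'a) line_bundle \<Rightarrow> bool" where
  "ample Y L \<longleftrightarrow> compact_space (zariski Y) \<and>
     (\<forall>x\<in>topspace (zariski Y). \<exists>d>0. \<exists>s\<in>global_sections Y (bundle_power L d).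
        x \<in> nonvanishing_locus (bundle_power L d) s \<and>
        affine_open Y (nonvanishing_locus (bundle_power L d) s))"

text \<open>Varieties are quasi-compact, so countably many charts suffice to represent every class in the
  Picard group; that the class of \<open>L\<close> generates it means that each class is a power of it.\<close>

definition generates_Pic :: "('p, 'a::field) variety \<Rightarrow> (nat, 'p, 'a) line_bundle \<Rightarrow> bool" where
  "generates_Pic Y L \<longleftrightarrow>
     (\<forall>M :: (nat, 'p, 'a) line_bundle. is_line_bundle Y M \<longrightarrow>
        (\<exists>d::int. isomorphic_bundles Y M (bundle_power L d)))"

definition ample_generator :: "('p, 'a::field) variety \<Rightarrow> (nat, 'p, 'a) line_bundle \<Rightarrow> bool" where
  "ample_generator Y L \<longleftrightarrow> is_line_bundle Y L \<and> ample Y L \<and> generates_Pic Y L"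

text \<open>The algebra \<open>\<Oplus>\<^sub>a \<Gamma>(Y, L\<^sub>1\<^bsup>a\<^sub>1\<^esup> \<otimes> \<dots> \<otimes> L\<^sub>n\<^bsup>a\<^sub>n\<^esup>)\<close>.  A multidegree is a function that is zero
  outside \<open>{1..n}\<close>; an element assigns a section to every multidegree, almost all of them zero.\<close>

definition multidegrees :: "nat \<Rightarrow> (nat \<Rightarrow> nat) set" where
  "multidegrees n = {a. \<forall>k. k \<notin> {1..n} \<longrightarrow> a k = 0}"

definition section_algebra ::
  "('p, 'a::field) variety \<Rightarrow> nat \<Rightarrow> (nat \<Rightarrow> ('i, 'p, 'a) line_bundle) \<Rightarrow>
   ('a, (nat \<Rightarrow> nat) \<Rightarrow> (nat \<Rightarrow> 'i) \<Rightarrow> 'p \<Rightarrow> 'a) module" where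
  "section_algebra Y n L = \<lparr>
     carrier = {F.
       (\<forall>a\<in>multidegrees n. F a \<in> global_sections Y (bundle_monomial n L a)) \<and>
       (\<forall>a. a \<notin> multidegrees n \<longrightarrow> F a = (\<lambda>_ _. 0)) \<and>
       finite {a. F a \<noteq> (\<lambda>_ _. 0)}},
     monoid.mult = (\<lambda>F G c \<iota> x. \<Sum>a | \<forall>k. a k \<le> c k. F a \<iota> x * G (\<lambda>k. c k - a k) \<iota> x),
     one = (\<lambda>a \<iota> x. if (\<forall>k. a k = 0) \<and> x \<in> chart (bundle_monomial n L a) \<iota> then 1 else 0),
     ring.zero = (\<lambda>_ _ _. 0),
     ring.add = (\<lambda>F G a \<iota> x. F a \<iota> x + G a \<iota> x),
     module.smult = (\<lambda>c F a \<iota> x. c * F a \<iota> x)\<rparr>"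


section \<open>Homogeneous spaces of the special linear group\<close>

definition SL :: "nat \<Rightarrow> 'a::field mat monoid" where
  "SL m = \<lparr>carrier = {A \<in> carrier_mat m m. det A = 1}, monoid.mult = (*), one = 1\<^sub>m m\<rparr>"

definition SL_variety :: "nat \<Rightarrow> ('a::field mat, 'a) variety" where
  "SL_variety m = affine_variety (carrier (SL m)) {\<lambda>A. A $$ (i, j) |i j. i < m \<and> j < m}"

text \<open>Matrix indices start at 0.\<close>

definition parabolic :: "nat \<Rightarrow> nat \<Rightarrow> 'a::field mat set" where
  "parabolic m k = {A \<in> carrier (SL m). \<forall>i j. k \<le> i \<and> i < m \<and> j < k \<longrightarrow> A $$ (i, j) = 0}"

definition flag_parabolic :: "nat \<Rightarrow> nat \<Rightarrow> 'a::field mat set" where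
  "flag_parabolic n m = (\<Inter>k\<in>{1..n}. parabolic m k)"

text \<open>The quotient variety of \<open>SL m\<close> by a closed subgroup \<open>H\<close>: its points are the left cosets; a
  set of cosets is open iff its preimage in \<open>SL m\<close> is, and a function is regular iff its pullback
  to \<open>SL m\<close> is.\<close>

definition coset_preimage :: "nat \<Rightarrow> 'a::field mat set \<Rightarrow> 'a mat set set \<Rightarrow> 'a mat set" where
  "coset_preimage m H U = {g \<in> carrier (SL m). g <#\<^bsub>SL m\<^esub> H \<in> U}"

definition SL_quotient :: "nat \<Rightarrow> 'a::field mat set \<Rightarrow> ('a mat set, 'a) variety" where
  "SL_quotient m H = \<lparr>
     zariski = topology (\<lambda>U. U \<subseteq> (\<lambda>g. g <#\<^bsub>SL m\<^esub> H) ` carrier (SL m) \<and>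
                             openin (zariski (SL_variety m)) (coset_preimage m H U)),
     regular = (\<lambda>U. {f. (\<lambda>g. f (g <#\<^bsub>SL m\<^esub> H)) \<in> regular (SL_variety m) (coset_preimage m H U)})\<rparr>"

lemma openin_SL_quotient:
  "openin (zariski (SL_quotient m H)) U \<longleftrightarrow>
     U \<subseteq> (\<lambda>g. g <#\<^bsub>SL m\<^esub> H) ` carrier (SL m) \<and>
     openin (zariski (SL_variety m)) (coset_preimage m H U)"
proof -
  have int: "coset_preimage m H (S \<inter> T) = coset_preimage m H S \<inter> coset_preimage m H T" for S T
    by (auto simp: coset_preimage_def)
  have un: "coset_preimage m H (\<Union>\<U>) = (\<Union>U\<in>\<U>. coset_preimage m H U)" for \<U>
    by (auto simp: coset_preimage_def)
  have "istopology (\<lambda>U. U \<subseteq> (\<lambda>g. g <#\<^bsub>SL m\<^esub> H) ` carrier (SL m) \<and>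
                        openin (zariski (SL_variety m)) (coset_preimage m H U))"
    unfolding istopology_def int un by blast
  then show ?thesis
    by (simp add: SL_quotient_def topology_inverse')
qed

text \<open>On \<open>SL\<^sub>m / Q\<^sub>n\<^sub>,\<^sub>m\<close> the bundle \<open>L k\<close> is pulled back along \<open>g Q \<mapsto> g Q P\<^sub>k = g P\<^sub>k\<close>.\<close>

definition flag_section_algebra ::
  "nat \<Rightarrow> nat \<Rightarrow> (nat \<Rightarrow> ('i, 'a::field mat set, 'a) line_bundle) \<Rightarrow>
   ('a, (nat \<Rightarrow> nat) \<Rightarrow> (nat \<Rightarrow> 'i) \<Rightarrow> 'a mat set \<Rightarrow> 'a) module" where
  "flag_section_algebra n m L =
     section_algebra (SL_quotient m (flag_parabolic n m)) n
       (\<lambda>k. bundle_pullback (SL_quotient m (flag_parabolic n m))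
              (\<lambda>C. C <#>\<^bsub>SL m\<^esub> parabolic m k) (L k))"


section \<open>Flat degenerations\<close>

abbreviation (input) ground_field :: "'a::field ring" where
  "ground_field \<equiv> ring_of_type_algebra"

abbreviation (input) base_ring :: "'a::field poly ring" where
  "base_ring \<equiv> ring_of_type_algebra"

abbreviation (input) base_function_field :: "'a::field poly fract ring" where
  "base_function_field \<equiv> ring_of_type_algebra"

definition isomorphic_algebras :: "'k ring \<Rightarrow> ('k, 'r) module \<Rightarrow> ('k, 's) module \<Rightarrow> bool" where
  "isomorphic_algebras K A B \<longleftrightarrow>
     (\<exists>\<phi>\<in>ring_iso A B. \<forall>c\<in>carrier K. \<forall>x\<in>carrier A. \<phi> (c \<odot>\<^bsub>A\<^esub> x) = c \<odot>\<^bsub>B\<^esub> \<phi> x)"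

definition finite_type_algebra :: "'k ring \<Rightarrow> ('k, 'r) module \<Rightarrow> bool" where
  "finite_type_algebra K A \<longleftrightarrow> Module.algebra K A \<and>
     (\<exists>S. finite S \<and> S \<subseteq> carrier A \<and>
        generate_ring A (S \<union> {c \<odot>\<^bsub>A\<^esub> \<one>\<^bsub>A\<^esub> |c. c \<in> carrier K}) = carrier A)"

text \<open>\<open>N \<otimes>\<^sub>R M\<close> is the free abelian group on \<open>N \<times> M\<close> modulo these relations.\<close>

inductive_set tensor_relations ::
  "'k ring \<Rightarrow> ('k, 'n) module \<Rightarrow> ('k, 'm) module \<Rightarrow> (('n \<times> 'm) \<Rightarrow>\<^sub>0 int) set"
  for R N M where
  zero: "0 \<in> tensor_relations R N M"
| diff: "u \<in> tensor_relations R N M \<Longrightarrow> v \<in> tensor_relations R N M \<Longrightarrow>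
    u - v \<in> tensor_relations R N M"
| add_left: "x \<in> carrier N \<Longrightarrow> x' \<in> carrier N \<Longrightarrow> y \<in> carrier M \<Longrightarrow>
    Poly_Mapping.single (x \<oplus>\<^bsub>N\<^esub> x', y) 1 - Poly_Mapping.single (x, y) 1
      - Poly_Mapping.single (x', y) 1 \<in> tensor_relations R N M"
| add_right: "x \<in> carrier N \<Longrightarrow> y \<in> carrier M \<Longrightarrow> y' \<in> carrier M \<Longrightarrow>
    Poly_Mapping.single (x, y \<oplus>\<^bsub>M\<^esub> y') 1 - Poly_Mapping.single (x, y) 1
      - Poly_Mapping.single (x, y') 1 \<in> tensor_relations R N M"
| balanced: "c \<in> carrier R \<Longrightarrow> x \<in> carrier N \<Longrightarrow> y \<in> carrier M \<Longrightarrow>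
    Poly_Mapping.single (c \<odot>\<^bsub>N\<^esub> x, y) 1 - Poly_Mapping.single (x, c \<odot>\<^bsub>M\<^esub> y) 1
      \<in> tensor_relations R N M"

text \<open>
  \<open>M\<close> is flat if \<open>N' \<otimes> M \<rightarrow> N \<otimes> M\<close> is injective for every submodule \<open>N'\<close> of a module \<open>N\<close>.  A
  definition in HOL can only quantify over modules with elements in a fixed type; the type of
  elements of \<open>R\<close> suffices, since already the submodules of \<open>R\<close> itself detect flatness.
\<close>

definition flat :: "'k ring \<Rightarrow> ('k, 'm) module \<Rightarrow> bool" where
  "flat R M \<longleftrightarrow> Module.module R M \<and>
     (\<forall>(N :: ('k, 'k) module) N'. Module.module R N \<and> submodule N' R N \<longrightarrow>
        (\<forall>z. Poly_Mapping.keys z \<subseteq> N' \<times> carrier M \<and> z \<in> tensor_relations R N M \<longrightarrow>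
             z \<in> tensor_relations R (N\<lparr>carrier := N'\<rparr>) M))"

text \<open>The fibre \<open>R / (t - c) R\<close> of a \<open>K[t]\<close>-algebra over a closed point \<open>c\<close> of the affine line.\<close>

definition fibre :: "'a::field \<Rightarrow> ('a poly, 'r) module \<Rightarrow> ('a, 'r set) module" where
  "fibre c R = (let I = PIdl\<^bsub>R\<^esub> ([:- c, 1:] \<odot>\<^bsub>R\<^esub> \<one>\<^bsub>R\<^esub>) in
     \<lparr>carrier = carrier (R Quot I), monoid.mult = monoid.mult (R Quot I), one = one (R Quot I),
      ring.zero = ring.zero (R Quot I), ring.add = ring.add (R Quot I),
      module.smult = (\<lambda>b C. \<Union>r\<in>C. I +>\<^bsub>R\<^esub> ([:b:] \<odot>\<^bsub>R\<^esub> r))\<rparr>)"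

text \<open>The fibre \<open>R \<otimes>\<^bsub>K[t]\<^esub> K(t)\<close> over the generic point, constructed as the localisation of \<open>R\<close> at
  the nonzero polynomials.\<close>

definition fraction :: "('a::field poly, 'r) module \<Rightarrow> 'r \<Rightarrow> 'a poly \<Rightarrow> ('r \<times> 'a poly) set" where
  "fraction R r p = {(r', p'). r' \<in> carrier R \<and> p' \<noteq> 0 \<and>
     (\<exists>u. u \<noteq> 0 \<and> u \<odot>\<^bsub>R\<^esub> (p' \<odot>\<^bsub>R\<^esub> r) = u \<odot>\<^bsub>R\<^esub> (p \<odot>\<^bsub>R\<^esub> r'))}"

definition generic_fibre ::
  "('a::field poly, 'r) module \<Rightarrow> ('a poly fract, ('r \<times> 'a poly) set) module" where
  "generic_fibre R = \<lparr>
     carrier = {fraction R r p |r p. r \<in> carrier R \<and> p \<noteq> 0},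
     monoid.mult = (\<lambda>C D. \<Union>(r, p)\<in>C. \<Union>(s, q)\<in>D. fraction R (r \<otimes>\<^bsub>R\<^esub> s) (p * q)),
     one = fraction R \<one>\<^bsub>R\<^esub> 1,
     ring.zero = fraction R \<zero>\<^bsub>R\<^esub> 1,
     ring.add = (\<lambda>C D. \<Union>(r, p)\<in>C. \<Union>(s, q)\<in>D.
              fraction R ((q \<odot>\<^bsub>R\<^esub> r) \<oplus>\<^bsub>R\<^esub> (p \<odot>\<^bsub>R\<^esub> s)) (p * q)),
     module.smult = (\<lambda>c C. \<Union>(r, p)\<in>C. \<Union>(a, b)\<in>{(a, b). b \<noteq> 0 \<and> c = Fract a b}.
                fraction R (a \<odot>\<^bsub>R\<^esub> r) (b * p))\<rparr>"

text \<open>The trivial family \<open>A \<otimes>\<^sub>K K[t] = A[t]\<close>.\<close>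

definition trivial_family :: "('a::field, 'r) module \<Rightarrow> ('a poly, nat \<Rightarrow> 'r) module" where
  "trivial_family A = \<lparr>
     carrier = carrier (UP A), monoid.mult = monoid.mult (UP A), one = one (UP A),
     ring.zero = ring.zero (UP A), ring.add = ring.add (UP A),
     module.smult = (\<lambda>p f k. \<Oplus>\<^bsub>A\<^esub>i\<in>{..k}. Polynomial.coeff p i \<odot>\<^bsub>A\<^esub> f (k - i))\<rparr>"

text \<open>
  \<open>B\<close> is a flat degeneration of \<open>A\<close> if there is a flat family of algebras over the affine line, of
  finite type, with special fibre \<open>B\<close> over \<open>0\<close> and generic fibre \<open>A\<close>.  ``Generic fibre \<open>A\<close>'' is
  taken in both common senses: the fibre over every closed point \<open>c \<noteq> 0\<close> is \<open>A\<close>, and the fibre over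
  the generic point is \<open>A \<otimes>\<^sub>K K(t)\<close>.  Every algebra of finite type over \<open>K[t]\<close> is a
  quotient of a polynomial ring over \<open>K\<close>, so up to isomorphism its elements are sets of polynomials
  over \<open>K\<close>; this fixes the type of the elements of the total space, but not its structure.
\<close>

definition flat_degeneration :: "('a::field, 'r) module \<Rightarrow> ('a, 's) module \<Rightarrow> bool" where
  "flat_degeneration A B \<longleftrightarrow>
     (\<exists>R :: ('a poly, ((nat \<Rightarrow>\<^sub>0 nat) \<Rightarrow>\<^sub>0 'a) set) module.
        finite_type_algebra base_ring R \<and> flat base_ring R \<and>
        isomorphic_algebras ground_field (fibre 0 R) B \<and>
        (\<forall>c. c \<noteq> 0 \<longrightarrow> isomorphic_algebras ground_field (fibre c R) A) \<and>
        isomorphic_algebras base_function_field (generic_fibre R) (generic_fibre (trivial_family A)))"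

end

theory Submission
 imports Defs "HOL-Algebra.Free_Abelian_Groups"
begin

text \<open>
 Both algebras are found inside the polynomial ring in the entries of an \<open>m \<times> n\<close> matrix: the section
 algebra as the span of products of minors, the tableaux algebra as the algebra of their leading terms.
 The degeneration is the Rees algebra of a filtration by weight.

 \<^emph>\<open>Sections.\<close>  Call functions \<open>\<theta>\<close> on the preimages in \<open>SL\<^sub>m\<close> of the charts of \<open>L\<^sub>k\<close> a frame if they have no
 zeros, satisfy the transition rule, and are multiplied by the character \<open>\<chi>\<^sub>k\<close> of \<open>P\<^sub>k\<close> (the upper left \<open>k \<times> k\<close>
 minor) under translation by \<open>P\<^sub>k\<close>.  Maximal minors of the first \<open>k\<close> columns define a bundle \<open>O(1)\<close> on
 \<open>SL\<^sub>m / P\<^sub>k\<close> that has a frame.  As \<open>L\<^sub>k\<close> generates the Picard group, \<open>O(1)\<close> is isomorphic to \<open>L\<^sub>k\<^bsup>d\<^esup>\<close> for some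
 \<open>d\<close>.  Along a line in \<open>SL\<^sub>m / P\<^sub>k\<close> all orders of vanishing of the frame are divisible by \<open>d\<close>, while they
 add up to 1; so \<open>d\<close> is a unit, and it is 1 because \<open>L\<^sub>k\<close> is ample (\<open>ample_generator_frame\<close>).  With these
 frames, sections of \<open>L\<^bsup>a\<^esup>\<close> become regular functions on \<open>SL\<^sub>m\<close> with \<open>f (g q) = \<Prod>\<^sub>k \<chi>\<^sub>k(q)\<^bsup>a k\<^esup> f g\<close> for \<open>q\<close> in
 \<open>Q\<^sub>n\<^sub>,\<^sub>m\<close>.

 \<^emph>\<open>Functions.\<close>  Such a function depends only on the first \<open>n\<close> columns.  It is locally a quotient of polynomials
 in their entries, defined wherever the columns are linearly independent.  Since \<open>n < m\<close>, the dependent ones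
 form a set of codimension at least two, so the function is a polynomial; \<open>locally_rational_polynomial\<close> shows
 this by removing the variables from a denominator one at a time.  Semi-invariance says that the polynomial is
 homogeneous in each column and invariant under adding a multiple of a column to the next one.

 \<^emph>\<open>Polynomials.\<close>  The lexicographically leading exponent of such an invariant satisfies inequalities
 (\<open>leading_exponent_interlaces\<close>) which say that it counts the entries in the rows of a semistandard tableau \<open>T\<close>
 (\<open>exponent_of_tableau\<close>).  The product of the minors given by the columns of \<open>T\<close> is an invariant with the same
 leading exponent.  Subtracting multiples of such products reduces every invariant to zero
 (\<open>flag_invariants_spanned\<close>), so the section algebra has a basis indexed by the tableaux.

 \<^emph>\<open>Degeneration.\<close>  The leading exponent turns \<open>\<star>\<close> into addition.  The leading monomial of each basis element is
 also the only one of maximal weight for a suitable weight of the variables.  Hence the graded algebra of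
 the filtration by weight is the tableaux algebra.  The Rees algebra is free over \<open>K[t]\<close>, with the basis
 elements multiplied by \<open>t\<close> to their weights as a basis; its fibre over 0 is the graded algebra and its
 other fibres are the section algebra (\<open>rees_flat_degeneration\<close>).
\<close>

section \<open>Polynomials in countably many variables\<close>

abbreviation keys :: "('b \<Rightarrow>\<^sub>0 'c::zero) => 'b set" where
 "keys \<equiv> Poly_Mapping.keys"

abbreviation lookup :: "('b \<Rightarrow>\<^sub>0 'c::zero) => 'b => 'c" where
 "lookup \<equiv> Poly_Mapping.lookup"

type_synonym 'a mpoly = "(nat \<Rightarrow>\<^sub>0 nat) \<Rightarrow>\<^sub>0 'a"

definition Const :: "'a::comm_ring_1 => 'a mpoly" where
 "Const c = Poly_Mapping.single 0 c"

definition Var :: "nat => 'a::comm_ring_1 mpoly" where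
 "Var v = Poly_Mapping.single (Poly_Mapping.single v 1) 1"

definition power_product :: "(nat => 'b::comm_ring_1) => (nat \<Rightarrow>\<^sub>0 nat) => 'b" where
 "power_product x \<beta> = (\<Prod>v\<in>keys \<beta>. x v ^ lookup \<beta> v)"

definition evaluate :: "('a::comm_ring_1 => 'b::comm_ring_1) => (nat => 'b) => 'a mpoly => 'b" where
 "evaluate h x P = (\<Sum>\<beta>\<in>keys P. h (lookup P \<beta>) * power_product x \<beta>)"

abbreviation eval :: "(nat => 'a::comm_ring_1) => 'a mpoly => 'a" where
 "eval \<equiv> evaluate (\<lambda>c. c)"

lemma power_product_superset:
 assumes "finite V" "keys \<beta> \<subseteq> V"
 shows "power_product x \<beta> = (\<Prod>v\<in>V. x v ^ lookup \<beta> v)"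
 unfolding power_product_def
 by (rule prod.mono_neutral_left[OF assms]) (auto simp: in_keys_iff)

lemma power_product_0 [simp]: "power_product x 0 = 1"
 by (simp add: power_product_def)

lemma power_product_add: "power_product x (\<beta> + \<gamma>) = power_product x \<beta> * power_product x \<gamma>"
proof -
 let ?V = "keys \<beta> \<union> keys \<gamma>"
 have "keys (\<beta> + \<gamma>) \<subseteq> ?V" by (rule Poly_Mapping.keys_add)
 then show ?thesis
  by (simp add: power_product_superset[of ?V] lookup_add power_add prod.distrib)
qed

lemma Const_hom: "comm_ring_hom (Const :: 'a::comm_ring_1 => 'a mpoly)"
 by unfold_locales (auto simp: Const_def single_add mult_single)

lemma Const_hom_simps [simp]:
 "Const 0 = 0" "Const 1 = 1" "Const (a + b) = Const a + Const b" "Const (a * b) = Const a * Const b"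
 by (auto simp: Const_def single_add mult_single)

lemma Const_minus [simp]: "Const (- a) = - Const a" "Const (a - b) = Const a - Const b"
 by (auto simp: Const_def single_uminus single_diff)

lemma Const_eq_0_iff [simp]: "Const c = 0 \<longleftrightarrow> c = 0"
 by (metis Const_def lookup_single_eq lookup_zero Const_hom_simps(1))

lemma Const_sum: "Const (sum f A) = (\<Sum>i\<in>A. Const (f i))"
 by (induction A rule: infinite_finite_induct) auto

lemma lookup_Const_mult [simp]: "lookup (Const c * P) \<beta> = c * lookup P \<beta>"
 unfolding Const_def mult_map_scale_conv_mult[symmetric]
 by (simp add: Poly_Mapping.map.rep_eq when_def)

lemma keys_nonempty: "P \<noteq> 0 ==> keys P \<noteq> {}"
 by (metis empty_iff in_keys_iff lookup_zero poly_mapping_eqI)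

lemma keys_Const_mult: "keys (Const c * P) \<subseteq> keys P"
 by (auto simp: in_keys_iff)

lemma mpoly_as_sum: "P = (\<Sum>\<beta>\<in>keys P. Poly_Mapping.single \<beta> (lookup P \<beta>))"
 by (rule poly_mapping_eqI)
  (auto simp: lookup_sum lookup_single when_def in_keys_iff sum.delta)

lemma evaluate_superset:
 assumes "h 0 = 0" "finite S" "keys P \<subseteq> S"
 shows "evaluate h x P = (\<Sum>\<beta>\<in>S. h (lookup P \<beta>) * power_product x \<beta>)"
 unfolding evaluate_def
 by (rule sum.mono_neutral_left) (use assms in \<open>auto simp: in_keys_iff\<close>)

lemma evaluate_single: "h 0 = 0 ==> evaluate h x (Poly_Mapping.single \<beta> c) = h c * power_product x \<beta>"
 by (subst evaluate_superset[of h "{\<beta>}"]) auto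

lemma evaluate_Const: "h 0 = 0 ==> evaluate h x (Const c) = h c"
 by (simp add: Const_def evaluate_single)

lemma evaluate_hom:
 assumes "comm_ring_hom h"
 shows "comm_ring_hom (evaluate h x)"
proof -
 interpret h: comm_ring_hom h by fact
 have add: "evaluate h x (P + Q) = evaluate h x P + evaluate h x Q" for P Q
 proof -
  let ?S = "keys P \<union> keys Q"
  have "keys (P + Q) \<subseteq> ?S" by (rule Poly_Mapping.keys_add)
  then show ?thesis
   by (simp add: evaluate_superset[of h ?S] lookup_add h.hom_add algebra_simps sum.distrib)
 qed
 have sum: "evaluate h x (sum f A) = (\<Sum>i\<in>A. evaluate h x (f i))" for f :: "'i => _" and A
  by (induction A rule: infinite_finite_induct) (auto simp: add, simp_all add: evaluate_def)
 have mult: "evaluate h x (P * Q) = evaluate h x P * evaluate h x Q" for P Q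
 proof -
  have "P * Q = (\<Sum>\<beta>\<in>keys P. \<Sum>\<gamma>\<in>keys Q. Poly_Mapping.single (\<beta> + \<gamma>) (lookup P \<beta> * lookup Q \<gamma>))"
   using arg_cong2[where f = "(*)", OF mpoly_as_sum[of P] mpoly_as_sum[of Q]]
   by (simp add: sum_product mult_single)
  then have "evaluate h x (P * Q) = (\<Sum>\<beta>\<in>keys P. \<Sum>\<gamma>\<in>keys Q.
    evaluate h x (Poly_Mapping.single (\<beta> + \<gamma>) (lookup P \<beta> * lookup Q \<gamma>)))"
   by (simp only: sum)
  also have "\<dots> = evaluate h x P * evaluate h x Q"
   unfolding evaluate_def[of h x P] evaluate_def[of h x Q]
   by (simp add: evaluate_single h.hom_mult power_product_add sum_product algebra_simps)
  finally show ?thesis .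
 qed
 show ?thesis
  by unfold_locales (auto simp: add mult, simp_all add: evaluate_def power_product_def h.hom_one)
qed

lemma evaluate_Var: "comm_ring_hom h ==> evaluate h x (Var v) = x v"
proof -
 assume "comm_ring_hom h"
 then interpret h: comm_ring_hom h .
 show ?thesis by (simp add: Var_def evaluate_single power_product_def)
qed

lemma hom_evaluate:
 assumes "comm_ring_hom \<phi>"
 shows "\<phi> (evaluate h x P) = evaluate (\<lambda>c. \<phi> (h c)) (\<lambda>v. \<phi> (x v)) P"
proof -
 interpret \<phi>: comm_ring_hom \<phi> by fact
 show ?thesis
  by (simp add: evaluate_def power_product_def \<phi>.hom_sum \<phi>.hom_mult \<phi>.hom_prod \<phi>.hom_power)
qed

lemma id_hom: "comm_ring_hom (\<lambda>c::'a::comm_ring_1. c)"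
 by unfold_locales auto

lemma eval_hom: "comm_ring_hom (eval x)"
 by (rule evaluate_hom[OF id_hom])

lemma eval_simps [simp]:
 "eval x (P + Q) = eval x P + eval x Q" "eval x (P * Q) = eval x P * eval x Q"
 "eval x 0 = 0" "eval x 1 = 1" "eval x (- P) = - eval x P" "eval x (P - Q) = eval x P - eval x Q"
 "eval x (Const c) = c" "eval x (Var v) = x v" "eval x (P ^ k) = eval x P ^ k"
proof -
 interpret h: comm_ring_hom "eval x" by (rule eval_hom)
 show "eval x (P + Q) = eval x P + eval x Q" "eval x (P * Q) = eval x P * eval x Q"
  "eval x 0 = 0" "eval x 1 = 1" "eval x (- P) = - eval x P" "eval x (P - Q) = eval x P - eval x Q"
  "eval x (P ^ k) = eval x P ^ k"
  by (auto simp: hom_distribs)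
qed (auto simp: evaluate_Const evaluate_Var id_hom)

lemma eval_sum: "eval x (sum f A) = (\<Sum>i\<in>A. eval x (f i))"
 by (induction A rule: infinite_finite_induct) auto

lemma eval_prod: "eval x (prod f A) = (\<Prod>i\<in>A. eval x (f i))"
 by (induction A rule: infinite_finite_induct) auto

lemma evaluate_Const_Var: "evaluate Const Var P = P"
proof -
 have pow: "(Var v :: 'a mpoly) ^ k = Poly_Mapping.single (Poly_Mapping.single v k) 1" for v k
  by (induction k) (auto simp: Var_def mult_single simp flip: single_add)
 have prod: "(\<Prod>v\<in>A. Poly_Mapping.single (f v) (1::'a)) = Poly_Mapping.single (sum f A) 1"
  for A and f :: "nat => nat \<Rightarrow>\<^sub>0 nat"
  by (induction A rule: infinite_finite_induct) (auto simp: mult_single)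
 have "\<beta> = (\<Sum>v\<in>keys \<beta>. Poly_Mapping.single v (lookup \<beta> v))" for \<beta> :: "nat \<Rightarrow>\<^sub>0 nat"
  by (rule poly_mapping_eqI)
   (auto simp: lookup_sum lookup_single when_def in_keys_iff sum.delta)
 then have "power_product Var \<beta> = Poly_Mapping.single \<beta> (1::'a)" for \<beta>
  by (simp add: power_product_def pow prod)
 then show ?thesis
  by (subst (3) mpoly_as_sum) (simp add: evaluate_def Const_def mult_single)
qed

text \<open>Over an infinite field, a vanishing polynomial identity in the variables \<open>V\<close> may be compared
 coefficient by coefficient.  The index set \<open>B\<close> may list the same exponent several times, and the
 weights may depend on further variables that are kept fixed.\<close>

lemma coefficient_comparison1:
 fixes w :: "'i => 'a::field_char_0" and e :: "'i => nat"
 assumes "finite B" "\<And>t. (\<Sum>\<beta>\<in>B. w \<beta> * t ^ e \<beta>) = 0"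
 shows "(\<Sum>\<beta>\<in>{\<beta>\<in>B. e \<beta> = k}. w \<beta>) = 0"
proof -
 let ?p = "\<Sum>\<beta>\<in>B. Polynomial.monom (w \<beta>) (e \<beta>)"
 have "poly ?p t = 0" for t
  using assms(2) by (simp add: poly_sum poly_monom)
 then have "?p = 0" using poly_all_0_iff_0 by blast
 then have "0 = Polynomial.coeff ?p k" by simp
 also have "\<dots> = (\<Sum>\<beta>\<in>B. if e \<beta> = k then w \<beta> else 0)"
  by (simp add: Polynomial.coeff_sum)
 finally show ?thesis
  using assms(1) by (simp add: sum.inter_filter)
qed

lemma coefficient_comparison:
 fixes w :: "'i => 'a::field_char_0" and e :: "'i => nat => nat"
 assumes "finite V" "finite B" "\<And>x. (\<Sum>\<beta>\<in>B. w \<beta> * (\<Prod>v\<in>V. x v ^ e \<beta> v)) = 0"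
 shows "(\<Sum>\<beta>\<in>{\<beta>\<in>B. \<forall>v\<in>V. e \<beta> v = \<rho> v}. w \<beta>) = 0"
 using assms
proof (induction V arbitrary: B rule: finite_induct)
 case empty
 then show ?case by simp
next
 case (insert v V)
 let ?B = "{\<beta>\<in>B. e \<beta> v = \<rho> v}"
 have "(\<Sum>\<beta>\<in>?B. w \<beta> * (\<Prod>u\<in>V. x u ^ e \<beta> u)) = 0" for x
 proof (rule coefficient_comparison1[OF insert.prems(1)])
  fix t
  have "(\<Prod>u\<in>V. (x(v := t)) u ^ e \<beta> u) = (\<Prod>u\<in>V. x u ^ e \<beta> u)" for \<beta>
   using insert.hyps by (intro prod.cong) auto
  then show "(\<Sum>\<beta>\<in>B. w \<beta> * (\<Prod>u\<in>V. x u ^ e \<beta> u) * t ^ e \<beta> v) = 0"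
   using insert.prems(2)[of "x(v := t)"] insert.hyps by (simp add: mult_ac)
 qed
 then have "(\<Sum>\<beta>\<in>{\<beta>\<in>?B. \<forall>u\<in>V. e \<beta> u = \<rho> u}. w \<beta>) = 0"
  using insert.prems(1) by (intro insert.IH) auto
 moreover have "{\<beta>\<in>?B. \<forall>u\<in>V. e \<beta> u = \<rho> u} = {\<beta>\<in>B. \<forall>u\<in>insert v V. e \<beta> u = \<rho> u}"
  by auto
 ultimately show ?case by simp
qed

lemma eval_eq_0_imp:
 fixes P :: "'a::field_char_0 mpoly"
 assumes "\<And>x. eval x P = 0"
 shows "P = 0"
proof (rule ccontr)
 assume "P \<noteq> 0"
 then obtain \<alpha> where \<alpha>: "\<alpha> \<in> keys P" using keys_nonempty by blast
 let ?V = "\<Union>(keys ` keys P)"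
 have V: "finite ?V" by auto
 have pp: "power_product x \<beta> = (\<Prod>v\<in>?V. x v ^ lookup \<beta> v)" if "\<beta> \<in> keys P" for x :: "nat => 'a" and \<beta>
  using that by (intro power_product_superset) auto
 have "(\<Sum>\<beta>\<in>keys P. lookup P \<beta> * (\<Prod>v\<in>?V. x v ^ lookup \<beta> v)) = 0" for x
  using assms[of x] by (simp add: evaluate_def pp cong: sum.cong)
 note coefficient_comparison[OF V finite_keys this, of "lookup \<alpha>"]
 moreover have "{\<beta> \<in> keys P. \<forall>v\<in>?V. lookup \<beta> v = lookup \<alpha> v} = {\<alpha>}"
 proof -
  have "\<beta> = \<alpha>" if "\<beta> \<in> keys P" "\<forall>v\<in>?V. lookup \<beta> v = lookup \<alpha> v" for \<beta>
  proof (rule poly_mapping_eqI)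
   fix v show "lookup \<beta> v = lookup \<alpha> v"
    using that \<alpha> by (cases "v \<in> ?V") (auto simp: in_keys_iff)
  qed
  then show ?thesis using \<alpha> by auto
 qed
 ultimately show False using \<alpha> by (simp add: in_keys_iff)
qed

text \<open>A principal open set is dense: multiplying the difference by \<open>R\<close> gives a polynomial without
 nonzero values.\<close>

lemma eval_eq_on_dense:
 fixes P Q R :: "'a::field_char_0 mpoly"
 assumes "R \<noteq> 0" "\<And>x. eval x R \<noteq> 0 ==> eval x P = eval x Q"
 shows "P = Q"
proof -
 have "(P - Q) * R = 0"
  by (rule eval_eq_0_imp) (use assms(2) in force)
 with assms(1) show ?thesis by simp
qed

text \<open>In characteristic zero the powers of 2 are distinct, so scaling the variables in \<open>W\<close> by 2 separates
 the monomials by their degree in these variables.\<close>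

lemma degree_by_scaling:
 fixes P :: "'a::field_char_0 mpoly"
 assumes W: "finite W"
  and scale: "\<And>x. eval (\<lambda>v. if v \<in> W then 2 * x v else x v) P = 2 ^ d * eval x P"
  and \<beta>: "\<beta> \<in> keys P"
 shows "(\<Sum>v\<in>W. lookup \<beta> v) = d"
proof -
 define Q where "Q = Poly_Mapping.mapp (\<lambda>\<gamma> c. c * (2 ^ (\<Sum>v\<in>W. lookup \<gamma> v) - 2 ^ d)) P"
 have lookup_Q: "lookup Q \<gamma> = lookup P \<gamma> * (2 ^ (\<Sum>v\<in>W. lookup \<gamma> v) - 2 ^ d)" for \<gamma>
  by (auto simp: Q_def lookup_mapp when_def in_keys_iff)
 have "eval x Q = 0" for x
 proof -
  have pp: "power_product (\<lambda>v. if v \<in> W then 2 * x v else x v) \<gamma> =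
    2 ^ (\<Sum>v\<in>W. lookup \<gamma> v) * power_product x \<gamma>" for \<gamma>
  proof -
   let ?V = "W \<union> keys \<gamma>"
   have "(\<Prod>v\<in>?V. (if v \<in> W then 2 * x v else x v) ^ lookup \<gamma> v) =
     (\<Prod>v\<in>?V. (if v \<in> W then 2 else 1) ^ lookup \<gamma> v) * (\<Prod>v\<in>?V. x v ^ lookup \<gamma> v)"
    by (simp flip: prod.distrib add: power_mult_distrib if_distrib[of "\<lambda>z. z ^ _"] cong: if_cong)
     (intro prod.cong, auto simp: power_mult_distrib)
   also have "(\<Prod>v\<in>?V. (if v \<in> W then 2 else 1::'a) ^ lookup \<gamma> v) = (\<Prod>v\<in>W. 2 ^ lookup \<gamma> v)"
    using W by (intro prod.mono_neutral_cong_right) auto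
   finally show ?thesis
    using W by (simp add: power_product_superset[of ?V] power_sum)
  qed
  have "eval x Q = (\<Sum>\<gamma>\<in>keys P. lookup Q \<gamma> * power_product x \<gamma>)"
   by (rule evaluate_superset) (auto simp: in_keys_iff lookup_Q)
  also have "\<dots> = eval (\<lambda>v. if v \<in> W then 2 * x v else x v) P - 2 ^ d * eval x P"
   by (simp add: evaluate_def lookup_Q pp sum_distrib_left flip: sum_subtractf)
    (intro sum.cong, auto simp: algebra_simps)
  finally show ?thesis using scale[of x] by simp
 qed
 then have "lookup Q \<beta> = 0" using eval_eq_0_imp[of Q] by simp
 then have "(2::'a) ^ (\<Sum>v\<in>W. lookup \<beta> v) = 2 ^ d"
  using \<beta> by (simp add: lookup_Q in_keys_iff)
 then have "(of_nat (2 ^ (\<Sum>v\<in>W. lookup \<beta> v)) :: 'a) = of_nat (2 ^ d)"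
  by simp
 then show ?thesis by (metis of_nat_eq_iff one_less_numeral_iff power_inject_exp semiring_norm(76))
qed

section \<open>Leading exponents of unipotent invariants\<close>

text \<open>The invariance under adding a multiple of one column to the next concerns two columns \<open>y\<close> and \<open>z\<close> at a
 time.  Polynomials in \<open>2 r\<close> variables are written as explicit sums of monomials, whose coefficients \<open>w\<close>
 absorb all other variables.\<close>

definition bimonomial :: "nat => (nat => nat) => (nat => nat) => (nat => 'a::comm_ring_1) => (nat => 'a) => 'a"
 where "bimonomial r a b y z = (\<Prod>i<r. y i ^ a i * z i ^ b i)"

lemma bimonomial_scale:
 "bimonomial r a b (\<lambda>i. s * y i) (\<lambda>i. t * z i) = s ^ sum a {..<r} * t ^ sum b {..<r} * bimonomial r a b y z"
 by (simp add: bimonomial_def power_mult_distrib prod.distrib power_sum mult_ac)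

lemma poly_eq_if_eq_nonzero:
 fixes p q :: "'a::field_char_0 poly"
 assumes "\<And>c. c \<noteq> 0 ==> poly p c = poly q c"
 shows "p = q"
proof -
 have "poly ((p - q) * [:0, 1:]) c = 0" for c
  using assms[of c] by (cases "c = 0") auto
 then have "(p - q) * [:0, 1:] = 0" using poly_all_0_iff_0 by blast
 then show ?thesis by simp
qed

text \<open>Suppose that \<open>h\<close> has degree \<open>d1\<close> in \<open>y\<close> and \<open>d2\<close> in \<open>z\<close>, and that \<open>h(y, z - \<tau> y)\<close> has degree at most
 \<open>k\<close> in \<open>\<tau>\<close>.  For \<open>y = u - c v\<close> homogeneity gives \<open>h(u - c v, u) = c\<^bsup>d2\<^esup> h(y, v + y/c)\<close>, a polynomial in
 \<open>c\<close> that is divisible by \<open>c\<^bsup>d2 - k\<^esup>\<close> and has degree at most \<open>d1\<close>.  It vanishes if \<open>d1 + k < d2\<close>.\<close>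

lemma shear_degree_bound:
 fixes w w' :: "'i => 'a::field_char_0"
 assumes fin: "finite H" "finite H'"
  and d1: "\<And>\<beta>. \<beta> \<in> H ==> sum (a \<beta>) {..<r} = d1"
  and d2: "\<And>\<beta>. \<beta> \<in> H ==> sum (b \<beta>) {..<r} = d2"
  and shear: "\<And>\<tau> y z. (\<Sum>\<beta>\<in>H. w \<beta> * bimonomial r (a \<beta>) (b \<beta>) y (\<lambda>i. z i - \<tau> * y i)) =
     (\<Sum>\<beta>\<in>H'. w' \<beta> * \<tau> ^ s \<beta> * bimonomial r (a' \<beta>) (b' \<beta>) y z)"
  and s: "\<And>\<beta>. \<beta> \<in> H' ==> s \<beta> \<le> k"
  and k: "d1 + k < d2"
 shows "(\<Sum>\<beta>\<in>H. w \<beta> * bimonomial r (a \<beta>) (b \<beta>) y z) = 0"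
proof -
 let ?h = "\<lambda>y z. \<Sum>\<beta>\<in>H. w \<beta> * bimonomial r (a \<beta>) (b \<beta>) y z"
 have zero: "?h (\<lambda>i. u i - v i) u = 0" for u v :: "nat => 'a"
 proof -
  define L where "L = (\<Sum>\<beta>\<in>H. smult (w \<beta>) (\<Prod>i<r. [:u i, - v i:] ^ a \<beta> i * [:u i ^ b \<beta> i:]))"
  define R where "R = (\<Sum>\<beta>\<in>H'. smult (w' \<beta> * (-1) ^ s \<beta>)
   (Polynomial.monom 1 (k - s \<beta>) * (\<Prod>i<r. [:u i, - v i:] ^ a' \<beta> i * [:v i ^ b' \<beta> i:])))"
  have L: "poly L c = ?h (\<lambda>i. u i - c * v i) u" for c
   by (simp add: L_def poly_sum poly_prod bimonomial_def algebra_simps)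
  have R: "poly R c * c ^ (d2 - k) = c ^ d2 * (\<Sum>\<beta>\<in>H'. w' \<beta> * (- (1 / c)) ^ s \<beta> *
    bimonomial r (a' \<beta>) (b' \<beta>) (\<lambda>i. u i - c * v i) v)" if "c \<noteq> 0" for c
  proof -
   have "c ^ d2 * (w' \<beta> * (- (1 / c)) ^ s \<beta>) = (w' \<beta> * (-1) ^ s \<beta>) * c ^ (k - s \<beta>) * c ^ (d2 - k)"
    if \<beta>: "\<beta> \<in> H'" for \<beta>
   proof -
    have "d2 = (k - s \<beta>) + (d2 - k) + s \<beta>" using s[OF \<beta>] k by simp
    then have "c ^ d2 = c ^ (k - s \<beta>) * c ^ (d2 - k) * c ^ s \<beta>"
     by (metis power_add)
    moreover have "(- (1 / c)) ^ s \<beta> * c ^ s \<beta> = (-1) ^ s \<beta>"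
     using that \<open>c \<noteq> 0\<close> by (simp flip: power_mult_distrib)
    ultimately show ?thesis by (simp add: mult_ac)
   qed
   then show ?thesis
    unfolding R_def poly_sum sum_distrib_left sum_distrib_right
    by (intro sum.cong refl)
     (simp add: poly_prod poly_monom bimonomial_def algebra_simps, metis mult.assoc mult.commute)
  qed
  have "L = R * Polynomial.monom 1 (d2 - k)"
  proof (rule poly_eq_if_eq_nonzero)
   fix c :: 'a assume c: "c \<noteq> 0"
   let ?y = "\<lambda>i. u i - c * v i"
   have "?h ?y (\<lambda>i. c * (v i - (- (1 / c)) * ?y i)) = c ^ d2 * ?h ?y (\<lambda>i. v i - (- (1 / c)) * ?y i)"
    unfolding sum_distrib_left
   proof (intro sum.cong refl)
    fix \<beta> assume "\<beta> \<in> H"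
    then show "w \<beta> * bimonomial r (a \<beta>) (b \<beta>) ?y (\<lambda>i. c * (v i - (- (1 / c)) * ?y i)) =
      c ^ d2 * (w \<beta> * bimonomial r (a \<beta>) (b \<beta>) ?y (\<lambda>i. v i - (- (1 / c)) * ?y i))"
     using bimonomial_scale[of r "a \<beta>" "b \<beta>" 1 ?y c] d2 by simp
   qed
   moreover have "(\<lambda>i. c * (v i - (- (1 / c)) * ?y i)) = u"
    using c by (auto simp: field_simps)
   ultimately have "?h ?y u = c ^ d2 * ?h ?y (\<lambda>i. v i - (- (1 / c)) * ?y i)" by simp
   then show "poly L c = poly (R * Polynomial.monom 1 (d2 - k)) c"
    unfolding L shear using R[OF c] by (simp add: poly_monom)
  qed
  moreover have "degree L \<le> d1"
   unfolding L_def
  proof (intro degree_sum_le fin order.trans[OF degree_smult_le])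
   fix \<beta> assume \<beta>: "\<beta> \<in> H"
   have "degree (\<Prod>i<r. [:u i, - v i:] ^ a \<beta> i * [:u i ^ b \<beta> i:]) \<le>
     (\<Sum>i<r. degree ([:u i, - v i:] ^ a \<beta> i * [:u i ^ b \<beta> i:]))"
    using degree_prod_sum_le[of "{..<r}" "\<lambda>i. [:u i, - v i:] ^ a \<beta> i * [:u i ^ b \<beta> i:]"]
    by (simp only: comp_def finite_lessThan)
   also have "\<dots> \<le> (\<Sum>i<r. a \<beta> i)"
   proof (intro sum_mono)
    fix i
    have "degree ([:u i, - v i:] ^ a \<beta> i) \<le> degree [:u i, - v i:] * a \<beta> i" by (rule degree_power_le)
    also have "\<dots> \<le> a \<beta> i" by simp
    finally show "degree ([:u i, - v i:] ^ a \<beta> i * [:u i ^ b \<beta> i:]) \<le> a \<beta> i"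
     using order.trans[OF degree_mult_le[of "[:u i, - v i:] ^ a \<beta> i" "[:u i ^ b \<beta> i:]"]] by simp
   qed
   finally show "degree (\<Prod>i<r. [:u i, - v i:] ^ a \<beta> i * [:u i ^ b \<beta> i:]) \<le> d1"
    using d1[OF \<beta>] by simp
  qed
  ultimately have "R = 0"
   using k by (cases "R = 0") (auto simp: degree_mult_eq degree_monom_eq)
  then have "L = 0" using \<open>L = R * _\<close> by simp
  then show ?thesis using L[of 1] by simp
 qed
 show ?thesis using zero[of z "\<lambda>i. z i - y i"] by simp
qed

text \<open>Splitting off the last row of two columns \<open>y\<close>, \<open>z\<close>.  The terms of highest degree \<open>b0\<close> in \<open>z\<^sub>r\<close> and then
 of degree \<open>a0\<close> in \<open>y\<^sub>r\<close> inherit the invariance.  For the inequality put \<open>z\<^sub>r = \<tau> y\<^sub>r\<close> and subtract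
 \<open>\<tau> y\<close> from \<open>z\<close>, which makes the last entry of \<open>z\<close> zero.  The coefficient of \<open>y\<^sub>r\<^bsup>a0 + b0\<^esup>\<close> has degree at most
 \<open>b0\<close> in \<open>\<tau>\<close> before the subtraction, and after it has the form \<open>h(y, z - \<tau> y)\<close>, with \<open>h\<close> of degree
 \<open>A - a0 - b0\<close> in \<open>y\<close> and \<open>B\<close> in \<open>z\<close>.  So \<open>A < B + a0\<close> would force \<open>h = 0\<close> by the previous lemma.\<close>

lemma shear_invariant_leading:
 fixes w :: "'i => 'a::field_char_0" and a b :: "'i => nat => nat" and a0 b0 :: nat
 assumes fin: "finite H"
  and inv: "\<And>y z c. (\<Sum>\<beta>\<in>H. w \<beta> * bimonomial (Suc r) (a \<beta>) (b \<beta>) y (\<lambda>i. z i + c * y i)) =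
     (\<Sum>\<beta>\<in>H. w \<beta> * bimonomial (Suc r) (a \<beta>) (b \<beta>) y z)"
  and max_b: "\<And>\<beta>. \<beta> \<in> H ==> b \<beta> r \<le> b0"
 defines "H0 \<equiv> {\<beta>\<in>H. b \<beta> r = b0 \<and> a \<beta> r = a0}"
 shows "(\<Sum>\<beta>\<in>H0. w \<beta> * bimonomial r (a \<beta>) (b \<beta>) y (\<lambda>i. z i + c * y i)) =
     (\<Sum>\<beta>\<in>H0. w \<beta> * bimonomial r (a \<beta>) (b \<beta>) y z)" (is ?step)
  and "[|\<And>\<beta>. \<beta> \<in> H ==> sum (a \<beta>) {..r} = A; \<And>\<beta>. \<beta> \<in> H ==> sum (b \<beta>) {..r} = B;
   (\<Sum>\<beta>\<in>H0. w \<beta> * bimonomial r (a \<beta>) (b \<beta>) y0 z0) \<noteq> 0;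
   \<And>\<beta>. \<beta> \<in> H ==> b \<beta> r = b0 ==> a \<beta> r \<le> a0|] ==> B + a0 \<le> A"
proof -
 have bi: "bimonomial (Suc r) a b y z = bimonomial r a b y z * (y r ^ a r * z r ^ b r)"
  for a b and y z :: "nat => 'a"
  by (simp add: bimonomial_def)
 have upd: "bimonomial r a b (y(r := s)) z = bimonomial r a b y z"
  "bimonomial r a b y (z(r := s)) = bimonomial r a b y z" for a b s and y z :: "nat => 'a"
  by (simp_all add: bimonomial_def)
 have upd': "bimonomial r a b y (\<lambda>i. (if i = r then s else z i) + c * (if i = r then t else y i)) = bimonomial r a b y (\<lambda>i. z i + c * y i)"
  for a b s t c and y z :: "nat => 'a"
  by (simp add: bimonomial_def)
 have "(\<Sum>\<beta>\<in>{\<beta>\<in>H. b \<beta> r = b0}. w \<beta> * (bimonomial r (a \<beta>) (b \<beta>) y (\<lambda>i. z i + c * y i)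
   - bimonomial r (a \<beta>) (b \<beta>) y z) * s ^ a \<beta> r) = 0" for s
 proof -
  define p where "p = (\<Sum>\<beta>\<in>H. smult (w \<beta> * bimonomial r (a \<beta>) (b \<beta>) y (\<lambda>i. z i + c * y i) * s ^ a \<beta> r)
    ([:c * s, 1:] ^ b \<beta> r))"
  define q where "q = (\<Sum>\<beta>\<in>H. Polynomial.monom (w \<beta> * bimonomial r (a \<beta>) (b \<beta>) y z * s ^ a \<beta> r) (b \<beta> r))"
  have "poly p t = poly q t" for t
   using inv[of "y(r := s)" "z(r := t)" c]
   by (simp add: p_def q_def poly_sum poly_monom bi upd upd' algebra_simps)
  then have "p = q" using poly_eq_poly_eq_iff by blast
  have top: "Polynomial.coeff ([:c * s, 1:] ^ e) b0 = (if e = b0 then 1 else 0)" if "e \<le> b0" for e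
  proof -
   have deg: "degree ([:c * s, 1:] ^ e) = e" by (simp add: degree_power_eq)
   moreover have "lead_coeff ([:c * s, 1:] ^ e) = 1" by (simp add: lead_coeff_power)
   ultimately show ?thesis using that by (auto simp: coeff_eq_0)
  qed
  have "Polynomial.coeff p b0 = (\<Sum>\<beta>\<in>H. if b \<beta> r = b0 then
    w \<beta> * bimonomial r (a \<beta>) (b \<beta>) y (\<lambda>i. z i + c * y i) * s ^ a \<beta> r else 0)"
   unfolding p_def Polynomial.coeff_sum using top max_b by (intro sum.cong) auto
  moreover have "Polynomial.coeff q b0 = (\<Sum>\<beta>\<in>H. if b \<beta> r = b0 then
    w \<beta> * bimonomial r (a \<beta>) (b \<beta>) y z * s ^ a \<beta> r else 0)"
   by (simp add: q_def Polynomial.coeff_sum)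
  moreover have "(\<Sum>\<beta>\<in>{\<beta>\<in>H. b \<beta> r = b0}. w \<beta> * (bimonomial r (a \<beta>) (b \<beta>) y (\<lambda>i. z i + c * y i)
   - bimonomial r (a \<beta>) (b \<beta>) y z) * s ^ a \<beta> r) =
   (\<Sum>\<beta>\<in>H. if b \<beta> r = b0 then w \<beta> * bimonomial r (a \<beta>) (b \<beta>) y (\<lambda>i. z i + c * y i) * s ^ a \<beta> r else 0) -
   (\<Sum>\<beta>\<in>H. if b \<beta> r = b0 then w \<beta> * bimonomial r (a \<beta>) (b \<beta>) y z * s ^ a \<beta> r else 0)"
   using fin unfolding sum_subtractf[symmetric] sum.inter_filter[OF fin]
   by (intro sum.cong) (auto simp: algebra_simps)
  ultimately show ?thesis using \<open>p = q\<close> by simp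
 qed
 from coefficient_comparison1[OF _ this, of a0] fin
 have "(\<Sum>\<beta>\<in>{\<beta>\<in>{\<beta>\<in>H. b \<beta> r = b0}. a \<beta> r = a0}. w \<beta> * (bimonomial r (a \<beta>) (b \<beta>) y (\<lambda>i. z i + c * y i)
   - bimonomial r (a \<beta>) (b \<beta>) y z)) = 0" by simp
 moreover have "{\<beta>\<in>{\<beta>\<in>H. b \<beta> r = b0}. a \<beta> r = a0} = H0" by (auto simp: H0_def)
 ultimately show ?step by (simp add: algebra_simps sum_subtractf)

 assume A: "\<And>\<beta>. \<beta> \<in> H ==> sum (a \<beta>) {..r} = A" and B: "\<And>\<beta>. \<beta> \<in> H ==> sum (b \<beta>) {..r} = B"
  and nz: "(\<Sum>\<beta>\<in>H0. w \<beta> * bimonomial r (a \<beta>) (b \<beta>) y0 z0) \<noteq> 0"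
  and max_a: "\<And>\<beta>. \<beta> \<in> H ==> b \<beta> r = b0 ==> a \<beta> r \<le> a0"
 show "B + a0 \<le> A"
 proof (rule ccontr)
  assume neg: "\<not> B + a0 \<le> A"
  define k where "k = a0 + b0"
  define H1 where "H1 = {\<beta>\<in>H. b \<beta> r = 0 \<and> a \<beta> r = k}"
  define H2 where "H2 = {\<beta>\<in>H. a \<beta> r + b \<beta> r = k}"
  have shear: "(\<Sum>\<beta>\<in>H1. w \<beta> * bimonomial r (a \<beta>) (b \<beta>) y (\<lambda>i. z i - \<tau> * y i)) =
     (\<Sum>\<beta>\<in>H2. w \<beta> * \<tau> ^ b \<beta> r * bimonomial r (a \<beta>) (b \<beta>) y z)" for \<tau> y z
  proof -
   let ?l = "\<lambda>\<beta>. w \<beta> * bimonomial r (a \<beta>) (b \<beta>) y (\<lambda>i. z i - \<tau> * y i) * (if b \<beta> r = 0 then 1 else 0)"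
   let ?r = "\<lambda>\<beta>. w \<beta> * \<tau> ^ b \<beta> r * bimonomial r (a \<beta>) (b \<beta>) y z"
   define p where "p = (\<Sum>\<beta>\<in>H. Polynomial.monom (?l \<beta>) (a \<beta> r))"
   define q where "q = (\<Sum>\<beta>\<in>H. Polynomial.monom (?r \<beta>) (a \<beta> r + b \<beta> r))"
   have "poly p t = poly q t" for t
   proof -
    have 1: "bimonomial r a b y (\<lambda>i. (z(r := \<tau> * t)) i + - \<tau> * (y(r := t)) i)
     = bimonomial r a b y (\<lambda>i. z i - \<tau> * y i)" for a b
     by (simp add: bimonomial_def)
    have "poly p t = (\<Sum>\<beta>\<in>H. w \<beta> * bimonomial (Suc r) (a \<beta>) (b \<beta>) (y(r := t)) (\<lambda>i. (z(r := \<tau> * t)) i + - \<tau> * (y(r := t)) i))"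
     unfolding p_def poly_sum
     by (intro sum.cong refl) (simp only: bi upd 1, simp add: poly_monom)
    also have "\<dots> = (\<Sum>\<beta>\<in>H. w \<beta> * bimonomial (Suc r) (a \<beta>) (b \<beta>) (y(r := t)) (z(r := \<tau> * t)))"
     by (rule inv)
    also have "\<dots> = poly q t"
     unfolding q_def poly_sum
     by (intro sum.cong refl) (simp only: bi upd, simp add: poly_monom power_mult_distrib power_add)
    finally show ?thesis .
   qed
   then have "p = q" using poly_eq_poly_eq_iff by blast
   then have "Polynomial.coeff p k = Polynomial.coeff q k" by simp
   moreover have "Polynomial.coeff p k = (\<Sum>\<beta>\<in>H1. w \<beta> * bimonomial r (a \<beta>) (b \<beta>) y (\<lambda>i. z i - \<tau> * y i))"
    using fin by (auto simp: p_def H1_def Polynomial.coeff_sum sum.inter_filter intro!: sum.cong)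
   moreover have "Polynomial.coeff q k = (\<Sum>\<beta>\<in>H2. ?r \<beta>)"
    using fin by (auto simp: q_def H2_def Polynomial.coeff_sum sum.inter_filter intro!: sum.cong)
   ultimately show ?thesis by simp
  qed
  have split: "sum f {..r} = sum f {..<r} + f r" for f :: "nat => nat"
   by (simp flip: lessThan_Suc_atMost)
  have zero: "(\<Sum>\<beta>\<in>H1. w \<beta> * bimonomial r (a \<beta>) (b \<beta>) y z) = 0" for y z
  proof (cases "H1 = {}")
   case False
   then obtain \<beta> where "\<beta> \<in> H1" by blast
   then have "k \<le> A" using A[of \<beta>] split[of "a \<beta>"] by (simp add: H1_def)
   then have "A - k + b0 < B" using neg by (simp add: k_def)
   show ?thesis
   proof (rule shear_degree_bound[OF _ _ _ _ shear _ \<open>A - k + b0 < B\<close>])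
    show "finite H1" "finite H2" using fin by (auto simp: H1_def H2_def)
    show "sum (a \<beta>) {..<r} = A - k" if "\<beta> \<in> H1" for \<beta>
     using A[of \<beta>] split[of "a \<beta>"] that by (auto simp: H1_def)
    show "sum (b \<beta>) {..<r} = B" if "\<beta> \<in> H1" for \<beta>
     using B[of \<beta>] split[of "b \<beta>"] that by (auto simp: H1_def)
    show "b \<beta> r \<le> b0" if "\<beta> \<in> H2" for \<beta> using max_b that by (auto simp: H2_def)
   qed
  qed auto
  have "(\<Sum>\<beta>\<in>H2. w \<beta> * bimonomial r (a \<beta>) (b \<beta>) y0 z0 * \<tau> ^ b \<beta> r) = 0" for \<tau>
   using shear[of y0 z0 \<tau>] zero by (simp add: mult_ac)
  then have "(\<Sum>\<beta>\<in>{\<beta>\<in>H2. b \<beta> r = b0}. w \<beta> * bimonomial r (a \<beta>) (b \<beta>) y0 z0) = 0"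
   by (intro coefficient_comparison1) (use fin in \<open>auto simp: H2_def\<close>)
  moreover have "{\<beta>\<in>H2. b \<beta> r = b0} = H0"
   by (auto simp: H2_def H0_def k_def)
  ultimately show False using nz by simp
 qed
qed

text \<open>The entry in row \<open>i\<close> and column \<open>j\<close> of an \<open>m \<times> n\<close> matrix is the variable \<open>entry_var m n i j\<close>.  Rows
 and columns are numbered backwards: in the lexicographic order on exponents, the smallest variable
 is the most significant one, and this has to be the entry in the bottom right corner.\<close>

definition entry_var :: "nat => nat => nat => nat => nat" where
 "entry_var m n i j = (m - 1 - i) * n + (n - 1 - j)"

lemma entry_var_less:
 assumes "i < m" "i' < m" "j < n" "j' < n" "i' < i \<or> (i = i' \<and> j' < j)"
 shows "entry_var m n i j < entry_var m n i' j'"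
proof (cases "i' < i")
 case True
 then have "Suc (m - 1 - i) \<le> m - 1 - i'" using assms(1) by simp
 then have "Suc (m - 1 - i) * n \<le> (m - 1 - i') * n" by (rule mult_le_mono1)
 moreover have "n - 1 - j < n" using assms(3) by simp
 ultimately show ?thesis by (simp add: entry_var_def)
qed (use assms in \<open>auto simp: entry_var_def\<close>)

lemma entry_var_less_iff:
 assumes "i < m" "i' < m" "j < n" "j' < n"
 shows "entry_var m n i j < entry_var m n i' j' \<longleftrightarrow> i' < i \<or> (i = i' \<and> j' < j)"
proof
 assume less: "entry_var m n i j < entry_var m n i' j'"
 show "i' < i \<or> (i = i' \<and> j' < j)"
 proof (rule ccontr)
  assume "\<not> (i' < i \<or> (i = i' \<and> j' < j))"
  then have "(i = i' \<and> j = j') \<or> i < i' \<or> (i' = i \<and> j < j')" by auto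
  then show False
   using less entry_var_less[of i' m i j' n j] assms by auto
 qed
qed (rule entry_var_less[OF assms])

lemma entry_var_eq_iff [simp]:
 assumes "i < m" "i' < m" "j < n" "j' < n"
 shows "entry_var m n i j = entry_var m n i' j' \<longleftrightarrow> i = i' \<and> j = j'"
 using entry_var_less_iff[of i m i' j n j'] entry_var_less_iff[of i' m i j' n j] assms
 by (metis less_irrefl nat_neq_iff)

lemma entry_var_Suc: "Suc j < n ==> entry_var m n i j = Suc (entry_var m n i (Suc j))"
 by (simp add: entry_var_def)

text \<open>By the numbering of the entries, \<open>x (Suc v)\<close> is the entry to the left of the entry \<open>x v\<close>.\<close>

definition shear_column :: "nat => nat => nat => 'a => (nat => 'a::comm_ring_1) => nat => 'a" where
 "shear_column m n j c x = (\<lambda>v. if \<exists>i<m. v = entry_var m n i (Suc j) then x v + c * x (Suc v) else x v)"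

text \<open>All variables outside the two columns are frozen at their leading exponents, and the rows are split off from
 the last one upwards; \<open>shear_invariant_leading\<close> keeps the invariance until row \<open>r\<close> is reached and then
 gives the inequality.\<close>

lemma leading_exponent_interlaces:
 fixes P :: "'a::field_char_0 mpoly"
 assumes "P \<noteq> 0" and j: "Suc j < n" and r: "r < m"
  and inv: "\<And>x c. eval (shear_column m n j c x) P = eval x P"
  and deg: "\<And>\<beta>. \<beta> \<in> keys P ==> (\<Sum>i<m. lookup \<beta> (entry_var m n i j)) = d"
   "\<And>\<beta>. \<beta> \<in> keys P ==> (\<Sum>i<m. lookup \<beta> (entry_var m n i (Suc j))) = d'"
 shows "(\<Sum>i\<le>r. lookup (Max (keys P)) (entry_var m n i (Suc j))) \<le>
  (\<Sum>i<r. lookup (Max (keys P)) (entry_var m n i j))"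
proof -
 define \<alpha> where "\<alpha> = Max (keys P)"
 have \<alpha>: "\<alpha> \<in> keys P" and max: "\<And>\<beta>. \<beta> \<in> keys P ==> \<beta> \<le> \<alpha>"
  unfolding \<alpha>_def using keys_nonempty[OF \<open>P \<noteq> 0\<close>] by auto
 let ?y = "\<lambda>i. entry_var m n i j" and ?z = "\<lambda>i. entry_var m n i (Suc j)"
 define a b :: "(nat \<Rightarrow>\<^sub>0 nat) => nat => nat" where "a = (\<lambda>\<beta> i. lookup \<beta> (?y i))" and "b = (\<lambda>\<beta> i. lookup \<beta> (?z i))"
 define W where "W = ?y ` {..<m} \<union> ?z ` {..<m}"
 define V where "V = \<Union>(keys ` keys P) - W"
 define H where "H = (\<lambda>s. {\<beta>\<in>keys P. (\<forall>v\<in>V. lookup \<beta> v = lookup \<alpha> v) \<and>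
   (\<forall>i. s \<le> i \<and> i < m --> a \<beta> i = a \<alpha> i \<and> b \<beta> i = b \<alpha> i)})"
 have finV: "finite V" and finW: "finite W" by (auto simp: V_def W_def)
 have finH: "finite (H s)" for s by (simp add: H_def)
 have H_step: "H s = {\<beta>\<in>H (Suc s). b \<beta> s = b \<alpha> s \<and> a \<beta> s = a \<alpha> s}" if "s < m" for s
 proof -
  have "s \<le> i \<and> i < m \<longleftrightarrow> i = s \<or> (Suc s \<le> i \<and> i < m)" for i using that by auto
  then show ?thesis unfolding H_def by auto
 qed
 have below: "lookup \<beta> v = lookup \<alpha> v" if \<beta>: "\<beta> \<in> H (Suc s)" and s: "s < m" and v: "v < ?z s" for \<beta> s v
 proof (cases "v \<in> W")
  case True
  then obtain i where i: "i < m" "v = ?y i \<or> v = ?z i" by (auto simp: W_def)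
  then have "s < i" using v s j by (auto simp: entry_var_less_iff)
  then show ?thesis using \<beta> i by (auto simp: H_def a_def b_def)
 next
  case False
  then show ?thesis using \<beta> \<alpha> by (cases "v \<in> V") (auto simp: H_def V_def in_keys_iff)
 qed
 have max_b: "b \<beta> s \<le> b \<alpha> s" if "\<beta> \<in> H (Suc s)" "s < m" for \<beta> s
 proof (rule ccontr)
  assume "\<not> b \<beta> s \<le> b \<alpha> s"
  then have "\<alpha> < \<beta>" using below[OF that]
   by (auto simp: less_poly_mapping.rep_eq less_fun_def b_def intro!: exI[of _ "?z s"])
  then show False using max[of \<beta>] that by (auto simp: H_def)
 qed
 have max_a: "a \<beta> s \<le> a \<alpha> s" if "\<beta> \<in> H (Suc s)" "s < m" "b \<beta> s = b \<alpha> s" for \<beta> s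
 proof (rule ccontr)
  assume "\<not> a \<beta> s \<le> a \<alpha> s"
  moreover have "lookup \<beta> v = lookup \<alpha> v" if "v < ?y s" for v
   using below[OF \<open>\<beta> \<in> _\<close> \<open>s < m\<close>, of v] \<open>b \<beta> s = b \<alpha> s\<close> that j
   by (auto simp: entry_var_Suc b_def less_Suc_eq)
  ultimately have "\<alpha> < \<beta>"
   by (auto simp: less_poly_mapping.rep_eq less_fun_def a_def intro!: exI[of _ "?y s"])
  then show False using max[of \<beta>] that by (auto simp: H_def)
 qed
 let ?G = "\<lambda>s y z. \<Sum>\<beta>\<in>H s. lookup P \<beta> * bimonomial s (a \<beta>) (b \<beta>) y z"
 have inj: "inj_on ?y {..<m}" "inj_on ?z {..<m}" and disj: "?y ` {..<m} \<inter> ?z ` {..<m} = {}"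
  using j by (auto simp: inj_on_def)
 have pp: "power_product x \<beta> = bimonomial m (a \<beta>) (b \<beta>) (\<lambda>i. x (?y i)) (\<lambda>i. x (?z i)) *
   (\<Prod>v\<in>V. x v ^ lookup \<beta> v)" if "\<beta> \<in> keys P" for \<beta> and x :: "nat => 'a"
 proof -
  have sub: "keys \<beta> \<subseteq> W \<union> V" and "W \<inter> V = {}" using that by (auto simp: V_def)
  then have "power_product x \<beta> = (\<Prod>v\<in>W. x v ^ lookup \<beta> v) * (\<Prod>v\<in>V. x v ^ lookup \<beta> v)"
   using finV finW by (simp add: power_product_superset[OF _ sub] prod.union_disjoint)
  also have "(\<Prod>v\<in>W. x v ^ lookup \<beta> v) = bimonomial m (a \<beta>) (b \<beta>) (\<lambda>i. x (?y i)) (\<lambda>i. x (?z i))"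
   unfolding W_def using disj inj
   by (simp add: prod.union_disjoint prod.reindex bimonomial_def a_def b_def prod.distrib)
  finally show ?thesis .
 qed
 have Inv: "\<forall>y z c. ?G s y (\<lambda>i. z i + c * y i) = ?G s y z" if "s \<le> m" for s
  using that
 proof (induction rule: inc_induct)
  case base
  show ?case
  proof (intro allI)
   fix y z :: "nat => 'a" and c :: 'a
   have "(\<Sum>\<beta>\<in>keys P. (lookup P \<beta> * (bimonomial m (a \<beta>) (b \<beta>) y (\<lambda>i. z i + c * y i) -
     bimonomial m (a \<beta>) (b \<beta>) y z)) * (\<Prod>v\<in>V. x v ^ lookup \<beta> v)) = 0" for x
   proof -
    define x' where "x' v = (if v \<in> ?y ` {..<m} then y (inv_into {..<m} ?y v)
     else if v \<in> ?z ` {..<m} then z (inv_into {..<m} ?z v) else x v)" for v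
    have x': "x' (?y i) = y i" "x' (?z i) = z i" if "i < m" for i
     using that disj inv_into_f_f[OF inj(1), of i] inv_into_f_f[OF inj(2), of i]
     by (auto simp: x'_def)
    have V: "x' v = x v" "shear_column m n j c x' v = x v" if "v \<in> V" for v
     using that by (auto simp: x'_def V_def W_def shear_column_def)
    have sh: "shear_column m n j c x' (?y i) = y i" "shear_column m n j c x' (?z i) = z i + c * y i"
     if "i < m" for i
     using that x' j by (auto simp: shear_column_def simp flip: entry_var_Suc)
    have bi: "bimonomial m a' b' (\<lambda>i. x1 (?y i)) (\<lambda>i. x1 (?z i)) = bimonomial m a' b' y1 z1"
     if "\<And>i. i < m ==> x1 (?y i) = y1 i" "\<And>i. i < m ==> x1 (?z i) = z1 i" for a' b' x1 and y1 z1 :: "nat => 'a"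
     using that by (simp add: bimonomial_def)
    have "eval (shear_column m n j c x') P - eval x' P = 0" using inv by simp
    then show ?thesis
     unfolding evaluate_def
     by (simp add: pp bi[OF sh] bi[OF x'] V algebra_simps sum_subtractf cong: sum.cong)
   qed
   from coefficient_comparison[OF finV finite_keys this, of "lookup \<alpha>"]
   have "(\<Sum>\<beta>\<in>{\<beta>\<in>keys P. \<forall>v\<in>V. lookup \<beta> v = lookup \<alpha> v}. lookup P \<beta> *
    (bimonomial m (a \<beta>) (b \<beta>) y (\<lambda>i. z i + c * y i) - bimonomial m (a \<beta>) (b \<beta>) y z)) = 0" .
   moreover have "{\<beta>\<in>keys P. \<forall>v\<in>V. lookup \<beta> v = lookup \<alpha> v} = H m" by (auto simp: H_def)
   ultimately show "?G m y (\<lambda>i. z i + c * y i) = ?G m y z"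
    by (simp add: algebra_simps sum_subtractf)
  qed
 next
  case (step s)
  have inv': "?G (Suc s) y (\<lambda>i. z i + c * y i) = ?G (Suc s) y z" for y z c
   using step.IH by blast
  have "?G s y (\<lambda>i. z i + c * y i) = ?G s y z" for y z c
   unfolding H_step[OF step.hyps(2)]
   by (rule shear_invariant_leading(1)[OF finH inv']) (use max_b step.hyps in auto)
  then show ?case by blast
 qed
 have nz: "\<exists>y z. ?G s y z \<noteq> 0" if "s \<le> m" for s
 proof (rule ccontr)
  assume "\<not> ?thesis"
  then have zero: "?G s y z = 0" for y z by auto
  let ?W = "?y ` {..<s} \<union> ?z ` {..<s}"
  have "(\<Prod>v\<in>?W. x v ^ lookup \<beta> v) = bimonomial s (a \<beta>) (b \<beta>) (\<lambda>i. x (?y i)) (\<lambda>i. x (?z i))"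
   for x :: "nat => 'a" and \<beta>
  proof -
   have "inj_on ?y {..<s}" "inj_on ?z {..<s}" "?y ` {..<s} \<inter> ?z ` {..<s} = {}"
    using j that by (auto simp: inj_on_def)
   then show ?thesis
    by (simp add: prod.union_disjoint prod.reindex bimonomial_def a_def b_def prod.distrib)
  qed
  then have "(\<Sum>\<beta>\<in>H s. lookup P \<beta> * (\<Prod>v\<in>?W. x v ^ lookup \<beta> v)) = 0" for x
   using zero by simp
  from coefficient_comparison[OF _ finH this, of "lookup \<alpha>"]
  have "(\<Sum>\<beta>\<in>{\<beta>\<in>H s. \<forall>v\<in>?W. lookup \<beta> v = lookup \<alpha> v}. lookup P \<beta>) = 0" by simp
  moreover have "{\<beta>\<in>H s. \<forall>v\<in>?W. lookup \<beta> v = lookup \<alpha> v} = {\<alpha>}"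
  proof -
   have "\<beta> = \<alpha>" if \<beta>: "\<beta> \<in> H s" "\<forall>v\<in>?W. lookup \<beta> v = lookup \<alpha> v" for \<beta>
   proof (rule poly_mapping_eqI)
    fix v
    consider "v \<in> ?W" | i where "s \<le> i" "i < m" "v = ?y i \<or> v = ?z i" | "v \<in> V" | "v \<notin> W \<union> V"
    proof (cases "v \<in> W")
     case True
     then obtain i where "i < m" "v = ?y i \<or> v = ?z i" by (auto simp: W_def)
     then show ?thesis using that(1,2) by (cases "s \<le> i") auto
    qed (use that(3,4) in blast)
    then show "lookup \<beta> v = lookup \<alpha> v"
    proof cases
     case 2
     then show ?thesis using \<beta>(1) by (auto simp: H_def a_def b_def)
    next
     case 4
     then show ?thesis using \<beta>(1) \<alpha> by (auto simp: H_def V_def in_keys_iff)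
    qed (use \<beta> in \<open>auto simp: H_def\<close>)
   qed
   then show ?thesis using \<alpha> by (auto simp: H_def)
  qed
  ultimately show False using \<alpha> by (simp add: in_keys_iff)
 qed
 have tail: "(\<Sum>i<m. f i) = (\<Sum>i\<le>r. f i) + (\<Sum>i\<in>{r<..<m}. f i)" for f :: "nat => nat"
 proof -
  have "{..<m} = {..r} \<union> {r<..<m}" using r by auto
  then have "(\<Sum>i<m. f i) = sum f ({..r} \<union> {r<..<m})" by (rule arg_cong)
  also have "\<dots> = (\<Sum>i\<le>r. f i) + (\<Sum>i\<in>{r<..<m}. f i)" by (rule sum.union_disjoint) auto
  finally show ?thesis .
 qed
 obtain y0 z0 where nz0: "?G r y0 z0 \<noteq> 0" using nz[OF less_imp_le[OF r]] by blast
 have "(\<Sum>i\<le>r. b \<alpha> i) + a \<alpha> r \<le> (\<Sum>i\<le>r. a \<alpha> i)"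
 proof (rule shear_invariant_leading(2)[OF finH[of "Suc r"], where w="lookup P" and a=a and b=b and ?a0.0="a \<alpha> r"
    and ?b0.0="b \<alpha> r" and ?y0.0=y0 and ?z0.0=z0])
  show "?G (Suc r) y (\<lambda>i. z i + c * y i) = ?G (Suc r) y z" for y z c
   using Inv[of "Suc r"] r by auto
  show "(\<Sum>\<beta>\<in>{\<beta>\<in>H (Suc r). b \<beta> r = b \<alpha> r \<and> a \<beta> r = a \<alpha> r}. lookup P \<beta> * bimonomial r (a \<beta>) (b \<beta>) y0 z0) \<noteq> 0"
   using nz0 H_step[OF r] by simp
  fix \<beta> assume \<beta>: "\<beta> \<in> H (Suc r)"
  show "b \<beta> r \<le> b \<alpha> r" using max_b[OF \<beta> r] .
  show "b \<beta> r = b \<alpha> r ==> a \<beta> r \<le> a \<alpha> r" using max_a[OF \<beta> r] .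
  have "(\<Sum>i\<in>{r<..<m}. a \<beta> i) = (\<Sum>i\<in>{r<..<m}. a \<alpha> i)" "(\<Sum>i\<in>{r<..<m}. b \<beta> i) = (\<Sum>i\<in>{r<..<m}. b \<alpha> i)"
   using \<beta> by (auto simp: H_def intro!: sum.cong)
  moreover have "(\<Sum>i<m. a \<beta> i) = (\<Sum>i<m. a \<alpha> i)" "(\<Sum>i<m. b \<beta> i) = (\<Sum>i<m. b \<alpha> i)"
   using \<beta> \<alpha> deg by (auto simp: H_def a_def b_def)
  ultimately show "sum (a \<beta>) {..r} = (\<Sum>i\<le>r. a \<alpha> i)" "sum (b \<beta>) {..r} = (\<Sum>i\<le>r. b \<alpha> i)"
   unfolding tail by auto
 qed
 moreover have "(\<Sum>i\<le>r. a \<alpha> i) = (\<Sum>i<r. a \<alpha> i) + a \<alpha> r"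
  by (simp flip: lessThan_Suc_atMost)
 ultimately show ?thesis by (simp add: a_def b_def \<alpha>_def)
qed

section \<open>Semistandard tableaux and their exponents\<close>

text \<open>Strictly increasing columns become inequalities between numbers of entries, which add up when rows are
 merged.\<close>

lemma rows_strict_iff_counts:
 fixes r s :: "nat list"
 assumes "sorted r" "sorted s"
 shows "length s \<le> length r \<and> (\<forall>j<length s. r ! j < s ! j) \<longleftrightarrow>
  (\<forall>v. length (filter (\<lambda>e. e \<le> v) s) \<le> length (filter (\<lambda>e. e < v) r))"
proof
 assume strict: "length s \<le> length r \<and> (\<forall>j<length s. r ! j < s ! j)"
 show "\<forall>v. length (filter (\<lambda>e. e \<le> v) s) \<le> length (filter (\<lambda>e. e < v) r)"
 proof
  fix v
  have "{j. j < length s \<and> s ! j \<le> v} \<subseteq> {j. j < length r \<and> r ! j < v}"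
   using strict by (auto intro: less_le_trans)
  then show "length (filter (\<lambda>e. e \<le> v) s) \<le> length (filter (\<lambda>e. e < v) r)"
   unfolding length_filter_conv_card by (intro card_mono) auto
 qed
next
 assume counts: "\<forall>v. length (filter (\<lambda>e. e \<le> v) s) \<le> length (filter (\<lambda>e. e < v) r)"
 have "j < length r \<and> r ! j < s ! j" if j: "j < length s" for j
 proof (rule ccontr)
  assume neg: "\<not> (j < length r \<and> r ! j < s ! j)"
  have "{i. i < length r \<and> r ! i < s ! j} \<subseteq> {..<j}"
  proof
   fix i assume "i \<in> {i. i < length r \<and> r ! i < s ! j}"
   then have i: "i < length r" "r ! i < s ! j" by auto
   show "i \<in> {..<j}"
   proof (rule ccontr)
    assume "i \<notin> {..<j}"
    then have "r ! j \<le> r ! i" using sorted_nth_mono[OF assms(1), of j i] i by auto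
    then show False using neg i \<open>i \<notin> _\<close> by auto
   qed
  qed
  then have "length (filter (\<lambda>e. e < s ! j) r) \<le> j"
   unfolding length_filter_conv_card using card_mono[of "{..<j}"] by force
  moreover have "{..j} \<subseteq> {i. i < length s \<and> s ! i \<le> s ! j}"
   using j sorted_nth_mono[OF assms(2)] by auto
  then have "card {..j} \<le> card {i. i < length s \<and> s ! i \<le> s ! j}" by (intro card_mono) auto
  then have "Suc j \<le> length (filter (\<lambda>e. e \<le> s ! j) s)"
   by (simp add: length_filter_conv_card)
  ultimately show False using counts by (metis Suc_n_not_le_n le_trans)
 qed
 then show "length s \<le> length r \<and> (\<forall>j<length s. r ! j < s ! j)"
  by (metis not_less less_irrefl)
qed

lemma SSYT_iff:
 "T \<in> SSYT n m \<longleftrightarrow> length T \<le> n \<and> (\<forall>r\<in>set T. r \<noteq> [] \<and> sorted r \<and> set r \<subseteq> {1..m}) \<and>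
  (\<forall>i v. length (filter (\<lambda>e. e \<le> v) (tableau_row T (Suc i))) \<le> length (filter (\<lambda>e. e < v) (tableau_row T i)))"
proof -
 have "(\<forall>i. Suc i < length T --> length (T ! Suc i) \<le> length (T ! i) \<and>
    (\<forall>j < length (T ! Suc i). T ! i ! j < T ! Suc i ! j)) \<longleftrightarrow>
  (\<forall>i v. length (filter (\<lambda>e. e \<le> v) (tableau_row T (Suc i))) \<le> length (filter (\<lambda>e. e < v) (tableau_row T i)))"
  (is "(\<forall>i. ?l i) \<longleftrightarrow> (\<forall>i. ?r i)") if "\<forall>r\<in>set T. r \<noteq> [] \<and> sorted r \<and> set r \<subseteq> {1..m}"
 proof -
  have "?l i \<longleftrightarrow> ?r i" for i
  proof (cases "Suc i < length T")
   case True
   then have "sorted (T ! i)" "sorted (T ! Suc i)" using that by auto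
   from rows_strict_iff_counts[OF this] True show ?thesis by (simp add: tableau_row_def)
  next
   case False
   then show ?thesis by (simp add: tableau_row_def)
  qed
  then show ?thesis by auto
 qed
 then show ?thesis unfolding SSYT_def by blast
qed

lemma tableau_row_sorted: "T \<in> SSYT n m ==> sorted (tableau_row T i)"
 and tableau_row_entries: "T \<in> SSYT n m ==> set (tableau_row T i) \<subseteq> {1..m}"
 and tableau_row_nonempty: "T \<in> SSYT n m ==> tableau_row T i \<noteq> [] \<longleftrightarrow> i < length T"
 by (auto simp: SSYT_iff tableau_row_def)

lemma tableau_row_star: "tableau_row (star T T') i = sort (tableau_row T i @ tableau_row T' i)"
 by (auto simp: star_def tableau_row_def)

lemma length_filter_sort: "length (filter P (sort xs)) = length (filter P xs)"
proof -
 have "mset (filter P (sort xs)) = mset (filter P xs)" by simp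
 then show ?thesis by (metis size_mset)
qed

text \<open>The counting inequalities of the two tableaux add up to those of the product.\<close>

lemma star_closed:
 assumes T: "T \<in> SSYT n m" and T': "T' \<in> SSYT n m"
 shows "star T T' \<in> SSYT n m"
 unfolding SSYT_iff
proof (intro conjI ballI allI)
 show "length (star T T') \<le> n" using assms by (simp add: star_def SSYT_iff)
 fix r assume "r \<in> set (star T T')"
 then obtain i where i: "i < max (length T) (length T')" "r = sort (tableau_row T i @ tableau_row T' i)"
  by (auto simp: star_def)
 show "sorted r" using i by simp
 show "set r \<subseteq> {1..m}" using i tableau_row_entries[OF T] tableau_row_entries[OF T'] by auto
 have "tableau_row T i \<noteq> [] \<or> tableau_row T' i \<noteq> []"
  using i(1) tableau_row_nonempty[OF T, of i] tableau_row_nonempty[OF T', of i] by linarith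
 then have "set r \<noteq> {}" unfolding i(2) set_sort by simp
 then show "r \<noteq> []" by simp
next
 fix i v
 have "length (filter (\<lambda>e. e \<le> v) (tableau_row S (Suc i))) \<le> length (filter (\<lambda>e. e < v) (tableau_row S i))"
  if "S \<in> SSYT n m" for S using that by (simp add: SSYT_iff)
 from this[OF T] this[OF T']
 show "length (filter (\<lambda>e. e \<le> v) (tableau_row (star T T') (Suc i)))
  \<le> length (filter (\<lambda>e. e < v) (tableau_row (star T T') i))"
  by (simp add: tableau_row_star length_filter_sort)
qed

text \<open>The exponent of \<open>T\<close> counts how often the entry \<open>i + 1\<close> occurs in row \<open>j\<close>.\<close>

definition tableau_exponent :: "nat => nat => nat list list => nat \<Rightarrow>\<^sub>0 nat" where
 "tableau_exponent m n T =
  (\<Sum>j<n. \<Sum>e\<in>#mset (tableau_row T j). Poly_Mapping.single (entry_var m n (e - 1) j) 1)"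

lemma tableau_exponent_star:
 "tableau_exponent m n (star T T') = tableau_exponent m n T + tableau_exponent m n T'"
 by (simp add: tableau_exponent_def tableau_row_star sum.distrib)

lemma tableau_exponent_Nil: "tableau_exponent m n [] = 0"
 by (simp add: tableau_exponent_def tableau_row_def)

lemma lookup_sum_mset: "lookup (\<Sum>e\<in>#M. f e) v = (\<Sum>e\<in>#M. lookup (f e) v)"
 by (induction M) (auto simp: lookup_add)

lemma lookup_tableau_exponent:
 assumes T: "T \<in> SSYT n m" and "i < m" "j < n"
 shows "lookup (tableau_exponent m n T) (entry_var m n i j) = count (mset (tableau_row T j)) (Suc i)"
proof -
 have single: "lookup (Poly_Mapping.single (entry_var m n (e - 1) j') 1) (entry_var m n i j) =
   (if e = Suc i \<and> j' = j then 1 else 0 :: nat)" if "e \<in># mset (tableau_row T j')" "j' < n" for e j'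
 proof -
  have "1 \<le> e" "e \<le> m" using that tableau_row_entries[OF T, of j'] by auto
  then show ?thesis using assms that by (auto simp: lookup_single when_def)
 qed
 have "lookup (tableau_exponent m n T) (entry_var m n i j) =
  (\<Sum>j'<n. \<Sum>e\<in>#mset (tableau_row T j'). if e = Suc i \<and> j' = j then 1 else 0)"
  unfolding tableau_exponent_def lookup_sum lookup_sum_mset
  by (intro sum.cong refl arg_cong[where f = sum_mset] image_mset_cong single) auto
 also have "\<dots> = (\<Sum>j'<n. if j' = j then (\<Sum>e\<in>#mset (tableau_row T j). if e = Suc i then 1 else 0) else 0)"
  by (intro sum.cong) auto
 also have "\<dots> = (\<Sum>e\<in>#mset (tableau_row T j). if e = Suc i then 1 else 0)"
  using assms by simp
 also have "\<dots> = count (mset (tableau_row T j)) (Suc i)"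
 proof -
  have "(\<Sum>e\<in>#M. if e = Suc i then 1 else 0) = count M (Suc i)" for M by (induction M) auto
  then show ?thesis .
 qed
 finally show ?thesis .
qed

definition entry_vars :: "nat => nat => nat set" where
 "entry_vars m n = {entry_var m n i j |i j. i < m \<and> j < n}"

lemma entry_vars_eq: "entry_vars m n = (\<lambda>(i, j). entry_var m n i j) ` ({..<m} \<times> {..<n})"
 by (auto simp: entry_vars_def)

lemma finite_entry_vars [simp]: "finite (entry_vars m n)"
 by (simp add: entry_vars_eq)

lemma keys_tableau_exponent:
 assumes T: "T \<in> SSYT n m"
 shows "keys (tableau_exponent m n T) \<subseteq> entry_vars m n"
proof
 fix v assume v: "v \<in> keys (tableau_exponent m n T)"
 show "v \<in> entry_vars m n"
 proof (rule ccontr)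
  assume nv: "v \<notin> entry_vars m n"
  have z: "lookup (Poly_Mapping.single (entry_var m n (e - 1) j) (1::nat)) v = 0"
   if "j < n" "e \<in> set (tableau_row T j)" for j e
  proof -
   have "e - 1 < m" using tableau_row_entries[OF T, of j] that by fastforce
   then have "entry_var m n (e - 1) j \<in> entry_vars m n" using that by (auto simp: entry_vars_def)
   then show ?thesis using nv by (auto simp: lookup_single when_def)
  qed
  have "lookup (tableau_exponent m n T) v = 0"
   unfolding tableau_exponent_def lookup_sum lookup_sum_mset
   by (intro sum.neutral ballI) (use z in auto)
  then show False using v by (simp add: in_keys_iff)
 qed
qed

lemma mset_eq_of_counts:
 assumes "set xs \<subseteq> {1..m}" "set ys \<subseteq> {1..m}" "\<And>i. i < m ==> count (mset xs) (Suc i) = count (mset ys) (Suc i)"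
 shows "mset xs = mset ys"
proof (rule multiset_eqI)
 fix e
 show "count (mset xs) e = count (mset ys) e"
 proof (cases "e \<in> {1..m}")
  case True
  then show ?thesis using assms(3)[of "e - 1"] by auto
 next
  case False
  then have "e \<notin># mset xs" "e \<notin># mset ys" using assms(1,2) by auto
  then show ?thesis by (metis count_eq_zero_iff)
 qed
qed

lemma tableau_exponent_inj:
 assumes T: "T \<in> SSYT n m" and T': "T' \<in> SSYT n m"
  and eq: "tableau_exponent m n T = tableau_exponent m n T'"
 shows "T = T'"
proof -
 have row: "tableau_row T j = tableau_row T' j" for j
 proof (cases "j < n")
  case True
  have "mset (tableau_row T j) = mset (tableau_row T' j)"
  proof (rule mset_eq_of_counts)
   show "set (tableau_row T j) \<subseteq> {1..m}" "set (tableau_row T' j) \<subseteq> {1..m}"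
    using tableau_row_entries T T' by blast+
   fix i assume "i < m"
   then show "count (mset (tableau_row T j)) (Suc i) = count (mset (tableau_row T' j)) (Suc i)"
    using lookup_tableau_exponent[OF T, of i j] lookup_tableau_exponent[OF T', of i j] eq True by simp
  qed
  then show ?thesis
   using tableau_row_sorted[OF T] tableau_row_sorted[OF T'] by (metis properties_for_sort sorted_sort_id)
 next
  case False
  then show ?thesis using T T' by (auto simp: tableau_row_def SSYT_iff)
 qed
 have "i < length T \<longleftrightarrow> i < length T'" for i
  using tableau_row_nonempty[OF T] tableau_row_nonempty[OF T'] row by simp
 then have "length T = length T'" by (metis less_irrefl nat_neq_iff)
 moreover have "T ! i = T' ! i" if "i < length T" for i
  using row[of i] that \<open>length T = length T'\<close> by (simp add: tableau_row_def)
 ultimately show ?thesis by (rule nth_equalityI)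
qed

lemma length_filter_eq_sum_count:
 assumes "finite B"
 shows "length (filter (\<lambda>e. e \<in> B) xs) = (\<Sum>e\<in>B. count (mset xs) e)"
proof (induction xs)
 case (Cons x xs)
 have "(\<Sum>e\<in>B. count (mset (x # xs)) e) = (\<Sum>e\<in>B. count (mset xs) e + (if e = x then 1 else 0))"
  by (intro sum.cong) auto
 also have "\<dots> = (\<Sum>e\<in>B. count (mset xs) e) + (if x \<in> B then 1 else 0)"
  using assms by (simp add: sum.distrib)
 finally show ?case using Cons by simp
qed simp

text \<open>Row \<open>j\<close> of the tableau has as many entries \<open>i + 1\<close> as the exponent says; the inequalities are those of
 \<open>rows_strict_iff_counts\<close>.\<close>

lemma exponent_of_tableau:
 assumes keys: "keys \<alpha> \<subseteq> entry_vars m n"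
  and interlace: "\<And>j r. Suc j < n ==> r < m ==>
   (\<Sum>i\<le>r. lookup \<alpha> (entry_var m n i (Suc j))) \<le> (\<Sum>i<r. lookup \<alpha> (entry_var m n i j))"
 obtains T where "T \<in> SSYT n m" "tableau_exponent m n T = \<alpha>"
proof -
 define a where "a i j = lookup \<alpha> (entry_var m n i j)" for i j
 define row where "row j = concat (map (\<lambda>i. replicate (a i j) (Suc i)) [0..<m])" for j
 have sorted: "sorted (row j)" for j
 proof -
  have "sorted (concat (map (\<lambda>i. replicate (a i j) (Suc i)) [0..<k]))" for k
   by (induction k) (auto simp: sorted_append sorted_replicate)
  then show ?thesis by (simp add: row_def)
 qed
 have count: "count (mset (row j)) e = (if 1 \<le> e \<and> e \<le> m then a (e - 1) j else 0)" for e j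
 proof -
  have "count (mset (concat (map (\<lambda>i. replicate (a i j) (Suc i)) [0..<k]))) e =
    (if 1 \<le> e \<and> e \<le> k then a (e - 1) j else 0)" for k
   by (induction k) (auto simp: le_Suc_eq)
  then show ?thesis by (simp add: row_def)
 qed
 have set: "set (row j) \<subseteq> {1..m}" for j by (auto simp: row_def)
 have len: "length (filter (\<lambda>e. e \<le> v) (row j)) = (\<Sum>i<min v m. a i j)" for v j
 proof -
  have "length (filter (\<lambda>e. e \<le> v) (row j)) = length (filter (\<lambda>e. e \<in> {..v}) (row j))" by simp
  also have "\<dots> = (\<Sum>e\<in>{..v}. count (mset (row j)) e)" by (rule length_filter_eq_sum_count) simp
  also have "\<dots> = (\<Sum>e\<in>Suc ` {..<min v m}. count (mset (row j)) e)"
  proof (rule sum.mono_neutral_right)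
   show "\<forall>e\<in>{..v} - Suc ` {..<min v m}. count (mset (row j)) e = 0"
   proof
    fix e assume e: "e \<in> {..v} - Suc ` {..<min v m}"
    have "\<not> (1 \<le> e \<and> e \<le> m)"
    proof
     assume "1 \<le> e \<and> e \<le> m"
     then have "e = Suc (e - 1)" "e - 1 \<in> {..<min v m}" using e by auto
     then show False using e by blast
    qed
    then show "count (mset (row j)) e = 0" unfolding count by (rule if_not_P)
   qed
  qed auto
  also have "\<dots> = (\<Sum>i<min v m. a i j)" by (simp add: sum.reindex count)
  finally show ?thesis .
 qed
 have len': "length (filter (\<lambda>e. e < v) (row j)) = (\<Sum>i<min (v - 1) m. a i j)" for v j
 proof (cases v)
  case (Suc u)
  then show ?thesis using len[of u j] by (simp add: less_Suc_eq_le)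
 qed simp
 have dom: "length (filter (\<lambda>e. e \<le> v) (row (Suc j))) \<le> length (filter (\<lambda>e. e < v) (row j))" if "Suc j < n" for j v
 proof (cases "min v m = 0")
  case True
  then show ?thesis by (simp add: len)
 next
  case False
  then obtain r where r: "min v m = Suc r" by (cases "min v m") auto
  then have "(\<Sum>i<min v m. a i (Suc j)) \<le> (\<Sum>i<r. a i j)"
   using interlace[OF that, of r] by (simp add: a_def lessThan_Suc_atMost)
  also have "\<dots> \<le> (\<Sum>i<min (v - 1) m. a i j)" using r by (intro sum_mono2) auto
  finally show ?thesis by (simp add: len len')
 qed
 define k where "k = (LEAST k. k = n \<or> row k = [])"
 have k: "k = n \<or> row k = []" unfolding k_def by (rule LeastI[of _ n]) simp
 have k_le: "k \<le> n" unfolding k_def by (rule Least_le) simp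
 have ne: "row j \<noteq> []" if "j < k" for j using not_less_Least[of j] that unfolding k_def by auto
 have emp: "row j = []" if "k \<le> j" "j < n" for j
  using that
 proof (induction j rule: dec_induct)
  case base
  then show ?case using k by simp
 next
  case (step j)
  then have "length (filter (\<lambda>e. e \<le> m) (row (Suc j))) = 0" using dom[of j m] by simp
  moreover have "filter (\<lambda>e. e \<le> m) (row (Suc j)) = row (Suc j)" using set[of "Suc j"] by (intro filter_True) auto
  ultimately show ?case by simp
 qed
 define T where "T = map row [0..<k]"
 have row_T: "tableau_row T j = row j" if "j < n" for j
  using emp[of j] that by (auto simp: T_def tableau_row_def)
 have T: "T \<in> SSYT n m"
  unfolding SSYT_iff
 proof (intro conjI ballI allI)
  show "length T \<le> n" using k_le by (simp add: T_def)
  fix r assume "r \<in> set T"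
  then show "r \<noteq> []" "sorted r" "set r \<subseteq> {1..m}" using ne sorted set by (auto simp: T_def)
 next
  fix j v
  show "length (filter (\<lambda>e. e \<le> v) (tableau_row T (Suc j))) \<le> length (filter (\<lambda>e. e < v) (tableau_row T j))"
  proof (cases "Suc j < n")
   case True
   then show ?thesis using dom[OF True, of v] by (simp add: row_T)
  next
   case False
   then show ?thesis using k_le by (simp add: T_def tableau_row_def)
  qed
 qed
 moreover have "tableau_exponent m n T = \<alpha>"
 proof (rule poly_mapping_eqI)
  fix v
  show "lookup (tableau_exponent m n T) v = lookup \<alpha> v"
  proof (cases "v \<in> entry_vars m n")
   case True
   then obtain i j where ij: "v = entry_var m n i j" "i < m" "j < n" by (auto simp: entry_vars_def)
   then show ?thesis by (simp add: lookup_tableau_exponent[OF T] row_T count a_def)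
  next
   case False
   then show ?thesis using keys keys_tableau_exponent[OF T] by (metis in_keys_iff subsetD)
  qed
 qed
 ultimately show ?thesis by (rule that)
qed

definition columns :: "nat => nat => nat list set" where
 "columns n m = {l. sorted_wrt (<) l \<and> set l \<subseteq> {1..m} \<and> length l \<le> n}"

definition tableau_column :: "nat list list => nat => nat list" where
 "tableau_column T c = map (\<lambda>r. r ! c) (takeWhile (\<lambda>r. c < length r) T)"

lemma SSYT_row_lengths:
 assumes "T \<in> SSYT n m" "i \<le> j" "j < length T"
 shows "length (T ! j) \<le> length (T ! i)"
 using assms(2,3)
proof (induction j rule: dec_induct)
 case (step j)
 then have "length (T ! Suc j) \<le> length (T ! j)" using assms(1) by (simp add: SSYT_def)
 then show ?case using step by simp
qed simp

lemma length_tableau_column: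
 assumes "T \<in> SSYT n m"
 shows "a < length (tableau_column T c) \<longleftrightarrow> a < length T \<and> c < length (T ! a)"
proof -
 let ?t = "takeWhile (\<lambda>r. c < length r) T"
 have "c < length (T ! a)" if "a < length ?t" for a
  using that by (metis nth_mem set_takeWhileD takeWhile_nth)
 moreover have "length ?t \<le> length T" by (rule length_takeWhile_le)
 moreover have "a < length ?t" if "a < length T" "c < length (T ! a)" for a
 proof (rule ccontr)
  assume "\<not> a < length ?t"
  then have "\<not> c < length (T ! length ?t)" "length (T ! a) \<le> length (T ! length ?t)"
   using nth_length_takeWhile[of "\<lambda>r. c < length r" T] SSYT_row_lengths[OF assms, of "length ?t" a] that by auto
  then show False using that by simp
 qed
 ultimately show ?thesis by (auto simp: tableau_column_def)
qed

lemma nth_tableau_column: "a < length (tableau_column T c) ==> tableau_column T c ! a = T ! a ! c"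
 by (simp add: tableau_column_def takeWhile_nth)

lemma tableau_column_in_columns:
 assumes T: "T \<in> SSYT n m"
 shows "tableau_column T c \<in> columns n m"
 unfolding columns_def mem_Collect_eq
proof (intro conjI)
 let ?l = "tableau_column T c"
 have "length ?l \<le> length T" by (simp add: tableau_column_def length_takeWhile_le)
 then show "length ?l \<le> n" using T by (simp add: SSYT_def)
 have "?l ! a < ?l ! Suc a" if "Suc a < length ?l" for a
 proof -
  have "?l ! a = T ! a ! c" "?l ! Suc a = T ! Suc a ! c"
   using that by (simp_all add: nth_tableau_column)
  then show ?thesis using T that length_tableau_column[OF T, of "Suc a" c] by (simp add: SSYT_def)
 qed
 then show "sorted_wrt (<) ?l"
  by (simp add: sorted_wrt_iff_nth_Suc_transp)
 show "set ?l \<subseteq> {1..m}"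
 proof
  fix e assume "e \<in> set ?l"
  then obtain a where "a < length ?l" "e = ?l ! a" by (auto simp: in_set_conv_nth)
  then have "a < length T" "c < length (T ! a)" "e = T ! a ! c"
   using length_tableau_column[OF T] by (auto simp: nth_tableau_column)
  moreover have "set (T ! a) \<subseteq> {1..m}" using T \<open>a < length T\<close> by (simp add: SSYT_def)
  ultimately show "e \<in> {1..m}" by (metis nth_mem subsetD)
 qed
qed

lemma finite_columns: "finite (columns n m)"
 by (rule finite_subset[OF _ finite_lists_length_le[of "{1..m}" n]]) (auto simp: columns_def)

definition column_exponent :: "nat => nat => nat list => nat \<Rightarrow>\<^sub>0 nat" where
 "column_exponent m n l = (\<Sum>a<length l. Poly_Mapping.single (entry_var m n (l ! a - 1) a) 1)"

definition width :: "nat list list => nat" where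
 "width T = length (tableau_row T 0)"

lemma tableau_exponent_columns:
 assumes T: "T \<in> SSYT n m"
 shows "tableau_exponent m n T = (\<Sum>c<width T. column_exponent m n (tableau_column T c))"
proof -
 let ?f = "\<lambda>a c. Poly_Mapping.single (entry_var m n (T ! a ! c - 1) a) (1::nat)"
 have "tableau_exponent m n T = (\<Sum>a<n. \<Sum>c<length (tableau_row T a). ?f a c)"
  unfolding tableau_exponent_def
 proof (intro sum.cong refl)
  fix a
  have "(\<Sum>e\<in>#mset xs. g e) = (\<Sum>c<length xs. g (xs ! c))" for xs :: "nat list" and g :: "nat => nat \<Rightarrow>\<^sub>0 nat"
  proof -
   have "(\<Sum>e\<in>#mset xs. g e) = sum_list (map g xs)" by (metis mset_map sum_mset_sum_list)
   then show ?thesis by (simp add: sum_list_sum_nth atLeast0LessThan)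
  qed
  then show "(\<Sum>e\<in>#mset (tableau_row T a). Poly_Mapping.single (entry_var m n (e - 1) a) 1) =
    (\<Sum>c<length (tableau_row T a). ?f a c)"
   by (auto simp: tableau_row_def)
 qed
 also have "\<dots> = (\<Sum>(a, c)\<in>(SIGMA a:{..<n}. {..<length (tableau_row T a)}). ?f a c)"
  by (simp add: sum.Sigma)
 also have "\<dots> = (\<Sum>(c, a)\<in>(SIGMA c:{..<width T}. {..<length (tableau_column T c)}). ?f a c)"
 proof (rule sum.reindex_bij_witness[of _ "\<lambda>(c, a). (a, c)" "\<lambda>(a, c). (c, a)"])
  fix p assume "p \<in> (SIGMA a:{..<n}. {..<length (tableau_row T a)})"
  then obtain a c where p: "p = (a, c)" "a < n" "c < length (tableau_row T a)" by auto
  then have ac: "a < length T" "c < length (T ! a)" by (auto simp: tableau_row_def split: if_splits)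
  then have "c < length (T ! 0)" using SSYT_row_lengths[OF T, of 0 a] by simp
  then show "(case p of (a, c) => (c, a)) \<in> (SIGMA c:{..<width T}. {..<length (tableau_column T c)})"
   using p ac length_tableau_column[OF T, of a c] by (auto simp: width_def tableau_row_def)
 next
  fix p assume "p \<in> (SIGMA c:{..<width T}. {..<length (tableau_column T c)})"
  then obtain a c where p: "p = (c, a)" "c < width T" "a < length (tableau_column T c)" by auto
  then show "(case p of (c, a) => (a, c)) \<in> (SIGMA a:{..<n}. {..<length (tableau_row T a)})"
   using T length_tableau_column[OF T, of a c] by (auto simp: tableau_row_def SSYT_def)
 qed auto
 also have "\<dots> = (\<Sum>c<width T. \<Sum>a<length (tableau_column T c). ?f a c)"
  by (simp add: sum.Sigma)
 also have "\<dots> = (\<Sum>c<width T. column_exponent m n (tableau_column T c))"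
  unfolding column_exponent_def by (intro sum.cong refl) (simp add: nth_tableau_column)
 finally show ?thesis .
qed

lemma column_tableau:
 assumes l: "l \<in> columns n m" "l \<noteq> []"
 shows "map (\<lambda>e. [e]) l \<in> SSYT n m" "width (map (\<lambda>e. [e]) l) = 1" "tableau_column (map (\<lambda>e. [e]) l) 0 = l"
proof -
 have "l ! i < l ! Suc i" if "Suc i < length l" for i
  using l that by (simp add: columns_def sorted_wrt_iff_nth_less)
 then show "map (\<lambda>e. [e]) l \<in> SSYT n m"
  using l by (auto simp: SSYT_def columns_def)
 show "width (map (\<lambda>e. [e]) l) = 1" using l(2) by (simp add: width_def tableau_row_def)
 have "takeWhile (\<lambda>r. 0 < length r) (map (\<lambda>e. [e]) l) = map (\<lambda>e. [e]) l"
  by (rule takeWhile_eq_all_conv[THEN iffD2]) auto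
 then show "tableau_column (map (\<lambda>e. [e]) l) 0 = l"
  unfolding tableau_column_def by (simp only: map_map comp_def nth_Cons_0 map_ident)
qed

section \<open>Products of flag minors\<close>

definition minor :: "nat => nat => nat list => 'a::comm_ring_1 mpoly" where
 "minor m n l = det (mat (length l) (length l) (\<lambda>(a, b). Var (entry_var m n (l ! a - 1) b)))"

definition tableau_poly :: "nat => nat => nat list list => 'a::comm_ring_1 mpoly" where
 "tableau_poly m n T = (\<Prod>c<width T. minor m n (tableau_column T c))"

lemma columns_nth:
 assumes "l \<in> columns n m" "a < length l"
 shows "1 \<le> l ! a" "l ! a \<le> m" "a < n" "l ! a - 1 < m"
proof -
 have "l ! a \<in> {1..m}" using assms nth_mem by (fastforce simp: columns_def)
 then show "1 \<le> l ! a" "l ! a \<le> m" "l ! a - 1 < m" by auto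
 show "a < n" using assms by (simp add: columns_def)
qed

lemma columns_strict:
 "l \<in> columns n m ==> a < b ==> b < length l ==> l ! a - 1 < l ! b - 1"
 using columns_nth(1)[of l n m a] sorted_wrt_nth_less[of "(<)" l a b] by (auto simp: columns_def)

lemma eval_det: "eval x (det A) = det (map_mat (eval x) A)"
proof -
 interpret comm_ring_hom "eval x" by (rule eval_hom)
 show ?thesis by simp
qed

lemma eval_minor:
 "eval x (minor m n l) = det (mat (length l) (length l) (\<lambda>(a, b). x (entry_var m n (l ! a - 1) b)))"
 unfolding minor_def eval_det by (intro arg_cong[where f = det] eq_matI) auto

text \<open>The submatrix of the new entries is the product of the submatrix of the old entries with the matrix \<open>u\<close>.\<close>

lemma eval_minor_transform:
 assumes l: "l \<in> columns n m"
  and x': "\<And>i b'. i < m ==> b' < length l ==>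
   x' (entry_var m n i b') = (\<Sum>b<length l. x (entry_var m n i b) * u b b')"
 shows "eval x' (minor m n l) = eval x (minor m n l) * det (mat (length l) (length l) (\<lambda>(b, b'). u b b'))"
proof -
 let ?k = "length l"
 have "mat ?k ?k (\<lambda>(a, b). x' (entry_var m n (l ! a - 1) b)) =
   mat ?k ?k (\<lambda>(a, b). x (entry_var m n (l ! a - 1) b)) * mat ?k ?k (\<lambda>(b, b'). u b b')"
  using x' columns_nth(4)[OF l]
  by (intro eq_matI) (auto simp: scalar_prod_def atLeast0LessThan intro!: sum.cong)
 then show ?thesis by (simp add: eval_minor det_mult[of _ ?k])
qed

text \<open>A polynomial is topped by the exponent \<open>\<alpha>\<close> if it is monic with leading exponent \<open>\<alpha>\<close>.\<close>

definition topped :: "((nat \<Rightarrow>\<^sub>0 nat) => (nat \<Rightarrow>\<^sub>0 nat) => bool) => (nat \<Rightarrow>\<^sub>0 nat) => 'a::comm_ring_1 mpoly => bool"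
 where "topped lt \<alpha> P \<longleftrightarrow> (\<forall>\<beta>\<in>keys (P - Poly_Mapping.single \<alpha> 1). lt \<beta> \<alpha>)"

definition exponent_order :: "((nat \<Rightarrow>\<^sub>0 nat) => (nat \<Rightarrow>\<^sub>0 nat) => bool) => bool" where
 "exponent_order lt \<longleftrightarrow> irreflp lt \<and> transp lt \<and> (\<forall>\<alpha> \<beta> \<gamma>. lt \<alpha> \<beta> --> lt (\<alpha> + \<gamma>) (\<beta> + \<gamma>))"

lemma topped_lookup: "exponent_order lt ==> topped lt \<alpha> P ==> lookup P \<alpha> = 1"
 unfolding exponent_order_def topped_def irreflp_def
 by (metis (no_types, lifting) in_keys_iff lookup_minus lookup_single_eq right_minus_eq)

lemma topped_keys: "topped lt \<alpha> P ==> \<beta> \<in> keys P ==> \<beta> = \<alpha> \<or> lt \<beta> \<alpha>"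
 unfolding topped_def by (metis diff_zero in_keys_iff lookup_minus lookup_single_not_eq)

lemma topped_one: "topped lt 0 1"
 by (simp add: topped_def)

lemma topped_mult:
 assumes lt: "exponent_order lt" and P: "topped lt \<alpha> P" and Q: "topped lt \<beta> Q"
 shows "topped lt (\<alpha> + \<beta>) (P * Q)"
 unfolding topped_def
proof
 let ?P = "P - Poly_Mapping.single \<alpha> 1" and ?Q = "Q - Poly_Mapping.single \<beta> 1"
 have mono: "lt (\<gamma> + \<delta>) (\<gamma>' + \<delta>)" "lt (\<delta> + \<gamma>) (\<delta> + \<gamma>')" if "lt \<gamma> \<gamma>'" for \<gamma> \<gamma>' \<delta>
  using lt that by (auto simp: exponent_order_def add.commute[of \<delta>])
 fix \<gamma> assume "\<gamma> \<in> keys (P * Q - Poly_Mapping.single (\<alpha> + \<beta>) 1)"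
 moreover have "P * Q - Poly_Mapping.single (\<alpha> + \<beta>) 1 = ?P * Q + Poly_Mapping.single \<alpha> 1 * ?Q"
  by (simp add: algebra_simps mult_single)
 ultimately have "\<gamma> \<in> keys (?P * Q) \<or> \<gamma> \<in> keys (Poly_Mapping.single \<alpha> 1 * ?Q)"
  using Poly_Mapping.keys_add[of "?P * Q" "Poly_Mapping.single \<alpha> 1 * ?Q"] by auto
 then show "lt \<gamma> (\<alpha> + \<beta>)"
 proof
  assume "\<gamma> \<in> keys (?P * Q)"
  then obtain a b where "\<gamma> = a + b" "a \<in> keys ?P" "b \<in> keys Q"
   using keys_mult[of ?P Q] by auto
  moreover have "lt a \<alpha>" using P \<open>a \<in> _\<close> by (auto simp: topped_def)
  moreover have "b = \<beta> \<or> lt b \<beta>" using topped_keys[OF Q \<open>b \<in> _\<close>] .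
  ultimately show ?thesis
   using lt mono(1)[of a \<alpha> b] mono(2)[of b \<beta> \<alpha>] by (auto simp: exponent_order_def dest: transpD)
 next
  assume "\<gamma> \<in> keys (Poly_Mapping.single \<alpha> 1 * ?Q)"
  then obtain b where "\<gamma> = \<alpha> + b" "b \<in> keys ?Q"
   using keys_mult[of "Poly_Mapping.single \<alpha> (1::'a)" ?Q] by (auto split: if_splits)
  then show ?thesis using Q mono(2) by (auto simp: topped_def)
 qed
qed

lemma topped_prod:
 assumes "exponent_order lt" "\<And>i. i \<in> A ==> topped lt (f i) (P i)"
 shows "topped lt (\<Sum>i\<in>A. f i) (\<Prod>i\<in>A. P i)"
 using assms(2) by (induction A rule: infinite_finite_induct) (auto simp: topped_one intro: topped_mult[OF assms(1)])

text \<open>The exponent of the term of a minor that belongs to the permutation \<open>p\<close>.\<close>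

definition permutation_exponent :: "nat => nat => nat list => (nat => nat) => nat \<Rightarrow>\<^sub>0 nat" where
 "permutation_exponent m n l p = (\<Sum>a<length l. Poly_Mapping.single (entry_var m n (l ! a - 1) (p a)) 1)"

lemma minor_expansion:
 "(minor m n l :: 'a::comm_ring_1 mpoly) = (\<Sum>p | p permutes {0..<length l}.
   Poly_Mapping.single (permutation_exponent m n l p) (signof p))"
proof -
 have prod: "(\<Prod>i\<in>A. Poly_Mapping.single (f i) (1::'a)) = Poly_Mapping.single (\<Sum>i\<in>A. f i) 1"
  for A :: "nat set" and f :: "nat => nat \<Rightarrow>\<^sub>0 nat"
  by (induction A rule: infinite_finite_induct) (auto simp: mult_single)
 have sign: "(signof p :: 'a mpoly) = Const (signof p)" for p :: "nat => nat"
  by (simp add: sign_def)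
 let ?k = "length l" and ?M = "mat (length l) (length l) (\<lambda>(a, b). Var (entry_var m n (l ! a - 1) b) :: 'a mpoly)"
 have "signof p * (\<Prod>i = 0..<?k. ?M $$ (i, p i)) =
   Poly_Mapping.single (permutation_exponent m n l p) (signof p)" if p: "p permutes {0..<?k}" for p
 proof -
  have "(\<Prod>i = 0..<?k. ?M $$ (i, p i)) =
    (\<Prod>i = 0..<?k. Poly_Mapping.single (Poly_Mapping.single (entry_var m n (l ! i - 1) (p i)) 1) 1)"
  proof (rule prod.cong[OF refl])
   fix i assume "i \<in> {0..<?k}"
   then have "i < ?k" "p i < ?k" using permutes_in_image[OF p, of i] by simp_all
   then show "?M $$ (i, p i) = Poly_Mapping.single (Poly_Mapping.single (entry_var m n (l ! i - 1) (p i)) 1) 1"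
    by (simp add: Var_def)
  qed
  also have "\<dots> = Poly_Mapping.single (permutation_exponent m n l p) 1"
   by (simp only: prod permutation_exponent_def atLeast0LessThan)
  finally show ?thesis by (simp only: sign Const_def mult_single add_0 mult_1_right)
 qed
 then show ?thesis
  unfolding minor_def by (subst det_def'[of _ ?k]) (simp, intro sum.cong, auto)
qed

lemma topped_minor:
 assumes "\<And>p. p permutes {0..<length l} ==> p \<noteq> id ==>
  lt (permutation_exponent m n l p) (column_exponent m n l)"
 shows "topped lt (column_exponent m n l) (minor m n l :: 'a::comm_ring_1 mpoly)"
 unfolding topped_def
proof
 let ?S = "{p. p permutes {0..<length l}}"
 fix \<beta> assume "\<beta> \<in> keys ((minor m n l :: 'a mpoly) - Poly_Mapping.single (column_exponent m n l) 1)"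
 moreover have "(minor m n l :: 'a mpoly) - Poly_Mapping.single (column_exponent m n l) 1 =
  (\<Sum>p\<in>?S - {id}. Poly_Mapping.single (permutation_exponent m n l p) (signof p))"
  unfolding minor_expansion
  by (subst sum.remove[of _ id])
   (auto simp: finite_permutations permutes_id permutation_exponent_def column_exponent_def)
 ultimately have "\<beta> \<in> (\<Union>p\<in>?S - {id}. keys (Poly_Mapping.single (permutation_exponent m n l p) (signof p :: 'a)))"
  using Poly_Mapping.keys_sum[of "\<lambda>p. Poly_Mapping.single (permutation_exponent m n l p) (signof p :: 'a)" "?S - {id}"]
  by auto
 then obtain p where p: "p \<in> ?S - {id}"
  "\<beta> \<in> keys (Poly_Mapping.single (permutation_exponent m n l p) (signof p :: 'a))" by blast
 then have "\<beta> = permutation_exponent m n l p" by (simp split: if_splits)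
 then show "lt \<beta> (column_exponent m n l)" using assms[of p] p(1) by blast
qed

text \<open>Beyond the last moved index everything is fixed, so that index has to move down: in the last row where a
 term of a minor differs from the diagonal term, it uses a column further to the left.\<close>

lemma permutation_last_moved:
 assumes "p permutes {0..<k}" "p \<noteq> (id :: nat => nat)"
 obtains a where "a < k" "p a < a" "\<And>b. a < b ==> p b = b"
proof -
 let ?M = "{a. p a \<noteq> a}"
 have sub: "?M \<subseteq> {0..<k}" using assms(1) permutes_not_in by fastforce
 then have fin: "finite ?M" by (rule finite_subset) simp
 have ne: "?M \<noteq> {}" using assms(2) by auto
 have a: "Max ?M \<in> ?M" by (rule Max_in[OF fin ne])
 have above: "b \<le> Max ?M" if "b \<in> ?M" for b by (rule Max_ge[OF fin that])
 have fixed: "p b = b" if "Max ?M < b" for b using above[of b] that by fastforce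
 have "p (Max ?M) < Max ?M"
 proof (rule ccontr)
  assume "\<not> p (Max ?M) < Max ?M"
  then have "Max ?M < p (Max ?M)" using a by auto
  then have "p (p (Max ?M)) = p (Max ?M)" by (rule fixed)
  then show False using a permutes_inj[OF assms(1)] by (auto dest: injD)
 qed
 moreover have "Max ?M < k" using a sub by auto
 ultimately show ?thesis using that fixed by blast
qed

lemma permutation_exponent_lex:
 assumes l: "l \<in> columns n m" and p: "p permutes {0..<length l}" "p \<noteq> id"
 shows "permutation_exponent m n l p < column_exponent m n l"
proof -
 obtain a where a: "a < length l" "p a < a" and fixed: "\<And>b. a < b ==> p b = b"
  using permutation_last_moved[OF p] by metis
 let ?e = "\<lambda>q b. entry_var m n (l ! b - 1) (q b)"
 have p_less: "p b < length l" if "b < length l" for b using permutes_in_image[OF p(1), of b] that by auto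
 have lookup: "lookup (permutation_exponent m n l q) v = card {b. b < length l \<and> ?e q b = v}" for q v
 proof -
  have "lookup (permutation_exponent m n l q) v = (\<Sum>b<length l. if ?e q b = v then 1 else 0)"
   by (simp add: permutation_exponent_def lookup_sum lookup_single when_def del: One_nat_def)
  also have "\<dots> = card ({..<length l} \<inter> {b. ?e q b = v})" by (simp add: sum.If_cases)
  also have "{..<length l} \<inter> {b. ?e q b = v} = {b. b < length l \<and> ?e q b = v}" by auto
  finally show ?thesis .
 qed
 let ?v = "?e id a"
 have big: "?v < ?e q b" if "b < a" "q b < length l" for q b
  using columns_strict[OF l that(1) a(1)] columns_nth[OF l] a(1) that
  by (intro entry_var_less) (auto intro: order.strict_trans)
 have big': "?v < ?e p a"
  using columns_nth[OF l a(1)] a(2) by (intro entry_var_less) auto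
 have small: "?e q b < ?v" if "a < b" "b < length l" "q b < length l" for q b
  using columns_strict[OF l that(1,2)] columns_nth[OF l] a(1) that
  by (intro entry_var_less) auto
 have same: "{b. b < length l \<and> ?e p b = v} = {b. b < length l \<and> ?e id b = v}" if v: "v < ?v" for v
 proof -
  have "?e p b = v \<longleftrightarrow> ?e id b = v" if b: "b < length l" for b
  proof (cases "a < b")
   case False
   then have "?v < ?e p b" "?v \<le> ?e id b"
    using big[of b p] big[of b id] big' p_less[OF b] b by (cases "b = a", simp, simp)+
   then show ?thesis using v by auto
  qed (simp add: fixed)
  then show ?thesis by auto
 qed
 have e1: "{b. b < length l \<and> ?e p b = ?v} = {}"
 proof -
  have "?e p b \<noteq> ?v" if b: "b < length l" for b
   using big[of b p] big' small[of b p] p_less[OF b] b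
   by (cases b a rule: linorder_cases) auto
  then show ?thesis by auto
 qed
 have "{b. b < length l \<and> ?e id b = ?v} \<noteq> {}" using a by auto
 then have e2: "card {b. b < length l \<and> ?e id b = ?v} > 0" by (simp add: card_gt_0_iff)
 have "lookup (permutation_exponent m n l p) ?v < lookup (permutation_exponent m n l id) ?v"
  unfolding lookup e1 using e2 by simp
 moreover have "\<forall>v<?v. lookup (permutation_exponent m n l p) v = lookup (permutation_exponent m n l id) v"
  unfolding lookup using same by simp
 moreover have "permutation_exponent m n l id = column_exponent m n l"
  by (simp add: permutation_exponent_def column_exponent_def)
 ultimately show ?thesis
  unfolding less_poly_mapping.rep_eq less_fun_def by metis
qed

text \<open>The weight that defines the degeneration: \<open>entry_var m n i j\<close> has weight
 \<open>(j + 1) (n + 1)\<^sup>i\<close>, so that the weight of a monomial of a minor is a number whose digits in base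
 \<open>n + 1\<close> are the columns chosen in the rows.\<close>

definition exponent_weight :: "nat => nat => (nat \<Rightarrow>\<^sub>0 nat) => nat" where
 "exponent_weight m n \<beta> = (\<Sum>v\<in>keys \<beta>. (n - v mod n) * (n + 1) ^ (m - 1 - v div n) * lookup \<beta> v)"

lemma exponent_weight_superset:
 assumes "finite V" "keys \<beta> \<subseteq> V"
 shows "exponent_weight m n \<beta> = (\<Sum>v\<in>V. (n - v mod n) * (n + 1) ^ (m - 1 - v div n) * lookup \<beta> v)"
 unfolding exponent_weight_def
 by (rule sum.mono_neutral_left[OF assms]) (auto simp: in_keys_iff)

lemma exponent_weight_0 [simp]: "exponent_weight m n 0 = 0"
 by (simp add: exponent_weight_def)

lemma exponent_weight_add: "exponent_weight m n (\<beta> + \<gamma>) = exponent_weight m n \<beta> + exponent_weight m n \<gamma>"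
proof -
 let ?V = "keys \<beta> \<union> keys \<gamma>"
 have "keys (\<beta> + \<gamma>) \<subseteq> ?V" by (rule Poly_Mapping.keys_add)
 then show ?thesis
  by (simp add: exponent_weight_superset[of ?V] lookup_add distrib_left sum.distrib)
qed

lemma exponent_weight_sum: "exponent_weight m n (\<Sum>i\<in>A. f i) = (\<Sum>i\<in>A. exponent_weight m n (f i))"
 by (induction A rule: infinite_finite_induct) (auto simp: exponent_weight_add)

lemma exponent_weight_entry:
 assumes "i < m" "j < n"
 shows "exponent_weight m n (Poly_Mapping.single (entry_var m n i j) 1) = (j + 1) * (n + 1) ^ i"
proof -
 have "entry_var m n i j div n = m - 1 - i" "entry_var m n i j mod n = n - 1 - j"
 proof -
  have "(q * n + r) div n = q" "(q * n + r) mod n = r" if "r < n" for q r using that by auto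
  from this[of "n - 1 - j" "m - 1 - i"] assms(2)
  show "entry_var m n i j div n = m - 1 - i" "entry_var m n i j mod n = n - 1 - j"
   unfolding entry_var_def by auto
 qed
 moreover have "n - (n - 1 - j) = j + 1" "m - 1 - (m - 1 - i) = i" using assms by auto
 ultimately show ?thesis by (simp only: exponent_weight_def keys_single lookup_single_eq, simp)
qed

lemma permutation_exponent_weight:
 assumes l: "l \<in> columns n m" and p: "p permutes {0..<length l}" "p \<noteq> id"
 shows "exponent_weight m n (permutation_exponent m n l p) < exponent_weight m n (column_exponent m n l)"
proof -
 obtain a where a: "a < length l" "p a < a" and fixed: "\<And>b. a < b ==> p b = b"
  using permutation_last_moved[OF p] by metis
 have p_less: "p b < length l" if "b < length l" for b using permutes_in_image[OF p(1), of b] that by auto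
 let ?B = "n + 1"
 let ?w = "\<lambda>q b. (q b + 1) * ?B ^ (l ! b - 1)"
 have len: "length l \<le> n" using l by (simp add: columns_def)
 have w: "exponent_weight m n (permutation_exponent m n l q) = (\<Sum>b<length l. ?w q b)"
  if "\<And>b. b < length l ==> q b < length l" for q
  unfolding permutation_exponent_def exponent_weight_sum
  using columns_nth(4)[OF l] that len by (intro sum.cong refl exponent_weight_entry) (auto intro: less_le_trans)
 have geometric: "(\<Sum>i<N. n * ?B ^ i) < ?B ^ N" for N
  by (induction N) auto
 have "(\<Sum>b<a. ?w p b) \<le> (\<Sum>b<a. n * ?B ^ (l ! b - 1))"
 proof (intro sum_mono mult_right_mono)
  fix b assume "b \<in> {..<a}"
  then show "p b + 1 \<le> n" using p_less[of b] a(1) len by simp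
 qed simp
 also have "\<dots> = (\<Sum>i\<in>(\<lambda>b. l ! b - 1) ` {..<a}. n * ?B ^ i)"
 proof -
  have "inj_on (\<lambda>b. l ! b - 1) {..<a}"
  proof (rule linorder_inj_onI)
   fix b c assume "b < c" "b \<in> {..<a}" "c \<in> {..<a}"
   then show "l ! b - 1 \<noteq> l ! c - 1" using columns_strict[OF l, of b c] a(1) by simp
  qed auto
  then show ?thesis by (simp add: sum.reindex)
 qed
 also have "\<dots> \<le> (\<Sum>i<l ! a - 1. n * ?B ^ i)"
  using columns_strict[OF l _ a(1)] by (intro sum_mono2) auto
 also have "\<dots> < ?B ^ (l ! a - 1)" by (rule geometric)
 finally have "(\<Sum>b<a. ?w p b) + ?w p a < (p a + 2) * ?B ^ (l ! a - 1)" by (simp add: algebra_simps)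
 also have "\<dots> \<le> ?w id a" using a(2) by (intro mult_right_mono) auto
 finally have less: "(\<Sum>b<a. ?w p b) + ?w p a < (\<Sum>b<a. ?w id b) + ?w id a" by simp
 have split: "(\<Sum>b<length l. f b) = (\<Sum>b<a. f b) + f a + (\<Sum>b\<in>{a<..<length l}. f b)" for f :: "nat => nat"
 proof -
  have "{..<length l} = insert a ({..<a} \<union> {a<..<length l})" using a(1) by auto
  then have "(\<Sum>b<length l. f b) = sum f (insert a ({..<a} \<union> {a<..<length l}))" by (rule arg_cong)
  also have "\<dots> = f a + ((\<Sum>b<a. f b) + (\<Sum>b\<in>{a<..<length l}. f b))"
   by (subst sum.insert) (auto intro!: sum.union_disjoint)
  finally show ?thesis by simp
 qed
 have "(\<Sum>b\<in>{a<..<length l}. ?w p b) = (\<Sum>b\<in>{a<..<length l}. ?w id b)"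
  using fixed by (intro sum.cong) auto
 then have "(\<Sum>b<length l. ?w p b) < (\<Sum>b<length l. ?w id b)"
  using less by (simp add: split)
 moreover have "permutation_exponent m n l id = column_exponent m n l"
  by (simp add: permutation_exponent_def column_exponent_def)
 ultimately show ?thesis using w[of p] w[of id] p_less by simp
qed

definition weight_less :: "nat => nat => (nat \<Rightarrow>\<^sub>0 nat) => (nat \<Rightarrow>\<^sub>0 nat) => bool" where
 "weight_less m n \<beta> \<gamma> \<longleftrightarrow> exponent_weight m n \<beta> < exponent_weight m n \<gamma>"

lemma exponent_orders: "exponent_order (weight_less m n)" "exponent_order (<)"
 by (auto simp: exponent_order_def weight_less_def exponent_weight_add irreflp_def
   intro!: transpI add_strict_right_mono)

lemma topped_tableau_poly:
 assumes T: "T \<in> SSYT n m"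
 shows "topped (weight_less m n) (tableau_exponent m n T) (tableau_poly m n T :: 'a::comm_ring_1 mpoly)"
  and "topped (<) (tableau_exponent m n T) (tableau_poly m n T :: 'a::comm_ring_1 mpoly)"
proof -
 note col = tableau_column_in_columns[OF T]
 show "topped (weight_less m n) (tableau_exponent m n T) (tableau_poly m n T :: 'a mpoly)"
  unfolding tableau_exponent_columns[OF T] tableau_poly_def
  by (intro topped_prod exponent_orders topped_minor)
   (simp add: weight_less_def permutation_exponent_weight[OF col])
 show "topped (<) (tableau_exponent m n T) (tableau_poly m n T :: 'a mpoly)"
  unfolding tableau_exponent_columns[OF T] tableau_poly_def
  by (intro topped_prod exponent_orders topped_minor permutation_exponent_lex[OF col])
qed

section \<open>Products of flag minors span the unipotent invariants\<close>

definition column_degree :: "nat => nat => (nat \<Rightarrow>\<^sub>0 nat) => nat => nat" where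
 "column_degree m n \<beta> j = (\<Sum>i<m. lookup \<beta> (entry_var m n i j))"

text \<open>Highest weight vectors for right multiplication by upper triangular matrices; the weight is recorded by the
 degrees \<open>ds\<close> in the columns.\<close>

definition flag_invariants :: "nat => nat => (nat => nat) => 'a::comm_ring_1 mpoly set" where
 "flag_invariants m n ds = {P.
  (\<forall>\<beta>\<in>keys P. keys \<beta> \<subseteq> entry_vars m n \<and> (\<forall>j<n. column_degree m n \<beta> j = ds j)) \<and>
  (\<forall>j x c. Suc j < n --> eval (shear_column m n j c x) P = eval x P)}"

lemma column_degree_0 [simp]: "column_degree m n 0 j = 0"
 by (simp add: column_degree_def)

lemma column_degree_add: "column_degree m n (\<beta> + \<gamma>) j = column_degree m n \<beta> j + column_degree m n \<gamma> j"
 by (simp add: column_degree_def lookup_add sum.distrib)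

lemma flag_invariants_add:
 "P \<in> flag_invariants m n ds ==> Q \<in> flag_invariants m n ds ==> P + Q \<in> flag_invariants m n ds"
 using Poly_Mapping.keys_add[of P Q] by (auto simp: flag_invariants_def; blast)

lemma flag_invariants_Const_mult:
 "P \<in> flag_invariants m n ds ==> Const c * P \<in> flag_invariants m n ds"
 using keys_Const_mult[of c P] by (auto simp: flag_invariants_def; blast)

lemma flag_invariants_mult:
 assumes "P \<in> flag_invariants m n ds" "Q \<in> flag_invariants m n \<mu>"
 shows "P * Q \<in> flag_invariants m n (\<lambda>j. ds j + \<mu> j)"
proof -
 have "keys \<gamma> \<subseteq> entry_vars m n \<and> (\<forall>j<n. column_degree m n \<gamma> j = ds j + \<mu> j)" if "\<gamma> \<in> keys (P * Q)" for \<gamma>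
 proof -
  obtain a b where "\<gamma> = a + b" "a \<in> keys P" "b \<in> keys Q" using keys_mult[of P Q] \<open>\<gamma> \<in> _\<close> by auto
  then show ?thesis
   using assms Poly_Mapping.keys_add[of a b] unfolding flag_invariants_def
   by (auto simp: column_degree_add; blast)
 qed
 then show ?thesis using assms by (auto simp: flag_invariants_def)
qed

lemma flag_invariants_one: "1 \<in> flag_invariants m n (\<lambda>j. 0)"
 by (simp add: flag_invariants_def)

lemma minor_flag_invariant:
 assumes l: "l \<in> columns n m"
 shows "(minor m n l :: 'a::comm_ring_1 mpoly) \<in> flag_invariants m n (\<lambda>j. if j < length l then 1 else 0)"
 unfolding flag_invariants_def mem_Collect_eq
proof (intro conjI ballI allI impI)
 let ?k = "length l"
 have len: "?k \<le> n" using l by (simp add: columns_def)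
 fix \<beta> assume "\<beta> \<in> keys (minor m n l :: 'a mpoly)"
 then have "\<beta> \<in> (\<Union>p\<in>{p. p permutes {0..<?k}}. keys (Poly_Mapping.single (permutation_exponent m n l p) (signof p :: 'a)))"
  unfolding minor_expansion
  using Poly_Mapping.keys_sum[of "\<lambda>p. Poly_Mapping.single (permutation_exponent m n l p) (signof p :: 'a)" "{p. p permutes {0..<?k}}"]
  by auto
 then obtain p where p: "p permutes {0..<?k}" and \<beta>: "\<beta> = permutation_exponent m n l p"
  by (auto split: if_splits)
 have p_less: "p b < ?k" if "b < ?k" for b using permutes_in_image[OF p, of b] that by auto
 show "keys \<beta> \<subseteq> entry_vars m n"
 proof
  fix v assume "v \<in> keys \<beta>"
  then have "v \<in> (\<Union>b\<in>{..<?k}. keys (Poly_Mapping.single (entry_var m n (l ! b - 1) (p b)) (1::nat)))"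
   unfolding \<beta> permutation_exponent_def
   using Poly_Mapping.keys_sum[of "\<lambda>b. Poly_Mapping.single (entry_var m n (l ! b - 1) (p b)) (1::nat)" "{..<?k}"] by auto
  then obtain b where "b < ?k" "v = entry_var m n (l ! b - 1) (p b)" by (auto split: if_splits)
  then show "v \<in> entry_vars m n"
   using columns_nth(4)[OF l, of b] p_less[of b] len unfolding entry_vars_def by (auto intro: less_le_trans)
 qed
 fix j assume j: "j < n"
 have "column_degree m n \<beta> j = (\<Sum>i<m. \<Sum>b<?k. if l ! b - 1 = i \<and> p b = j then 1 else 0)"
  unfolding column_degree_def \<beta> permutation_exponent_def lookup_sum
 proof (intro sum.cong refl)
  fix i b assume "i \<in> {..<m}" "b \<in> {..<?k}"
  then show "lookup (Poly_Mapping.single (entry_var m n (l ! b - 1) (p b)) 1) (entry_var m n i j) =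
    (if l ! b - 1 = i \<and> p b = j then 1 else 0 :: nat)"
   using entry_var_eq_iff[of "l ! b - 1" m i "p b" n j] columns_nth(4)[OF l, of b] p_less[of b] len j
   by (simp add: lookup_single when_def)
 qed
 also have "\<dots> = (\<Sum>b<?k. \<Sum>i<m. if l ! b - 1 = i \<and> p b = j then 1 else 0)" by (rule sum.swap)
 also have "\<dots> = (\<Sum>b<?k. if p b = j then 1 else 0)"
 proof (intro sum.cong refl)
  fix b assume "b \<in> {..<?k}"
  then have "l ! b - 1 < m" using columns_nth(4)[OF l, of b] by simp
  then show "(\<Sum>i<m. if l ! b - 1 = i \<and> p b = j then 1 else 0) = (if p b = j then 1 else 0 :: nat)"
   by (cases "p b = j") auto
 qed
 also have "\<dots> = (\<Sum>b\<in>p ` {..<?k}. if b = j then 1 else 0)"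
  using permutes_inj[OF p] by (subst sum.reindex) (auto intro: inj_on_subset)
 also have "p ` {..<?k} = {..<?k}" using permutes_image[OF p] by (simp add: atLeast0LessThan)
 finally show "column_degree m n \<beta> j = (if j < ?k then 1 else 0)" by simp
next
 let ?k = "length l"
 have len: "?k \<le> n" using l by (simp add: columns_def)
 fix j and x :: "nat => 'a" and c assume j: "Suc j < n"
 define u where "u = (\<lambda>b b'. if b = b' then 1 else if b = j \<and> b' = Suc j then c else (0::'a))"
 have "eval (shear_column m n j c x) (minor m n l) = eval x (minor m n l) * det (mat ?k ?k (\<lambda>(b, b'). u b b'))"
 proof (rule eval_minor_transform[OF l])
  fix i b' assume i: "i < m" and b': "b' < ?k"
  have sh: "shear_column m n j c x (entry_var m n i b') =
   (if b' = Suc j then x (entry_var m n i b') + c * x (entry_var m n i j) else x (entry_var m n i b'))"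
   using i b' len j by (auto simp: shear_column_def entry_var_Suc)
  have "(\<Sum>b<?k. x (entry_var m n i b) * u b b') =
   (\<Sum>b<?k. (if b = b' then x (entry_var m n i b) else 0) + (if b = j then if b' = Suc j then c * x (entry_var m n i j) else 0 else 0))"
   unfolding u_def by (intro sum.cong) (auto simp: mult.commute)
  also have "\<dots> = shear_column m n j c x (entry_var m n i b')"
   using b' unfolding sh by (simp add: sum.distrib)
  finally show "shear_column m n j c x (entry_var m n i b') = (\<Sum>b<?k. x (entry_var m n i b) * u b b')" ..
 qed
 also have "det (mat ?k ?k (\<lambda>(b, b'). u b b')) = 1"
  by (subst det_upper_triangular[of _ ?k])
   (auto simp: u_def upper_triangular_def prod_list_diag_prod)
 finally show "eval (shear_column m n j c x) (minor m n l) = eval x (minor m n l)" by simp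
qed

definition shape :: "nat list list => nat => nat" where
 "shape T j = length (tableau_row T j)"

lemma column_degree_tableau_exponent:
 assumes T: "T \<in> SSYT n m" and j: "j < n"
 shows "column_degree m n (tableau_exponent m n T) j = shape T j"
proof -
 have "column_degree m n (tableau_exponent m n T) j = (\<Sum>i<m. count (mset (tableau_row T j)) (Suc i))"
  using j by (simp add: column_degree_def lookup_tableau_exponent[OF T])
 also have "\<dots> = (\<Sum>e\<in>{1..m}. count (mset (tableau_row T j)) e)"
  by (rule sum.reindex_bij_witness[of _ "\<lambda>e. e - 1" Suc]) auto
 also have "\<dots> = length (filter (\<lambda>e. e \<in> {1..m}) (tableau_row T j))"
  by (rule length_filter_eq_sum_count[symmetric]) simp
 also have "filter (\<lambda>e. e \<in> {1..m}) (tableau_row T j) = tableau_row T j"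
  using tableau_row_entries[OF T, of j] by (intro filter_True) auto
 finally show ?thesis by (simp add: shape_def)
qed

lemma flag_invariants_cong:
 "(\<And>j. j < n ==> ds j = \<mu> j) ==> flag_invariants m n ds = flag_invariants m n \<mu>"
 by (simp add: flag_invariants_def)

lemma tableau_poly_flag_invariant:
 assumes T: "T \<in> SSYT n m"
 shows "(tableau_poly m n T :: 'a::comm_ring_1 mpoly) \<in> flag_invariants m n (shape T)"
proof -
 have "(\<Prod>c\<in>A. minor m n (tableau_column T c) :: 'a mpoly) \<in>
   flag_invariants m n (\<lambda>j. \<Sum>c\<in>A. if j < length (tableau_column T c) then 1 else 0)" if "finite A" for A
  using that
 proof (induction A)
  case (insert c A)
  then show ?case
   using flag_invariants_mult[OF minor_flag_invariant[OF tableau_column_in_columns[OF T, of c]] insert.IH] by simp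
 qed (simp add: flag_invariants_one)
 then have "(tableau_poly m n T :: 'a mpoly) \<in> flag_invariants m n (\<lambda>j. \<Sum>c<width T. if j < length (tableau_column T c) then 1 else 0)"
  by (simp add: tableau_poly_def)
 moreover have "(\<Sum>c<width T. if j < length (tableau_column T c) then 1 else 0) = shape T j" for j
 proof -
  have "{c. c < width T \<and> j < length (tableau_column T c)} = {..<shape T j}"
   using SSYT_row_lengths[OF T, of 0 j]
   by (auto simp: length_tableau_column[OF T] shape_def width_def tableau_row_def)
  moreover have "(\<Sum>c<width T. if j < length (tableau_column T c) then 1 else 0) =
    card {c. c < width T \<and> j < length (tableau_column T c)}"
   by (simp add: sum.If_cases Int_def)
  ultimately show ?thesis by simp
 qed
 ultimately show ?thesis by simp
qed

interpretation mpoly: vector_space "\<lambda>c (P :: 'a::field mpoly). Const c * P"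
 by unfold_locales (auto simp: algebra_simps)

lemma finite_exponents_of_degree:
 "finite {\<beta>. keys \<beta> \<subseteq> entry_vars m n \<and> (\<forall>j<n. column_degree m n \<beta> j = ds j)}" (is "finite ?E")
proof -
 let ?N = "\<Sum>j<n. ds j"
 have "lookup ` ?E \<subseteq> {f. \<forall>v. (v \<in> entry_vars m n --> f v \<in> {..?N}) \<and> (v \<notin> entry_vars m n --> f v = 0)}"
 proof safe
  fix \<beta> v assume \<beta>: "\<forall>j<n. column_degree m n \<beta> j = ds j" and "v \<in> entry_vars m n"
  then obtain i j where v: "v = entry_var m n i j" "i < m" "j < n" by (auto simp: entry_vars_def)
  then have "lookup \<beta> v \<le> column_degree m n \<beta> j"
   unfolding column_degree_def using member_le_sum[of i "{..<m}" "\<lambda>i. lookup \<beta> (entry_var m n i j)"] by simp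
  also have "\<dots> = ds j" using \<beta> v by simp
  also have "\<dots> \<le> ?N" using v(3) by (intro member_le_sum) auto
  finally show "lookup \<beta> v \<le> ?N" .
 next
  fix \<beta> v assume "keys \<beta> \<subseteq> entry_vars m n" "v \<notin> entry_vars m n"
  then show "lookup \<beta> v = 0" by (metis in_keys_iff subsetD)
 qed
 then have "finite (lookup ` ?E)"
  by (rule finite_subset) (rule finite_set_of_finite_funs, auto)
 then show ?thesis by (rule finite_imageD) (simp add: inj_on_def lookup_inject)
qed

text \<open>An invariant is reduced to zero by subtracting multiples of tableau polynomials with the same
 lexicographically leading exponent.\<close>

theorem flag_invariants_spanned:
 fixes P :: "'a::field_char_0 mpoly"
 assumes "P \<in> flag_invariants m n ds"
 shows "P \<in> mpoly.span (tableau_poly m n ` {T \<in> SSYT n m. \<forall>j<n. shape T j = ds j})"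
proof -
 let ?E = "{\<beta>. keys \<beta> \<subseteq> entry_vars m n \<and> (\<forall>j<n. column_degree m n \<beta> j = ds j)}"
 let ?S = "mpoly.span (tableau_poly m n ` {T \<in> SSYT n m. \<forall>j<n. shape T j = ds j})"
 have "P \<in> flag_invariants m n ds ==> P \<in> ?S" for P :: "'a mpoly"
 proof (induction "card {\<beta>\<in>?E. \<exists>\<gamma>\<in>keys P. \<beta> \<le> \<gamma>}" arbitrary: P rule: less_induct)
  case less
  show ?case
  proof (cases "P = 0")
   case False
   define \<alpha> where "\<alpha> = Max (keys P)"
   have \<alpha>: "\<alpha> \<in> keys P" and max: "\<And>\<beta>. \<beta> \<in> keys P ==> \<beta> \<le> \<alpha>"
    unfolding \<alpha>_def using keys_nonempty[OF False] by auto
   have \<alpha>E: "keys \<alpha> \<subseteq> entry_vars m n" "\<And>j. j < n ==> column_degree m n \<alpha> j = ds j"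
    using less.prems \<alpha> by (auto simp: flag_invariants_def)
   have "(\<Sum>i\<le>r. lookup \<alpha> (entry_var m n i (Suc j))) \<le> (\<Sum>i<r. lookup \<alpha> (entry_var m n i j))"
    if "Suc j < n" "r < m" for j r
    unfolding \<alpha>_def
   proof (rule leading_exponent_interlaces[OF False that])
    show "eval (shear_column m n j c x) P = eval x P" for x c
     using less.prems that by (auto simp: flag_invariants_def)
    show "(\<Sum>i<m. lookup \<beta> (entry_var m n i j)) = ds j"
     "(\<Sum>i<m. lookup \<beta> (entry_var m n i (Suc j))) = ds (Suc j)" if "\<beta> \<in> keys P" for \<beta>
     using less.prems that \<open>Suc j < n\<close> by (auto simp: flag_invariants_def column_degree_def)
   qed
   from exponent_of_tableau[OF \<alpha>E(1) this]
   obtain T where T: "T \<in> SSYT n m" "tableau_exponent m n T = \<alpha>" by blast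
   have shape: "shape T j = ds j" if "j < n" for j
    using column_degree_tableau_exponent[OF T(1) that] \<alpha>E(2)[OF that] T(2) by simp
   let ?t = "tableau_poly m n T :: 'a mpoly"
   have t: "?t \<in> flag_invariants m n ds"
    using tableau_poly_flag_invariant[OF T(1)] flag_invariants_cong[of n "shape T" ds m] shape by auto
   have top: "topped (<) \<alpha> ?t" using topped_tableau_poly(2)[OF T(1)] T(2) by simp
   define Q where "Q = P + Const (- lookup P \<alpha>) * ?t"
   have Q: "Q \<in> flag_invariants m n ds"
    unfolding Q_def by (intro flag_invariants_add flag_invariants_Const_mult less.prems t)
   have "lookup Q \<alpha> = 0"
    by (simp add: Q_def lookup_add lookup_minus topped_lookup[OF exponent_orders(2) top])
   have "\<gamma> < \<alpha>" if "\<gamma> \<in> keys Q" for \<gamma>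
   proof -
    have "\<gamma> \<in> keys P \<or> \<gamma> \<in> keys ?t"
     using that Poly_Mapping.keys_add[of P "Const (- lookup P \<alpha>) * ?t"] keys_Const_mult[of "- lookup P \<alpha>" ?t]
     unfolding Q_def by blast
    then have "\<gamma> \<le> \<alpha>" using max topped_keys[OF top, of \<gamma>] by auto
    moreover have "\<gamma> \<noteq> \<alpha>" using that \<open>lookup Q \<alpha> = 0\<close> by (auto simp: in_keys_iff)
    ultimately show ?thesis by simp
   qed
   then have below: "\<beta> < \<alpha>" if "\<gamma> \<in> keys Q" "\<beta> \<le> \<gamma>" for \<beta> \<gamma> using that by (meson le_less_trans)
   have "{\<beta>\<in>?E. \<exists>\<gamma>\<in>keys Q. \<beta> \<le> \<gamma>} \<subseteq> {\<beta>\<in>?E. \<exists>\<gamma>\<in>keys P. \<beta> \<le> \<gamma>} - {\<alpha>}"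
   proof
    fix \<beta> assume \<beta>: "\<beta> \<in> {\<beta>\<in>?E. \<exists>\<gamma>\<in>keys Q. \<beta> \<le> \<gamma>}"
    then have "\<beta> < \<alpha>" using below by blast
    then show "\<beta> \<in> {\<beta>\<in>?E. \<exists>\<gamma>\<in>keys P. \<beta> \<le> \<gamma>} - {\<alpha>}"
     using \<alpha> \<beta> less_imp_le[OF \<open>\<beta> < \<alpha>\<close>] by blast
   qed
   moreover have "\<alpha> \<in> {\<beta>\<in>?E. \<exists>\<gamma>\<in>keys P. \<beta> \<le> \<gamma>}" using \<alpha> \<alpha>E by auto
   moreover have "finite {\<beta>\<in>?E. \<exists>\<gamma>\<in>keys P. \<beta> \<le> \<gamma>}"
    by (rule finite_subset[OF _ finite_exponents_of_degree[of m n ds]]) auto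
   ultimately have "card {\<beta>\<in>?E. \<exists>\<gamma>\<in>keys Q. \<beta> \<le> \<gamma>} < card {\<beta>\<in>?E. \<exists>\<gamma>\<in>keys P. \<beta> \<le> \<gamma>}"
    by (metis (no_types, lifting) Diff_subset card_Diff1_less card_mono finite_Diff le_less_trans)
   then have "Q \<in> ?S" using less.hyps Q by blast
   moreover have "Const (lookup P \<alpha>) * ?t \<in> ?S"
    using T(1) shape by (intro mpoly.span_scale mpoly.span_base) auto
   ultimately have "Q + Const (lookup P \<alpha>) * ?t \<in> ?S" by (rule mpoly.span_add)
   then show ?thesis by (simp add: Q_def)
  qed (simp add: mpoly.span_zero)
 qed
 then show ?thesis using assms by blast
qed

section \<open>Algebras embedded in a ring\<close>

text \<open>A record of operations that is carried into an actual commutative ring by an injective map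
 inherits all algebra laws.\<close>

locale algebra_embedding =
 fixes M :: "('k::comm_ring_1, 'r) module" (structure) and s :: "'k => 'c::comm_ring_1" and \<phi> :: "'r => 'c"
 assumes s_hom: "comm_ring_hom s"
  and inj: "inj_on \<phi> (carrier M)"
  and closed: "\<zero> \<in> carrier M" "\<one> \<in> carrier M"
   "\<And>x y. x \<in> carrier M ==> y \<in> carrier M ==> x \<oplus> y \<in> carrier M"
   "\<And>x y. x \<in> carrier M ==> y \<in> carrier M ==> x \<otimes> y \<in> carrier M"
   "\<And>c x. x \<in> carrier M ==> c \<odot> x \<in> carrier M"
  and hom: "\<phi> \<zero> = 0" "\<phi> \<one> = 1"
   "\<And>x y. x \<in> carrier M ==> y \<in> carrier M ==> \<phi> (x \<oplus> y) = \<phi> x + \<phi> y"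
   "\<And>x y. x \<in> carrier M ==> y \<in> carrier M ==> \<phi> (x \<otimes> y) = \<phi> x * \<phi> y"
   "\<And>c x. x \<in> carrier M ==> \<phi> (c \<odot> x) = s c * \<phi> x"
begin

interpretation s: comm_ring_hom s by (rule s_hom)

lemma eq_iff: "x \<in> carrier M ==> y \<in> carrier M ==> x = y \<longleftrightarrow> \<phi> x = \<phi> y"
 using inj by (auto simp: inj_on_def)

lemma is_cring: "cring M"
proof (rule cringI)
 show "abelian_group M"
 proof (rule abelian_groupI)
  fix x assume x: "x \<in> carrier M"
  show "\<exists>y\<in>carrier M. y \<oplus> x = \<zero>"
   using x by (intro bexI[of _ "(-1) \<odot> x"]) (auto simp: eq_iff closed hom s.hom_uminus)
 qed (auto simp: eq_iff closed hom algebra_simps)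
 show "Group.comm_monoid M"
  by (rule Group.comm_monoidI) (auto simp: eq_iff closed hom algebra_simps)
qed (auto simp: eq_iff closed hom algebra_simps)

lemma is_algebra: "Module.algebra (ring_of_type_algebra :: 'k ring) M"
proof (rule Module.algebraI)
 show "cring (ring_of_type_algebra :: 'k ring)" by (rule cring_from_type_algebra)
 show "cring M" by (rule is_cring)
qed (auto simp: eq_iff closed hom algebra_simps ring_of_type_algebra_def s.hom_add s.hom_mult s.hom_one)

lemma is_module: "Module.module (ring_of_type_algebra :: 'k ring) M"
 using is_algebra by (simp add: Module.algebra_def)

lemma hom_finsum:
 assumes "finite I" "\<And>i. i \<in> I ==> f i \<in> carrier M"
 shows "\<phi> (\<Oplus>i\<in>I. f i) = (\<Sum>i\<in>I. \<phi> (f i))" "(\<Oplus>i\<in>I. f i) \<in> carrier M"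
proof -
 interpret cring M by (rule is_cring)
 show "(\<Oplus>i\<in>I. f i) \<in> carrier M" using assms(2) by (intro finsum_closed) auto
 show "\<phi> (\<Oplus>i\<in>I. f i) = (\<Sum>i\<in>I. \<phi> (f i))"
  using assms
 proof (induction I rule: finite_induct)
  case (insert i I)
  have "(\<Oplus>j\<in>I. f j) \<in> carrier M" using insert.prems by (intro finsum_closed) auto
  then show ?case using insert by (simp add: finsum_insert hom Pi_def)
 qed (simp add: hom)
qed

end

section \<open>Fibres over closed points\<close>

text \<open>The first isomorphism theorem for the quotient by \<open>t - c\<close>; the hypothesis on \<open>\<psi>\<close> says that the kernel is
 \<open>(t - c) R\<close>.\<close>

lemma fibre_isomorphic:
 fixes R :: "('a::field poly, 'r) module" (structure) and B :: "('a, 's) module" (structure)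
 assumes "Module.algebra (ring_of_type_algebra :: 'a poly ring) R"
  and surj: "\<psi> ` carrier R = carrier B"
  and add: "\<And>x y. x \<in> carrier R ==> y \<in> carrier R ==> \<psi> (x \<oplus>\<^bsub>R\<^esub> y) = \<psi> x \<oplus>\<^bsub>B\<^esub> \<psi> y"
  and mult: "\<And>x y. x \<in> carrier R ==> y \<in> carrier R ==> \<psi> (x \<otimes>\<^bsub>R\<^esub> y) = \<psi> x \<otimes>\<^bsub>B\<^esub> \<psi> y"
  and one: "\<psi> \<one>\<^bsub>R\<^esub> = \<one>\<^bsub>B\<^esub>"
  and smult: "\<And>b x. x \<in> carrier R ==> \<psi> ([:b:] \<odot>\<^bsub>R\<^esub> x) = b \<odot>\<^bsub>B\<^esub> \<psi> x"
  and kernel: "\<And>x y. x \<in> carrier R ==> y \<in> carrier R ==>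
   \<psi> x = \<psi> y \<longleftrightarrow> (\<exists>q\<in>carrier R. x = ([:- c, 1:] \<odot>\<^bsub>R\<^esub> q) \<oplus>\<^bsub>R\<^esub> y)"
 shows "isomorphic_algebras ring_of_type_algebra (fibre c R) B"
proof -
 interpret R: Module.algebra "ring_of_type_algebra :: 'a poly ring" R by fact
 have UNIV [simp]: "carrier (ring_of_type_algebra :: 'a poly ring) = UNIV" "carrier (ring_of_type_algebra :: 'a ring) = UNIV"
  unfolding atomize_conj by (simp add: ring_of_type_algebra_def)
 let ?t = "[:- c, 1:] \<odot>\<^bsub>R\<^esub> \<one>\<^bsub>R\<^esub>"
 define I where "I = PIdl\<^bsub>R\<^esub> ?t"
 have smult_closed: "p \<odot>\<^bsub>R\<^esub> x \<in> carrier R" if "x \<in> carrier R" for p x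
  using R.smult_closed[of p x] that by simp
 have t: "?t \<in> carrier R" by (rule smult_closed) simp
 interpret I: ideal I R unfolding I_def by (rule R.cgenideal_ideal[OF t])
 have tq: "q \<otimes>\<^bsub>R\<^esub> ?t = [:- c, 1:] \<odot>\<^bsub>R\<^esub> q" if "q \<in> carrier R" for q
  using R.smult_assoc2[of "[:- c, 1:]" "\<one>\<^bsub>R\<^esub>" q] that t by (simp add: R.m_comm[OF that t])
 have coset: "I +>\<^bsub>R\<^esub> x = {y \<in> carrier R. \<psi> y = \<psi> x}" if "x \<in> carrier R" for x
 proof -
  have "I +>\<^bsub>R\<^esub> x = {([:- c, 1:] \<odot>\<^bsub>R\<^esub> q) \<oplus>\<^bsub>R\<^esub> x |q. q \<in> carrier R}"
   using tq unfolding a_r_coset_def' I_def cgenideal_def by force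
  also have "\<dots> = {y \<in> carrier R. \<psi> y = \<psi> x}"
   using kernel[OF _ that] that smult_closed by auto
  finally show ?thesis .
 qed
 let ?h = "\<lambda>Z. the_elem (\<psi> ` Z)"
 have h: "?h (I +>\<^bsub>R\<^esub> x) = \<psi> x" if "x \<in> carrier R" for x
 proof -
  have "\<psi> ` (I +>\<^bsub>R\<^esub> x) = {\<psi> x}" using that by (auto simp: coset)
  then show ?thesis by simp
 qed
 have coset_eq: "I +>\<^bsub>R\<^esub> x = I +>\<^bsub>R\<^esub> y \<longleftrightarrow> \<psi> x = \<psi> y" if "x \<in> carrier R" "y \<in> carrier R" for x y
  using that by (auto simp: coset)
 have carr: "carrier (fibre c R) = (\<lambda>x. I +>\<^bsub>R\<^esub> x) ` carrier R"
  by (auto simp: fibre_def Let_def FactRing_def A_RCOSETS_def' I_def)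
 have "?h \<in> ring_iso (fibre c R) B"
 proof (rule ring_iso_memI)
  fix Z assume "Z \<in> carrier (fibre c R)"
  then show "?h Z \<in> carrier B" using surj by (auto simp: carr h)
 next
  fix Z Y assume "Z \<in> carrier (fibre c R)" "Y \<in> carrier (fibre c R)"
  then obtain x y where xy: "x \<in> carrier R" "y \<in> carrier R" "Z = I +>\<^bsub>R\<^esub> x" "Y = I +>\<^bsub>R\<^esub> y"
   by (auto simp: carr)
  have "Z \<otimes>\<^bsub>fibre c R\<^esub> Y = I +>\<^bsub>R\<^esub> (x \<otimes>\<^bsub>R\<^esub> y)"
   using xy I.rcoset_mult_add by (simp add: fibre_def Let_def FactRing_def I_def)
  then show "?h (Z \<otimes>\<^bsub>fibre c R\<^esub> Y) = ?h Z \<otimes>\<^bsub>B\<^esub> ?h Y"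
   using xy by (simp add: h mult)
  have "Z \<oplus>\<^bsub>fibre c R\<^esub> Y = I +>\<^bsub>R\<^esub> (x \<oplus>\<^bsub>R\<^esub> y)"
   using xy I.a_rcos_sum by (simp add: fibre_def Let_def FactRing_def I_def)
  then show "?h (Z \<oplus>\<^bsub>fibre c R\<^esub> Y) = ?h Z \<oplus>\<^bsub>B\<^esub> ?h Y"
   using xy by (simp add: h add)
 next
  have "\<one>\<^bsub>fibre c R\<^esub> = I +>\<^bsub>R\<^esub> \<one>\<^bsub>R\<^esub>" by (simp add: fibre_def Let_def FactRing_def I_def)
  then show "?h \<one>\<^bsub>fibre c R\<^esub> = \<one>\<^bsub>B\<^esub>" by (simp add: h one)
 next
  show "bij_betw ?h (carrier (fibre c R)) (carrier B)"
   unfolding bij_betw_def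
  proof
   show "inj_on ?h (carrier (fibre c R))"
    by (auto simp: inj_on_def carr h coset_eq)
   show "?h ` carrier (fibre c R) = carrier B"
   proof -
    have "?h ` carrier (fibre c R) = (\<lambda>x. ?h (I +>\<^bsub>R\<^esub> x)) ` carrier R" by (simp only: carr image_image)
    also have "\<dots> = \<psi> ` carrier R" by (rule image_cong[OF refl h])
    finally show ?thesis by (simp only: surj)
   qed
  qed
 qed
 moreover have "?h (b \<odot>\<^bsub>fibre c R\<^esub> Z) = b \<odot>\<^bsub>B\<^esub> ?h Z" if "Z \<in> carrier (fibre c R)" for b Z
 proof -
  obtain x where x: "x \<in> carrier R" "Z = I +>\<^bsub>R\<^esub> x" using \<open>Z \<in> _\<close> by (auto simp: carr)
  have "b \<odot>\<^bsub>fibre c R\<^esub> Z = (\<Union>r\<in>Z. I +>\<^bsub>R\<^esub> ([:b:] \<odot>\<^bsub>R\<^esub> r))"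
   by (simp add: fibre_def Let_def I_def)
  also have "\<dots> = (\<Union>r\<in>Z. I +>\<^bsub>R\<^esub> ([:b:] \<odot>\<^bsub>R\<^esub> x))"
   using x by (intro SUP_cong) (auto simp: coset smult smult_closed)
  also have "\<dots> = I +>\<^bsub>R\<^esub> ([:b:] \<odot>\<^bsub>R\<^esub> x)" using x by (auto simp: coset)
  finally show ?thesis using x by (simp add: h smult smult_closed)
 qed
 ultimately show ?thesis unfolding isomorphic_algebras_def by (intro bexI[of _ ?h] ballI)
qed

section \<open>Generic fibres\<close>

lemma UN_pairs_const:
 assumes "A \<noteq> {}" "\<And>x q. (x, q) \<in> A ==> f x q = c"
 shows "(\<Union>(x, q)\<in>A. f x q) = c"
 using assms by fastforce

text \<open>If the algebra is a torsion-free subring of a domain, two fractions agree iff cross multiplication holds in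
 that domain.\<close>

locale idom_algebra_embedding = algebra_embedding M s \<phi>
 for M :: "('a::field poly, 'r) module" (structure) and s :: "'a poly => 'c::idom" and \<phi> +
 assumes s_inj: "s p = 0 ==> p = 0"
begin

interpretation s: comm_ring_hom s by (rule s_hom)

lemma fraction_eq:
 assumes "r \<in> carrier M"
 shows "fraction M r p = {(r', p'). r' \<in> carrier M \<and> p' \<noteq> 0 \<and> s p' * \<phi> r = s p * \<phi> r'}"
proof -
 have "(\<exists>u. u \<noteq> 0 \<and> u \<odot> (p' \<odot> r) = u \<odot> (p \<odot> r')) \<longleftrightarrow> s p' * \<phi> r = s p * \<phi> r'"
  if "r' \<in> carrier M" for r' p'
 proof -
  have "u \<odot> (p' \<odot> r) = u \<odot> (p \<odot> r') \<longleftrightarrow> s p' * \<phi> r = s p * \<phi> r'" if "u \<noteq> 0" for u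
   using assms \<open>r' \<in> _\<close> s_inj[of u] that by (auto simp: eq_iff closed hom)
  then show ?thesis by (metis zero_neq_one)
 qed
 then show ?thesis unfolding fraction_def by auto
qed

lemma fraction_mem: "r \<in> carrier M ==> p \<noteq> 0 ==> (r, p) \<in> fraction M r p"
 by (simp add: fraction_eq)

lemma fraction_eq_iff:
 assumes "r \<in> carrier M" "r' \<in> carrier M" "p \<noteq> 0" "p' \<noteq> 0"
 shows "fraction M r p = fraction M r' p' \<longleftrightarrow> s p' * \<phi> r = s p * \<phi> r'"
proof
 assume "fraction M r p = fraction M r' p'"
 then have "(r', p') \<in> fraction M r p" using assms fraction_mem by blast
 then show "s p' * \<phi> r = s p * \<phi> r'" by (simp add: fraction_eq assms)
next
 assume eq: "s p' * \<phi> r = s p * \<phi> r'"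
 have nz: "s p \<noteq> 0" "s p' \<noteq> 0" using assms s_inj by auto
 have "s q * \<phi> r = s p * \<phi> y \<longleftrightarrow> s q * \<phi> r' = s p' * \<phi> y" for q y
 proof -
  have "s q * \<phi> r = s p * \<phi> y \<longleftrightarrow> s p' * (s q * \<phi> r) = s p' * (s p * \<phi> y)" using nz by simp
  also have "s p' * (s q * \<phi> r) = s p * (s q * \<phi> r')" using eq by (simp add: mult.left_commute)
  also have "s p' * (s p * \<phi> y) = s p * (s p' * \<phi> y)" by (rule mult.left_commute)
  finally show ?thesis using nz by simp
 qed
 then show "fraction M r p = fraction M r' p'" by (simp add: fraction_eq assms)
qed

lemma fraction_cases:
 assumes "(r', p') \<in> fraction M r p" "r \<in> carrier M" "p \<noteq> 0"
 shows "r' \<in> carrier M" "p' \<noteq> 0" "s p' * \<phi> r = s p * \<phi> r'"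
 using assms by (auto simp: fraction_eq)

lemma generic_mult:
 assumes "r \<in> carrier M" "p \<noteq> 0" "r' \<in> carrier M" "p' \<noteq> 0"
 shows "fraction M r p \<otimes>\<^bsub>generic_fibre M\<^esub> fraction M r' p' = fraction M (r \<otimes> r') (p * p')"
proof -
 have "(\<Union>(x, q)\<in>fraction M r p. \<Union>(x', q')\<in>fraction M r' p'. fraction M (x \<otimes> x') (q * q')) =
  fraction M (r \<otimes> r') (p * p')"
 proof (intro UN_pairs_const)
  show "fraction M r p \<noteq> {}" "fraction M r' p' \<noteq> {}" using fraction_mem assms by blast+
  fix x q x' q' assume "(x, q) \<in> fraction M r p" "(x', q') \<in> fraction M r' p'"
  note f = fraction_cases[OF this(1) assms(1,2)] fraction_cases[OF this(2) assms(3,4)]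
  have "s (q * q') * \<phi> (r \<otimes> r') = (s q * \<phi> r) * (s q' * \<phi> r')"
   using f(1,2,4,5) assms by (simp add: hom s.hom_mult algebra_simps)
  also have "\<dots> = s (p * p') * \<phi> (x \<otimes> x')"
   unfolding f(3,6) using f(1,2,4,5) assms by (simp add: hom s.hom_mult algebra_simps)
  finally show "fraction M (x \<otimes> x') (q * q') = fraction M (r \<otimes> r') (p * p')"
   using f(1,2,4,5) assms by (subst fraction_eq_iff) (auto simp: closed)
 qed
 then show ?thesis by (simp add: generic_fibre_def)
qed

lemma generic_add:
 assumes "r \<in> carrier M" "p \<noteq> 0" "r' \<in> carrier M" "p' \<noteq> 0"
 shows "fraction M r p \<oplus>\<^bsub>generic_fibre M\<^esub> fraction M r' p' = fraction M ((p' \<odot> r) \<oplus> (p \<odot> r')) (p * p')"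
proof -
 have "(\<Union>(x, q)\<in>fraction M r p. \<Union>(x', q')\<in>fraction M r' p'. fraction M ((q' \<odot> x) \<oplus> (q \<odot> x')) (q * q')) =
  fraction M ((p' \<odot> r) \<oplus> (p \<odot> r')) (p * p')"
 proof (intro UN_pairs_const)
  show "fraction M r p \<noteq> {}" "fraction M r' p' \<noteq> {}" using fraction_mem assms by blast+
  fix x q x' q' assume "(x, q) \<in> fraction M r p" "(x', q') \<in> fraction M r' p'"
  note f = fraction_cases[OF this(1) assms(1,2)] fraction_cases[OF this(2) assms(3,4)]
  have "s (q * q') * \<phi> ((p' \<odot> r) \<oplus> (p \<odot> r')) =
    s q' * s p' * (s q * \<phi> r) + s q * s p * (s q' * \<phi> r')"
   using f(1,2,4,5) assms by (simp add: closed hom s.hom_mult algebra_simps)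
  also have "\<dots> = s (p * p') * \<phi> ((q' \<odot> x) \<oplus> (q \<odot> x'))"
   unfolding f(3,6) using f(1,2,4,5) assms by (simp add: closed hom s.hom_mult algebra_simps)
  finally show "fraction M ((q' \<odot> x) \<oplus> (q \<odot> x')) (q * q') = fraction M ((p' \<odot> r) \<oplus> (p \<odot> r')) (p * p')"
   using f(1,2,4,5) assms by (subst fraction_eq_iff) (auto simp: closed)
 qed
 then show ?thesis by (simp add: generic_fibre_def)
qed

lemma generic_smult:
 assumes "r \<in> carrier M" "p \<noteq> 0" "b \<noteq> 0"
 shows "Fract a b \<odot>\<^bsub>generic_fibre M\<^esub> fraction M r p = fraction M (a \<odot> r) (b * p)"
proof -
 let ?F = "{(a', b'). b' \<noteq> 0 \<and> Fract a b = Fract a' b'}"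
 have "(\<Union>(x, q)\<in>fraction M r p. \<Union>(a', b')\<in>?F. fraction M (a' \<odot> x) (b' * q)) =
  fraction M (a \<odot> r) (b * p)"
 proof (intro UN_pairs_const)
  show "fraction M r p \<noteq> {}" "?F \<noteq> {}" using fraction_mem assms by blast+
  fix x q a' b' assume "(x, q) \<in> fraction M r p" and "(a', b') \<in> ?F"
  then have b': "b' \<noteq> 0" "a * b' = a' * b" by (auto simp: eq_fract assms(3))
  note f = fraction_cases[OF \<open>(x, q) \<in> _\<close> assms(1,2)]
  have ab: "s a * s b' = s a' * s b" using b'(2) by (metis s.hom_mult)
  have "s (b' * q) * \<phi> (a \<odot> r) = (s a * s b') * (s q * \<phi> r)"
   using f(1,2) assms by (simp add: hom s.hom_mult algebra_simps)
  also have "\<dots> = s (b * p) * \<phi> (a' \<odot> x)"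
   unfolding f(3) ab using f(1,2) assms by (simp add: hom s.hom_mult algebra_simps)
  finally show "fraction M (a' \<odot> x) (b' * q) = fraction M (a \<odot> r) (b * p)"
   using f(1,2) assms b' by (subst fraction_eq_iff) (auto simp: closed)
 qed
 then show ?thesis by (simp add: generic_fibre_def)
qed

end

text \<open>The inclusion of the smaller algebra induces the isomorphism; it is surjective because denominators from the base
 move every element into the smaller algebra.\<close>

lemma generic_fibre_isomorphic:
 fixes M1 :: "('a::field poly, 'r) module" and M2 :: "('a poly, 's) module" and s :: "'a poly => 'c::idom"
 assumes e1: "idom_algebra_embedding M1 s \<phi>1" and e2: "idom_algebra_embedding M2 s \<phi>2"
  and sub: "\<phi>1 ` carrier M1 \<subseteq> \<phi>2 ` carrier M2"
  and denom: "\<And>y. y \<in> carrier M2 ==> \<exists>p. p \<noteq> 0 \<and> s p * \<phi>2 y \<in> \<phi>1 ` carrier M1"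
 shows "isomorphic_algebras ring_of_type_algebra (generic_fibre M1) (generic_fibre M2)"
proof -
 interpret e1: idom_algebra_embedding M1 s \<phi>1 by fact
 interpret e2: idom_algebra_embedding M2 s \<phi>2 by fact
 interpret s: comm_ring_hom s by (rule e1.s_hom)
 define \<kappa> where "\<kappa> x = (SOME y. y \<in> carrier M2 \<and> \<phi>2 y = \<phi>1 x)" for x
 have \<kappa>: "\<kappa> x \<in> carrier M2" "\<phi>2 (\<kappa> x) = \<phi>1 x" if "x \<in> carrier M1" for x
 proof -
  have "\<exists>y. y \<in> carrier M2 \<and> \<phi>2 y = \<phi>1 x" using sub that by force
  from someI_ex[OF this] show "\<kappa> x \<in> carrier M2" "\<phi>2 (\<kappa> x) = \<phi>1 x" by (auto simp: \<kappa>_def)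
 qed
 define \<Theta> where "\<Theta> C = (\<Union>(x, p)\<in>C. fraction M2 (\<kappa> x) p)" for C
 have \<Theta>: "\<Theta> (fraction M1 x p) = fraction M2 (\<kappa> x) p" if x: "x \<in> carrier M1" "p \<noteq> 0" for x p
 proof -
  have "\<Theta> (fraction M1 x p) = (\<Union>(x', p')\<in>fraction M1 x p. fraction M2 (\<kappa> x) p)"
   unfolding \<Theta>_def
  proof (intro SUP_cong refl; clarsimp)
   fix x' p' assume "(x', p') \<in> fraction M1 x p"
   note f = e1.fraction_cases[OF this x]
   show "fraction M2 (\<kappa> x') p' = fraction M2 (\<kappa> x) p"
    using f x by (subst e2.fraction_eq_iff) (auto simp: \<kappa>)
  qed
  then show ?thesis using e1.fraction_mem[OF x] by auto
 qed
 have carr1: "\<exists>x p. x \<in> carrier M1 \<and> p \<noteq> 0 \<and> C = fraction M1 x p" if "C \<in> carrier (generic_fibre M1)" for C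
  using that by (auto simp: generic_fibre_def)
 have mem2: "fraction M2 y p \<in> carrier (generic_fibre M2)" if "y \<in> carrier M2" "p \<noteq> 0" for y p
  using that by (auto simp: generic_fibre_def)
 note closed = e1.closed e2.closed and hom = e1.hom e2.hom
 have eq2: "\<kappa> x = y" if "x \<in> carrier M1" "y \<in> carrier M2" "\<phi>1 x = \<phi>2 y" for x y
  using that \<kappa> by (simp add: e2.eq_iff)
 have "\<Theta> \<in> ring_iso (generic_fibre M1) (generic_fibre M2)"
 proof (rule ring_iso_memI)
  fix C assume "C \<in> carrier (generic_fibre M1)"
  then show "\<Theta> C \<in> carrier (generic_fibre M2)" using carr1 \<Theta> \<kappa> mem2 by metis
 next
  fix C D assume "C \<in> carrier (generic_fibre M1)" "D \<in> carrier (generic_fibre M1)"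
  then obtain x p y q where C: "x \<in> carrier M1" "p \<noteq> 0" "C = fraction M1 x p"
   and D: "y \<in> carrier M1" "q \<noteq> 0" "D = fraction M1 y q" using carr1 by meson
  have "\<kappa> (x \<otimes>\<^bsub>M1\<^esub> y) = \<kappa> x \<otimes>\<^bsub>M2\<^esub> \<kappa> y"
   using C D by (intro eq2) (auto simp: closed hom \<kappa>)
  then show "\<Theta> (C \<otimes>\<^bsub>generic_fibre M1\<^esub> D) = \<Theta> C \<otimes>\<^bsub>generic_fibre M2\<^esub> \<Theta> D"
   using C D by (simp add: e1.generic_mult e2.generic_mult \<Theta> closed \<kappa>)
  have "\<kappa> ((q \<odot>\<^bsub>M1\<^esub> x) \<oplus>\<^bsub>M1\<^esub> (p \<odot>\<^bsub>M1\<^esub> y)) = (q \<odot>\<^bsub>M2\<^esub> \<kappa> x) \<oplus>\<^bsub>M2\<^esub> (p \<odot>\<^bsub>M2\<^esub> \<kappa> y)"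
   using C D by (intro eq2) (auto simp: closed hom \<kappa>)
  then show "\<Theta> (C \<oplus>\<^bsub>generic_fibre M1\<^esub> D) = \<Theta> C \<oplus>\<^bsub>generic_fibre M2\<^esub> \<Theta> D"
   using C D by (simp add: e1.generic_add e2.generic_add \<Theta> closed \<kappa>)
 next
  have "\<kappa> \<one>\<^bsub>M1\<^esub> = \<one>\<^bsub>M2\<^esub>" by (intro eq2) (auto simp: closed hom)
  then have "\<Theta> (fraction M1 \<one>\<^bsub>M1\<^esub> 1) = fraction M2 \<one>\<^bsub>M2\<^esub> 1" by (simp add: \<Theta> closed)
  then show "\<Theta> \<one>\<^bsub>generic_fibre M1\<^esub> = \<one>\<^bsub>generic_fibre M2\<^esub>" by (simp add: generic_fibre_def)
 next
  show "bij_betw \<Theta> (carrier (generic_fibre M1)) (carrier (generic_fibre M2))"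
   unfolding bij_betw_def
  proof
   show "inj_on \<Theta> (carrier (generic_fibre M1))"
   proof (rule inj_onI)
    fix C D assume "C \<in> carrier (generic_fibre M1)" "D \<in> carrier (generic_fibre M1)" and eq: "\<Theta> C = \<Theta> D"
    then obtain x p y q where C: "x \<in> carrier M1" "p \<noteq> 0" "C = fraction M1 x p"
     and D: "y \<in> carrier M1" "q \<noteq> 0" "D = fraction M1 y q" using carr1 by meson
    then show "C = D" using eq by (simp add: \<Theta> e1.fraction_eq_iff e2.fraction_eq_iff \<kappa>)
   qed
   show "\<Theta> ` carrier (generic_fibre M1) = carrier (generic_fibre M2)"
   proof
    show "\<Theta> ` carrier (generic_fibre M1) \<subseteq> carrier (generic_fibre M2)"
     using carr1 \<Theta> \<kappa> mem2 by (metis image_subsetI)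
    show "carrier (generic_fibre M2) \<subseteq> \<Theta> ` carrier (generic_fibre M1)"
    proof
     fix D assume "D \<in> carrier (generic_fibre M2)"
     then obtain y q where D: "y \<in> carrier M2" "q \<noteq> 0" "D = fraction M2 y q"
      by (auto simp: generic_fibre_def)
     obtain p x where px: "p \<noteq> 0" "x \<in> carrier M1" "s p * \<phi>2 y = \<phi>1 x" using denom[OF D(1)] by blast
     have "fraction M2 (\<kappa> x) (p * q) = D"
      using px D by (simp add: e2.fraction_eq_iff \<kappa> s.hom_mult flip: px(3))
     then have "\<Theta> (fraction M1 x (p * q)) = D" using px D by (simp add: \<Theta>)
     moreover have "fraction M1 x (p * q) \<in> carrier (generic_fibre M1)"
      using px(1,2) D(2) by (auto simp: generic_fibre_def intro!: exI[of _ x] exI[of _ "p * q"])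
     ultimately show "D \<in> \<Theta> ` carrier (generic_fibre M1)" by blast
    qed
   qed
  qed
 qed
 moreover have "\<Theta> (c \<odot>\<^bsub>generic_fibre M1\<^esub> C) = c \<odot>\<^bsub>generic_fibre M2\<^esub> \<Theta> C"
  if C_in: "C \<in> carrier (generic_fibre M1)" for c C
 proof -
  obtain x p where C: "x \<in> carrier M1" "p \<noteq> 0" "C = fraction M1 x p" using carr1[OF C_in] by blast
  obtain a b where c: "c = Fract a b" "b \<noteq> 0" by (cases c) auto
  have "\<kappa> (a \<odot>\<^bsub>M1\<^esub> x) = a \<odot>\<^bsub>M2\<^esub> \<kappa> x" using C by (intro eq2) (auto simp: closed hom \<kappa>)
  then show ?thesis
   using C c by (simp add: e1.generic_smult e2.generic_smult \<Theta> closed \<kappa>)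
 qed
 ultimately show ?thesis unfolding isomorphic_algebras_def by (intro bexI[of _ \<Theta>] ballI)
qed

section \<open>Free modules are flat\<close>

text \<open>Let \<open>e\<close> be a basis with coordinates \<open>C\<close>.  A tensor in \<open>N \<otimes> M\<close> is \<open>\<Sum>\<^sub>x n\<^sub>x \<otimes> e\<^sub>x\<close>
 with \<open>n\<^sub>x\<close> computed by the additive map \<open>y \<otimes> r \<mapsto> C\<^sub>x(r) y\<close>.  For a tensor of elements of \<open>N'\<close> that is
 zero in \<open>N \<otimes> M\<close>, all \<open>n\<^sub>x\<close> are zero, and the same expansion over \<open>N'\<close> shows that it is already
 zero in \<open>N' \<otimes> M\<close>.\<close>

lemma free_module_flat:
 fixes M :: "('k::comm_ring_1, 'm) module" and C :: "'g => 'm => 'k"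
 defines "K \<equiv> (ring_of_type_algebra :: 'k ring)"
 assumes M: "Module.module K M"
  and e: "\<And>x. x \<in> J ==> e x \<in> carrier M"
  and C_add: "\<And>x r r'. x \<in> J ==> r \<in> carrier M ==> r' \<in> carrier M ==> C x (r \<oplus>\<^bsub>M\<^esub> r') = C x r + C x r'"
  and C_smult: "\<And>x c r. x \<in> J ==> r \<in> carrier M ==> C x (c \<odot>\<^bsub>M\<^esub> r) = c * C x r"
  and fin: "\<And>r. r \<in> carrier M ==> finite {x\<in>J. C x r \<noteq> 0}"
  and expand: "\<And>r. r \<in> carrier M ==> r = (\<Oplus>\<^bsub>M\<^esub>x\<in>{x\<in>J. C x r \<noteq> 0}. C x r \<odot>\<^bsub>M\<^esub> e x)"
 shows "flat K M"
 unfolding flat_def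
proof (intro conjI allI impI)
 show "Module.module K M" by fact
 fix N :: "('k, 'k) module" and N' z
 assume N: "Module.module K N \<and> submodule N' K N"
  and z: "Poly_Mapping.keys z \<subseteq> N' \<times> carrier M \<and> z \<in> tensor_relations K N M"
 interpret N: Module.module K N using N by simp
 interpret M: Module.module K M by fact
 have K [simp]: "c \<in> carrier K" for c by (simp add: K_def ring_of_type_algebra_def)
 have K_ops: "x \<oplus>\<^bsub>K\<^esub> y = x + y" "x \<otimes>\<^bsub>K\<^esub> y = x * y" for x y by (auto simp: K_def ring_of_type_algebra_def)
 have N'_sub: "N' \<subseteq> carrier N" and N'_ne: "N' \<noteq> {}"
  and N'_inv: "\<And>a. a \<in> N' ==> \<ominus>\<^bsub>N\<^esub> a \<in> N'"
  and N'_add: "\<And>a b. a \<in> N' ==> b \<in> N' ==> a \<oplus>\<^bsub>N\<^esub> b \<in> N'"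
  and N'_smult: "\<And>c a. a \<in> N' ==> c \<odot>\<^bsub>N\<^esub> a \<in> N'"
  using N.submoduleE[of N'] N K by auto
 have N'_zero: "\<zero>\<^bsub>N\<^esub> \<in> N'"
 proof -
  obtain a where "a \<in> N'" using N'_ne by blast
  then have "a \<oplus>\<^bsub>N\<^esub> (\<ominus>\<^bsub>N\<^esub> a) \<in> N'" using N'_add N'_inv by blast
  then show ?thesis using \<open>a \<in> N'\<close> N'_sub by (simp add: N.r_neg subset_iff)
 qed
 let ?T = "tensor_relations K (N\<lparr>carrier := N'\<rparr>) M"
 have T_zero: "0 \<in> ?T" and T_diff: "\<And>u v. u \<in> ?T ==> v \<in> ?T ==> u - v \<in> ?T"
  by (auto intro: tensor_relations.intros)
 have T_add: "u + v \<in> ?T" if "u \<in> ?T" "v \<in> ?T" for u v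
  using T_diff[OF that(1) T_diff[OF T_zero that(2)]] by simp
 have T_sum: "sum f Z \<in> ?T" if "\<And>x. x \<in> Z ==> f x \<in> ?T" for f :: "'g => _" and Z
  using that by (induction Z rule: infinite_finite_induct) (auto intro: T_zero T_add)
 let ?s = "\<lambda>a r. Poly_Mapping.single (a, r) (1::int)"
 have T_left: "?s (a \<oplus>\<^bsub>N\<^esub> b) r - ?s a r - ?s b r \<in> ?T" if "a \<in> N'" "b \<in> N'" "r \<in> carrier M" for a b r
  using tensor_relations.add_left[of a "N\<lparr>carrier := N'\<rparr>" b r M K] that by simp
 have T_right: "?s a (r \<oplus>\<^bsub>M\<^esub> r') - ?s a r - ?s a r' \<in> ?T" if "a \<in> N'" "r \<in> carrier M" "r' \<in> carrier M" for a r r'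
  using tensor_relations.add_right[of a "N\<lparr>carrier := N'\<rparr>" r M r' K] that by simp
 have T_bal: "?s (c \<odot>\<^bsub>N\<^esub> a) r - ?s a (c \<odot>\<^bsub>M\<^esub> r) \<in> ?T" if "a \<in> N'" "r \<in> carrier M" for c a r
  using tensor_relations.balanced[of c K a "N\<lparr>carrier := N'\<rparr>" r M] that by simp
 have T_left0: "?s \<zero>\<^bsub>N\<^esub> r \<in> ?T" if "r \<in> carrier M" for r
  using T_diff[OF T_zero T_left[OF N'_zero N'_zero that]] by simp
 have T_right0: "?s a \<zero>\<^bsub>M\<^esub> \<in> ?T" if "a \<in> N'" for a
  using T_diff[OF T_zero T_right[OF that, of "\<zero>\<^bsub>M\<^esub>" "\<zero>\<^bsub>M\<^esub>"]] by simp
 define F where "F = free_Abelian_group (carrier N \<times> carrier M)"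
 have "\<exists>h. h \<in> hom F (add_monoid N) \<and> (\<forall>a r. a \<in> carrier N --> r \<in> carrier M --> h (frag_of (a, r)) = C x r \<odot>\<^bsub>N\<^esub> a)" for x
 proof -
  have "(\<lambda>(a, r). C x r \<odot>\<^bsub>N\<^esub> a) ` (carrier N \<times> carrier M) \<subseteq> carrier (add_monoid N)" by auto
  from comm_group.free_Abelian_group_universal[OF N.a_comm_group this] show ?thesis unfolding F_def
   by (metis (mono_tags, lifting) case_prod_conv mem_Sigma_iff)
 qed
 then obtain h where h_hom: "\<And>x. h x \<in> hom F (add_monoid N)"
  and h: "\<And>x a r. a \<in> carrier N ==> r \<in> carrier M ==> h x (frag_of (a, r)) = C x r \<odot>\<^bsub>N\<^esub> a" by metis
 let ?F = "{u. Poly_Mapping.keys u \<subseteq> carrier N \<times> carrier M}"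
 have h_closed: "h x u \<in> carrier N" and h_add: "v \<in> ?F ==> h x (u + v) = h x u \<oplus>\<^bsub>N\<^esub> h x v"
  if "u \<in> ?F" for x u v
  using h_hom[of x] that by (auto simp: hom_def F_def Pi_iff)
 have h_diff: "h x (u - v) = h x u \<ominus>\<^bsub>N\<^esub> h x v" if "u \<in> ?F" "v \<in> ?F" for x u v
 proof -
  have uv: "u - v \<in> ?F" using that keys_diff[of u v] by auto
  then have "h x u = h x (u - v) \<oplus>\<^bsub>N\<^esub> h x v" using h_add[OF uv that(2)] by simp
  then show ?thesis using h_closed that uv
   by (simp add: N.minus_eq N.add.inv_solve_right)
 qed
 have h_zero: "h x 0 = \<zero>\<^bsub>N\<^esub>" for x using h_diff[of 0 0 x] h_closed[of 0 x] by (simp add: N.minus_eq N.r_neg)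
 have N_cancel: "a = b \<oplus>\<^bsub>N\<^esub> d ==> a \<ominus>\<^bsub>N\<^esub> b \<ominus>\<^bsub>N\<^esub> d = \<zero>\<^bsub>N\<^esub>" if "b \<in> carrier N" "d \<in> carrier N" for a b d
  using that by (simp add: N.minus_eq N.add.m_comm[of b d] N.add.m_assoc N.r_neg)
 have F_of: "frag_of (a, r) \<in> ?F" if "a \<in> carrier N" "r \<in> carrier M" for a r
  using that by (simp add: keys_frag_of)
 have F_diff: "u - v \<in> ?F" if "u \<in> ?F" "v \<in> ?F" for u v
  using that keys_diff[of u v] by auto
 have h_T: "u \<in> ?F \<and> (x \<in> J --> h x u = \<zero>\<^bsub>N\<^esub>)" if "u \<in> tensor_relations K N M" for x u
  using that
 proof induction
  case zero
  then show ?case by (simp add: h_zero)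
 next
  case (diff u v)
  then have uv: "u \<in> ?F" "v \<in> ?F" by blast+
  show ?case using F_diff[OF uv] h_diff[OF uv, of x] diff by (simp add: N.minus_eq)
 next
  case (add_left a b r)
  note F = F_of[of "a \<oplus>\<^bsub>N\<^esub> b" r] F_of[of a r] F_of[of b r]
  have "(C x r \<odot>\<^bsub>N\<^esub> (a \<oplus>\<^bsub>N\<^esub> b)) \<ominus>\<^bsub>N\<^esub> (C x r \<odot>\<^bsub>N\<^esub> a) \<ominus>\<^bsub>N\<^esub> (C x r \<odot>\<^bsub>N\<^esub> b) = \<zero>\<^bsub>N\<^esub>"
   using add_left by (intro N_cancel) (auto simp: N.smult_r_distr)
  then show ?case
   using add_left F F_diff[OF F_diff[OF F(1,2)] F(3)] F_diff[OF F(1,2)] by (simp add: h_diff h del: mem_Collect_eq)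
 next
  case (add_right a r r')
  note F = F_of[of a "r \<oplus>\<^bsub>M\<^esub> r'"] F_of[of a r] F_of[of a r']
  have "(C x r + C x r') \<odot>\<^bsub>N\<^esub> a = C x r \<odot>\<^bsub>N\<^esub> a \<oplus>\<^bsub>N\<^esub> C x r' \<odot>\<^bsub>N\<^esub> a"
   using N.smult_l_distr[of "C x r" "C x r'" a] add_right K_ops by simp
  then have "((C x r + C x r') \<odot>\<^bsub>N\<^esub> a) \<ominus>\<^bsub>N\<^esub> (C x r \<odot>\<^bsub>N\<^esub> a) \<ominus>\<^bsub>N\<^esub> (C x r' \<odot>\<^bsub>N\<^esub> a) = \<zero>\<^bsub>N\<^esub>"
   using add_right by (intro N_cancel) auto
  then show ?case
   using add_right F F_diff[OF F_diff[OF F(1,2)] F(3)] F_diff[OF F(1,2)] by (simp add: h_diff h C_add del: mem_Collect_eq)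
 next
  case (balanced c a r)
  note F = F_of[of "c \<odot>\<^bsub>N\<^esub> a" r] F_of[of a "c \<odot>\<^bsub>M\<^esub> r"]
  have "C x r \<odot>\<^bsub>N\<^esub> (c \<odot>\<^bsub>N\<^esub> a) = (c * C x r) \<odot>\<^bsub>N\<^esub> a"
   using N.smult_assoc1[of "C x r" c a] balanced K_ops by (simp add: mult.commute)
  moreover have "(c * C x r) \<odot>\<^bsub>N\<^esub> a \<ominus>\<^bsub>N\<^esub> (c * C x r) \<odot>\<^bsub>N\<^esub> a = \<zero>\<^bsub>N\<^esub>"
   using balanced by (simp add: N.minus_eq N.r_neg)
  ultimately show ?case
   using balanced F F_diff[OF F] by (simp add: h_diff h C_smult del: mem_Collect_eq)
 qed
 have reduce: "\<exists>Z. finite Z \<and> Z \<subseteq> J \<and> (\<forall>Y. finite Y --> Z \<subseteq> Y --> Y \<subseteq> J -->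
   u - (\<Sum>x\<in>Y. ?s (h x u) (e x)) \<in> ?T) \<and> (\<forall>x. h x u \<in> N') \<and> u \<in> ?F"
  if "Poly_Mapping.keys u \<subseteq> N' \<times> carrier M" for u
  using that
 proof (induction u rule: frag_induction)
  case zero
  have "0 - (\<Sum>x\<in>Y. ?s (h x 0) (e x)) \<in> ?T" if "Y \<subseteq> J" for Y
   using that by (intro T_diff T_zero T_sum) (auto simp: h_zero intro!: T_left0 e)
  then show ?case using N'_zero by (intro exI[of _ "{}"]) (auto simp: h_zero)
 next
  case (one p)
  then obtain a r where p: "p = (a, r)" "a \<in> N'" "r \<in> carrier M" by (cases p) auto
  have a: "a \<in> carrier N" using p N'_sub by auto
  let ?Z = "{x\<in>J. C x r \<noteq> 0}"
  have eq: "?s a (\<Oplus>\<^bsub>M\<^esub>x\<in>Y. C x r \<odot>\<^bsub>M\<^esub> e x) - (\<Sum>x\<in>Y. ?s (C x r \<odot>\<^bsub>N\<^esub> a) (e x)) \<in> ?T"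
   if "finite Y" "Y \<subseteq> J" for Y
   using that
  proof (induction Y rule: finite_induct)
   case empty
   then show ?case using T_right0[OF p(2)] by simp
  next
   case (insert x Y)
   let ?r = "\<Oplus>\<^bsub>M\<^esub>x\<in>Y. C x r \<odot>\<^bsub>M\<^esub> e x"
   have cl: "C x r \<odot>\<^bsub>M\<^esub> e x \<in> carrier M" if "x \<in> J" for x using e[OF that] by simp
   have r: "?r \<in> carrier M" using insert.prems cl by (intro M.finsum_closed) auto
   have "(\<Oplus>\<^bsub>M\<^esub>x\<in>insert x Y. C x r \<odot>\<^bsub>M\<^esub> e x) = C x r \<odot>\<^bsub>M\<^esub> e x \<oplus>\<^bsub>M\<^esub> ?r"
    using insert cl by (intro M.finsum_insert) auto
   moreover have "?s a (C x r \<odot>\<^bsub>M\<^esub> e x \<oplus>\<^bsub>M\<^esub> ?r) - ?s a (C x r \<odot>\<^bsub>M\<^esub> e x) - ?s a ?r \<in> ?T"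
    using insert.prems cl r by (intro T_right p) auto
   moreover have "?s (C x r \<odot>\<^bsub>N\<^esub> a) (e x) - ?s a (C x r \<odot>\<^bsub>M\<^esub> e x) \<in> ?T"
    using insert.prems e by (intro T_bal p) auto
   moreover have "?s a ?r - (\<Sum>x\<in>Y. ?s (C x r \<odot>\<^bsub>N\<^esub> a) (e x)) \<in> ?T" using insert by auto
   ultimately show ?case
    using T_diff[OF T_add[of "?s a (C x r \<odot>\<^bsub>M\<^esub> e x \<oplus>\<^bsub>M\<^esub> ?r) - ?s a (C x r \<odot>\<^bsub>M\<^esub> e x) - ?s a ?r"
      "?s a ?r - (\<Sum>x\<in>Y. ?s (C x r \<odot>\<^bsub>N\<^esub> a) (e x))"] , of "?s (C x r \<odot>\<^bsub>N\<^esub> a) (e x) - ?s a (C x r \<odot>\<^bsub>M\<^esub> e x)"]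
     insert.hyps by (simp add: algebra_simps)
  qed
  have "?s a r - (\<Sum>x\<in>Y. ?s (h x (frag_of p)) (e x)) \<in> ?T" if Y: "finite Y" "?Z \<subseteq> Y" "Y \<subseteq> J" for Y
  proof -
   have "(\<Oplus>\<^bsub>M\<^esub>x\<in>Y. C x r \<odot>\<^bsub>M\<^esub> e x) = (\<Oplus>\<^bsub>M\<^esub>x\<in>?Z. C x r \<odot>\<^bsub>M\<^esub> e x)"
   proof (rule M.add.finprod_mono_neutral_cong_right)
    fix i assume "i \<in> Y - ?Z"
    then have "C i r = \<zero>\<^bsub>K\<^esub>" "i \<in> J" using Y by (auto simp: K_def ring_of_type_algebra_def)
    then show "C i r \<odot>\<^bsub>M\<^esub> e i = \<zero>\<^bsub>M\<^esub>" using e[of i] by simp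
   qed (use Y e in auto)
   then have "(\<Oplus>\<^bsub>M\<^esub>x\<in>Y. C x r \<odot>\<^bsub>M\<^esub> e x) = r" using expand[OF p(3)] by simp
   then show ?thesis using eq[OF Y(1,3)] by (simp add: p h a)
  qed
  then show ?case
   using fin[OF p(3)] p a N'_smult by (intro exI[of _ ?Z]) (auto simp: h keys_frag_of)
 next
  case (diff u v)
  then obtain X1 X2 where
   1: "finite X1" "X1 \<subseteq> J" "\<And>Y. finite Y ==> X1 \<subseteq> Y ==> Y \<subseteq> J ==> u - (\<Sum>x\<in>Y. ?s (h x u) (e x)) \<in> ?T"
    "\<And>x. h x u \<in> N'" "u \<in> ?F"
   and 2: "finite X2" "X2 \<subseteq> J" "\<And>Y. finite Y ==> X2 \<subseteq> Y ==> Y \<subseteq> J ==> v - (\<Sum>x\<in>Y. ?s (h x v) (e x)) \<in> ?T"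
    "\<And>x. h x v \<in> N'" "v \<in> ?F" by auto
  have huv: "h x (u - v) = h x u \<oplus>\<^bsub>N\<^esub> (\<ominus>\<^bsub>N\<^esub> h x v)" for x using 1 2 by (simp add: h_diff N.minus_eq)
  have huv': "h x (u - v) \<in> N'" for x unfolding huv using 1 2 N'_add N'_inv by auto
  have huv'': "h x (u - v) \<oplus>\<^bsub>N\<^esub> h x v = h x u" for x
  proof -
   have "h x u \<in> carrier N" "h x v \<in> carrier N" using 1(4)[of x] 2(4)[of x] N'_sub by auto
   then show ?thesis unfolding huv by (simp add: N.add.m_assoc N.l_neg)
  qed
  have "u - v - (\<Sum>x\<in>Y. ?s (h x (u - v)) (e x)) \<in> ?T" if Y: "finite Y" "X1 \<union> X2 \<subseteq> Y" "Y \<subseteq> J" for Y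
  proof -
   have "(\<Sum>x\<in>Y. ?s (h x u) (e x) - ?s (h x (u - v)) (e x) - ?s (h x v) (e x)) \<in> ?T"
   proof (intro T_sum)
    fix x assume "x \<in> Y"
    then have "e x \<in> carrier M" using Y(3) e by auto
    from T_left[OF huv'[of x] 2(4)[of x] this]
    show "?s (h x u) (e x) - ?s (h x (u - v)) (e x) - ?s (h x v) (e x) \<in> ?T" unfolding huv'' .
   qed
   moreover have "u - (\<Sum>x\<in>Y. ?s (h x u) (e x)) - (v - (\<Sum>x\<in>Y. ?s (h x v) (e x))) \<in> ?T"
    using Y by (intro T_diff 1 2) auto
   ultimately have "(\<Sum>x\<in>Y. ?s (h x u) (e x) - ?s (h x (u - v)) (e x) - ?s (h x v) (e x)) +
    (u - (\<Sum>x\<in>Y. ?s (h x u) (e x)) - (v - (\<Sum>x\<in>Y. ?s (h x v) (e x)))) \<in> ?T" by (rule T_add)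
   then show ?thesis by (simp add: sum_subtractf sum.distrib algebra_simps)
  qed
  then show ?case
   using 1 2 huv' keys_diff[of u v] by (intro exI[of _ "X1 \<union> X2"]) auto
 qed
 from z obtain Z where Z: "finite Z" "Z \<subseteq> J" "z - (\<Sum>x\<in>Z. ?s (h x z) (e x)) \<in> ?T"
  using reduce[of z] by blast
 have "(\<Sum>x\<in>Z. ?s (h x z) (e x)) \<in> ?T"
  using Z(2) z h_T by (intro T_sum) (auto intro!: T_left0 e)
 from T_add[OF Z(3) this] show "z \<in> ?T" by simp
qed

section \<open>The Rees degeneration\<close>

abbreviation pcoeff :: "'c::zero poly => nat => 'c" where
 "pcoeff \<equiv> Polynomial.coeff"

abbreviation pmonom :: "'c::zero => nat => 'c poly" where
 "pmonom \<equiv> Polynomial.monom"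

text \<open>The elements of the total space have to be sets of polynomials.  Pairing turns a coefficient and its index
 into one polynomial, and a polynomial over \<open>'a mpoly\<close> is the set of its encoded coefficients.\<close>

lemma poly_encoding: "\<exists>e :: 'a::field_char_0 mpoly poly => 'a mpoly set. inj e"
proof -
 have "infinite (UNIV :: 'a mpoly set)" by (rule infinite_UNIV_char_0)
 from card_of_Times_same_infinite[OF this]
 have "\<exists>f :: 'a mpoly \<times> 'a mpoly => 'a mpoly. bij_betw f (UNIV \<times> UNIV) UNIV"
  by (simp only: card_of_ordIso)
 then obtain f :: "'a mpoly \<times> 'a mpoly => 'a mpoly" where "bij_betw f (UNIV \<times> UNIV) UNIV" ..
 then have "inj f" by (simp add: bij_betw_def)
 then have f_inj: "f p = f q \<longleftrightarrow> p = q" for p q by (rule inj_eq)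
 define e where "e p = range (\<lambda>i. f (of_nat i, pcoeff p i))" for p :: "'a mpoly poly"
 have "inj e"
 proof (rule injI)
  fix p q assume eq: "e p = e q"
  show "p = q"
  proof (rule poly_eqI)
   fix i
   have "f (of_nat i, pcoeff p i) \<in> e q" using eq by (auto simp: e_def)
   then obtain j where "f (of_nat i, pcoeff p i) = f (of_nat j, pcoeff q j)" by (auto simp: e_def)
   then have "(of_nat i :: 'a mpoly, pcoeff p i) = (of_nat j, pcoeff q j)" by (simp only: f_inj)
   then have "(of_nat i :: 'a mpoly) = of_nat j" and c: "pcoeff p i = pcoeff q j" by auto
   then show "pcoeff p i = pcoeff q i" by (metis of_nat_eq_iff)
  qed
 qed
 then show ?thesis by blast
qed

text \<open>The algebra \<open>A\<close> is realised by polynomials, with a spanning set \<open>b x\<close> indexed by a commutative monoid \<open>G\<close>; \<open>b x\<close>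
 has a single monomial \<open>\<alpha> x\<close> of maximal weight, and these monomials multiply as in \<open>G\<close>.  The set \<open>gens\<close> makes
 the Rees algebra finitely generated.\<close>

locale topped_basis =
 fixes A :: "('a::field_char_0, 'r) module" and \<Psi> :: "'r => 'a mpoly"
  and G :: "'g monoid" and b :: "'g => 'a mpoly" and \<alpha> :: "'g => nat \<Rightarrow>\<^sub>0 nat"
  and w :: "(nat \<Rightarrow>\<^sub>0 nat) => nat" and gens :: "'g set"
 assumes emb_A: "algebra_embedding A Const \<Psi>"
  and range_\<Psi>: "\<Psi> ` carrier A = mpoly.span (b ` carrier G)"
  and w_add: "w (\<beta> + \<gamma>) = w \<beta> + w \<gamma>"
  and topped: "x \<in> carrier G ==> topped (\<lambda>\<beta> \<gamma>. w \<beta> < w \<gamma>) (\<alpha> x) (b x)"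
  and \<alpha>_inj: "x \<in> carrier G ==> y \<in> carrier G ==> \<alpha> x = \<alpha> y ==> x = y"
  and \<alpha>_mult: "x \<in> carrier G ==> y \<in> carrier G ==> \<alpha> (x \<otimes>\<^bsub>G\<^esub> y) = \<alpha> x + \<alpha> y"
  and \<alpha>_one: "\<alpha> \<one>\<^bsub>G\<^esub> = 0"
  and G_closed: "\<one>\<^bsub>G\<^esub> \<in> carrier G" "x \<in> carrier G ==> y \<in> carrier G ==> x \<otimes>\<^bsub>G\<^esub> y \<in> carrier G"
  and gens: "finite gens" "gens \<subseteq> carrier G"
   "x \<in> carrier G ==> \<exists>xs. set xs \<subseteq> gens \<and> b x = prod_list (map b xs) \<and> \<alpha> x = sum_list (map \<alpha> xs)"
begin

interpretation A: algebra_embedding A Const \<Psi> by (rule emb_A)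

definition S :: "'a mpoly set" where "S = mpoly.span (b ` carrier G)"

abbreviation wt :: "'g => nat" where "wt x \<equiv> w (\<alpha> x)"

lemma w_0: "w 0 = 0" using w_add[of 0 0] by simp

lemma order: "exponent_order (\<lambda>\<beta> \<gamma>. w \<beta> < w \<gamma>)"
 by (auto simp: exponent_order_def w_add irreflp_def intro!: transpI)

lemma S_\<Psi>: "P \<in> S \<longleftrightarrow> (\<exists>r\<in>carrier A. P = \<Psi> r)"
 using range_\<Psi> by (auto simp: S_def)

lemma S_mult: "P \<in> S ==> Q \<in> S ==> P * Q \<in> S"
 unfolding S_\<Psi> using A.closed(4) A.hom(4) by metis

lemma S_one: "1 \<in> S"
 unfolding S_\<Psi> using A.closed(2) A.hom(2) by metis

lemma S_lin: "0 \<in> S" "P \<in> S ==> Q \<in> S ==> P + Q \<in> S" "P \<in> S ==> Q \<in> S ==> P - Q \<in> S"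
 "P \<in> S ==> Const c * P \<in> S" "x \<in> carrier G ==> b x \<in> S"
 unfolding S_def by (auto intro: mpoly.span_zero mpoly.span_add mpoly.span_diff mpoly.span_scale mpoly.span_base)

lemma lookup_top:
 assumes "x \<in> carrier G" "y \<in> carrier G" "wt x \<le> wt y"
 shows "lookup (b x) (\<alpha> y) = (if x = y then 1 else 0)"
proof (cases "x = y")
 case True
 then show ?thesis using topped_lookup[OF order topped[OF assms(2)]] by simp
next
 case False
 then have "\<alpha> y \<notin> keys (b x)"
  using topped_keys[OF topped[OF assms(1)], of "\<alpha> y"] \<alpha>_inj assms by fastforce
 then show ?thesis using False by (simp add: in_keys_iff)
qed

text \<open>Leading monomials of different basis elements cannot cancel.\<close>

lemma combination_weight:
 assumes "finite Z" "Z \<subseteq> carrier G" and P: "P = (\<Sum>x\<in>Z. Const (c x) * b x)"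
  and keys: "\<And>\<beta>. \<beta> \<in> keys P ==> w \<beta> \<le> i" and x: "x \<in> Z" "c x \<noteq> 0"
 shows "wt x \<le> i"
proof -
 let ?Z = "{x\<in>Z. c x \<noteq> 0}"
 have Z: "finite ?Z" "?Z \<noteq> {}" using assms by auto
 have fin: "finite (wt ` ?Z)" using Z by blast
 have "Max (wt ` ?Z) \<in> wt ` ?Z" by (rule Max_in[OF fin]) (use Z in blast)
 then obtain y where y0: "y \<in> ?Z" "Max (wt ` ?Z) = wt y" by (rule imageE) blast
 have y: "y \<in> ?Z" "wt z \<le> wt y" if "z \<in> ?Z" for z
  using y0 Max_ge[OF fin, of "wt z"] that by auto
 have y1: "y \<in> ?Z" by (rule y0)
 have "lookup P (\<alpha> y) = (\<Sum>z\<in>Z. c z * lookup (b z) (\<alpha> y))" by (simp add: P lookup_sum)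
 also have "\<dots> = (\<Sum>z\<in>Z. if z = y then c y else 0)"
 proof (intro sum.cong refl)
  fix z assume "z \<in> Z"
  then show "c z * lookup (b z) (\<alpha> y) = (if z = y then c y else 0)"
   using lookup_top[of z y] y(2)[of z] y1 subsetD[OF assms(2), of z] subsetD[OF assms(2), of y]
   by (cases "c z = 0") auto
 qed
 also have "\<dots> = c y" using assms(1) y1 by simp
 finally have "\<alpha> y \<in> keys P" using y1 by (simp add: in_keys_iff)
 then show ?thesis using keys[of "\<alpha> y"] y(2)[of x] x by simp
qed

lemma b_inj: "inj_on b (carrier G)"
proof (rule inj_onI)
 fix x y assume xy: "x \<in> carrier G" "y \<in> carrier G" "b x = b y"
 have "x = y" if "x \<in> carrier G" "y \<in> carrier G" "b x = b y" "wt x \<le> wt y" for x y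
 proof (rule ccontr)
  assume "x \<noteq> y"
  then have "lookup (b x) (\<alpha> y) = 0" using lookup_top[OF that(1,2,4)] by simp
  then show False using lookup_top[OF that(2,2) order_refl] that(3) by simp
 qed
 then show "x = y" using xy by (cases "wt x \<le> wt y") (metis nat_le_linear)+
qed

lemma independent: "mpoly.independent (b ` carrier G)"
 unfolding mpoly.independent_explicit_module
proof (intro allI impI)
 fix t u v assume t: "finite t" "t \<subseteq> b ` carrier G" "(\<Sum>v\<in>t. Const (u v) * v) = 0" "v \<in> t"
 obtain Z where Z: "Z \<subseteq> carrier G" "finite Z" "t = b ` Z"
  using finite_subset_image[OF t(1,2)] by blast
 show "u v = 0"
 proof (rule ccontr)
  assume u: "u v \<noteq> 0"
  obtain x where x: "x \<in> Z" "v = b x" using t Z by auto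
  have eq: "0 = (\<Sum>x\<in>Z. Const (u (b x)) * b x)"
   using t(3) Z b_inj by (simp add: sum.reindex inj_on_subset)
  have wx: "wt x = 0" using combination_weight[OF Z(2,1) eq _ x(1), of 0] u x by simp
  have "lookup (0 :: 'a mpoly) (\<alpha> x) = (\<Sum>z\<in>Z. u (b z) * lookup (b z) (\<alpha> x))"
   by (subst eq) (simp add: lookup_sum)
  also have "\<dots> = (\<Sum>z\<in>Z. if z = x then u (b x) else 0)"
  proof (intro sum.cong refl)
   fix z assume z: "z \<in> Z"
   show "u (b z) * lookup (b z) (\<alpha> x) = (if z = x then u (b x) else 0)"
   proof (cases "u (b z) = 0")
    case False
    then have "wt z = 0" using combination_weight[OF Z(2,1) eq _ z, of 0] by simp
    then show ?thesis using lookup_top[OF subsetD[OF Z(1) z] subsetD[OF Z(1) x(1)]] wx by simp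
   qed auto
  qed
  also have "\<dots> = u (b x)" using Z x by simp
  finally show False using u x by simp
 qed
qed

text \<open>The coordinate of \<open>P\<close> at the basis element \<open>b x\<close>.\<close>

definition \<kappa> :: "'g => 'a mpoly => 'a" where
 "\<kappa> x P = mpoly.representation (b ` carrier G) P (b x)"

lemma \<kappa>_add: "P \<in> S ==> Q \<in> S ==> \<kappa> x (P + Q) = \<kappa> x P + \<kappa> x Q"
 and \<kappa>_diff: "P \<in> S ==> Q \<in> S ==> \<kappa> x (P - Q) = \<kappa> x P - \<kappa> x Q"
 and \<kappa>_scale: "P \<in> S ==> \<kappa> x (Const c * P) = c * \<kappa> x P"
 and \<kappa>_0 [simp]: "\<kappa> x 0 = 0"
 using independent
 by (auto simp: \<kappa>_def S_def mpoly.representation_add mpoly.representation_diff mpoly.representation_scale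
   mpoly.representation_zero)

lemma \<kappa>_b: "x \<in> carrier G ==> y \<in> carrier G ==> \<kappa> x (b y) = (if x = y then 1 else 0)"
 using b_inj by (auto simp: \<kappa>_def mpoly.representation_basis[OF independent] inj_on_def)

lemma \<kappa>_sum: "(\<And>i. i \<in> I ==> f i \<in> S) ==> \<kappa> x (sum f I) = (\<Sum>i\<in>I. \<kappa> x (f i))"
proof (induction I rule: infinite_finite_induct)
 case (insert i I)
 have "sum f I \<in> S" unfolding S_def using insert.prems by (intro mpoly.span_sum) (auto simp: S_def)
 then show ?case using insert by (simp add: \<kappa>_add)
qed auto

definition supp :: "'a mpoly => 'g set" where "supp P = {x\<in>carrier G. \<kappa> x P \<noteq> 0}"

lemma supp_finite: "finite (supp P)"
proof -
 have "b ` supp P \<subseteq> {v. mpoly.representation (b ` carrier G) P v \<noteq> 0}" by (auto simp: supp_def \<kappa>_def)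
 then have "finite (b ` supp P)" using mpoly.finite_representation finite_subset by blast
 then show ?thesis by (rule finite_imageD) (rule inj_on_subset[OF b_inj], auto simp: supp_def)
qed

lemma expand_supp:
 assumes "P \<in> S"
 shows "P = (\<Sum>x\<in>supp P. Const (\<kappa> x P) * b x)"
proof -
 have "{v. mpoly.representation (b ` carrier G) P v \<noteq> 0} = b ` supp P"
  using mpoly.representation_ne_zero by (fastforce simp: supp_def \<kappa>_def)
 then have "P = (\<Sum>v\<in>b ` supp P. Const (mpoly.representation (b ` carrier G) P v) * v)"
  using mpoly.sum_nonzero_representation_eq[OF independent, of P] assms by (simp add: S_def)
 also have "\<dots> = (\<Sum>x\<in>supp P. Const (\<kappa> x P) * b x)"
  by (subst sum.reindex) (auto simp: \<kappa>_def supp_def intro: inj_on_subset[OF b_inj])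
 finally show ?thesis .
qed

lemma expand_superset:
 assumes "P \<in> S" "finite Z" "supp P \<subseteq> Z" "Z \<subseteq> carrier G"
 shows "P = (\<Sum>x\<in>Z. Const (\<kappa> x P) * b x)"
 by (subst expand_supp[OF assms(1)], rule sum.mono_neutral_left) (use assms in \<open>auto simp: supp_def\<close>)

definition F :: "nat => 'a mpoly set" where
 "F i = {P\<in>S. \<forall>\<beta>\<in>keys P. w \<beta> \<le> i}"

lemma F_S: "P \<in> F i ==> P \<in> S" by (simp add: F_def)

lemma F_lin: "0 \<in> F i" "P \<in> F i ==> Q \<in> F i ==> P + Q \<in> F i" "P \<in> F i ==> Q \<in> F i ==> P - Q \<in> F i"
 "P \<in> F i ==> Const c * P \<in> F i"
proof -
 show "0 \<in> F i" by (simp add: F_def S_lin)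
 show add: "P + Q \<in> F i" if "P \<in> F i" "Q \<in> F i" for P Q
  using that Poly_Mapping.keys_add[of P Q] by (auto simp: F_def S_lin)
 show scale: "Const c * P \<in> F i" if "P \<in> F i" for c P
  using that keys_Const_mult[of c P] by (auto simp: F_def S_lin)
 show "P - Q \<in> F i" if "P \<in> F i" "Q \<in> F i"
  using add[OF that(1) scale[OF that(2), of "-1"]] by simp
qed

lemma F_sum: "(\<And>i. i \<in> I ==> f i \<in> F k) ==> sum f I \<in> F k"
 by (induction I rule: infinite_finite_induct) (auto simp: F_lin)

lemma F_mono: "P \<in> F i ==> i \<le> j ==> P \<in> F j"
 by (fastforce simp: F_def)

lemma F_mult: "P \<in> F i ==> Q \<in> F j ==> P * Q \<in> F (i + j)"
 using keys_mult[of P Q] by (fastforce simp: F_def S_mult w_add intro: add_mono)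

lemma F_one: "1 \<in> F 0"
 by (auto simp: F_def S_one w_0)

lemma F_b: "x \<in> carrier G ==> b x \<in> F (wt x)"
 using topped_keys[OF topped] by (fastforce simp: F_def S_lin)

lemma F_exhaustive: "P \<in> S ==> \<exists>i. P \<in> F i"
 by (intro exI[of _ "\<Sum>\<beta>\<in>keys P. w \<beta>"]) (auto simp: F_def intro!: member_le_sum)

lemma \<kappa>_F: "P \<in> F i ==> x \<in> supp P ==> wt x \<le> i"
 using combination_weight[OF supp_finite _ expand_supp[OF F_S], of P i i x]
 by (auto simp: F_def supp_def)

text \<open>In top weight a coordinate is the coefficient of the corresponding leading monomial.\<close>

lemma \<kappa>_top:
 assumes P: "P \<in> F (wt x)" and x: "x \<in> carrier G"
 shows "\<kappa> x P = lookup P (\<alpha> x)"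
proof -
 have "lookup P (\<alpha> x) = (\<Sum>y\<in>insert x (supp P). \<kappa> y P * lookup (b y) (\<alpha> x))"
  using x by (subst expand_superset[OF F_S[OF P], of "insert x (supp P)"])
   (auto simp: lookup_sum supp_finite, auto simp: supp_def)
 also have "\<dots> = (\<Sum>y\<in>insert x (supp P). if y = x then \<kappa> x P else 0)"
 proof (intro sum.cong refl)
  fix y assume "y \<in> insert x (supp P)"
  then have "wt y \<le> wt x" "y \<in> carrier G" using \<kappa>_F[OF P, of y] x by (auto simp: supp_def)
  then show "\<kappa> y P * lookup (b y) (\<alpha> x) = (if y = x then \<kappa> x P else 0)"
   using lookup_top[of y x] x by simp
 qed
 also have "\<dots> = \<kappa> x P" by (simp add: supp_finite)
 finally show ?thesis ..
qed

lemma F_pred: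
 assumes P: "P \<in> F i" and top: "\<And>x. x \<in> carrier G ==> wt x = i ==> \<kappa> x P = 0"
 shows "P \<in> F (i - 1)" "i = 0 ==> P = 0"
proof -
 have less: "wt x < i" if "x \<in> supp P" for x
  using \<kappa>_F[OF P that] top[of x] that by (auto simp: supp_def le_less)
 have "(\<Sum>x\<in>supp P. Const (\<kappa> x P) * b x) \<in> F (i - 1)"
 proof (intro F_sum F_lin)
  fix x assume "x \<in> supp P"
  then show "b x \<in> F (i - 1)" using F_b[of x] less[of x] F_mono[of "b x" "wt x" "i - 1"] by (auto simp: supp_def)
 qed
 then show "P \<in> F (i - 1)" using expand_supp[OF F_S[OF P]] by simp
 assume "i = 0"
 then have "supp P = {}" using less by auto
 then show "P = 0" using expand_supp[OF F_S[OF P]] by simp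
qed

text \<open>The product of the leading monomials of \<open>b x\<close> and \<open>b y\<close> is the leading monomial of \<open>x \<otimes> y\<close>, and no other
 product of their monomials has the same weight; so top coordinates multiply as in the monoid algebra.\<close>

lemma \<kappa>_mult:
 assumes P: "P \<in> F i" and Q: "Q \<in> F j" and z: "z \<in> carrier G" "wt z = i + j"
  and Z: "finite Z" "supp P \<subseteq> Z" "Z \<subseteq> carrier G" and Y: "finite Y" "supp Q \<subseteq> Y" "Y \<subseteq> carrier G"
 shows "\<kappa> z (P * Q) = (\<Sum>x\<in>Z. \<Sum>y\<in>Y. if x \<otimes>\<^bsub>G\<^esub> y = z then \<kappa> x P * \<kappa> y Q else 0)"
proof -
 have "P * Q = (\<Sum>x\<in>Z. \<Sum>y\<in>Y. Const (\<kappa> x P * \<kappa> y Q) * (b x * b y))"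
  using arg_cong2[where f = "(*)", OF expand_superset[OF F_S[OF P] Z] expand_superset[OF F_S[OF Q] Y]]
  by (simp add: sum_product mult_ac)
 moreover have "P * Q \<in> F (wt z)" using F_mult[OF P Q] z by simp
 ultimately have "\<kappa> z (P * Q) = (\<Sum>x\<in>Z. \<Sum>y\<in>Y. \<kappa> x P * \<kappa> y Q * lookup (b x * b y) (\<alpha> z))"
  using \<kappa>_top[OF _ z(1)] by (simp add: lookup_sum del: Const_hom_simps)
 also have "\<dots> = (\<Sum>x\<in>Z. \<Sum>y\<in>Y. if x \<otimes>\<^bsub>G\<^esub> y = z then \<kappa> x P * \<kappa> y Q else 0)"
 proof (intro sum.cong refl)
  fix x y assume xy: "x \<in> Z" "y \<in> Y"
  then have xy': "x \<in> carrier G" "y \<in> carrier G" using Z Y by auto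
  show "\<kappa> x P * \<kappa> y Q * lookup (b x * b y) (\<alpha> z) = (if x \<otimes>\<^bsub>G\<^esub> y = z then \<kappa> x P * \<kappa> y Q else 0)"
  proof (cases "\<kappa> x P = 0 \<or> \<kappa> y Q = 0")
   case False
   then have le: "wt x \<le> i" "wt y \<le> j" using \<kappa>_F[OF P, of x] \<kappa>_F[OF Q, of y] xy' by (auto simp: supp_def)
   have top: "topped (\<lambda>\<beta> \<gamma>. w \<beta> < w \<gamma>) (\<alpha> (x \<otimes>\<^bsub>G\<^esub> y)) (b x * b y)"
    using topped_mult[OF order topped[OF xy'(1)] topped[OF xy'(2)]] \<alpha>_mult[OF xy'] by simp
   show ?thesis
   proof (cases "x \<otimes>\<^bsub>G\<^esub> y = z")
    case True
    then show ?thesis using topped_lookup[OF order top] by simp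
   next
    case ne: False
    have "\<alpha> z \<notin> keys (b x * b y)"
    proof
     assume "\<alpha> z \<in> keys (b x * b y)"
     from topped_keys[OF top this]
     have "wt z < w (\<alpha> (x \<otimes>\<^bsub>G\<^esub> y))" using \<alpha>_inj[of z "x \<otimes>\<^bsub>G\<^esub> y"] z G_closed xy' ne by auto
     then show False using le z(2) \<alpha>_mult[OF xy'] w_add by simp
    qed
    then show ?thesis using ne by (simp add: in_keys_iff)
   qed
  qed auto
 qed
 finally show ?thesis .
qed

text \<open>The Rees algebra \<open>\<Sum>\<^sub>i F\<^sub>i t\<^sup>i\<close>.\<close>

definition R0 :: "'a mpoly poly set" where "R0 = {p. \<forall>i. pcoeff p i \<in> F i}"

definition scal :: "'a poly => 'a mpoly poly" where "scal = map_poly Const"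

definition enc :: "'a mpoly poly => 'a mpoly set" where "enc = (SOME e. inj e)"

definition dec :: "'a mpoly set => 'a mpoly poly" where "dec = inv_into UNIV enc"

lemma dec_enc [simp]: "dec (enc p) = p"
proof -
 have "inj enc" unfolding enc_def by (rule someI_ex[OF poly_encoding])
 then show ?thesis by (simp add: dec_def)
qed

definition R :: "('a poly, 'a mpoly set) module" where
 "R = \<lparr>carrier = enc ` R0, monoid.mult = (\<lambda>x y. enc (dec x * dec y)), one = enc 1,
  ring.zero = enc 0, ring.add = (\<lambda>x y. enc (dec x + dec y)), module.smult = (\<lambda>c x. enc (scal c * dec x))\<rparr>"

lemma coeff_scal [simp]: "pcoeff (scal p) i = Const (pcoeff p i)"
 by (simp add: scal_def coeff_map_poly)

lemma scal_hom: "comm_ring_hom scal"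
proof unfold_locales
 show "scal (p + q) = scal p + scal q" for p q by (rule poly_eqI) simp
 show "scal (p * q) = scal p * scal q" for p q
  by (rule poly_eqI) (simp add: coeff_mult Const_sum)
 show "scal 0 = 0" "scal 1 = 1" by (auto intro!: poly_eqI simp: coeff_1)
qed

lemma scal_inj: "scal p = 0 ==> p = 0"
 by (metis Const_eq_0_iff coeff_0 coeff_scal poly_eqI)

lemma scal_pCons [simp]: "scal 0 = 0" "scal (pCons c p) = pCons (Const c) (scal p)"
 by (rule poly_eqI, simp add: coeff_pCons split: nat.splits)+

lemma R0_lin: "0 \<in> R0" "1 \<in> R0" "p \<in> R0 ==> q \<in> R0 ==> p + q \<in> R0" "p \<in> R0 ==> q \<in> R0 ==> p - q \<in> R0"
 by (auto simp: R0_def F_lin coeff_1 F_one F_mono)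

lemma R0_mult: "p \<in> R0 ==> q \<in> R0 ==> p * q \<in> R0"
 unfolding R0_def by (auto simp: coeff_mult intro!: F_sum F_mono[OF F_mult])

lemma R0_scal: "p \<in> R0 ==> scal c * p \<in> R0"
 unfolding R0_def by (auto simp: coeff_mult intro!: F_sum F_lin(4) intro: F_mono[of _ "_ - _"])

lemma emb_R: "idom_algebra_embedding R scal dec"
proof (intro idom_algebra_embedding.intro algebra_embedding.intro idom_algebra_embedding_axioms.intro scal_hom)
 show "inj_on dec (carrier R)" by (auto simp: R_def inj_on_def)
 show "p = 0" if "scal p = 0" for p using that by (rule scal_inj)
qed (auto simp: R_def R0_lin R0_mult R0_scal)

lemma monom_R0: "P \<in> F k ==> pmonom P k \<in> R0"
 by (simp add: R0_def F_lin)

lemma R0_sum: "(\<And>i. i \<in> I ==> f i \<in> R0) ==> sum f I \<in> R0"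
 by (induction I rule: infinite_finite_induct) (auto simp: R0_lin)

interpretation R: idom_algebra_embedding R scal dec by (rule emb_R)

lemma carrier_R: "r \<in> carrier R \<longleftrightarrow> (\<exists>p\<in>R0. r = enc p)" "p \<in> R0 ==> enc p \<in> carrier R"
 "r \<in> carrier R ==> dec r \<in> R0" "r \<in> carrier R ==> enc (dec r) = r"
 by (auto simp: R_def)

text \<open>The elements \<open>t\<^bsup>wt x\<^esup> b x\<close> form a basis of the Rees algebra over \<open>K[t]\<close>.\<close>

definition rees_basis :: "'g => 'a mpoly poly" where "rees_basis x = pmonom (b x) (wt x)"

definition coord :: "'g => 'a mpoly poly => 'a poly" where
 "coord x p = (\<Sum>k\<le>degree p. pmonom (\<kappa> x (pcoeff p (k + wt x))) k)"

lemma rees_basis_R0: "x \<in> carrier G ==> rees_basis x \<in> R0"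
 unfolding rees_basis_def by (intro monom_R0 F_b)

lemma coeff_coord: "pcoeff (coord x p) k = \<kappa> x (pcoeff p (k + wt x))"
proof -
 have "pcoeff (coord x p) k = (\<Sum>j\<le>degree p. if j = k then \<kappa> x (pcoeff p (k + wt x)) else 0)"
  unfolding coord_def Polynomial.coeff_sum by (intro sum.cong) auto
 also have "\<dots> = \<kappa> x (pcoeff p (k + wt x))" by (auto simp: coeff_eq_0)
 finally show ?thesis .
qed

lemma R0_F: "p \<in> R0 ==> pcoeff p i \<in> F i" by (simp add: R0_def)

lemma R0_S: "p \<in> R0 ==> pcoeff p i \<in> S" by (rule F_S[OF R0_F])

lemma R0_\<kappa>: "p \<in> R0 ==> x \<in> carrier G ==> i < wt x ==> \<kappa> x (pcoeff p i) = 0"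
 using \<kappa>_F[OF R0_F[of p i], of x] by (auto simp: supp_def)

lemma coord_add: "p \<in> R0 ==> q \<in> R0 ==> coord x (p + q) = coord x p + coord x q"
 by (rule poly_eqI) (simp add: coeff_coord \<kappa>_add R0_S)

lemma coord_scal:
 assumes p: "p \<in> R0" and x: "x \<in> carrier G"
 shows "coord x (scal c * p) = c * coord x p"
proof (rule poly_eqI)
 fix k
 have "pcoeff (coord x (scal c * p)) k = (\<Sum>i\<le>k + wt x. pcoeff c i * \<kappa> x (pcoeff p (k + wt x - i)))"
  unfolding coeff_coord coeff_mult coeff_scal
  using F_S[OF R0_F[OF p]] by (subst \<kappa>_sum) (auto simp: S_lin \<kappa>_scale)
 also have "\<dots> = (\<Sum>i\<le>k. pcoeff c i * \<kappa> x (pcoeff p (k + wt x - i)))"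
  using R0_\<kappa>[OF p x] by (intro sum.mono_neutral_right) auto
 also have "\<dots> = pcoeff (c * coord x p) k"
  unfolding coeff_mult coeff_coord by (intro sum.cong) (auto simp: algebra_simps)
 finally show "pcoeff (coord x (scal c * p)) k = pcoeff (c * coord x p) k" .
qed

lemma coord_finite:
 assumes "p \<in> R0"
 shows "finite {x\<in>carrier G. coord x p \<noteq> 0}"
proof -
 have "{x\<in>carrier G. coord x p \<noteq> 0} \<subseteq> (\<Union>i\<le>degree p. supp (pcoeff p i))"
 proof
  fix x assume "x \<in> {x\<in>carrier G. coord x p \<noteq> 0}"
  then obtain k where "x \<in> carrier G" "pcoeff (coord x p) k \<noteq> 0" by (auto simp: poly_eq_iff)
  then have "x \<in> supp (pcoeff p (k + wt x))" "pcoeff p (k + wt x) \<noteq> 0" by (auto simp: coeff_coord supp_def)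
  then show "x \<in> (\<Union>i\<le>degree p. supp (pcoeff p i))" using le_degree by blast
 qed
 then show ?thesis by (rule finite_subset) (auto simp: supp_finite)
qed

lemma coord_expand:
 assumes p: "p \<in> R0"
 shows "p = (\<Sum>x\<in>{x\<in>carrier G. coord x p \<noteq> 0}. scal (coord x p) * rees_basis x)"
proof (rule poly_eqI)
 fix i
 let ?Z = "{x\<in>carrier G. coord x p \<noteq> 0}"
 have sub: "supp (pcoeff p i) \<subseteq> ?Z"
 proof
  fix x assume x: "x \<in> supp (pcoeff p i)"
  then have "wt x \<le> i" by (rule \<kappa>_F[OF R0_F[OF p]])
  then have "pcoeff (coord x p) (i - wt x) \<noteq> 0" using x by (simp add: coeff_coord supp_def)
  then show "x \<in> ?Z" using x by (auto simp: supp_def)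
 qed
 have "pcoeff p i = (\<Sum>x\<in>?Z. Const (\<kappa> x (pcoeff p i)) * b x)"
  by (rule expand_superset[OF F_S[OF R0_F[OF p]] coord_finite[OF p] sub]) auto
 also have "\<dots> = (\<Sum>x\<in>?Z. pcoeff (scal (coord x p) * rees_basis x) i)"
 proof (intro sum.cong refl)
  fix x assume "x \<in> ?Z"
  then have x: "x \<in> carrier G" by simp
  have "pcoeff (scal (coord x p) * rees_basis x) i = pcoeff (pmonom (b x) (wt x) * scal (coord x p)) i"
   by (simp add: rees_basis_def mult.commute)
  also have "\<dots> = Const (\<kappa> x (pcoeff p i)) * b x"
   using R0_\<kappa>[OF p x, of i] by (auto simp: coeff_monom_mult coeff_coord mult.commute)
  finally show "Const (\<kappa> x (pcoeff p i)) * b x = pcoeff (scal (coord x p) * rees_basis x) i" ..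
 qed
 finally show "pcoeff p i = pcoeff (\<Sum>x\<in>?Z. scal (coord x p) * rees_basis x) i"
  by (simp add: Polynomial.coeff_sum)
qed

lemma R_flat: "flat ring_of_type_algebra R"
proof (rule free_module_flat[where J = "carrier G" and e = "\<lambda>x. enc (rees_basis x)" and C = "\<lambda>x r. coord x (dec r)"])
 show "Module.module ring_of_type_algebra R" by (rule R.is_module)
 show "enc (rees_basis x) \<in> carrier R" if "x \<in> carrier G" for x
  using that by (intro carrier_R rees_basis_R0)
 show "coord x (dec (r \<oplus>\<^bsub>R\<^esub> r')) = coord x (dec r) + coord x (dec r')"
  if "r \<in> carrier R" "r' \<in> carrier R" for x r r'
  using that by (simp add: R.hom coord_add carrier_R(3))
 show "coord x (dec (c \<odot>\<^bsub>R\<^esub> r)) = c * coord x (dec r)" if "x \<in> carrier G" "r \<in> carrier R" for x c r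
  using that by (simp add: R.hom coord_scal carrier_R(3))
 show "finite {x\<in>carrier G. coord x (dec r) \<noteq> 0}" if "r \<in> carrier R" for r
  using that by (intro coord_finite carrier_R)
 fix r assume r: "r \<in> carrier R"
 let ?Z = "{x\<in>carrier G. coord x (dec r) \<noteq> 0}" and ?f = "\<lambda>x. coord x (dec r) \<odot>\<^bsub>R\<^esub> enc (rees_basis x)"
 have f: "?f x \<in> carrier R" if "x \<in> ?Z" for x
  using that by (intro R.closed carrier_R rees_basis_R0) auto
 note fs = R.hom_finsum[OF coord_finite[OF carrier_R(3)[OF r]] f]
 have "dec (\<Oplus>\<^bsub>R\<^esub>x\<in>?Z. ?f x) = (\<Sum>x\<in>?Z. dec (?f x))" by (rule fs(1))
 also have "\<dots> = (\<Sum>x\<in>?Z. scal (coord x (dec r)) * rees_basis x)"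
  by (intro sum.cong) (auto simp: R.hom carrier_R(2) rees_basis_R0)
 also have "\<dots> = dec r" using coord_expand[OF carrier_R(3)[OF r]] by simp
 finally show "r = (\<Oplus>\<^bsub>R\<^esub>x\<in>?Z. ?f x)"
  using R.eq_iff[OF r fs(2)] by simp
qed

text \<open>Each \<open>t\<^bsup>wt x\<^esup> b x\<close> is a product of those with \<open>x\<close> in \<open>gens\<close>, since weights add up.\<close>

lemma R_finite_type: "finite_type_algebra ring_of_type_algebra R"
 unfolding finite_type_algebra_def
proof (intro conjI exI)
 show "Module.algebra ring_of_type_algebra R" by (rule R.is_algebra)
 let ?S = "(\<lambda>x. enc (rees_basis x)) ` gens"
 let ?K = "{c \<odot>\<^bsub>R\<^esub> \<one>\<^bsub>R\<^esub> |c. c \<in> carrier (ring_of_type_algebra :: 'a poly ring)}"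
 show "finite ?S" using gens(1) by simp
 show S: "?S \<subseteq> carrier R" using gens(2) by (auto intro!: carrier_R rees_basis_R0)
 let ?H = "generate_ring R (?S \<union> ?K)"
 have K: "?K \<subseteq> carrier R" using R.closed by auto
 interpret Rr: cring R by (rule R.is_cring)
 have H_sub: "?H \<subseteq> carrier R" using Rr.generate_ring_in_carrier[of "?S \<union> ?K"] S K by blast
 define D where "D = {p\<in>R0. enc p \<in> ?H}"
 have enc_ops: "enc (p + q) = enc p \<oplus>\<^bsub>R\<^esub> enc q" "enc (p * q) = enc p \<otimes>\<^bsub>R\<^esub> enc q" for p q
  by (simp_all add: R_def)
 have D_add: "p + q \<in> D" and D_mult: "p * q \<in> D" if "p \<in> D" "q \<in> D" for p q
  using that by (auto simp: D_def enc_ops R0_lin R0_mult intro: generate_ring.intros)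
 have D_scal: "scal c \<in> D" for c
 proof -
  have "c \<odot>\<^bsub>R\<^esub> \<one>\<^bsub>R\<^esub> \<in> ?H"
   by (rule generate_ring.incl) (auto simp: ring_of_type_algebra_def)
  moreover have "c \<odot>\<^bsub>R\<^esub> \<one>\<^bsub>R\<^esub> = enc (scal c)" by (simp add: R_def)
  moreover have "scal c \<in> R0" using R0_scal[OF R0_lin(2), of c] by simp
  ultimately show ?thesis by (simp add: D_def)
 qed
 have D_0: "0 \<in> D" and D_1: "1 \<in> D"
  using D_scal[of 0] D_scal[of 1] by (simp_all add: one_pCons)
 have D_sum: "sum f I \<in> D" if "\<And>i. i \<in> I ==> f i \<in> D" for f :: "'g => _" and I
  using that by (induction I rule: infinite_finite_induct) (auto simp: D_0 D_add)
 have D_gens: "pmonom (prod_list (map b xs)) (w (sum_list (map \<alpha> xs))) \<in> D" if "set xs \<subseteq> gens" for xs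
  using that
 proof (induction xs)
  case Nil
  then show ?case using D_1 by (simp add: w_0)
 next
  case (Cons x xs)
  have "rees_basis x \<in> D"
   using Cons.prems gens(2) rees_basis_R0[of x] by (auto simp: D_def intro: generate_ring.incl)
  moreover have "pmonom (prod_list (map b (x # xs))) (w (sum_list (map \<alpha> (x # xs)))) =
    rees_basis x * pmonom (prod_list (map b xs)) (w (sum_list (map \<alpha> xs)))"
   by (simp add: rees_basis_def mult_monom w_add)
  ultimately show ?case using Cons D_mult by simp
 qed
 have "p \<in> D" if "p \<in> R0" for p
 proof -
  have "rees_basis x \<in> D" if "x \<in> carrier G" for x
   using gens(3)[OF that] D_gens by (auto simp: rees_basis_def)
  then have "(\<Sum>x\<in>{x\<in>carrier G. coord x p \<noteq> 0}. scal (coord x p) * rees_basis x) \<in> D"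
   by (intro D_sum D_mult D_scal) auto
  then show ?thesis using coord_expand[OF that] by simp
 qed
 then show "?H = carrier R" using H_sub by (auto simp: D_def carrier_R(1))
qed

text \<open>Evaluation at \<open>t = c\<close> is surjective onto the section algebra because every polynomial has some weight bound
 and \<open>c\<close> is invertible.  If \<open>p\<close> vanishes at \<open>c\<close>, synthetic division by \<open>t - c\<close>, started from the constant
 term, respects the filtration.\<close>

lemma R_fibre_nonzero:
 assumes c: "c \<noteq> 0"
 shows "isomorphic_algebras ring_of_type_algebra (fibre c R) A"
proof -
 let ?ev = "\<lambda>p :: 'a mpoly poly. poly p (Const c)"
 define \<psi> where "\<psi> r = inv_into (carrier A) \<Psi> (?ev (dec r))" for r
 have pow: "Const c ^ i = Const (c ^ i)" for i by (induction i) auto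
 have S_sum: "sum f I \<in> S" if "\<And>i. i \<in> I ==> f i \<in> S" for f :: "nat => 'a mpoly" and I
  using that by (induction I rule: infinite_finite_induct) (auto simp: S_lin)
 have ev_S: "?ev p \<in> S" if "p \<in> R0" for p
  unfolding poly_altdef pow mult.commute[of _ "Const _"]
  using F_S[OF R0_F[OF that]] by (intro S_sum S_lin(4))
 have \<psi>: "\<psi> r \<in> carrier A" "\<Psi> (\<psi> r) = ?ev (dec r)" if "r \<in> carrier R" for r
 proof -
  have "?ev (dec r) \<in> \<Psi> ` carrier A"
   using ev_S[OF carrier_R(3)[OF that]] by (simp add: range_\<Psi> S_def)
  then show "\<psi> r \<in> carrier A" "\<Psi> (\<psi> r) = ?ev (dec r)"
   unfolding \<psi>_def by (rule inv_into_into, rule f_inv_into_f)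
 qed
 show ?thesis
 proof (rule fibre_isomorphic[where \<psi> = \<psi>])
  show "Module.algebra ring_of_type_algebra R" by (rule R.is_algebra)
  show "\<psi> ` carrier R = carrier A"
  proof
   show "\<psi> ` carrier R \<subseteq> carrier A" using \<psi> by auto
   show "carrier A \<subseteq> \<psi> ` carrier R"
   proof
    fix a assume a: "a \<in> carrier A"
    then have "\<Psi> a \<in> S" by (auto simp: S_\<Psi>)
    then obtain i where i: "\<Psi> a \<in> F i" using F_exhaustive by blast
    let ?p = "pmonom (Const (inverse c ^ i) * \<Psi> a) i"
    have p: "?p \<in> R0" by (intro monom_R0 F_lin i)
    have "?ev ?p = Const (inverse c ^ i * c ^ i) * \<Psi> a"
     by (simp only: poly_monom pow Const_hom_simps mult_ac)
    also have "inverse c ^ i * c ^ i = 1" using c by (simp flip: power_mult_distrib)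
    finally have "\<Psi> (\<psi> (enc ?p)) = \<Psi> a" using \<psi>(2)[OF carrier_R(2)[OF p]] by simp
    then have "\<psi> (enc ?p) = a" using A.eq_iff[OF \<psi>(1)[OF carrier_R(2)[OF p]] a] by simp
    then show "a \<in> \<psi> ` carrier R" using imageI[OF carrier_R(2)[OF p], of \<psi>] by simp
   qed
  qed
  show "\<psi> (x \<oplus>\<^bsub>R\<^esub> y) = \<psi> x \<oplus>\<^bsub>A\<^esub> \<psi> y" "\<psi> (x \<otimes>\<^bsub>R\<^esub> y) = \<psi> x \<otimes>\<^bsub>A\<^esub> \<psi> y"
   if "x \<in> carrier R" "y \<in> carrier R" for x y
   using that by (simp_all add: A.eq_iff \<psi> A.closed A.hom R.closed R.hom)
  show "\<psi> \<one>\<^bsub>R\<^esub> = \<one>\<^bsub>A\<^esub>" by (simp add: A.eq_iff \<psi> A.closed A.hom R.closed R.hom)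
  show "\<psi> ([:d:] \<odot>\<^bsub>R\<^esub> x) = d \<odot>\<^bsub>A\<^esub> \<psi> x" if "x \<in> carrier R" for d x
   using that by (simp add: A.eq_iff \<psi> A.closed A.hom R.closed R.hom)
  fix x y assume x: "x \<in> carrier R" and y: "y \<in> carrier R"
  have t: "scal [:- c, 1:] = [:- Const c, 1:]" by simp
  show "\<psi> x = \<psi> y \<longleftrightarrow> (\<exists>q\<in>carrier R. x = ([:- c, 1:] \<odot>\<^bsub>R\<^esub> q) \<oplus>\<^bsub>R\<^esub> y)"
  proof
   assume "\<psi> x = \<psi> y"
   then have "poly (dec x - dec y) (Const c) = 0" using \<psi>(2)[OF x] \<psi>(2)[OF y] by simp
   then have "[:- Const c, 1:] dvd dec x - dec y" by (simp only: poly_eq_0_iff_dvd)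
   then obtain q where q: "dec x - dec y = [:- Const c, 1:] * q" by (rule dvdE)
   have d: "dec x - dec y \<in> R0" by (intro R0_lin carrier_R x y)
   have "pcoeff q i \<in> F i" for i
   proof (induction i)
    case 0
    have "pcoeff q 0 = Const (- inverse c) * pcoeff (dec x - dec y) 0"
     using c by (simp add: q mult.assoc[symmetric] flip: Const_hom_simps(4))
    then show ?case using F_lin(4)[OF R0_F[OF d]] by metis
   next
    case (Suc i)
    have "pcoeff (dec x - dec y) (Suc i) = pcoeff q i - Const c * pcoeff q (Suc i)"
     by (simp add: q)
    then have "pcoeff q (Suc i) = Const (inverse c) * (pcoeff q i - pcoeff (dec x - dec y) (Suc i))"
     using c by (simp add: mult.assoc[symmetric] flip: Const_hom_simps(4))
    then show ?case using F_lin(4)[OF F_lin(3)[OF F_mono[OF Suc.IH] R0_F[OF d]]] by (metis le_SucI order_refl)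
   qed
   then have "q \<in> R0" by (simp add: R0_def)
   moreover have "x = ([:- c, 1:] \<odot>\<^bsub>R\<^esub> enc q) \<oplus>\<^bsub>R\<^esub> y"
    using x y \<open>q \<in> R0\<close> q by (simp add: R.eq_iff R.closed R.hom carrier_R(2) t algebra_simps)
   ultimately show "\<exists>q\<in>carrier R. x = ([:- c, 1:] \<odot>\<^bsub>R\<^esub> q) \<oplus>\<^bsub>R\<^esub> y" using carrier_R(2) by blast
  next
   assume "\<exists>q\<in>carrier R. x = ([:- c, 1:] \<odot>\<^bsub>R\<^esub> q) \<oplus>\<^bsub>R\<^esub> y"
   then obtain q where q: "q \<in> carrier R" "x = ([:- c, 1:] \<odot>\<^bsub>R\<^esub> q) \<oplus>\<^bsub>R\<^esub> y" by blast
   have "dec x = [:- Const c, 1:] * dec q + dec y" unfolding q(2) using q(1) y by (simp add: R.hom R.closed t)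
   then have "?ev (dec x) = ?ev (dec y)" by simp
   then show "\<psi> x = \<psi> y" by (simp add: \<psi>_def)
  qed
 qed
qed

text \<open>Reduction modulo \<open>t\<close>: only the coefficient of \<open>b x\<close> in its own weight survives.\<close>

definition symbol :: "'a mpoly poly => 'g \<Rightarrow>\<^sub>0 'a" where
 "symbol p = (\<Sum>x\<in>{x\<in>carrier G. coord x p \<noteq> 0}. Poly_Mapping.single x (\<kappa> x (pcoeff p (wt x))))"

lemma lookup_symbol:
 assumes "p \<in> R0"
 shows "lookup (symbol p) x = (if x \<in> carrier G then \<kappa> x (pcoeff p (wt x)) else 0)"
proof -
 have "lookup (symbol p) x = (\<Sum>y\<in>{x\<in>carrier G. coord x p \<noteq> 0}. if y = x then \<kappa> x (pcoeff p (wt x)) else 0)"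
  unfolding symbol_def lookup_sum by (intro sum.cong) (auto simp: lookup_single when_def)
 also have "\<dots> = (if x \<in> carrier G \<and> coord x p \<noteq> 0 then \<kappa> x (pcoeff p (wt x)) else 0)"
  using coord_finite[OF assms] by simp
 also have "\<dots> = (if x \<in> carrier G then \<kappa> x (pcoeff p (wt x)) else 0)"
  using coeff_coord[of x p 0] by auto
 finally show ?thesis .
qed

lemma keys_symbol: "p \<in> R0 ==> keys (symbol p) \<subseteq> carrier G"
 by (auto simp: in_keys_iff lookup_symbol split: if_splits)

lemma symbol_mult:
 assumes p: "p \<in> R0" and q: "q \<in> R0"
 shows "symbol (p * q) = (\<Sum>x\<in>keys (symbol p). \<Sum>y\<in>keys (symbol q).
  Poly_Mapping.single (x \<otimes>\<^bsub>G\<^esub> y) (lookup (symbol p) x * lookup (symbol q) y))" (is "_ = ?r")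
proof (rule poly_mapping_eqI)
 fix z
 let ?Z = "keys (symbol p) \<union> (\<Union>i\<le>wt z. supp (pcoeff p i))"
 let ?Y = "keys (symbol q) \<union> (\<Union>i\<le>wt z. supp (pcoeff q i))"
 have fin: "finite ?Z" "finite ?Y" by (auto simp: supp_finite)
 have sub: "?Z \<subseteq> carrier G" "?Y \<subseteq> carrier G" using keys_symbol[OF p] keys_symbol[OF q] by (auto simp: supp_def)
 have r: "lookup ?r z = (\<Sum>x\<in>?Z. \<Sum>y\<in>?Y. if x \<otimes>\<^bsub>G\<^esub> y = z then lookup (symbol p) x * lookup (symbol q) y else 0)"
 proof -
  have "lookup ?r z = (\<Sum>x\<in>keys (symbol p). \<Sum>y\<in>keys (symbol q).
   if x \<otimes>\<^bsub>G\<^esub> y = z then lookup (symbol p) x * lookup (symbol q) y else 0)"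
   by (simp add: lookup_sum lookup_single when_def)
  also have "\<dots> = (\<Sum>x\<in>?Z. \<Sum>y\<in>keys (symbol q).
   if x \<otimes>\<^bsub>G\<^esub> y = z then lookup (symbol p) x * lookup (symbol q) y else 0)"
   using fin by (intro sum.mono_neutral_left) (auto simp: in_keys_iff intro!: sum.neutral)
  also have "\<dots> = (\<Sum>x\<in>?Z. \<Sum>y\<in>?Y. if x \<otimes>\<^bsub>G\<^esub> y = z then lookup (symbol p) x * lookup (symbol q) y else 0)"
   using fin by (intro sum.cong refl sum.mono_neutral_left) (auto simp: in_keys_iff)
  finally show ?thesis .
 qed
 show "lookup (symbol (p * q)) z = lookup ?r z"
 proof (cases "z \<in> carrier G")
  case False
  then have "x \<otimes>\<^bsub>G\<^esub> y \<noteq> z" if "x \<in> ?Z" "y \<in> ?Y" for x y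
   using that sub G_closed(2)[of x y] by blast
  then have "lookup ?r z = 0" unfolding r by (intro sum.neutral ballI) auto
  then show ?thesis using False by (simp add: lookup_symbol R0_mult p q)
 next
  case z: True
  have "lookup (symbol (p * q)) z = \<kappa> z (\<Sum>i\<le>wt z. pcoeff p i * pcoeff q (wt z - i))"
   using z by (simp add: lookup_symbol R0_mult p q coeff_mult)
  also have "\<dots> = (\<Sum>i\<le>wt z. \<kappa> z (pcoeff p i * pcoeff q (wt z - i)))"
   using F_S[OF R0_F[OF p]] F_S[OF R0_F[OF q]] by (intro \<kappa>_sum S_mult)
  also have "\<dots> = (\<Sum>i\<le>wt z. \<Sum>x\<in>?Z. \<Sum>y\<in>?Y. if x \<otimes>\<^bsub>G\<^esub> y = z then \<kappa> x (pcoeff p i) * \<kappa> y (pcoeff q (wt z - i)) else 0)"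
   by (intro sum.cong refl \<kappa>_mult[OF R0_F[OF p] R0_F[OF q] z _ fin(1) _ sub(1) fin(2) _ sub(2)]) auto
  also have "\<dots> = (\<Sum>x\<in>?Z. \<Sum>y\<in>?Y. \<Sum>i\<le>wt z. if x \<otimes>\<^bsub>G\<^esub> y = z then \<kappa> x (pcoeff p i) * \<kappa> y (pcoeff q (wt z - i)) else 0)"
   by (subst sum.swap) (intro sum.cong refl sum.swap)
  also have "\<dots> = lookup ?r z"
   unfolding r
  proof (intro sum.cong refl)
   fix x y assume "x \<in> ?Z" "y \<in> ?Y"
   then have xy: "x \<in> carrier G" "y \<in> carrier G" using sub by blast+
   show "(\<Sum>i\<le>wt z. if x \<otimes>\<^bsub>G\<^esub> y = z then \<kappa> x (pcoeff p i) * \<kappa> y (pcoeff q (wt z - i)) else 0) =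
    (if x \<otimes>\<^bsub>G\<^esub> y = z then lookup (symbol p) x * lookup (symbol q) y else 0)"
   proof (cases "x \<otimes>\<^bsub>G\<^esub> y = z")
    case True
    then have wz: "wt z = wt x + wt y" using \<alpha>_mult[OF xy] w_add by simp
    have "(\<Sum>i\<le>wt z. \<kappa> x (pcoeff p i) * \<kappa> y (pcoeff q (wt z - i))) =
     (\<Sum>i\<in>{wt x}. \<kappa> x (pcoeff p i) * \<kappa> y (pcoeff q (wt z - i)))"
    proof (rule sum.mono_neutral_right)
     show "\<forall>i\<in>{..wt z} - {wt x}. \<kappa> x (pcoeff p i) * \<kappa> y (pcoeff q (wt z - i)) = 0"
     proof
      fix i assume "i \<in> {..wt z} - {wt x}"
      then have "i < wt x \<or> wt z - i < wt y" using wz by auto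
      then show "\<kappa> x (pcoeff p i) * \<kappa> y (pcoeff q (wt z - i)) = 0"
       using R0_\<kappa>[OF p xy(1)] R0_\<kappa>[OF q xy(2)] by auto
     qed
    qed (use wz in auto)
    then show ?thesis using True wz xy by (simp add: lookup_symbol p q)
   qed simp
  qed
  finally show ?thesis .
 qed
qed

lemma R_fibre_zero: "isomorphic_algebras ring_of_type_algebra (fibre 0 R) (monoid_algebra G :: ('a, 'g \<Rightarrow>\<^sub>0 'a) module)"
proof (rule fibre_isomorphic[where \<psi> = "\<lambda>r. symbol (dec r)"])
 show "Module.algebra ring_of_type_algebra R" by (rule R.is_algebra)
 have carr: "carrier (monoid_algebra G :: ('a, 'g \<Rightarrow>\<^sub>0 'a) module) = {f. keys f \<subseteq> carrier G}"
  by (simp add: monoid_algebra_def)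
 show "(\<lambda>r. symbol (dec r)) ` carrier R = carrier (monoid_algebra G)"
  unfolding carr
 proof
  show "(\<lambda>r. symbol (dec r)) ` carrier R \<subseteq> {f. keys f \<subseteq> carrier G}"
   using keys_symbol carrier_R(3) by blast
  show "{f. keys f \<subseteq> carrier G} \<subseteq> (\<lambda>r. symbol (dec r)) ` carrier R"
  proof
   fix f :: "'g \<Rightarrow>\<^sub>0 'a" assume "f \<in> {f. keys f \<subseteq> carrier G}"
   then have f: "keys f \<subseteq> carrier G" by simp
   define p where "p = (\<Sum>x\<in>keys f. scal [:lookup f x:] * rees_basis x)"
   have p: "p \<in> R0" unfolding p_def using f rees_basis_R0 by (intro R0_sum R0_scal) auto
   have "symbol p = f"
   proof (rule poly_mapping_eqI)
    fix y
    have "\<kappa> y (pcoeff p (wt y)) = lookup f y" if y: "y \<in> carrier G"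
    proof -
     have c: "pcoeff p (wt y) = (\<Sum>x\<in>keys f. if wt x = wt y then Const (lookup f x) * b x else 0)"
      unfolding p_def Polynomial.coeff_sum
      by (intro sum.cong refl) (auto simp: rees_basis_def)
     have "\<kappa> y (pcoeff p (wt y)) = (\<Sum>x\<in>keys f. \<kappa> y (if wt x = wt y then Const (lookup f x) * b x else 0))"
      unfolding c using f by (intro \<kappa>_sum) (auto simp: S_lin)
     also have "\<dots> = (\<Sum>x\<in>keys f. if x = y then lookup f y else 0)"
      using f y by (intro sum.cong refl) (auto simp: \<kappa>_scale S_lin \<kappa>_b subset_iff)
     also have "\<dots> = lookup f y" by (auto simp: in_keys_iff)
     finally show ?thesis .
    qed
    then show "lookup (symbol p) y = lookup f y"
     using f by (auto simp: lookup_symbol[OF p] in_keys_iff)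
   qed
   then have "f = symbol (dec (enc p))" by simp
   then show "f \<in> (\<lambda>r. symbol (dec r)) ` carrier R" using carrier_R(2)[OF p] by blast
  qed
 qed
 fix x y assume x: "x \<in> carrier R" and y: "y \<in> carrier R"
 note px = carrier_R(3)[OF x] and py = carrier_R(3)[OF y]
 show "symbol (dec (x \<oplus>\<^bsub>R\<^esub> y)) = symbol (dec x) \<oplus>\<^bsub>monoid_algebra G\<^esub> symbol (dec y)"
  by (rule poly_mapping_eqI)
   (simp add: R.hom x y monoid_algebra_def lookup_add lookup_symbol R0_lin px py \<kappa>_add R0_S)
 show "symbol (dec (x \<otimes>\<^bsub>R\<^esub> y)) = symbol (dec x) \<otimes>\<^bsub>monoid_algebra G\<^esub> symbol (dec y)"
  by (simp add: R.hom x y monoid_algebra_def symbol_mult px py)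
 show "symbol (dec x) = symbol (dec y) \<longleftrightarrow> (\<exists>q\<in>carrier R. x = ([:- 0, 1:] \<odot>\<^bsub>R\<^esub> q) \<oplus>\<^bsub>R\<^esub> y)"
 proof
  assume eq: "symbol (dec x) = symbol (dec y)"
  define d where "d = dec x - dec y"
  have d: "d \<in> R0" unfolding d_def by (intro R0_lin px py)
  have top: "\<kappa> z (pcoeff d i) = 0" if "z \<in> carrier G" "wt z = i" for z i
  proof -
   have "lookup (symbol (dec x)) z = lookup (symbol (dec y)) z" using eq by simp
   then show ?thesis
    using that by (auto simp: d_def lookup_symbol px py \<kappa>_diff R0_S)
  qed
  obtain a q where q: "d = pCons a q" by (cases d) auto
  have "pcoeff q i \<in> F i" for i
   using F_pred(1)[OF R0_F[OF d, of "Suc i"] top] q by simp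
  then have "q \<in> R0" by (simp add: R0_def)
  moreover have "a = 0" using F_pred(2)[OF R0_F[OF d, of 0] top] q by simp
  then have "dec x = scal [:- 0, 1:] * q + dec y" using q by (simp add: d_def algebra_simps)
  then have "x = ([:- 0, 1:] \<odot>\<^bsub>R\<^esub> enc q) \<oplus>\<^bsub>R\<^esub> y"
   using x y \<open>q \<in> R0\<close> by (simp add: R.eq_iff R.closed R.hom carrier_R(2))
  ultimately show "\<exists>q\<in>carrier R. x = ([:- 0, 1:] \<odot>\<^bsub>R\<^esub> q) \<oplus>\<^bsub>R\<^esub> y" using carrier_R(2) by blast
 next
  assume "\<exists>q\<in>carrier R. x = ([:- 0, 1:] \<odot>\<^bsub>R\<^esub> q) \<oplus>\<^bsub>R\<^esub> y"
  then obtain q where q: "q \<in> carrier R" "x = ([:- 0, 1:] \<odot>\<^bsub>R\<^esub> q) \<oplus>\<^bsub>R\<^esub> y" by blast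
  note pq = carrier_R(3)[OF q(1)]
  have "dec x = pCons 0 (dec q) + dec y" unfolding q(2) using q(1) y by (simp add: R.hom R.closed)
  then have "\<kappa> z (pcoeff (dec x) (wt z)) = \<kappa> z (pcoeff (dec y) (wt z))" if "z \<in> carrier G" for z
   using that R0_\<kappa>[OF pq that] F_S[OF R0_F[OF pq]] F_S[OF R0_F[OF py]]
   by (auto simp: coeff_pCons \<kappa>_add S_lin split: nat.splits)
  then show "symbol (dec x) = symbol (dec y)"
   by (intro poly_mapping_eqI) (simp add: lookup_symbol px py)
 qed
next
 show "symbol (dec \<one>\<^bsub>R\<^esub>) = \<one>\<^bsub>monoid_algebra G\<^esub>"
 proof (rule poly_mapping_eqI)
  fix x
  have "\<kappa> x (pcoeff 1 (wt x)) = (if x = \<one>\<^bsub>G\<^esub> then 1 else 0)" if x: "x \<in> carrier G"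
  proof (cases "wt x = 0")
   case True
   then have "\<kappa> x 1 = lookup 1 (\<alpha> x)" using \<kappa>_top[of 1 x] x F_one by simp
   moreover have "\<alpha> x = 0 \<longleftrightarrow> x = \<one>\<^bsub>G\<^esub>" using \<alpha>_inj[OF x G_closed(1)] \<alpha>_one by auto
   ultimately show ?thesis using True by (simp add: lookup_one when_def)
  next
   case False
   then have "x \<noteq> \<one>\<^bsub>G\<^esub>" using \<alpha>_one w_0 by auto
   then show ?thesis using False by (simp add: coeff_1)
  qed
  then show "lookup (symbol (dec \<one>\<^bsub>R\<^esub>)) x = lookup \<one>\<^bsub>monoid_algebra G\<^esub> x"
   using G_closed(1) by (auto simp: R.hom lookup_symbol R0_lin monoid_algebra_def lookup_single when_def)
 qed
next
 fix c x assume x: "x \<in> carrier R"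
 note px = carrier_R(3)[OF x]
 have "scal [:c:] * dec x \<in> R0" by (rule R0_scal[OF px])
 then show "symbol (dec ([:c:] \<odot>\<^bsub>R\<^esub> x)) = c \<odot>\<^bsub>monoid_algebra G\<^esub> symbol (dec x)"
  using F_S[OF R0_F[OF px]]
  by (intro poly_mapping_eqI)
   (auto simp: R.hom x lookup_symbol px monoid_algebra_def Poly_Mapping.map.rep_eq when_def \<kappa>_scale)
qed

lemma A_cring: "cring A" by (rule A.is_cring)

definition family_poly :: "(nat => 'r) => 'a mpoly poly" where
 "family_poly f = Abs_poly (\<lambda>i. \<Psi> (f i))"

lemma family_carrier: "f \<in> carrier (trivial_family A) \<longleftrightarrow> (\<forall>i. f i \<in> carrier A) \<and> (\<exists>n. \<forall>i>n. f i = \<zero>\<^bsub>A\<^esub>)"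
 by (auto simp: trivial_family_def UP_def up_def bound_def Pi_iff)

lemma coeff_family_poly:
 assumes "f \<in> carrier (trivial_family A)"
 shows "pcoeff (family_poly f) i = \<Psi> (f i)"
proof -
 obtain n where "\<forall>i>n. f i = \<zero>\<^bsub>A\<^esub>" using assms by (auto simp: family_carrier)
 then have "\<forall>i>n. \<Psi> (f i) = 0" using A.hom(1) by simp
 then have "\<forall>\<^sub>\<infinity>i. \<Psi> (f i) = 0" unfolding MOST_nat by blast
 then show ?thesis unfolding family_poly_def by (simp add: Abs_poly_inverse)
qed

lemma emb_family: "idom_algebra_embedding (trivial_family A) scal family_poly"
proof -
 interpret U: UP_cring A "UP A" by (intro UP_cring.intro A_cring)
 let ?T = "trivial_family A"
 have T_UP: "carrier ?T = carrier (UP A)" "\<zero>\<^bsub>?T\<^esub> = \<zero>\<^bsub>UP A\<^esub>" "\<one>\<^bsub>?T\<^esub> = \<one>\<^bsub>UP A\<^esub>"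
  "f \<oplus>\<^bsub>?T\<^esub> g = f \<oplus>\<^bsub>UP A\<^esub> g" "f \<otimes>\<^bsub>?T\<^esub> g = f \<otimes>\<^bsub>UP A\<^esub> g" for f g
  by (simp_all add: trivial_family_def)
 have mem: "f i \<in> carrier A" if "f \<in> carrier ?T" for f i using that by (simp add: family_carrier)
 have up: "up A = carrier ?T" by (simp add: T_UP UP_def)
 have smult: "(c \<odot>\<^bsub>?T\<^esub> f) k \<in> carrier A"
  "\<Psi> ((c \<odot>\<^bsub>?T\<^esub> f) k) = pcoeff (scal c * family_poly f) k" if f: "f \<in> carrier ?T" for c f k
 proof -
  have eq: "(c \<odot>\<^bsub>?T\<^esub> f) k = (\<Oplus>\<^bsub>A\<^esub>i\<in>{..k}. pcoeff c i \<odot>\<^bsub>A\<^esub> f (k - i))" by (simp add: trivial_family_def)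
  have cl: "pcoeff c i \<odot>\<^bsub>A\<^esub> f (k - i) \<in> carrier A" for i using mem[OF f] A.closed by simp
  note fs = A.hom_finsum[OF finite_atMost cl]
  show "(c \<odot>\<^bsub>?T\<^esub> f) k \<in> carrier A" unfolding eq by (rule fs(2))
  have "\<Psi> ((c \<odot>\<^bsub>?T\<^esub> f) k) = (\<Sum>i\<le>k. \<Psi> (pcoeff c i \<odot>\<^bsub>A\<^esub> f (k - i)))" unfolding eq by (rule fs(1))
  then show "\<Psi> ((c \<odot>\<^bsub>?T\<^esub> f) k) = pcoeff (scal c * family_poly f) k"
   by (simp add: coeff_mult coeff_family_poly[OF f] A.hom mem[OF f])
 qed
 have smult_closed: "c \<odot>\<^bsub>?T\<^esub> f \<in> carrier ?T" if f: "f \<in> carrier ?T" for c f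
  unfolding family_carrier
 proof (intro conjI allI exI impI)
  show "(c \<odot>\<^bsub>?T\<^esub> f) i \<in> carrier A" for i by (rule smult[OF f])
  fix i assume "degree (scal c * family_poly f) < i"
  then have "\<Psi> ((c \<odot>\<^bsub>?T\<^esub> f) i) = \<Psi> \<zero>\<^bsub>A\<^esub>" using smult(2)[OF f] by (simp add: coeff_eq_0 A.hom)
  then show "(c \<odot>\<^bsub>?T\<^esub> f) i = \<zero>\<^bsub>A\<^esub>" using A.eq_iff smult(1)[OF f] A.closed(1) by simp
 qed
 have add_closed: "f \<oplus>\<^bsub>?T\<^esub> g \<in> carrier ?T" and mult_closed: "f \<otimes>\<^bsub>?T\<^esub> g \<in> carrier ?T"
  if "f \<in> carrier ?T" "g \<in> carrier ?T" for f g
  using that by (simp_all add: T_UP)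
 have zero_closed: "\<zero>\<^bsub>?T\<^esub> \<in> carrier ?T" and one_closed: "\<one>\<^bsub>?T\<^esub> \<in> carrier ?T" by (simp_all add: T_UP)
 show ?thesis
 proof (intro idom_algebra_embedding.intro algebra_embedding.intro idom_algebra_embedding_axioms.intro scal_hom)
  show "inj_on family_poly (carrier ?T)"
  proof (rule inj_onI)
   fix f g assume f: "f \<in> carrier ?T" and g: "g \<in> carrier ?T" and "family_poly f = family_poly g"
   then have "\<Psi> (f i) = \<Psi> (g i)" for i using coeff_family_poly by metis
   then have "f i = g i" for i using A.eq_iff[OF mem[OF f, of i] mem[OF g, of i]] by simp
   then show "f = g" by auto
  qed
  show "scal p = 0 ==> p = 0" for p by (rule scal_inj)
  show "family_poly \<zero>\<^bsub>?T\<^esub> = 0"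
   by (rule poly_eqI) (simp add: coeff_family_poly[OF zero_closed] A.hom, simp add: T_UP UP_def A.hom)
  show "family_poly \<one>\<^bsub>?T\<^esub> = 1"
   by (rule poly_eqI) (simp add: coeff_family_poly[OF one_closed], simp add: T_UP UP_def A.hom coeff_1)
  fix f g assume f: "f \<in> carrier ?T" and g: "g \<in> carrier ?T"
  show "family_poly (f \<oplus>\<^bsub>?T\<^esub> g) = family_poly f + family_poly g"
   by (rule poly_eqI) (simp add: coeff_family_poly f g add_closed, simp add: T_UP(4) UP_def up f g A.hom mem)
  show "family_poly (f \<otimes>\<^bsub>?T\<^esub> g) = family_poly f * family_poly g"
  proof (rule poly_eqI)
   fix n
   have cl: "f i \<otimes>\<^bsub>A\<^esub> g (n - i) \<in> carrier A" for i using mem f g A.closed by simp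
   have "(f \<otimes>\<^bsub>?T\<^esub> g) n = (\<Oplus>\<^bsub>A\<^esub>i\<in>{..n}. f i \<otimes>\<^bsub>A\<^esub> g (n - i))"
    by (simp add: T_UP(5) UP_def up f g)
   then have "\<Psi> ((f \<otimes>\<^bsub>?T\<^esub> g) n) = (\<Sum>i\<le>n. \<Psi> (f i \<otimes>\<^bsub>A\<^esub> g (n - i)))"
    using A.hom_finsum(1)[OF finite_atMost cl] by simp
   then show "pcoeff (family_poly (f \<otimes>\<^bsub>?T\<^esub> g)) n = pcoeff (family_poly f * family_poly g) n"
    by (simp add: coeff_family_poly f g mult_closed coeff_mult A.hom mem)
  qed
  show "family_poly (c \<odot>\<^bsub>?T\<^esub> f) = scal c * family_poly f" for c
   by (rule poly_eqI) (simp add: coeff_family_poly[OF smult_closed[OF f]] smult(2)[OF f])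
 qed (rule zero_closed one_closed add_closed mult_closed smult_closed; assumption)+
qed

text \<open>Up to powers of \<open>t\<close>, the Rees algebra is the whole of \<open>A[t]\<close>.\<close>

lemma R_generic: "isomorphic_algebras ring_of_type_algebra (generic_fibre R) (generic_fibre (trivial_family A))"
proof (rule generic_fibre_isomorphic[OF emb_R emb_family])
 show "dec ` carrier R \<subseteq> family_poly ` carrier (trivial_family A)"
 proof
  fix p assume "p \<in> dec ` carrier R"
  then have p: "p \<in> R0" using carrier_R(3) by blast
  define f where "f i = inv_into (carrier A) \<Psi> (pcoeff p i)" for i
  have "pcoeff p i \<in> \<Psi> ` carrier A" for i using R0_S[OF p] by (simp add: range_\<Psi> S_def)
  then have f: "f i \<in> carrier A" "\<Psi> (f i) = pcoeff p i" for i
   unfolding f_def by (auto intro: inv_into_into f_inv_into_f)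
  have "f i = \<zero>\<^bsub>A\<^esub>" if "i > degree p" for i
   using that f[of i] A.eq_iff[of "f i" "\<zero>\<^bsub>A\<^esub>"] A.closed(1) by (simp add: coeff_eq_0 A.hom)
  then have "f \<in> carrier (trivial_family A)" using f(1) by (auto simp: family_carrier)
  moreover have "family_poly f = p"
   by (rule poly_eqI) (simp add: coeff_family_poly[OF calculation] f)
  ultimately show "p \<in> family_poly ` carrier (trivial_family A)" by blast
 qed
 fix f assume f: "f \<in> carrier (trivial_family A)"
 let ?q = "family_poly f"
 have "\<forall>i. \<exists>k. pcoeff ?q i \<in> F k"
  using F_exhaustive f by (auto simp: coeff_family_poly[OF f] S_\<Psi> family_carrier)
 then obtain k where k: "pcoeff ?q i \<in> F (k i)" for i by metis
 define N where "N = (\<Sum>i\<le>degree ?q. k i)"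
 have N: "pcoeff ?q i \<in> F N" for i
 proof (cases "i \<le> degree ?q")
  case True
  then have "k i \<le> N" unfolding N_def by (intro member_le_sum) auto
  then show ?thesis by (rule F_mono[OF k])
 qed (simp add: coeff_eq_0 F_lin)
 have "scal (pmonom 1 N) = pmonom 1 N" by (rule poly_eqI) simp
 then have "scal (pmonom 1 N) * ?q \<in> R0"
  using F_mono[OF N] by (auto simp: R0_def coeff_monom_mult F_lin)
 then have "scal (pmonom 1 N) * ?q \<in> dec ` carrier R"
  using imageI[OF carrier_R(2), of "scal (pmonom 1 N) * ?q" dec] by simp
 then show "\<exists>p. p \<noteq> 0 \<and> scal p * ?q \<in> dec ` carrier R"
  by (intro exI[of _ "pmonom 1 N"]) (simp add: monom_eq_0_iff)
qed

theorem rees_flat_degeneration: "flat_degeneration A (monoid_algebra G :: ('a, 'g \<Rightarrow>\<^sub>0 'a) module)"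
 unfolding flat_degeneration_def
 using R_finite_type R_flat R_fibre_zero R_fibre_nonzero R_generic by blast

end

section \<open>Locally rational functions\<close>

text \<open>A function on \<open>V\<close> is locally rational if near each point it is a quotient; the clause \<open>y \<in> V\<close> makes \<open>V\<close>
 open.  The case of one variable comes first.\<close>

definition locally_rational1 :: "'a::field set => ('a => 'a) => bool" where
 "locally_rational1 V f \<longleftrightarrow>
  (\<forall>x\<in>V. \<exists>p q. poly q x \<noteq> 0 \<and> (\<forall>y. poly q y \<noteq> 0 --> y \<in> V \<and> f y * poly q y = poly p y))"

lemma poly_eq_on_dense:
 fixes p q r :: "'a::field_char_0 poly"
 assumes "r \<noteq> 0" "\<And>x. poly r x \<noteq> 0 ==> poly p x = poly q x"
 shows "p = q"
proof -
 have "poly ((p - q) * r) x = 0" for x using assms(2)[of x] by (cases "poly r x = 0") auto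
 then have "(p - q) * r = 0" using poly_all_0_iff_0 by blast
 then show ?thesis using assms(1) by simp
qed

lemma locally_rational1_dense:
 fixes f :: "'a::field_char_0 => 'a"
 assumes f: "locally_rational1 V f" and r: "r \<noteq> 0"
  and eq: "\<And>y. y \<in> V ==> poly r y \<noteq> 0 ==> f y * poly q y = poly p y" and y: "y \<in> V"
 shows "f y * poly q y = poly p y"
proof -
 obtain p' q' where pq: "poly q' y \<noteq> 0" "\<And>z. poly q' z \<noteq> 0 ==> z \<in> V \<and> f z * poly q' z = poly p' z"
  using f y unfolding locally_rational1_def by blast
 have "p * q' = p' * q"
 proof (rule poly_eq_on_dense)
  show "r * q' \<noteq> 0" using r pq(1) by auto
  fix z assume "poly (r * q') z \<noteq> 0"
  then show "poly (p * q') z = poly (p' * q) z"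
   using pq(2)[of z] eq[of z] by (simp flip: eq)
 qed
 then have "poly p y * poly q' y = f y * poly q' y * poly q y"
  using pq(1) pq(2)[of y] by (metis poly_mult)
 then show ?thesis using pq(1) by simp
qed

text \<open>A global quotient is obtained by cancelling common zeros.\<close>

lemma locally_rational1_quotient:
 fixes f :: "'a::field_char_0 => 'a"
 assumes f: "locally_rational1 V f" and "V \<noteq> {}"
 obtains p q where "q \<noteq> 0" "\<And>y. y \<in> V ==> poly q y \<noteq> 0" "\<And>y. y \<in> V ==> f y * poly q y = poly p y"
proof -
 define rep where "rep p q \<longleftrightarrow> q \<noteq> 0 \<and> (\<forall>y\<in>V. f y * poly q y = poly p y)" for p q
 have "\<exists>d p q. rep p q \<and> degree q = d"
 proof -
  obtain x where "x \<in> V" using \<open>V \<noteq> {}\<close> by blast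
  then obtain p q where pq: "poly q x \<noteq> 0" "\<And>z. poly q z \<noteq> 0 ==> z \<in> V \<and> f z * poly q z = poly p z"
   using f unfolding locally_rational1_def by blast
  have q: "q \<noteq> 0" using pq(1) by auto
  have "rep p q" unfolding rep_def
   using locally_rational1_dense[OF f q, of q p] pq(2) q by blast
  then show ?thesis by blast
 qed
 then obtain d where d: "\<exists>p q. rep p q \<and> degree q = d" "\<And>d'. \<exists>p q. rep p q \<and> degree q = d' ==> d \<le> d'"
  using exists_least_iff[of "\<lambda>d. \<exists>p q. rep p q \<and> degree q = d"] by (metis not_less)
 then obtain p q where pq: "rep p q" "degree q = d" by blast
 have "poly q y \<noteq> 0" if y: "y \<in> V" for y
 proof
  assume q0: "poly q y = 0"
  then have "poly p y = 0" using pq(1) y by (metis mult_zero_right rep_def)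
  then obtain p1 q1 where 1: "p = [:- y, 1:] * p1" "q = [:- y, 1:] * q1"
   using q0 by (metis dvdE poly_eq_0_iff_dvd)
  have q1: "q1 \<noteq> 0" using pq(1) 1 by (auto simp: rep_def)
  have "f z * poly q1 z = poly p1 z" if "z \<in> V" "poly [:- y, 1:] z \<noteq> 0" for z
  proof -
   have "poly [:- y, 1:] z * (f z * poly q1 z) = poly [:- y, 1:] z * poly p1 z"
    using pq(1) that(1) unfolding rep_def 1 poly_mult by (metis mult.left_commute)
   then show ?thesis using that(2) by (metis mult_left_cancel)
  qed
  then have "rep p1 q1"
   unfolding rep_def using locally_rational1_dense[OF f, of "[:- y, 1:]" q1 p1] q1 by simp
  then have "d \<le> degree q1" using d(2) by blast
  moreover have "degree q = degree [:- y, 1:] + degree q1"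
   unfolding 1(2) by (rule degree_mult_eq) (use q1 in auto)
  ultimately show False using pq(2) by simp
 qed
 then show ?thesis using that[of q p] pq(1) by (auto simp: rep_def)
qed

text \<open>A quotient in lowest terms whose denominator has no zeros; over an algebraically closed field such a
 denominator is constant.\<close>

lemma locally_rational1_UNIV:
 fixes f :: "'a::{alg_closed_field, field_char_0} => 'a"
 assumes "locally_rational1 UNIV f"
 obtains p where "\<And>y. f y = poly p y"
proof -
 obtain p q where pq': "q \<noteq> 0" "\<And>y. y \<in> UNIV ==> poly q y \<noteq> 0" "\<And>y. y \<in> UNIV ==> f y * poly q y = poly p y"
  by (rule locally_rational1_quotient[OF assms UNIV_not_empty]) (rule that)
 note pq = pq'(1) pq'(2)[OF UNIV_I] pq'(3)[OF UNIV_I]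
 have "degree q = 0"
  using pq(2) alg_closed_imp_poly_has_root[of q] by (metis gr0I)
 then obtain c where "q = [:c:]" by (rule degree_eq_zeroE)
 then have "f y = poly (smult (inverse c) p) y" for y
  using pq(2)[of y] pq(3)[of y] by (simp add: field_simps)
 then show ?thesis by (rule that)
qed

definition locally_rational :: "(nat => 'a::field) set => ((nat => 'a) => 'a) => bool" where
 "locally_rational M F \<longleftrightarrow>
  (\<forall>x\<in>M. \<exists>P Q. eval x Q \<noteq> 0 \<and> (\<forall>y. eval y Q \<noteq> 0 --> y \<in> M \<and> F y * eval y Q = eval y P))"

lemma locally_rational_dense:
 fixes F :: "(nat => 'a::field_char_0) => 'a"
 assumes F: "locally_rational M F" and R: "R \<noteq> 0"
  and eq: "\<And>y. y \<in> M ==> eval y R \<noteq> 0 ==> F y * eval y Q = eval y P" and y: "y \<in> M"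
 shows "F y * eval y Q = eval y P"
proof -
 obtain P' Q' where PQ: "eval y Q' \<noteq> 0" "\<And>z. eval z Q' \<noteq> 0 ==> z \<in> M \<and> F z * eval z Q' = eval z P'"
  using F y unfolding locally_rational_def by blast
 have "P * Q' = P' * Q"
 proof (rule eval_eq_on_dense)
  show "R * Q' \<noteq> 0" using R PQ(1) by auto
  fix z assume "eval z (R * Q') \<noteq> 0"
  then have "eval z R \<noteq> 0" "eval z Q' \<noteq> 0" by auto
  then have "eval z P' = F z * eval z Q'" "eval z P = F z * eval z Q"
   using PQ(2)[of z] eq[of z] by simp_all
  then show "eval z (P * Q') = eval z (P' * Q)" by (simp add: mult_ac)
 qed
 then have "eval y (P * Q') = eval y (P' * Q)" by simp
 moreover have "eval y P' = F y * eval y Q'" using PQ by simp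
 ultimately have "eval y P * eval y Q' = F y * eval y Q' * eval y Q" by simp
 then show ?thesis using PQ(1) by simp
qed

definition line_poly :: "nat => (nat => 'a::field) => 'a mpoly => 'a poly" where
 "line_poly v x = evaluate (\<lambda>c. [:c:]) (\<lambda>u. if u = v then [:0, 1:] else [:x u:])"

lemma poly_at_hom: "comm_ring_hom (\<lambda>p. poly p (t::'c::comm_ring_1))"
 by unfold_locales auto

lemma poly_line_poly: "poly (line_poly v x P) t = eval (x(v := t)) P"
proof -
 have "(\<lambda>u. poly (if u = v then [:0, 1:] else [:x u:]) t) = x(v := t)" "(\<lambda>c. poly [:c:] t) = (\<lambda>c. c)" by auto
 then show ?thesis by (simp only: line_poly_def hom_evaluate[OF poly_at_hom])
qed

lemma degree_map_poly_eval: "degree (map_poly (eval x) p) \<le> degree p"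
 by (rule degree_le) (simp add: coeff_map_poly coeff_eq_0)

definition split_variable :: "nat => 'a::field mpoly => 'a mpoly poly" where
 "split_variable v = evaluate (\<lambda>c. [:Const c:]) (\<lambda>u. if u = v then [:0, 1:] else [:Var u:])"

lemma poly_split_variable: "poly (split_variable v P) (Var v) = P"
proof -
 have "poly (split_variable v P) (Var v) = evaluate Const (\<lambda>u. poly (if u = v then [:0, 1:] else [:Var u:]) (Var v)) P"
  unfolding split_variable_def by (simp add: hom_evaluate[OF poly_at_hom])
 also have "(\<lambda>u. poly (if u = v then [:0, 1:] else [:Var u:]) (Var v)) = (Var :: nat => 'a mpoly)" by auto
 finally show ?thesis by (simp add: evaluate_Const_Var)
qed

lemma map_poly_eval_hom: "comm_ring_hom (map_poly (eval x))"
proof -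
 have c: "pcoeff (map_poly (eval x) p) i = eval x (pcoeff p i)" for p i by (simp add: coeff_map_poly)
 show ?thesis
  by unfold_locales (auto intro!: poly_eqI simp: c coeff_mult eval_sum coeff_1)
qed

lemma map_poly_split_variable: "map_poly (eval x) (split_variable v P) = line_poly v x P"
proof -
 have "(\<lambda>u. map_poly (eval x) (if u = v then [:0, 1:] else [:Var u:])) = (\<lambda>u. if u = v then [:0, 1:] else [:x u:])"
  by (auto simp: map_poly_pCons)
 then show ?thesis
  unfolding split_variable_def line_poly_def hom_evaluate[OF map_poly_eval_hom] by (simp add: map_poly_pCons)
qed

definition independent_of :: "nat => 'a::field mpoly => bool" where
 "independent_of v Q \<longleftrightarrow> (\<forall>x t. eval (x(v := t)) Q = eval x Q)"

lemma locally_rational_line: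
 assumes "locally_rational M F"
 shows "locally_rational1 {t. x(v := t) \<in> M} (\<lambda>t. F (x(v := t)))"
 unfolding locally_rational1_def
proof
 fix t assume "t \<in> {t. x(v := t) \<in> M}"
 then obtain P Q where "eval (x(v := t)) Q \<noteq> 0"
  "\<And>y. eval y Q \<noteq> 0 ==> y \<in> M \<and> F y * eval y Q = eval y P"
  using assms unfolding locally_rational_def by blast
 then show "\<exists>p q. poly q t \<noteq> 0 \<and> (\<forall>y. poly q y \<noteq> 0 -->
   y \<in> {t. x(v := t) \<in> M} \<and> F (x(v := y)) * poly q y = poly p y)"
  by (intro exI[of _ "line_poly v x P"] exI[of _ "line_poly v x Q"]) (auto simp: poly_line_poly)
qed

text \<open>If the generic line in direction \<open>v\<close> lies in \<open>M\<close>, then \<open>F\<close> is polynomial on it, and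
 pseudo-division removes the variable \<open>v\<close> from the denominator of \<open>F\<close>.\<close>

lemma eliminate_variable:
 fixes F :: "(nat => 'a::{alg_closed_field, field_char_0}) => 'a"
 assumes F: "locally_rational M F" and r: "r \<noteq> 0" "independent_of v r" "\<And>x. eval x r \<noteq> 0 ==> x \<in> M"
  and Q: "Q \<noteq> 0" and rep: "\<And>x. x \<in> M ==> F x * eval x Q = eval x P"
 obtains P' Q' where "Q' \<noteq> 0" "\<And>x. x \<in> M ==> F x * eval x Q' = eval x P'"
  "independent_of v Q'" "\<And>u. independent_of u Q ==> independent_of u Q'"
proof -
 let ?p = "split_variable v P" and ?q = "split_variable v Q"
 have q: "?q \<noteq> 0" using poly_split_variable[of v Q] Q by auto
 obtain h s where hs: "pseudo_divmod ?p ?q = (h, s)" by (cases "pseudo_divmod ?p ?q")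
 define e where "e = Suc (degree ?p) - degree ?q"
 define a where "a = lead_coeff ?q"
 have pd: "smult (a ^ e) ?p = ?q * h + s" and s: "s = 0 \<or> degree s < degree ?q"
  using pseudo_divmod[OF q hs] by (auto simp: a_def e_def)
 have a: "a \<noteq> 0" using q by (simp add: a_def)
 have "pcoeff s k = 0" for k
 proof (rule eval_eq_on_dense)
  show "r * a \<noteq> 0" using r(1) a by simp
  fix x assume "eval x (r * a) \<noteq> 0"
  then have x: "eval x r \<noteq> 0" "eval x a \<noteq> 0" by auto
  then have M: "x(v := t) \<in> M" for t using r(2,3) by (auto simp: independent_of_def)
  then have "{t. x(v := t) \<in> M} = UNIV" by auto
  then have "locally_rational1 UNIV (\<lambda>t. F (x(v := t)))" using locally_rational_line[OF F, of x v] by simp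
  then obtain g where g: "\<And>t. F (x(v := t)) = poly g t" by (rule locally_rational1_UNIV) (rule that)
  interpret m: comm_ring_hom "map_poly (eval x)" by (rule map_poly_eval_hom)
  have "poly (g * line_poly v x Q) t = poly (line_poly v x P) t" for t
   using rep[OF M[of t]] by (simp add: poly_line_poly g)
  then have gq: "g * line_poly v x Q = line_poly v x P" using poly_eq_poly_eq_iff by blast
  have ma: "map_poly (eval x) (smult c p) = smult (eval x c) (map_poly (eval x) p)" for c p
   by (rule poly_eqI) (simp add: coeff_map_poly)
  have "map_poly (eval x) (smult (a ^ e) ?p) = map_poly (eval x) (?q * h + s)" using pd by simp
  then have "map_poly (eval x) s = line_poly v x Q * (smult (eval x a ^ e) g - map_poly (eval x) h)"
   by (simp add: ma m.hom_add m.hom_mult map_poly_split_variable algebra_simps flip: gq)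
  moreover have "degree (line_poly v x Q) = degree ?q"
   unfolding map_poly_split_variable[symmetric] using x(2)
   by (intro antisym degree_map_poly_eval le_degree) (simp add: coeff_map_poly a_def)
  moreover have "degree (map_poly (eval x) s) \<le> degree s" by (rule degree_map_poly_eval)
  moreover have "s \<noteq> 0 \<and> degree ?q \<le> degree (map_poly (eval x) s)" if nz: "map_poly (eval x) s \<noteq> 0"
  proof
   show "s \<noteq> 0" using nz by auto
   have "line_poly v x Q \<noteq> 0" "smult (eval x a ^ e) g - map_poly (eval x) h \<noteq> 0"
    using nz calculation(1) by auto
   then have "degree (map_poly (eval x) s) = degree (line_poly v x Q) + degree (smult (eval x a ^ e) g - map_poly (eval x) h)"
    unfolding calculation(1) by (rule degree_mult_eq)
   then show "degree ?q \<le> degree (map_poly (eval x) s)" using calculation(2) by simp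
  qed
  ultimately have "map_poly (eval x) s = 0" using s by fastforce
  then have "pcoeff (map_poly (eval x) s) k = 0" by simp
  then show "eval x (pcoeff s k) = eval x 0" by (simp add: coeff_map_poly)
 qed
 then have "s = 0" by (simp add: poly_eq_iff)
 then have "poly (smult (a ^ e) ?p) (Var v) = poly (?q * h) (Var v)" using pd by simp
 then have eq: "a ^ e * P = Q * poly h (Var v)" by (simp add: poly_split_variable)
 have eval_a: "eval x a = pcoeff (line_poly v x Q) (degree ?q)" for x
  by (simp add: a_def coeff_map_poly flip: map_poly_split_variable)
 have indep_a: "independent_of u (a ^ e)" if "\<And>x s. line_poly v (x(u := s)) Q = line_poly v x Q" for u
  using that by (simp add: independent_of_def eval_a)
 show ?thesis
 proof (rule that)
  show "a ^ e \<noteq> 0" using a by simp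
  show "F x * eval x (a ^ e) = eval x (poly h (Var v))" if x: "x \<in> M" for x
  proof (rule locally_rational_dense[OF F Q _ x])
   fix y assume y: "y \<in> M" "eval y Q \<noteq> 0"
   have "eval y Q * (F y * eval y (a ^ e)) = eval y (a ^ e * P)"
    by (simp add: rep[OF y(1), symmetric] mult_ac)
   also have "\<dots> = eval y Q * eval y (poly h (Var v))" by (simp add: eq)
   finally show "F y * eval y (a ^ e) = eval y (poly h (Var v))" using y(2) by simp
  qed
  show "independent_of v (a ^ e)"
  proof (rule indep_a)
   fix x s
   have "poly (line_poly v (x(v := s)) Q) t = poly (line_poly v x Q) t" for t by (simp add: poly_line_poly)
   then show "line_poly v (x(v := s)) Q = line_poly v x Q" using poly_eq_poly_eq_iff by blast
  qed
  show "independent_of u (a ^ e)" if u: "independent_of u Q" for u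
  proof (rule indep_a)
   fix x s
   have "poly (line_poly v (x(u := s)) Q) t = poly (line_poly v x Q) t" for t
   proof (cases "u = v")
    case False
    then have "x(u := s, v := t) = (x(v := t))(u := s)" by (rule fun_upd_twist)
    then show ?thesis using u by (simp add: poly_line_poly independent_of_def)
   qed (simp add: poly_line_poly)
   then show "line_poly v (x(u := s)) Q = line_poly v x Q" using poly_eq_poly_eq_iff by blast
  qed
 qed
qed

lemma eval_cong: "(\<And>\<beta> v. \<beta> \<in> keys P ==> v \<in> keys \<beta> ==> x v = y v) ==> eval x P = eval y P"
 unfolding evaluate_def power_product_def by (intro sum.cong prod.cong arg_cong2[where f = "(*)"]) auto

lemma independent_of_all_const:
 assumes "\<And>v. independent_of v Q"
 shows "eval x Q = eval y Q"
proof -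
 have "eval (\<lambda>v. if v \<in> W then x v else y v) Q = eval y Q" if "finite W" for W
  using that
 proof (induction W)
  case (insert u W)
  have "(\<lambda>v. if v \<in> insert u W then x v else y v) = (\<lambda>v. if v \<in> W then x v else y v)(u := x u)" by auto
  then show ?case using insert assms[of u] by (simp add: independent_of_def)
 qed simp
 from this[of "\<Union>(keys ` keys Q)"]
 have "eval (\<lambda>v. if v \<in> \<Union>(keys ` keys Q) then x v else y v) Q = eval y Q" by simp
 moreover have "eval (\<lambda>v. if v \<in> \<Union>(keys ` keys Q) then x v else y v) Q = eval x Q"
  by (rule eval_cong) auto
 ultimately show ?thesis by simp
qed

text \<open>The hypothesis says that, for every coordinate direction, the generic line lies in \<open>M\<close>; it expresses that the
 complement of \<open>M\<close> has codimension at least two.  The variables of a denominator are eliminated one by one.\<close>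

theorem locally_rational_polynomial:
 fixes F :: "(nat => 'a::{alg_closed_field, field_char_0}) => 'a"
 assumes F: "locally_rational M F" and "M \<noteq> {}"
  and r: "\<And>v. \<exists>r. r \<noteq> 0 \<and> independent_of v r \<and> (\<forall>x. eval x r \<noteq> 0 --> x \<in> M)"
 obtains P where "\<And>x. x \<in> M ==> F x = eval x P"
proof -
 obtain x where "x \<in> M" using \<open>M \<noteq> {}\<close> by blast
 then obtain P0 Q0 where PQ: "eval x Q0 \<noteq> 0" "\<And>z. eval z Q0 \<noteq> 0 ==> z \<in> M \<and> F z * eval z Q0 = eval z P0"
  using F unfolding locally_rational_def by blast
 have Q0: "Q0 \<noteq> 0" using PQ(1) by auto
 have rep0: "F y * eval y Q0 = eval y P0" if "y \<in> M" for y
  using locally_rational_dense[OF F Q0 _ that] PQ(2) by blast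
 let ?V = "\<Union>(keys ` keys Q0)"
 have elim: "\<exists>P Q. Q \<noteq> 0 \<and> (\<forall>y\<in>M. F y * eval y Q = eval y P) \<and> (\<forall>v. v \<in> W \<or> independent_of v Q0 --> independent_of v Q)"
  if "finite W" for W
  using that
 proof (induction W)
  case empty
  then show ?case using Q0 rep0 by blast
 next
  case (insert v W)
  then obtain P Q where 1: "Q \<noteq> 0" "\<And>y. y \<in> M ==> F y * eval y Q = eval y P"
   "\<And>u. u \<in> W \<or> independent_of u Q0 ==> independent_of u Q" by blast
  obtain r where rr: "r \<noteq> 0" "independent_of v r" "\<And>x. eval x r \<noteq> 0 ==> x \<in> M" using r by blast
  obtain P' Q' where 2: "Q' \<noteq> 0"
   "\<And>x. x \<in> M ==> F x * eval x Q' = eval x P'" "independent_of v Q'"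
   "\<And>u. independent_of u Q ==> independent_of u Q'"
   by (rule eliminate_variable[OF F rr(1,2) _ 1(1)]) (erule rr(3), erule 1(2), rule that)
  then have "u \<in> insert v W \<or> independent_of u Q0 --> independent_of u Q'" for u using 1(3)[of u] by auto
  then show ?case using 2(1,2) by (intro exI[of _ P'] exI[of _ Q']) auto
 qed
 have "\<exists>P Q. Q \<noteq> 0 \<and> (\<forall>y\<in>M. F y * eval y Q = eval y P) \<and> (\<forall>v. v \<in> ?V \<or> independent_of v Q0 --> independent_of v Q)"
  by (rule elim) simp
 then obtain P Q where PQ': "Q \<noteq> 0 \<and> (\<forall>y\<in>M. F y * eval y Q = eval y P) \<and> (\<forall>v. v \<in> ?V \<or> independent_of v Q0 --> independent_of v Q)"
  by (elim exE)
 have Q: "Q \<noteq> 0" "\<And>y. y \<in> M ==> F y * eval y Q = eval y P"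
  "\<And>v. v \<in> ?V \<or> independent_of v Q0 ==> independent_of v Q" using PQ' by (simp, simp, blast)
 have "independent_of v Q0" if "v \<notin> ?V" for v
  unfolding independent_of_def using that by (auto intro!: eval_cong)
 then have const: "eval x Q = eval y Q" for x y using Q(3) independent_of_all_const by blast
 define c where "c = eval x Q"
 have c: "eval y Q = c" for y unfolding c_def by (rule const)
 have "c \<noteq> 0" using Q(1) eval_eq_0_imp[of Q] c by auto
 then have "F y = eval y (Const (inverse c) * P)" if "y \<in> M" for y
  using Q(2)[OF that] c[of y] by (simp add: field_simps)
 then show ?thesis by (rule that)
qed

section \<open>Regular functions on the special linear group\<close>

text \<open>The normal form of a regular function on an open subset \<open>U\<close> of \<open>Y\<close>: the clause \<open>y \<in> U\<close> makes the
 nonvanishing locus of the denominator a neighbourhood inside \<open>U\<close>.\<close>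

definition fractional :: "'p set => ('p => 'a::field) set => 'p set => ('p => 'a) => bool" where
 "fractional Y C U f \<longleftrightarrow> (\<forall>x\<in>U. \<exists>p\<in>polynomial_functions C. \<exists>q\<in>polynomial_functions C.
  q x \<noteq> 0 \<and> (\<forall>y\<in>Y. q y \<noteq> 0 --> y \<in> U \<and> f y = p y / q y))"

lemma fractionalE:
 assumes "fractional Y C U f" "x \<in> U"
 obtains p q where "p \<in> polynomial_functions C" "q \<in> polynomial_functions C" "q x \<noteq> 0"
  "\<And>y. y \<in> Y ==> q y \<noteq> 0 ==> y \<in> U \<and> f y = p y / q y"
proof -
 have "\<exists>p\<in>polynomial_functions C. \<exists>q\<in>polynomial_functions C.
  q x \<noteq> 0 \<and> (\<forall>y\<in>Y. q y \<noteq> 0 --> y \<in> U \<and> f y = p y / q y)"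
  using assms(1) assms(2) unfolding fractional_def by (rule bspec)
 then show ?thesis
 proof (elim bexE conjE)
  fix p q assume p: "p \<in> polynomial_functions C" and q: "q \<in> polynomial_functions C" "q x \<noteq> 0"
   and *: "\<forall>y\<in>Y. q y \<noteq> 0 --> y \<in> U \<and> f y = p y / q y"
  show ?thesis by (rule that[OF p q]) (rule mp[OF bspec[OF *]])
 qed
qed

lemma openin_basic: "p \<in> polynomial_functions C ==> openin (zariski_topology Y C) {y\<in>Y. p y \<noteq> 0}"
 unfolding zariski_topology_def by (rule topology_generated_by_Basis) blast

text \<open>The basic open sets are closed under intersection, hence a basis of the topology they generate.\<close>

lemma openin_zariskiD:
 assumes "openin (zariski_topology Y C) U" "x \<in> U"
 shows "\<exists>p\<in>polynomial_functions C. x \<in> Y \<and> p x \<noteq> 0 \<and> {y\<in>Y. p y \<noteq> 0} \<subseteq> U"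
proof -
 have "generate_topology_on {{x\<in>Y. p x \<noteq> 0} |p. p \<in> polynomial_functions C} U"
  using assms(1) by (simp add: zariski_topology_def openin_topology_generated_by_iff)
 then show ?thesis
  using assms(2)
 proof (induction arbitrary: x rule: generate_topology_on.induct)
  case (Int a b)
  then obtain p q where "p \<in> polynomial_functions C" "x \<in> Y" "p x \<noteq> 0" "{y\<in>Y. p y \<noteq> 0} \<subseteq> a"
   "q \<in> polynomial_functions C" "q x \<noteq> 0" "{y\<in>Y. q y \<noteq> 0} \<subseteq> b" by blast
  then show ?case by (intro bexI[of _ "\<lambda>y. p y * q y"]) (auto intro: polynomial_functions.mult)
 next
  case (UN K)
  then obtain k where k: "k \<in> K" "x \<in> k" by blast
  from UN.IH[OF this] obtain p where "p \<in> polynomial_functions C" "x \<in> Y" "p x \<noteq> 0" "{y\<in>Y. p y \<noteq> 0} \<subseteq> k" by blast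
  then show ?case using k(1) by (intro bexI[of _ p]) auto
 qed auto
qed

lemma topspace_zariski:
 fixes C :: "('p => 'a::field) set"
 shows "topspace (zariski_topology Y C) = Y"
proof
 show "topspace (zariski_topology Y C) \<subseteq> Y"
 proof
  fix x assume "x \<in> topspace (zariski_topology Y C)"
  from openin_zariskiD[OF openin_topspace this] show "x \<in> Y" by (elim bexE conjE)
 qed
 have "openin (zariski_topology Y C) {y\<in>Y. (1::'a) \<noteq> 0}"
  by (rule openin_basic[OF polynomial_functions.const])
 from openin_subset[OF this] show "Y \<subseteq> topspace (zariski_topology Y C)" by simp
qed

lemma openin_zariskiI:
 assumes "\<And>x. x \<in> U ==> \<exists>p\<in>polynomial_functions C. x \<in> Y \<and> p x \<noteq> 0 \<and> {y\<in>Y. p y \<noteq> 0} \<subseteq> U"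
 shows "openin (zariski_topology Y C) U"
proof (subst openin_subopen, intro ballI)
 fix x assume "x \<in> U"
 from assms[OF this] obtain p where "p \<in> polynomial_functions C" "x \<in> Y" "p x \<noteq> 0" "{y\<in>Y. p y \<noteq> 0} \<subseteq> U" by blast
 then show "\<exists>T. openin (zariski_topology Y C) T \<and> x \<in> T \<and> T \<subseteq> U"
  by (intro exI[of _ "{y\<in>Y. p y \<noteq> 0}"]) (auto intro: openin_basic)
qed

lemma regular_affine_iff:
 assumes "U \<subseteq> Y"
 shows "f \<in> regular (affine_variety Y C) U \<longleftrightarrow> fractional Y C U f"
proof
 assume f: "f \<in> regular (affine_variety Y C) U"
 show "fractional Y C U f"
  unfolding fractional_def
 proof
  fix x assume "x \<in> U"
  then obtain V p q where V: "openin (zariski_topology Y C) V" "x \<in> V" "V \<subseteq> U"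
   "p \<in> polynomial_functions C" "q \<in> polynomial_functions C" "\<And>y. y \<in> V ==> q y \<noteq> 0 \<and> f y = p y / q y"
   using f unfolding affine_variety_def by auto
  obtain r where r: "r \<in> polynomial_functions C" "r x \<noteq> 0" "{y\<in>Y. r y \<noteq> 0} \<subseteq> V"
   using openin_zariskiD[OF V(1,2)] by blast
  have "y \<in> U \<and> f y = p y * r y / (q y * r y)" if "y \<in> Y" "q y * r y \<noteq> 0" for y
  proof -
   have "y \<in> V" using r(3) that by auto
   then show ?thesis using V(3) V(6)[of y] that by auto
  qed
  then show "\<exists>p\<in>polynomial_functions C. \<exists>q\<in>polynomial_functions C.
    q x \<noteq> 0 \<and> (\<forall>y\<in>Y. q y \<noteq> 0 --> y \<in> U \<and> f y = p y / q y)"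
   using V r by (intro bexI[of _ "\<lambda>y. p y * r y"] bexI[of _ "\<lambda>y. q y * r y"]) (auto intro: polynomial_functions.mult)
 qed
next
 assume f: "fractional Y C U f"
 have "\<exists>V. openin (zariski_topology Y C) V \<and> x \<in> V \<and> V \<subseteq> U \<and>
    (\<exists>p\<in>polynomial_functions C. \<exists>q\<in>polynomial_functions C. \<forall>y\<in>V. q y \<noteq> 0 \<and> f y = p y / q y)" if x: "x \<in> U" for x
 proof -
  obtain p q where pq: "p \<in> polynomial_functions C" "q \<in> polynomial_functions C" "q x \<noteq> 0"
   and val: "\<And>y. y \<in> Y ==> q y \<noteq> 0 ==> y \<in> U \<and> f y = p y / q y"
   using f x by (rule fractionalE) (rule that)
  have "openin (zariski_topology Y C) {y\<in>Y. q y \<noteq> 0}" by (rule openin_basic[OF pq(2)])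
  moreover have "x \<in> {y\<in>Y. q y \<noteq> 0}" using x assms pq(3) by (simp add: subsetD)
  moreover have "{y\<in>Y. q y \<noteq> 0} \<subseteq> U" using val by (simp add: subset_iff)
  moreover have "\<forall>y\<in>{y\<in>Y. q y \<noteq> 0}. q y \<noteq> 0 \<and> f y = p y / q y" by (simp add: val)
  ultimately show ?thesis using pq(1,2)
   by (intro exI[of _ "{y\<in>Y. q y \<noteq> 0}"] conjI) (assumption+, rule bexI[of _ p], rule bexI[of _ q])
 qed
 then show "f \<in> regular (affine_variety Y C) U" unfolding affine_variety_def by auto
qed

lemma fractional_open:
 assumes "U \<subseteq> Y" and f: "fractional Y C U f"
 shows "openin (zariski_topology Y C) U"
proof (rule openin_zariskiI)
 fix x assume x: "x \<in> U"
 obtain p q where "q \<in> polynomial_functions C" "q x \<noteq> 0"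
  and "\<And>y. y \<in> Y ==> q y \<noteq> 0 ==> y \<in> U \<and> f y = p y / q y"
  by (rule fractionalE[OF f x]) (rule that)
 then show "\<exists>p\<in>polynomial_functions C. x \<in> Y \<and> p x \<noteq> 0 \<and> {y \<in> Y. p y \<noteq> 0} \<subseteq> U"
  using x assms(1) by (intro bexI[of _ q]) auto
qed

lemma fractional_cong:
 assumes eq: "\<And>x. x \<in> U ==> f x = g x" and f: "fractional Y C U f"
 shows "fractional Y C U g"
 unfolding fractional_def
proof
 fix x assume "x \<in> U"
 from f this obtain p q where "p \<in> polynomial_functions C" "q \<in> polynomial_functions C" "q x \<noteq> 0"
  and v: "\<And>y. y \<in> Y ==> q y \<noteq> 0 ==> y \<in> U \<and> f y = p y / q y" by (rule fractionalE) (rule that)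
 moreover have "y \<in> U \<and> g y = p y / q y" if "y \<in> Y" "q y \<noteq> 0" for y using v[OF that] eq[of y] by simp
 ultimately show "\<exists>p\<in>polynomial_functions C. \<exists>q\<in>polynomial_functions C. q x \<noteq> 0 \<and> (\<forall>y\<in>Y. q y \<noteq> 0 --> y \<in> U \<and> g y = p y / q y)"
  by (intro bexI[of _ p] bexI[of _ q]) auto
qed

lemma fractional_polynomial:
 assumes "openin (zariski_topology Y C) U" "p \<in> polynomial_functions C"
 shows "fractional Y C U p"
 unfolding fractional_def
proof
 fix x assume "x \<in> U"
 from openin_zariskiD[OF assms(1) this] obtain r where "r \<in> polynomial_functions C" "r x \<noteq> 0" "{y\<in>Y. r y \<noteq> 0} \<subseteq> U" by blast
 then show "\<exists>p'\<in>polynomial_functions C. \<exists>q\<in>polynomial_functions C. q x \<noteq> 0 \<and> (\<forall>y\<in>Y. q y \<noteq> 0 --> y \<in> U \<and> p y = p' y / q y)"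
  using assms(2) by (intro bexI[of _ "\<lambda>y. p y * r y"] bexI[of _ r]) (auto intro: polynomial_functions.mult)
qed

lemma fractional_local:
 assumes "\<And>x. x \<in> U ==> \<exists>V. x \<in> V \<and> V \<subseteq> U \<and> fractional Y C V f"
 shows "fractional Y C U f"
 unfolding fractional_def
proof
 fix x assume "x \<in> U"
 then obtain V where V: "x \<in> V" "V \<subseteq> U" "fractional Y C V f" using assms by blast
 from V(3,1) obtain p q where "p \<in> polynomial_functions C" "q \<in> polynomial_functions C" "q x \<noteq> 0"
  "\<And>y. y \<in> Y ==> q y \<noteq> 0 ==> y \<in> V \<and> f y = p y / q y" by (rule fractionalE) (rule that)
 then show "\<exists>p\<in>polynomial_functions C. \<exists>q\<in>polynomial_functions C. q x \<noteq> 0 \<and> (\<forall>y\<in>Y. q y \<noteq> 0 --> y \<in> U \<and> f y = p y / q y)"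
  using V(2) by (intro bexI[of _ p] bexI[of _ q]) auto
qed

lemma fractional_binary:
 assumes f: "fractional Y C U f" and g: "fractional Y C V g"
  and op: "\<And>p q p' q'. [|p \<in> polynomial_functions C; q \<in> polynomial_functions C;
   p' \<in> polynomial_functions C; q' \<in> polynomial_functions C|] ==>
   \<exists>P\<in>polynomial_functions C. \<exists>Q\<in>polynomial_functions C. \<forall>y\<in>Y.
    (y \<in> U \<inter> V --> q y \<noteq> 0 --> q' y \<noteq> 0 --> f y = p y / q y --> g y = p' y / q' y --> Q y \<noteq> 0 \<and> h y = P y / Q y)"
  and UV: "U \<subseteq> Y"
 shows "fractional Y C (U \<inter> V) h"
 unfolding fractional_def
proof
 fix x assume x: "x \<in> U \<inter> V"
 obtain p q where 1: "p \<in> polynomial_functions C" "q \<in> polynomial_functions C" "q x \<noteq> 0"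
  "\<And>y. y \<in> Y ==> q y \<noteq> 0 ==> y \<in> U \<and> f y = p y / q y" by (rule fractionalE[OF f IntD1[OF x]]) (rule that)
 obtain p' q' where 2: "p' \<in> polynomial_functions C" "q' \<in> polynomial_functions C" "q' x \<noteq> 0"
  "\<And>y. y \<in> Y ==> q' y \<noteq> 0 ==> y \<in> V \<and> g y = p' y / q' y" by (rule fractionalE[OF g IntD2[OF x]]) (rule that)
 obtain P Q where PQ: "P \<in> polynomial_functions C" "Q \<in> polynomial_functions C"
  "\<And>y. y \<in> Y ==> y \<in> U \<inter> V ==> q y \<noteq> 0 ==> q' y \<noteq> 0 ==> f y = p y / q y ==> g y = p' y / q' y ==> Q y \<noteq> 0 \<and> h y = P y / Q y"
  using op[OF 1(1,2) 2(1,2)] by blast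
 have all: "y \<in> U \<inter> V \<and> Q y \<noteq> 0 \<and> h y = P y / Q y" if "y \<in> Y" "q y \<noteq> 0" "q' y \<noteq> 0" for y
  using 1(4)[of y] 2(4)[of y] PQ(3)[of y] that by auto
 show "\<exists>p\<in>polynomial_functions C. \<exists>q\<in>polynomial_functions C. q x \<noteq> 0 \<and> (\<forall>y\<in>Y. q y \<noteq> 0 --> y \<in> U \<inter> V \<and> h y = p y / q y)"
 proof (rule bexI[of _ "\<lambda>y. P y * (q y * q' y)"], rule bexI[of _ "\<lambda>y. Q y * (q y * q' y)"], intro conjI ballI impI)
  show "(\<lambda>y. P y * (q y * q' y)) \<in> polynomial_functions C" "(\<lambda>y. Q y * (q y * q' y)) \<in> polynomial_functions C"
   using PQ 1 2 by (auto intro!: polynomial_functions.mult)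
  show "Q x * (q x * q' x) \<noteq> 0" using all[of x] x UV 1(3) 2(3) by auto
  fix y assume "y \<in> Y" "Q y * (q y * q' y) \<noteq> 0"
  then show "y \<in> U \<inter> V" "h y = P y * (q y * q' y) / (Q y * (q y * q' y))" using all[of y] by auto
 qed
qed

lemma fractional_mult:
 assumes "fractional Y C U f" "fractional Y C V g" "U \<subseteq> Y"
 shows "fractional Y C (U \<inter> V) (\<lambda>x. f x * g x)"
proof (rule fractional_binary[OF assms(1,2) _ assms(3)])
 fix p q p' q' assume "p \<in> polynomial_functions C" "q \<in> polynomial_functions C"
   "p' \<in> polynomial_functions C" "q' \<in> polynomial_functions C"
 then show "\<exists>P\<in>polynomial_functions C. \<exists>Q\<in>polynomial_functions C. \<forall>y\<in>Y. (y \<in> U \<inter> V --> q y \<noteq> 0 --> q' y \<noteq> 0 -->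
   f y = p y / q y --> g y = p' y / q' y --> Q y \<noteq> 0 \<and> f y * g y = P y / Q y)"
  by (intro bexI[of _ "\<lambda>y. p y * p' y"] bexI[of _ "\<lambda>y. q y * q' y"]) (auto intro: polynomial_functions.mult)
qed

lemma fractional_divide:
 assumes "fractional Y C U f" "fractional Y C V g" "U \<subseteq> Y" and nz: "\<And>x. x \<in> U \<inter> V ==> g x \<noteq> 0"
 shows "fractional Y C (U \<inter> V) (\<lambda>x. f x / g x)"
proof (rule fractional_binary[OF assms(1,2) _ assms(3)])
 fix p q p' q' assume pq: "p \<in> polynomial_functions C" "q \<in> polynomial_functions C"
   "p' \<in> polynomial_functions C" "q' \<in> polynomial_functions C"
 have "q y * p' y \<noteq> 0 \<and> f y / g y = p y * q' y / (q y * p' y)"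
  if "y \<in> U \<inter> V" "q y \<noteq> 0" "q' y \<noteq> 0" "f y = p y / q y" "g y = p' y / q' y" for y
  using nz[OF that(1)] that by auto
 then show "\<exists>P\<in>polynomial_functions C. \<exists>Q\<in>polynomial_functions C. \<forall>y\<in>Y. (y \<in> U \<inter> V --> q y \<noteq> 0 --> q' y \<noteq> 0 -->
   f y = p y / q y --> g y = p' y / q' y --> Q y \<noteq> 0 \<and> f y / g y = P y / Q y)"
  using pq by (intro bexI[of _ "\<lambda>y. p y * q' y"] bexI[of _ "\<lambda>y. q y * p' y"]) (auto intro: polynomial_functions.mult)
qed

lemma fractional_add:
 assumes "fractional Y C U f" "fractional Y C V g" "U \<subseteq> Y"
 shows "fractional Y C (U \<inter> V) (\<lambda>x. f x + g x)"
proof (rule fractional_binary[OF assms(1,2) _ assms(3)])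
 fix p q p' q' assume "p \<in> polynomial_functions C" "q \<in> polynomial_functions C"
   "p' \<in> polynomial_functions C" "q' \<in> polynomial_functions C"
 then show "\<exists>P\<in>polynomial_functions C. \<exists>Q\<in>polynomial_functions C. \<forall>y\<in>Y. (y \<in> U \<inter> V --> q y \<noteq> 0 --> q' y \<noteq> 0 -->
   f y = p y / q y --> g y = p' y / q' y --> Q y \<noteq> 0 \<and> f y + g y = P y / Q y)"
  by (intro bexI[of _ "\<lambda>y. p y * q' y + p' y * q y"] bexI[of _ "\<lambda>y. q y * q' y"])
   (auto intro!: polynomial_functions.mult polynomial_functions.add simp: field_simps)
qed

lemma fractional_power:
 assumes "fractional Y C U f" "U \<subseteq> Y"
 shows "fractional Y C U (\<lambda>x. f x ^ k)"
proof (induction k)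
 case 0
 show ?case using fractional_polynomial[OF fractional_open[OF assms(2,1)] polynomial_functions.const[of 1]] by simp
next
 case (Suc k)
 show ?case using fractional_mult[OF assms(1) Suc assms(2)] by simp
qed

lemma polynomial_functions_sum: "(\<And>i. i \<in> I ==> f i \<in> polynomial_functions C) ==> (\<lambda>x. \<Sum>i\<in>I. f i x) \<in> polynomial_functions C"
 by (induction I rule: infinite_finite_induct) (auto intro: polynomial_functions.intros)

lemma polynomial_functions_prod: "(\<And>i. i \<in> I ==> f i \<in> polynomial_functions C) ==> (\<lambda>x. \<Prod>i\<in>I. f i x) \<in> polynomial_functions C"
 by (induction I rule: infinite_finite_induct) (auto intro: polynomial_functions.intros)

lemma polynomial_functions_power: "f \<in> polynomial_functions C ==> (\<lambda>x. f x ^ k) \<in> polynomial_functions C"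
 by (induction k) (auto intro: polynomial_functions.intros)

lemma polynomial_functions_det:
 assumes "\<And>i j. i < k ==> j < k ==> (\<lambda>x. B x i j) \<in> polynomial_functions C"
 shows "(\<lambda>x. det (mat k k (\<lambda>(i, j). B x i j))) \<in> polynomial_functions C"
proof -
 have "(\<lambda>x. det (mat k k (\<lambda>(i, j). B x i j))) =
  (\<lambda>x. \<Sum>p | p permutes {0..<k}. signof p * (\<Prod>i = 0..<k. B x i (p i)))"
 proof
  fix x
  show "det (mat k k (\<lambda>(i, j). B x i j)) = (\<Sum>p | p permutes {0..<k}. signof p * (\<Prod>i = 0..<k. B x i (p i)))"
   by (subst det_def'[of _ k]) (auto intro!: sum.cong prod.cong dest: permutes_in_image)
 qed
 moreover have "p i < k" if "p permutes {0..<k}" "i < k" for p i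
  using permutes_in_image[OF that(1), of i] that(2) by simp
 ultimately show ?thesis
  using assms by (auto intro!: polynomial_functions_sum polynomial_functions_prod polynomial_functions.mult[OF polynomial_functions.const])
qed

lemma polynomial_functions_eval:
 assumes "\<And>v. (\<lambda>x. y x v) \<in> polynomial_functions C"
 shows "(\<lambda>x. eval (y x) P) \<in> polynomial_functions C"
 unfolding evaluate_def power_product_def
 by (rule polynomial_functions_sum, rule polynomial_functions.mult[OF polynomial_functions.const],
   rule polynomial_functions_prod, rule polynomial_functions_power, rule assms)

definition matrix_entries :: "nat => ('a::field mat => 'a) set" where
 "matrix_entries m = {\<lambda>A. A $$ (i, j) |i j. i < m \<and> j < m}"

definition regular_on :: "nat => 'a::field mat set => ('a mat => 'a) => bool" where
 "regular_on m = fractional (carrier (SL m)) (matrix_entries m)"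

definition SL_open :: "nat => 'a::field mat set => bool" where
 "SL_open m = openin (zariski_topology (carrier (SL m)) (matrix_entries m))"

lemma matrix_entry_polynomial: "i < m ==> j < m ==> (\<lambda>A. A $$ (i, j)) \<in> polynomial_functions (matrix_entries m)"
 by (intro polynomial_functions.coord) (auto simp: matrix_entries_def)

lemma SL_open_iff: "openin (zariski (SL_variety m)) U \<longleftrightarrow> SL_open m U"
 by (simp add: SL_variety_def affine_variety_def SL_open_def matrix_entries_def)

lemma regular_quotient_iff:
 "f \<in> regular (SL_quotient m H) U \<longleftrightarrow> regular_on m (coset_preimage m H U) (\<lambda>g. f (g <#\<^bsub>SL m\<^esub> H))"
proof -
 have "coset_preimage m H U \<subseteq> carrier (SL m)" by (auto simp: coset_preimage_def)
 from regular_affine_iff[OF this, of _ "matrix_entries m"] show ?thesis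
  by (simp add: SL_quotient_def regular_on_def SL_variety_def matrix_entries_def)
qed

lemma open_quotient_iff:
 "openin (zariski (SL_quotient m H)) U \<longleftrightarrow>
  U \<subseteq> (\<lambda>g. g <#\<^bsub>SL m\<^esub> H) ` carrier (SL m) \<and> SL_open m (coset_preimage m H U)"
 by (simp add: openin_SL_quotient SL_open_iff)

lemma topspace_quotient: "topspace (zariski (SL_quotient m H)) = (\<lambda>g. g <#\<^bsub>SL m\<^esub> H) ` carrier (SL m)"
proof -
 have "coset_preimage m H ((\<lambda>g. g <#\<^bsub>SL m\<^esub> H) ` carrier (SL m)) = carrier (SL m)"
  by (auto simp: coset_preimage_def)
 moreover have "SL_open m (carrier (SL m))"
  unfolding SL_open_def using openin_topspace[of "zariski_topology (carrier (SL m)) (matrix_entries m)"]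
  by (simp add: topspace_zariski)
 ultimately have "openin (zariski (SL_quotient m H)) ((\<lambda>g. g <#\<^bsub>SL m\<^esub> H) ` carrier (SL m))"
  by (simp add: open_quotient_iff)
 from openin_subset[OF this] show ?thesis
  using open_quotient_iff[of m H "topspace (zariski (SL_quotient m H))"] by blast
qed

section \<open>Elementary matrices\<close>

text \<open>Right multiplication by this matrix adds \<open>c\<close> times column \<open>a\<close> to column \<open>b\<close>.\<close>

definition add_column_matrix :: "nat => nat => nat => 'a::field => 'a mat" where
 "add_column_matrix m a b c = mat m m (\<lambda>(i, j). if i = j then 1 else if i = a \<and> j = b then c else 0)"

definition scale_columns_matrix :: "nat => (nat => 'a::field) => 'a mat" where
 "scale_columns_matrix m d = mat m m (\<lambda>(i, j). if i = j then d i else 0)"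

lemma elementary_carrier [simp]:
 "add_column_matrix m a b c \<in> carrier_mat m m" "scale_columns_matrix m d \<in> carrier_mat m m"
 by (simp_all add: add_column_matrix_def scale_columns_matrix_def)

lemma det_add_column_matrix:
 assumes "a \<noteq> b"
 shows "det (add_column_matrix m a b c) = 1"
proof (cases "a < b")
 case True
 then have "upper_triangular (add_column_matrix m a b c)"
  by (auto simp: upper_triangular_def add_column_matrix_def)
 then show ?thesis by (subst det_upper_triangular[of _ m]) (auto simp: prod_list_diag_prod add_column_matrix_def)
next
 case False
 then show ?thesis
  using assms by (subst det_lower_triangular[of m]) (auto simp: prod_list_diag_prod add_column_matrix_def)
qed

lemma det_scale_columns_matrix: "det (scale_columns_matrix m d) = (\<Prod>i<m. d i)"
proof -
 have "upper_triangular (scale_columns_matrix m d)"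
  by (auto simp: upper_triangular_def scale_columns_matrix_def)
 then show ?thesis
  by (subst det_upper_triangular[of _ m])
   (auto simp: prod_list_diag_prod scale_columns_matrix_def atLeast0LessThan intro!: prod.cong)
qed

lemma mult_add_column_matrix:
 assumes "A \<in> carrier_mat m m" "i < m" "j < m" "a < m" "a \<noteq> b"
 shows "(A * add_column_matrix m a b c) $$ (i, j) = A $$ (i, j) + (if j = b then c * A $$ (i, a) else 0)"
proof -
 have "(A * add_column_matrix m a b c) $$ (i, j) =
   (\<Sum>l<m. A $$ (i, l) * (if l = j then 1 else if l = a \<and> j = b then c else 0))"
  using assms by (auto simp: add_column_matrix_def scalar_prod_def atLeast0LessThan intro!: sum.cong)
 also have "\<dots> = (\<Sum>l<m. (if l = j then A $$ (i, j) else 0) + (if l = a then if j = b then c * A $$ (i, a) else 0 else 0))"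
  using assms by (intro sum.cong) auto
 also have "\<dots> = A $$ (i, j) + (if j = b then c * A $$ (i, a) else 0)"
  using assms by (simp add: sum.distrib)
 finally show ?thesis .
qed

lemma mult_scale_columns_matrix:
 assumes "A \<in> carrier_mat m m" "i < m" "j < m"
 shows "(A * scale_columns_matrix m d) $$ (i, j) = A $$ (i, j) * d j"
proof -
 have "(A * scale_columns_matrix m d) $$ (i, j) = (\<Sum>l<m. A $$ (i, l) * (if l = j then d l else 0))"
  using assms by (auto simp: scale_columns_matrix_def scalar_prod_def atLeast0LessThan intro!: sum.cong)
 also have "\<dots> = (\<Sum>l<m. if l = j then A $$ (i, j) * d j else 0)" by (intro sum.cong) auto
 also have "\<dots> = A $$ (i, j) * d j" using assms by simp
 finally show ?thesis .
qed

lemma SL_iff: "g \<in> carrier (SL m) \<longleftrightarrow> g \<in> carrier_mat m m \<and> det g = 1"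
 by (simp add: SL_def)

lemma SL_mult: "g \<in> carrier (SL m) ==> h \<in> carrier (SL m) ==> g * h \<in> carrier (SL m)"
 by (auto simp: SL_iff det_mult[of _ m])

lemma SL_inverse:
 assumes "g \<in> carrier (SL m)"
 obtains h where "h \<in> carrier (SL m)" "h * g = 1\<^sub>m m" "g * h = 1\<^sub>m m"
proof -
 have g: "g \<in> carrier_mat m m" "det g = 1" using assms by (auto simp: SL_iff)
 then have "g \<in> Units (ring_mat TYPE('a) m ())" by (intro det_non_zero_imp_unit) auto
 then obtain h where h: "h \<in> carrier_mat m m" "h * g = 1\<^sub>m m" "g * h = 1\<^sub>m m"
  by (auto simp: Units_def ring_mat_def)
 have "det (h * g) = 1" using h(2) by simp
 then have "det h = 1" using det_mult[OF h(1) g(1)] g(2) by simp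
 then show ?thesis using that h by (auto simp: SL_iff)
qed

text \<open>On the parabolic subgroup of block size \<open>k\<close> this minor is multiplicative.\<close>

definition character :: "nat => 'a::field mat => 'a" where
 "character k q = det (mat k k (\<lambda>(i, j). q $$ (i, j)))"

definition semi_invariant :: "nat => nat => (nat => nat) => ('a::field mat => 'a) => bool" where
 "semi_invariant n m a f \<longleftrightarrow> (\<forall>g\<in>carrier (SL m). \<forall>q\<in>flag_parabolic n m.
  f (g * q) = (\<Prod>k\<in>{1..n}. character k q ^ a k) * f g)"

lemma flag_parabolic_iff:
 assumes "0 < n"
 shows "q \<in> flag_parabolic n m \<longleftrightarrow> q \<in> carrier (SL m) \<and> (\<forall>i j. j < i --> i < m --> j < n --> q $$ (i, j) = 0)"
proof
 assume q: "q \<in> flag_parabolic n m"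
 then have "\<forall>k\<in>{1..n}. q \<in> parabolic m k" by (simp add: flag_parabolic_def)
 then have "q \<in> parabolic m (Suc j)" if "j < n" for j by (rule bspec) (use that in simp)
 then have "q \<in> carrier (SL m) \<and> (\<forall>i. Suc j \<le> i --> i < m --> q $$ (i, j) = 0)" if "j < n" for j
  using that unfolding parabolic_def by simp
 then show "q \<in> carrier (SL m) \<and> (\<forall>i j. j < i --> i < m --> j < n --> q $$ (i, j) = 0)"
  using assms by (simp add: Suc_le_eq)
next
 assume "q \<in> carrier (SL m) \<and> (\<forall>i j. j < i --> i < m --> j < n --> q $$ (i, j) = 0)"
 then show "q \<in> flag_parabolic n m" by (auto simp: flag_parabolic_def parabolic_def)
qed

section \<open>Semi-invariant functions are polynomials in the first columns\<close>

text \<open>The inverse of the numbering \<open>entry_var\<close>.\<close>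

definition entries :: "nat => nat => 'a::field mat => nat => 'a" where
 "entries m n g v = (if v < m * n then g $$ (m - 1 - v div n, n - 1 - v mod n) else 0)"

lemma entries_entry_var:
 assumes "i < m" "j < n"
 shows "entries m n g (entry_var m n i j) = g $$ (i, j)"
proof -
 have "(q * n + r) div n = q" "(q * n + r) mod n = r" if "r < n" for q r using that by auto
 from this[of "n - 1 - j" "m - 1 - i"] assms
 have "entry_var m n i j div n = m - 1 - i" "entry_var m n i j mod n = n - 1 - j"
  by (simp_all only: entry_var_def)
 moreover have "entry_var m n i j < m * n"
 proof -
  have "entry_var m n i j < (m - 1 - i) * n + n" using assms by (simp add: entry_var_def)
  also have "\<dots> = Suc (m - 1 - i) * n" by simp
  also have "\<dots> \<le> m * n" using assms by (intro mult_right_mono) auto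
  finally show ?thesis .
 qed
 ultimately show ?thesis using assms by (simp add: entries_def)
qed

lemma entries_polynomial:
 assumes "0 < n" "n \<le> m"
 shows "(\<lambda>g. entries m n g v) \<in> polynomial_functions (matrix_entries m)"
proof (cases "v < m * n")
 case True
 then have "m - 1 - v div n < m" "n - 1 - v mod n < m" using assms by auto
 from matrix_entry_polynomial[OF this] True show ?thesis by (simp add: entries_def)
qed (simp add: entries_def polynomial_functions.const)

text \<open>The \<open>n\<close> columns given by the variables are completed to a square matrix by the columns of \<open>g0\<close>; where its
 determinant is nonzero, rescaling the last column (which is not among the first \<open>n < m\<close>) yields an element
 of \<open>SL\<^sub>m\<close> with the prescribed columns.\<close>

definition completion_entry :: "nat => nat => 'a::field mat => nat => nat => 'a mpoly" where
 "completion_entry m n g0 i j = (if j < n then Var (entry_var m n i j) else Const (g0 $$ (i, j)))"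

definition completion_det :: "nat => nat => 'a::field mat => 'a mpoly" where
 "completion_det m n g0 = det (mat m m (\<lambda>(i, j). completion_entry m n g0 i j))"

definition completion :: "nat => nat => 'a::field mat => (nat => 'a) => 'a mat" where
 "completion m n g0 x = mat m m (\<lambda>(i, j). eval x (completion_entry m n g0 i j))"

definition normalised_completion :: "nat => nat => 'a::field mat => (nat => 'a) => 'a mat" where
 "normalised_completion m n g0 x = completion m n g0 x *
  scale_columns_matrix m (\<lambda>j. if j = m - 1 then 1 / eval x (completion_det m n g0) else 1)"

lemma eval_completion_det: "eval x (completion_det m n g0) = det (completion m n g0 x)"
 unfolding completion_det_def eval_det completion_def
 by (intro arg_cong[where f = det] eq_matI) auto

lemma completion_carrier [simp]: "completion m n g0 x \<in> carrier_mat m m"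
 by (simp add: completion_def)

lemma normalised_completion_entry:
 assumes "i < m" "j < m"
 shows "normalised_completion m n g0 x $$ (i, j) = eval x (completion_entry m n g0 i j) *
  (if j = m - 1 then 1 / eval x (completion_det m n g0) else 1)"
 unfolding normalised_completion_def using assms
 by (subst mult_scale_columns_matrix[OF completion_carrier]) (auto simp: completion_def)

lemma normalised_completion_columns:
 assumes "i < m" "j < n" "n < m"
 shows "normalised_completion m n g0 x $$ (i, j) = x (entry_var m n i j)"
 using assms by (subst normalised_completion_entry) (auto simp: completion_entry_def)

lemma normalised_completion_SL:
 assumes "n < m" "eval x (completion_det m n g0) \<noteq> 0"
 shows "normalised_completion m n g0 x \<in> carrier (SL m)"
proof -
 let ?D = "eval x (completion_det m n g0)"
 have "(\<Prod>i<m. if i = m - 1 then 1 / ?D else 1) = 1 / ?D"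
  using assms(1) by (subst prod.delta) auto
 then have "det (normalised_completion m n g0 x) = ?D * (1 / ?D)"
  unfolding normalised_completion_def
  by (simp add: det_mult[of _ m] det_scale_columns_matrix flip: eval_completion_det)
 moreover have "normalised_completion m n g0 x \<in> carrier_mat m m"
  by (simp add: normalised_completion_def mult_carrier_mat[of _ m m])
 ultimately show ?thesis using assms(2) by (simp add: SL_iff)
qed

lemma completion_self:
 assumes "g \<in> carrier_mat m m" "\<And>i j. i < m ==> j < n ==> g $$ (i, j) = x (entry_var m n i j)"
 shows "completion m n g x = g"
 using assms by (intro eq_matI) (auto simp: completion_def completion_entry_def)

lemma completion_det_nonzero:
 assumes "g \<in> carrier_mat m m" "det g \<noteq> 0"
 shows "completion_det m n g \<noteq> 0"
proof
 assume "completion_det m n g = 0"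
 then have "det (completion m n g (entries m n g)) = 0" by (simp flip: eval_completion_det)
 moreover have "completion m n g (entries m n g) = g"
  by (rule completion_self[OF assms(1)]) (simp add: entries_entry_var)
 ultimately show False using assms(2) by simp
qed

text \<open>A regular function of the normalised completion is a rational function of the \<open>n\<close> columns; the only denominators
 are powers of the determinant.\<close>

lemma polynomial_function_normalised_completion:
 assumes "n < m" "p \<in> polynomial_functions (matrix_entries m)"
 shows "\<exists>e P. \<forall>x. eval x (completion_det m n g0) \<noteq> 0 -->
  p (normalised_completion m n g0 x) * eval x (completion_det m n g0) ^ e = eval x P"
 using assms(2)
proof induction
 case (const c)
 show ?case by (intro exI[of _ 0] exI[of _ "Const c"]) simp
next
 case (coord f)
 then obtain i j where ij: "i < m" "j < m" "f = (\<lambda>A. A $$ (i, j))" by (auto simp: matrix_entries_def)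
 show ?case
  by (intro exI[of _ 1] exI[of _ "completion_entry m n g0 i j * (if j = m - 1 then 1 else completion_det m n g0)"])
   (simp add: ij normalised_completion_entry)
next
 case (add f g)
 then obtain e P e' P' where
  "\<forall>x. eval x (completion_det m n g0) \<noteq> 0 --> f (normalised_completion m n g0 x) * eval x (completion_det m n g0) ^ e = eval x P"
  "\<forall>x. eval x (completion_det m n g0) \<noteq> 0 --> g (normalised_completion m n g0 x) * eval x (completion_det m n g0) ^ e' = eval x P'"
  by (elim exE)
 then show ?case
  by (intro exI[of _ "e + e'"] exI[of _ "P * completion_det m n g0 ^ e' + P' * completion_det m n g0 ^ e"])
   (simp add: power_add algebra_simps flip: mult.assoc)
next
 case (mult f g)
 then obtain e P e' P' where
  1: "\<forall>x. eval x (completion_det m n g0) \<noteq> 0 --> f (normalised_completion m n g0 x) * eval x (completion_det m n g0) ^ e = eval x P"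
  and 2: "\<forall>x. eval x (completion_det m n g0) \<noteq> 0 --> g (normalised_completion m n g0 x) * eval x (completion_det m n g0) ^ e' = eval x P'"
  by (elim exE)
 show ?case
 proof (intro exI[of _ "e + e'"] exI[of _ "P * P'"] allI impI)
  fix x assume D: "eval x (completion_det m n g0) \<noteq> 0"
  let ?D = "eval x (completion_det m n g0)" and ?N = "normalised_completion m n g0 x"
  have "f ?N * g ?N * ?D ^ (e + e') = (f ?N * ?D ^ e) * (g ?N * ?D ^ e')" by (simp add: power_add mult_ac)
  also have "\<dots> = eval x (P * P')" using 1 2 D by simp
  finally show "f ?N * g ?N * ?D ^ (e + e') = eval x (P * P')" .
 qed
qed

definition completable :: "nat => nat => (nat => 'a::field) set" where
 "completable m n = {x. \<exists>g\<in>carrier (SL m). \<forall>i<m. \<forall>j<n. g $$ (i, j) = x (entry_var m n i j)}"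

lemma completable_if_det:
 assumes "n < m" "eval x (completion_det m n g0) \<noteq> 0"
 shows "x \<in> completable m n"
 using normalised_completion_SL[OF assms] normalised_completion_columns[OF _ _ assms(1)]
 unfolding completable_def by blast

text \<open>For the entry in row \<open>i0\<close> let one of the completing columns be the unit vector \<open>e\<^bsub>i0\<^esub>\<close>: changing the entry is then a
 column operation and keeps the determinant.  So every coordinate line through a generic point stays among the
 completable matrices.\<close>

lemma completion_det_independent:
 fixes v :: nat
 assumes "0 < n" "n < m"
 shows "\<exists>r :: 'a::field mpoly. r \<noteq> 0 \<and> independent_of v r \<and> (\<forall>x. eval x r \<noteq> 0 --> x \<in> completable m n)"
proof (cases "v \<in> entry_vars m n")
 case True
 then obtain i0 j0 where v: "v = entry_var m n i0 j0" "i0 < m" "j0 < n" by (auto simp: entry_vars_def)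
 let ?g = "swaprows_mat m n i0 :: 'a mat"
 have "?g = 1\<^sub>m m" if "n = i0" using that by (intro eq_matI) auto
 then have det: "det ?g \<noteq> 0" using det_swaprows_mat[OF assms(2) v(2), where 'a = 'a] by (cases "n = i0") auto
 have "eval (x(v := t)) (completion_det m n ?g) = eval x (completion_det m n ?g)" for x t
 proof -
  have "completion m n ?g (x(v := t)) = completion m n ?g x * add_column_matrix m n j0 (t - x v)"
  proof (rule eq_matI)
   fix i j assume "i < dim_row (completion m n ?g x * add_column_matrix m n j0 (t - x v))"
    "j < dim_col (completion m n ?g x * add_column_matrix m n j0 (t - x v))"
   then have ij: "i < m" "j < m" by (auto simp: completion_def add_column_matrix_def)
   show "completion m n ?g (x(v := t)) $$ (i, j) = (completion m n ?g x * add_column_matrix m n j0 (t - x v)) $$ (i, j)"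
    using v ij assms
    by (subst mult_add_column_matrix[OF completion_carrier ij assms(2)])
     (auto simp: completion_def completion_entry_def)
  qed (auto simp: completion_def add_column_matrix_def)
  moreover have "n \<noteq> j0" using v by simp
  ultimately show ?thesis
   by (simp add: eval_completion_det det_mult[of _ m] det_add_column_matrix)
 qed
 then have "independent_of v (completion_det m n ?g)" unfolding independent_of_def by blast
 then show ?thesis
  using completion_det_nonzero[OF _ det] completable_if_det[OF assms(2)] by (metis swaprows_mat_carrier)
next
 case False
 have "eval (x(v := t)) (completion_det m n (1\<^sub>m m)) = eval x (completion_det m n (1\<^sub>m m :: 'a mat))" for x t
  unfolding eval_completion_det using False
  by (intro arg_cong[where f = det] eq_matI) (auto simp: completion_def completion_entry_def entry_vars_def)
 then have "independent_of v (completion_det m n (1\<^sub>m m :: 'a mat))" unfolding independent_of_def by blast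
 then show ?thesis
  using completion_det_nonzero[of "1\<^sub>m m" m n] completable_if_det[OF assms(2)] by (metis det_one one_carrier_mat one_neq_zero)
qed

lemma character_mat: "k \<le> m ==> character k (mat m m f) = det (mat k k f)"
 unfolding character_def by (intro arg_cong[where f = det] eq_matI) auto

text \<open>Two elements of \<open>SL\<^sub>m\<close> with the same first \<open>n\<close> columns differ by an element of the parabolic subgroup with
 trivial characters.\<close>

lemma semi_invariant_same_columns:
 assumes nm: "0 < n" "n < m" and inv: "semi_invariant n m a f"
  and g: "g \<in> carrier (SL m)" "g' \<in> carrier (SL m)" "\<And>i j. i < m ==> j < n ==> g' $$ (i, j) = g $$ (i, j)"
 shows "f g' = f g"
proof -
 obtain h where h: "h \<in> carrier (SL m)" "h * g = 1\<^sub>m m" "g * h = 1\<^sub>m m" by (rule SL_inverse[OF g(1)]) (rule that)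
 have car: "g \<in> carrier_mat m m" "g' \<in> carrier_mat m m" "h \<in> carrier_mat m m" using g h by (auto simp: SL_iff)
 have q: "(h * g') $$ (i, j) = (if i = j then 1 else 0)" if "i < m" "j < n" for i j
 proof -
  have "(h * g') $$ (i, j) = (h * g) $$ (i, j)"
   using car that nm g(3) by (auto simp: scalar_prod_def intro!: sum.cong)
  then show ?thesis using that nm h(2) by simp
 qed
 have qP: "h * g' \<in> flag_parabolic n m"
  using SL_mult[OF h(1) g(2)] q nm by (auto simp: flag_parabolic_iff)
 have "character k (h * g') = 1" if "k \<in> {1..n}" for k
 proof -
  have "mat k k (\<lambda>(i, j). (h * g') $$ (i, j)) = 1\<^sub>m k"
   using q nm that by (intro eq_matI) auto
  then show ?thesis by (simp add: character_def)
 qed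
 then have "f (g * (h * g')) = f g"
  using inv g(1) qP unfolding semi_invariant_def by simp
 moreover have "g * (h * g') = g'"
  using car h(3) by (simp flip: assoc_mult_mat[of _ m m _ m _ m])
 ultimately show ?thesis by simp
qed

lemma semi_invariant_polynomial:
 fixes f :: "'a::{alg_closed_field, field_char_0} mat => 'a"
 assumes nm: "0 < n" "n < m" and reg: "regular_on m (carrier (SL m)) f" and inv: "semi_invariant n m a f"
 shows "\<exists>P. \<forall>g\<in>carrier (SL m). \<forall>x. (\<forall>i<m. \<forall>j<n. g $$ (i, j) = x (entry_var m n i j)) --> f g = eval x P"
proof -
 define F where "F x = f (SOME g. g \<in> carrier (SL m) \<and> (\<forall>i<m. \<forall>j<n. g $$ (i, j) = x (entry_var m n i j)))" for x
 have F: "F x = f g" if g: "g \<in> carrier (SL m)" "\<And>i j. i < m ==> j < n ==> g $$ (i, j) = x (entry_var m n i j)" for g x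
 proof -
  let ?g = "SOME g. g \<in> carrier (SL m) \<and> (\<forall>i<m. \<forall>j<n. g $$ (i, j) = x (entry_var m n i j))"
  have "?g \<in> carrier (SL m) \<and> (\<forall>i<m. \<forall>j<n. ?g $$ (i, j) = x (entry_var m n i j))"
   by (rule someI[of _ g]) (use g in simp)
  then show ?thesis unfolding F_def using g by (intro semi_invariant_same_columns[OF nm inv]) auto
 qed
 have "locally_rational (completable m n) F"
  unfolding locally_rational_def
 proof
  fix x :: "nat => 'a" assume "x \<in> completable m n"
  then obtain g where g: "g \<in> carrier (SL m)" "\<forall>i<m. \<forall>j<n. g $$ (i, j) = x (entry_var m n i j)"
   by (auto simp: completable_def)
  have gc: "g \<in> carrier_mat m m" "det g = 1" using g(1) by (auto simp: SL_iff)
  let ?D = "completion_det m n g" and ?N = "normalised_completion m n g"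
  have comp: "completion m n g x = g" by (rule completion_self[OF gc(1)]) (use g(2) in simp)
  then have D1: "eval x ?D = 1" by (simp add: eval_completion_det gc)
  have Nx: "?N x = g"
  proof (rule eq_matI)
   fix i j assume "i < dim_row g" "j < dim_col g"
   then have ij: "i < m" "j < m" using gc by auto
   have "eval x (completion_entry m n g i j) = completion m n g x $$ (i, j)" using ij by (simp add: completion_def)
   then show "?N x $$ (i, j) = g $$ (i, j)" using ij by (simp add: normalised_completion_entry D1 comp)
  qed (use gc in \<open>auto simp: normalised_completion_def completion_def scale_columns_matrix_def\<close>)
  obtain p q where p: "p \<in> polynomial_functions (matrix_entries m)" and q: "q \<in> polynomial_functions (matrix_entries m)" "q g \<noteq> 0"
   and pq: "\<And>y. y \<in> carrier (SL m) ==> q y \<noteq> 0 ==> y \<in> carrier (SL m) \<and> f y = p y / q y"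
   by (rule fractionalE[OF reg[unfolded regular_on_def] g(1)]) (rule that)
  obtain e P where "\<forall>x. eval x ?D \<noteq> 0 --> p (?N x) * eval x ?D ^ e = eval x P"
   using polynomial_function_normalised_completion[OF nm(2) p, of g] by (elim exE)
  then have P: "p (?N x) * eval x ?D ^ e = eval x P" if "eval x ?D \<noteq> 0" for x using that by simp
  obtain e' Q where "\<forall>x. eval x ?D \<noteq> 0 --> q (?N x) * eval x ?D ^ e' = eval x Q"
   using polynomial_function_normalised_completion[OF nm(2) q(1), of g] by (elim exE)
  then have Q: "q (?N x) * eval x ?D ^ e' = eval x Q" if "eval x ?D \<noteq> 0" for x using that by simp
  have "y \<in> completable m n \<and> F y * eval y (Q * ?D ^ Suc e) = eval y (P * ?D ^ Suc e')"
   if y: "eval y (Q * ?D ^ Suc e) \<noteq> 0" for y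
  proof -
   have D: "eval y ?D \<noteq> 0" and Qy: "eval y Q \<noteq> 0" using y by auto
   have qy: "q (?N y) \<noteq> 0" using Q[OF D] Qy by auto
   have "F y = f (?N y)"
    by (rule F[OF normalised_completion_SL[OF nm(2) D]]) (rule normalised_completion_columns[OF _ _ nm(2)])
   also have "\<dots> = p (?N y) / q (?N y)" using pq[OF normalised_completion_SL[OF nm(2) D] qy] by simp
   finally have "F y * q (?N y) = p (?N y)" using qy by simp
   then have "F y * eval y (Q * ?D ^ Suc e) = eval y (P * ?D ^ Suc e')"
    by (simp flip: P[OF D] Q[OF D])
   then show ?thesis using completable_if_det[OF nm(2) D] by simp
  qed
  moreover have "eval x (Q * ?D ^ Suc e) \<noteq> 0"
   using Q[of x] D1 q(2) Nx by simp
  ultimately show "\<exists>P Q. eval x Q \<noteq> 0 \<and> (\<forall>y. eval y Q \<noteq> 0 --> y \<in> completable m n \<and> F y * eval y Q = eval y P)"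
   by (intro exI[of _ "P * ?D ^ Suc e'"] exI[of _ "Q * ?D ^ Suc e"]) simp
 qed
 moreover have "completable m n \<noteq> ({} :: (nat => 'a) set)"
 proof -
  have "entries m n (1\<^sub>m m) \<in> completable m n" unfolding completable_def
   by (auto simp: entries_entry_var SL_iff intro!: bexI[of _ "1\<^sub>m m"])
  then show ?thesis by blast
 qed
 ultimately obtain P where P: "\<And>x. x \<in> completable m n ==> F x = eval x P"
  by (rule locally_rational_polynomial[OF _ _ completion_det_independent[OF nm]]) (rule that)
 show ?thesis
 proof (intro exI[of _ P] ballI allI impI)
  fix g :: "'a mat" and x assume g: "g \<in> carrier (SL m)" "\<forall>i<m. \<forall>j<n. g $$ (i, j) = x (entry_var m n i j)"
  then have "x \<in> completable m n" by (auto simp: completable_def)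
  then show "f g = eval x P" using F[OF g(1), of x] g(2) P by simp
 qed
qed

text \<open>Substituting polynomials for the variables of \<open>P\<close> gives a polynomial again, to which density applies.\<close>

lemma substitution_on_dense:
 fixes P :: "'a::field_char_0 mpoly"
 assumes "R \<noteq> 0" "\<And>x. eval x R \<noteq> 0 ==> eval (\<lambda>v. eval x (\<sigma> v)) P = c * eval x P"
 shows "eval (\<lambda>v. eval x (\<sigma> v)) P = c * eval x P"
proof -
 have ev: "eval x (evaluate Const \<sigma> P) = eval (\<lambda>v. eval x (\<sigma> v)) P" for x
  by (subst hom_evaluate[OF eval_hom]) simp
 have "evaluate Const \<sigma> P = Const c * P"
  by (rule eval_eq_on_dense[OF assms(1)]) (simp add: ev assms(2))
 then show ?thesis using ev[of x] by simp
qed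

text \<open>The semi-invariance is tested on the identity, which shows that other variables do not occur, on diagonal matrices,
 which give the column degrees, and on elementary matrices, which give the invariance.  The factor 2 on a column
 is compensated in the last column, so that the determinant stays 1.\<close>

theorem semi_invariant_flag_invariant:
 fixes f :: "'a::{alg_closed_field, field_char_0} mat => 'a"
 assumes nm: "0 < n" "n < m" and reg: "regular_on m (carrier (SL m)) f" and inv: "semi_invariant n m a f"
 shows "\<exists>P\<in>flag_invariants m n (\<lambda>j. \<Sum>k\<in>{Suc j..n}. a k). \<forall>g\<in>carrier (SL m). f g = eval (entries m n g) P"
proof -
 obtain P where P': "\<forall>g\<in>carrier (SL m). \<forall>x. (\<forall>i<m. \<forall>j<n. g $$ (i, j) = x (entry_var m n i j)) --> f g = eval x P"
  using semi_invariant_polynomial[OF nm reg inv] by (elim exE)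
 have P: "f g = eval x P"
  if "g \<in> carrier (SL m)" "\<And>i j. i < m ==> j < n ==> g $$ (i, j) = x (entry_var m n i j)" for g x
  using P' that by simp
 let ?R = "completion_det m n (1\<^sub>m m) :: 'a mpoly"
 have R: "?R \<noteq> 0" by (rule completion_det_nonzero) auto
 have translate: "eval (y x) P = (\<Prod>k\<in>{1..n}. character k q ^ a k) * eval x P"
  if q: "q \<in> flag_parabolic n m" and x: "eval x ?R \<noteq> 0"
   and y: "\<And>g i j. g \<in> carrier_mat m m ==> (\<And>i j. i < m ==> j < n ==> g $$ (i, j) = x (entry_var m n i j)) ==>
    i < m ==> j < n ==> (g * q) $$ (i, j) = y x (entry_var m n i j)" for q x y
 proof -
  let ?g = "normalised_completion m n (1\<^sub>m m) x"
  have g: "?g \<in> carrier (SL m)" by (rule normalised_completion_SL[OF nm(2) x])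
  have gx: "?g $$ (i, j) = x (entry_var m n i j)" if "i < m" "j < n" for i j
   by (rule normalised_completion_columns[OF that nm(2)])
  have qS: "q \<in> carrier (SL m)" using q nm by (simp add: flag_parabolic_iff)
  have "eval (y x) P = f (?g * q)"
   by (rule P[symmetric, OF SL_mult[OF g qS]]) (rule y, use g gx in \<open>auto simp: SL_iff\<close>)
  also have "\<dots> = (\<Prod>k\<in>{1..n}. character k q ^ a k) * f ?g" using inv g q by (simp add: semi_invariant_def)
  also have "f ?g = eval x P" by (rule P[OF g gx])
  finally show ?thesis .
 qed
 have trivial: "character k (1\<^sub>m m :: 'a mat) = 1" if "k \<le> n" for k
 proof -
  have "mat k k (\<lambda>(i, j). (1\<^sub>m m :: 'a mat) $$ (i, j)) = 1\<^sub>m k" using nm that by (intro eq_matI) auto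
  then show ?thesis by (simp add: character_def)
 qed
 have vars: "keys \<beta> \<subseteq> entry_vars m n" if \<beta>: "\<beta> \<in> keys P" for \<beta>
 proof
  fix v assume v: "v \<in> keys \<beta>"
  show "v \<in> entry_vars m n"
  proof (rule ccontr)
   assume nv: "v \<notin> entry_vars m n"
   have one: "(1\<^sub>m m :: 'a mat) \<in> flag_parabolic n m" using nm by (auto simp: flag_parabolic_iff SL_iff)
   have "eval (\<lambda>u. eval x (if u \<in> {v} then Const 2 * Var u else Var u)) P = 1 * eval x P" if "eval x ?R \<noteq> 0" for x
   proof -
    have "eval (\<lambda>u. eval x (if u \<in> {v} then Const 2 * Var u else Var u)) P = (\<Prod>k\<in>{1..n}. character k (1\<^sub>m m :: 'a mat) ^ a k) * eval x P"
     by (rule translate[OF one that, of "\<lambda>x u. eval x (if u \<in> {v} then Const 2 * Var u else Var u)"])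
      (use nv in \<open>auto simp: entry_vars_def\<close>)
    then show ?thesis using trivial by simp
   qed
   from substitution_on_dense[OF R this]
   have scale: "eval (\<lambda>u. eval x (if u \<in> {v} then Const 2 * Var u else Var u)) P = 1 * eval x P" for x .
   have eq: "(\<lambda>u. eval x (if u \<in> {v} then Const 2 * Var u else Var u)) = (\<lambda>u. if u \<in> {v} then 2 * x u else x u)"
    for x :: "nat => 'a" by auto
   have "(\<Sum>u\<in>{v}. lookup \<beta> u) = 0"
    by (rule degree_by_scaling[OF _ _ \<beta>]) (use scale in \<open>simp_all only: eq finite.intros power_0\<close>)
   then show False using v by (simp add: in_keys_iff)
  qed
 qed
 have degree: "column_degree m n \<beta> j = (\<Sum>k\<in>{Suc j..n}. a k)" if \<beta>: "\<beta> \<in> keys P" and j: "j < n" for \<beta> j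
 proof -
  let ?d = "\<lambda>l. if l = j then 2 else if l = m - 1 then 1 / 2 else (1::'a)"
  let ?q = "scale_columns_matrix m ?d"
  let ?W = "(\<lambda>i. entry_var m n i j) ` {..<m}"
  let ?\<sigma> = "\<lambda>u. if u \<in> ?W then Const 2 * Var u else Var u :: 'a mpoly"
  have "(\<Prod>l<m. ?d l) = (\<Prod>l<m. if l = j then 2 else 1) * (\<Prod>l<m. if l = m - 1 then 1 / 2 else 1)"
   unfolding prod.distrib[symmetric] using j nm by (intro prod.cong) auto
  also have "\<dots> = 1" using j nm by (subst (1 2) prod.delta) auto
  finally have "?q \<in> carrier (SL m)" by (simp add: SL_iff det_scale_columns_matrix)
  then have q: "?q \<in> flag_parabolic n m" using nm by (auto simp: flag_parabolic_iff scale_columns_matrix_def)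
  have ch: "character k ?q = (if j < k then 2 else 1)" if "k \<in> {1..n}" for k
  proof -
   have "character k ?q = det (scale_columns_matrix k ?d)"
    unfolding scale_columns_matrix_def using that nm by (intro character_mat) auto
   also have "\<dots> = (\<Prod>l<k. if l = j then 2 else 1)"
    unfolding det_scale_columns_matrix using that nm by (intro prod.cong) auto
   also have "\<dots> = (if j < k then 2 else 1)" by (subst prod.delta) auto
   finally show ?thesis .
  qed
  have "(\<Prod>k\<in>{1..n}. character k ?q ^ a k) = (\<Prod>k\<in>{1..n}. if k \<in> {Suc j..n} then 2 ^ a k else 1)"
   using ch by (intro prod.cong) auto
  also have "\<dots> = (\<Prod>k\<in>{1..n} \<inter> {Suc j..n}. 2 ^ a k)" by (rule prod.inter_restrict[symmetric]) simp
  also have "{1..n} \<inter> {Suc j..n} = {Suc j..n}" by auto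
  finally have chi: "(\<Prod>k\<in>{1..n}. character k ?q ^ a k) = 2 ^ (\<Sum>k\<in>{Suc j..n}. a k)" by (simp add: power_sum)
  have "eval (\<lambda>u. eval x (?\<sigma> u)) P = 2 ^ (\<Sum>k\<in>{Suc j..n}. a k) * eval x P" if "eval x ?R \<noteq> 0" for x
   unfolding chi[symmetric]
  proof (rule translate[OF q that, of "\<lambda>x u. eval x (?\<sigma> u)"])
   fix g i l assume g: "g \<in> carrier_mat m m" "\<And>i j. i < m ==> j < n ==> g $$ (i, j) = x (entry_var m n i j)" and il: "i < m" "l < n"
   have "entry_var m n i l \<in> ?W \<longleftrightarrow> l = j" using il j by auto
   moreover have "l \<noteq> m - 1" "l < m" using il nm by auto
   ultimately show "(g * ?q) $$ (i, l) = eval x (?\<sigma> (entry_var m n i l))"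
    using g il by (subst mult_scale_columns_matrix) (auto simp del: image_iff)
  qed
  from substitution_on_dense[OF R this]
  have scale: "eval (\<lambda>u. eval x (?\<sigma> u)) P = 2 ^ (\<Sum>k\<in>{Suc j..n}. a k) * eval x P" for x .
  have "(\<lambda>u. eval x (?\<sigma> u)) = (\<lambda>u. if u \<in> ?W then 2 * x u else x u)" for x :: "nat => 'a"
   by (simp add: fun_eq_iff del: image_iff)
  note eq = this
  have "(\<Sum>u\<in>?W. lookup \<beta> u) = (\<Sum>k\<in>{Suc j..n}. a k)"
   by (rule degree_by_scaling[OF _ _ \<beta>]) (use scale in \<open>simp_all only: eq finite_imageI finite_lessThan\<close>)
  moreover have "(\<Sum>u\<in>?W. lookup \<beta> u) = column_degree m n \<beta> j"
   unfolding column_degree_def using j by (subst sum.reindex) (auto simp: inj_on_def)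
  ultimately show ?thesis by simp
 qed
 have shear: "eval (shear_column m n j c x) P = eval x P" if j: "Suc j < n" for j x c
 proof -
  let ?q = "add_column_matrix m j (Suc j) c"
  let ?\<sigma> = "\<lambda>u. if \<exists>i<m. u = entry_var m n i (Suc j) then Var u + Const c * Var (Suc u) else Var u :: 'a mpoly"
  have q: "?q \<in> flag_parabolic n m"
   using nm by (auto simp: flag_parabolic_iff SL_iff det_add_column_matrix) (auto simp: add_column_matrix_def)
  have ch: "character k ?q = 1" if "k \<in> {1..n}" for k
  proof -
   have "character k ?q = det (add_column_matrix k j (Suc j) c)"
    unfolding add_column_matrix_def using that nm by (intro character_mat) auto
   then show ?thesis by (simp add: det_add_column_matrix)
  qed
  have "eval (\<lambda>u. eval x (?\<sigma> u)) P = (\<Prod>k\<in>{1..n}. character k ?q ^ a k) * eval x P" if "eval x ?R \<noteq> 0" for x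
  proof (rule translate[OF q that, of "\<lambda>x u. eval x (?\<sigma> u)"])
   fix g i l assume g: "g \<in> carrier_mat m m" "\<And>i j. i < m ==> j < n ==> g $$ (i, j) = x (entry_var m n i j)" and il: "i < m" "l < n"
   have "(\<exists>i'<m. entry_var m n i l = entry_var m n i' (Suc j)) \<longleftrightarrow> l = Suc j" using il j by auto
   moreover have "l < m" "j < m" "j \<noteq> Suc j" using il j nm by auto
   ultimately show "(g * ?q) $$ (i, l) = eval x (?\<sigma> (entry_var m n i l))"
    using g il j by (subst mult_add_column_matrix) (auto simp: entry_var_Suc)
  qed
  then have on_dense: "eval (\<lambda>u. eval x (?\<sigma> u)) P = 1 * eval x P" if "eval x ?R \<noteq> 0" for x using that ch by simp
  have "eval (\<lambda>u. eval x (?\<sigma> u)) P = 1 * eval x P" by (rule substitution_on_dense[OF R on_dense])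
  moreover have "(\<lambda>u. eval x (?\<sigma> u)) = shear_column m n j c x" by (auto simp add: fun_eq_iff shear_column_def)
  ultimately show ?thesis by simp
 qed
 have "P \<in> flag_invariants m n (\<lambda>j. \<Sum>k\<in>{Suc j..n}. a k)"
  unfolding flag_invariants_def using vars degree shear by blast
 moreover have "f g = eval (entries m n g) P" if "g \<in> carrier (SL m)" for g
  by (rule P[OF that]) (simp add: entries_entry_var)
 ultimately show ?thesis by blast
qed

text \<open>The number of columns of length \<open>k\<close>.\<close>

definition column_lengths :: "nat list list => nat => nat" where
 "column_lengths T k = (if k = 0 then 0 else shape T (k - 1) - shape T k)"

lemma shape_beyond: "T \<in> SSYT n m ==> n \<le> k ==> shape T k = 0"
 by (auto simp: shape_def tableau_row_def SSYT_def)

lemma column_lengths_multidegree: "T \<in> SSYT n m ==> column_lengths T \<in> multidegrees n"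
 using shape_beyond by (auto simp: column_lengths_def multidegrees_def)

lemma column_lengths_eqI:
 assumes T: "T \<in> SSYT n m" and a: "a \<in> multidegrees n" "\<And>j. j < n ==> shape T j = (\<Sum>k\<in>{Suc j..n}. a k)"
 shows "column_lengths T = a"
proof
 fix k
 show "column_lengths T k = a k"
 proof (cases "k \<in> {1..n}")
  case True
  then have "shape T (k - 1) = (\<Sum>l\<in>{k..n}. a l)" using a(2)[of "k - 1"] by auto
  also have "\<dots> = a k + (\<Sum>l\<in>{Suc k..n}. a l)" using True by (subst sum.atLeast_Suc_atMost) auto
  also have "(\<Sum>l\<in>{Suc k..n}. a l) = shape T k"
   using True a(2)[of k] shape_beyond[OF T, of k] by (cases "k < n") auto
  finally show ?thesis using True by (simp add: column_lengths_def)
 next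
  case False
  then show ?thesis using a(1) column_lengths_multidegree[OF T] by (simp add: multidegrees_def)
 qed
qed

lemma prod_columns:
 assumes T: "T \<in> SSYT n m"
 shows "(\<Prod>c<width T. \<chi> (length (tableau_column T c))) = (\<Prod>k\<in>{1..n}. \<chi> k ^ column_lengths T k)"
proof -
 have len: "a < length (tableau_column T c) \<longleftrightarrow> c < shape T a" for a c
  using length_tableau_column[OF T] by (auto simp: shape_def tableau_row_def)
 have range: "(\<lambda>c. length (tableau_column T c)) ` {..<width T} \<subseteq> {1..n}"
 proof
  fix k assume "k \<in> (\<lambda>c. length (tableau_column T c)) ` {..<width T}"
  then obtain c where c: "k = length (tableau_column T c)" "c < width T" by auto
  have "k \<le> n" using tableau_column_in_columns[OF T, of c] c(1) by (simp add: columns_def)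
  moreover have "0 < k" using len[of 0 c] c by (simp add: width_def shape_def)
  ultimately show "k \<in> {1..n}" by simp
 qed
 have "(\<Prod>c<width T. \<chi> (length (tableau_column T c))) =
   (\<Prod>k\<in>{1..n}. \<Prod>c | c \<in> {..<width T} \<and> length (tableau_column T c) = k. \<chi> (length (tableau_column T c)))"
  by (rule prod.group[symmetric, OF _ _ range]) auto
 also have "\<dots> = (\<Prod>k\<in>{1..n}. \<chi> k ^ column_lengths T k)"
 proof (rule prod.cong[OF refl])
  fix k assume k: "k \<in> {1..n}"
  have "{c. c \<in> {..<width T} \<and> length (tableau_column T c) = k} = {shape T k..<shape T (k - 1)}"
  proof (intro Set.set_eqI iffI)
   fix c assume "c \<in> {c. c \<in> {..<width T} \<and> length (tableau_column T c) = k}"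
   then show "c \<in> {shape T k..<shape T (k - 1)}" using len[of k c] len[of "k - 1" c] k by auto
  next
   fix c assume c: "c \<in> {shape T k..<shape T (k - 1)}"
   then have l: "length (tableau_column T c) = k" using len[of k c] len[of "k - 1" c] k by auto
   then have "c < shape T 0" using len[of 0 c] k by auto
   then show "c \<in> {c. c \<in> {..<width T} \<and> length (tableau_column T c) = k}" using l by (simp add: width_def shape_def)
  qed
  moreover have "(\<Prod>c | c \<in> {..<width T} \<and> length (tableau_column T c) = k. \<chi> (length (tableau_column T c))) =
    (\<Prod>c | c \<in> {..<width T} \<and> length (tableau_column T c) = k. \<chi> k)" by (rule prod.cong) auto
  ultimately show "(\<Prod>c | c \<in> {..<width T} \<and> length (tableau_column T c) = k. \<chi> (length (tableau_column T c))) =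
    \<chi> k ^ column_lengths T k" using k by (simp add: column_lengths_def)
 qed
 finally show ?thesis .
qed

lemma tableau_poly_semi_invariant:
 assumes nm: "0 < n" "n < m" and T: "T \<in> SSYT n m"
 shows "semi_invariant n m (column_lengths T) (\<lambda>g. eval (entries m n g) (tableau_poly m n T))"
 unfolding semi_invariant_def
proof (intro ballI)
 fix g q :: "'a mat" assume g: "g \<in> carrier (SL m)" and q: "q \<in> flag_parabolic n m"
 have qS: "q \<in> carrier_mat m m" and gS: "g \<in> carrier_mat m m" using q g nm by (auto simp: flag_parabolic_iff SL_iff)
 have minor: "eval (entries m n (g * q)) (minor m n l) = eval (entries m n g) (minor m n l) * character (length l) q"
  if l: "l \<in> columns n m" for l
  unfolding character_def
 proof (rule eval_minor_transform[OF l])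
  fix i b' assume ib: "i < m" "b' < length l"
  have len: "length l \<le> n" using l by (simp add: columns_def)
  have "(g * q) $$ (i, b') = (\<Sum>b<m. g $$ (i, b) * q $$ (b, b'))"
   using gS qS ib len nm by (simp add: scalar_prod_def atLeast0LessThan)
  also have "\<dots> = (\<Sum>b<length l. g $$ (i, b) * q $$ (b, b'))"
   using q ib len nm by (intro sum.mono_neutral_right) (auto simp: flag_parabolic_iff)
  finally show "entries m n (g * q) (entry_var m n i b') = (\<Sum>b<length l. entries m n g (entry_var m n i b) * q $$ (b, b'))"
   using ib len by (simp add: entries_entry_var)
 qed
 show "eval (entries m n (g * q)) (tableau_poly m n T) =
   (\<Prod>k\<in>{1..n}. character k q ^ column_lengths T k) * eval (entries m n g) (tableau_poly m n T)"
  unfolding tableau_poly_def eval_prod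
  by (simp add: minor tableau_column_in_columns[OF T] prod.distrib prod_columns[OF T, of "\<lambda>k. character k q"])
qed

theorem semi_invariant_spanned:
 fixes f :: "'a::{alg_closed_field, field_char_0} mat => 'a"
 assumes nm: "0 < n" "n < m" and reg: "regular_on m (carrier (SL m)) f" and inv: "semi_invariant n m a f"
  and a: "a \<in> multidegrees n"
 shows "\<exists>P\<in>mpoly.span (tableau_poly m n ` {T \<in> SSYT n m. column_lengths T = a}).
  \<forall>g\<in>carrier (SL m). f g = eval (entries m n g) P"
proof -
 obtain P where P: "P \<in> flag_invariants m n (\<lambda>j. \<Sum>k\<in>{Suc j..n}. a k)" "\<forall>g\<in>carrier (SL m). f g = eval (entries m n g) P"
  using semi_invariant_flag_invariant[OF nm reg inv] by (elim bexE)
 have "{T \<in> SSYT n m. \<forall>j<n. shape T j = (\<Sum>k\<in>{Suc j..n}. a k)} \<subseteq> {T \<in> SSYT n m. column_lengths T = a}"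
  using column_lengths_eqI[OF _ a] by blast
 then have "mpoly.span (tableau_poly m n ` {T \<in> SSYT n m. \<forall>j<n. shape T j = (\<Sum>k\<in>{Suc j..n}. a k)}) \<subseteq>
   mpoly.span (tableau_poly m n ` {T \<in> SSYT n m. column_lengths T = a})"
  by (intro mpoly.span_mono image_mono)
 then show ?thesis using flag_invariants_spanned[OF P(1)] P(2) by blast
qed

section \<open>Cosets of parabolic subgroups\<close>

lemma SL_simps [simp]: "x \<otimes>\<^bsub>SL m\<^esub> y = x * y" "\<one>\<^bsub>SL m\<^esub> = 1\<^sub>m m"
 by (simp_all add: SL_def)

lemma SL_group: "group (SL m :: 'a::field mat monoid)"
proof (rule groupI)
 fix x y z :: "'a mat" assume "x \<in> carrier (SL m)" "y \<in> carrier (SL m)" "z \<in> carrier (SL m)"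
 then show "x \<otimes>\<^bsub>SL m\<^esub> y \<otimes>\<^bsub>SL m\<^esub> z = x \<otimes>\<^bsub>SL m\<^esub> (y \<otimes>\<^bsub>SL m\<^esub> z)"
  using assoc_mult_mat[of x m m y m z m] by (simp add: SL_iff)
next
 fix x :: "'a mat" assume x: "x \<in> carrier (SL m)"
 then show "\<one>\<^bsub>SL m\<^esub> \<otimes>\<^bsub>SL m\<^esub> x = x" by (auto simp: SL_iff)
 obtain h where "h \<in> carrier (SL m)" "h * x = 1\<^sub>m m" by (rule SL_inverse[OF x]) (rule that)
 then show "\<exists>y\<in>carrier (SL m). y \<otimes>\<^bsub>SL m\<^esub> x = \<one>\<^bsub>SL m\<^esub>" by (intro bexI[of _ h]) auto
qed (simp_all add: SL_mult, simp add: SL_iff)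

lemma det_block_upper:
 fixes M :: "'a::field mat"
 assumes M: "M \<in> carrier_mat m m" and k: "k \<le> m" and z: "\<And>i j. k \<le> i ==> i < m ==> j < k ==> M $$ (i, j) = 0"
 shows "det M = character k M * det (mat (m - k) (m - k) (\<lambda>(i, j). M $$ (i + k, j + k)))"
proof -
 let ?A = "mat k k (\<lambda>(i, j). M $$ (i, j))" and ?B = "mat k (m - k) (\<lambda>(i, j). M $$ (i, j + k))"
  and ?D = "mat (m - k) (m - k) (\<lambda>(i, j). M $$ (i + k, j + k))"
 have "M = four_block_mat ?A ?B (0\<^sub>m (m - k) k) ?D"
  using assms by (intro eq_matI) auto
 then have "det M = det (four_block_mat ?A ?B (0\<^sub>m (m - k) k) ?D)" by (rule arg_cong)
 also have "\<dots> = det ?A * det ?D"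
  by (rule det_four_block_mat_lower_left_zero) auto
 finally show ?thesis by (simp add: character_def)
qed

lemma character_nonzero:
 assumes q: "q \<in> parabolic m k" and "k \<le> m"
 shows "character k q \<noteq> 0"
proof
 assume "character k q = 0"
 moreover have "det q = character k q * det (mat (m - k) (m - k) (\<lambda>(i, j). q $$ (i + k, j + k)))"
  using assms by (intro det_block_upper) (auto simp: parabolic_def SL_iff)
 ultimately show False using q by (simp add: parabolic_def SL_iff)
qed

text \<open>The rows of the lower left block of the inverse are annihilated by the invertible upper left block.\<close>

lemma parabolic_inverse:
 assumes q: "q \<in> parabolic m k" and k: "k \<le> m" and h: "h \<in> carrier (SL m)" "h * q = 1\<^sub>m m"
 shows "h \<in> parabolic m k"
proof -
 have "h $$ (i, j) = 0" if i: "k \<le> i" "i < m" and j: "j < k" for i j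
 proof (rule ccontr)
  assume nz: "h $$ (i, j) \<noteq> 0"
  let ?A = "mat k k (\<lambda>(a, b). q $$ (b, a))" and ?v = "vec k (\<lambda>b. h $$ (i, b))"
  have "?A = transpose_mat (mat k k (\<lambda>(a, b). q $$ (a, b)))" by (intro eq_matI) auto
  then have "det ?A = character k q" by (simp add: character_def det_transpose[of _ k])
  moreover have "det ?A = 0"
  proof (subst det_0_iff_vec_prod_zero_field[of _ k])
   have "?A *\<^sub>v ?v = 0\<^sub>v k"
   proof (rule eq_vecI)
    fix a assume "a < dim_vec (0\<^sub>v k)"
    then have a: "a < k" by simp
    have "(?A *\<^sub>v ?v) $ a = (\<Sum>b<k. q $$ (b, a) * h $$ (i, b))"
     using a by (simp add: scalar_prod_def atLeast0LessThan)
    also have "\<dots> = (\<Sum>b<m. h $$ (i, b) * q $$ (b, a))"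
     using q a k by (intro sum.mono_neutral_cong_left) (auto simp: parabolic_def mult.commute)
    also have "\<dots> = (h * q) $$ (i, a)"
     using q h(1) i a k by (auto simp: parabolic_def SL_iff scalar_prod_def atLeast0LessThan)
    also have "\<dots> = 0" using h(2) i a by simp
    finally show "(?A *\<^sub>v ?v) $ a = 0\<^sub>v k $ a" using a by simp
   qed simp
   moreover have "?v \<noteq> 0\<^sub>v k"
   proof
    assume "?v = 0\<^sub>v k"
    then have "?v $ j = 0\<^sub>v k $ j" by simp
    then show False using nz j by simp
   qed
   ultimately show "\<exists>v. v \<in> carrier_vec k \<and> v \<noteq> 0\<^sub>v k \<and> ?A *\<^sub>v v = 0\<^sub>v k"
    by (intro exI[of _ ?v]) simp
  qed simp
  ultimately show False using character_nonzero[OF q k] by simp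
 qed
 then show ?thesis using h by (simp add: parabolic_def)
qed

lemma parabolic_subgroup:
 assumes "k \<le> m"
 shows "subgroup (parabolic m k :: 'a::field mat set) (SL m)"
proof -
 interpret group "SL m :: 'a mat monoid" by (rule SL_group)
 show ?thesis
 proof (rule subgroupI)
  show "parabolic m k \<subseteq> carrier (SL m :: 'a mat monoid)" by (auto simp: parabolic_def)
  have "1\<^sub>m m \<in> (parabolic m k :: 'a mat set)" by (auto simp: parabolic_def SL_iff)
  then show "parabolic m k \<noteq> ({} :: 'a mat set)" by blast
  fix a :: "'a mat" assume a: "a \<in> parabolic m k"
  then have aS: "a \<in> carrier (SL m)" by (simp add: parabolic_def)
  show "inv\<^bsub>SL m\<^esub> a \<in> parabolic m k"
   by (rule parabolic_inverse[OF a assms]) (use aS l_inv[OF aS] in simp_all)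
  fix b :: "'a mat" assume b: "b \<in> parabolic m k"
  have "(a * b) $$ (i, j) = 0" if i: "k \<le> i" "i < m" and j: "j < k" for i j
  proof -
   have "(a * b) $$ (i, j) = (\<Sum>l<m. a $$ (i, l) * b $$ (l, j))"
    using a b i j assms by (auto simp: parabolic_def SL_iff scalar_prod_def atLeast0LessThan)
   also have "\<dots> = 0"
    using a b i j by (intro sum.neutral ballI) (auto simp: parabolic_def not_less, metis not_less)
   finally show ?thesis .
  qed
  then show "a \<otimes>\<^bsub>SL m\<^esub> b \<in> parabolic m k" using a b by (simp add: parabolic_def SL_mult)
 qed
qed

lemma flag_parabolic_subgroup:
 assumes "0 < n" "n \<le> m"
 shows "subgroup (flag_parabolic n m :: 'a::field mat set) (SL m)"
proof -
 interpret group "SL m :: 'a mat monoid" by (rule SL_group)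
 show ?thesis unfolding flag_parabolic_def
  by (rule subgroups_Inter) (use assms in \<open>auto intro: parabolic_subgroup\<close>)
qed

lemma coset_eq_iff:
 fixes g :: "'a::field mat"
 assumes H: "subgroup H (SL m)" and g: "g \<in> carrier (SL m)" "g' \<in> carrier (SL m)"
 shows "g <#\<^bsub>SL m\<^esub> H = g' <#\<^bsub>SL m\<^esub> H \<longleftrightarrow> (\<exists>q\<in>H. g' = g * q)"
proof -
 interpret group "SL m :: 'a mat monoid" by (rule SL_group)
 have mem: "g' \<in> g <#\<^bsub>SL m\<^esub> H \<longleftrightarrow> (\<exists>q\<in>H. g' = g * q)" by (auto simp: l_coset_def)
 have "g' \<in> g' <#\<^bsub>SL m\<^esub> H"
  unfolding l_coset_def
  by (rule UN_I[of "\<one>\<^bsub>SL m\<^esub>"]) (use subgroup.one_closed[OF H] r_one[OF g(2)] in simp_all)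
 then show ?thesis using mem l_repr_independence[OF _ g(1) H, of g'] by auto
qed

lemma coset_mult:
 assumes "subgroup H (SL m)" "g \<in> carrier (SL m)" "q \<in> H"
 shows "(g * q) <#\<^bsub>SL m\<^esub> H = g <#\<^bsub>SL m\<^esub> H" "g * q \<in> carrier (SL m)"
proof -
 show "g * q \<in> carrier (SL m)" using assms SL_mult subgroup.subset by blast
 from coset_eq_iff[OF assms(1,2) this] assms(3) show "(g * q) <#\<^bsub>SL m\<^esub> H = g <#\<^bsub>SL m\<^esub> H" by auto
qed

section \<open>The Pluecker bundle\<close>

text \<open>The first \<open>k\<close> columns of \<open>g\<close>, followed by unit vectors: up to sign the determinant is a \<open>k \<times> k\<close> minor of
 these columns.  The list of unit vectors is coded by a number, as the charts of the bundle are numbered.\<close>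

definition plucker_matrix :: "nat => nat => (nat => nat) => 'a::field mat => 'a mat" where
 "plucker_matrix m k l g = mat m m (\<lambda>(r, c). if c < k then g $$ (r, c) else if r = l c then 1 else 0)"

definition plucker :: "nat => nat => nat => 'a::field mat => 'a" where
 "plucker m k i g = det (plucker_matrix m k (\<lambda>c. list_decode i ! c) g)"

lemma plucker_polynomial: "plucker m k i \<in> polynomial_functions (matrix_entries m)"
proof -
 have "(\<lambda>g. plucker m k i g) \<in> polynomial_functions (matrix_entries m)"
  unfolding plucker_def plucker_matrix_def
 proof (rule polynomial_functions_det)
  fix r c assume rc: "r < m" "c < m"
  show "(\<lambda>g. if c < k then g $$ (r, c) else if r = list_decode i ! c then 1 else 0) \<in> polynomial_functions (matrix_entries m)"
   using matrix_entry_polynomial[OF rc] polynomial_functions.const by (cases "c < k") auto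
 qed
 then show ?thesis .
qed

lemma plucker_mult:
 assumes g: "g \<in> carrier_mat m m" and q: "q \<in> parabolic m k" and k: "k \<le> m"
 shows "plucker m k i (g * q) = character k q * plucker m k i g"
proof -
 let ?l = "\<lambda>c. list_decode i ! c"
 let ?B = "mat m m (\<lambda>(r, c). if c < k then q $$ (r, c) else if r = c then 1 else 0)"
 have qc: "q \<in> carrier_mat m m" using q by (simp add: parabolic_def SL_iff)
 have "plucker_matrix m k ?l (g * q) = plucker_matrix m k ?l g * ?B"
 proof (rule eq_matI)
  fix r c assume "r < dim_row (plucker_matrix m k ?l g * ?B)" "c < dim_col (plucker_matrix m k ?l g * ?B)"
  then have rc: "r < m" "c < m" by (auto simp: plucker_matrix_def)
  have R: "(plucker_matrix m k ?l g * ?B) $$ (r, c) = (\<Sum>b<m. plucker_matrix m k ?l g $$ (r, b) * ?B $$ (b, c))"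
   using rc by (simp add: plucker_matrix_def scalar_prod_def atLeast0LessThan)
  show "plucker_matrix m k ?l (g * q) $$ (r, c) = (plucker_matrix m k ?l g * ?B) $$ (r, c)"
  proof (cases "c < k")
   case True
   have "plucker_matrix m k ?l (g * q) $$ (r, c) = (\<Sum>b<m. g $$ (r, b) * q $$ (b, c))"
    using True rc g qc by (simp add: plucker_matrix_def scalar_prod_def atLeast0LessThan)
   also have "\<dots> = (\<Sum>b<m. plucker_matrix m k ?l g $$ (r, b) * ?B $$ (b, c))"
    using True rc q by (intro sum.cong) (auto simp: plucker_matrix_def parabolic_def)
   finally show ?thesis unfolding R .
  next
   case False
   have "(\<Sum>b<m. plucker_matrix m k ?l g $$ (r, b) * ?B $$ (b, c)) = (\<Sum>b<m. if b = c then plucker_matrix m k ?l g $$ (r, c) else 0)"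
    using False rc by (intro sum.cong) auto
   also have "\<dots> = plucker_matrix m k ?l g $$ (r, c)" using rc by simp
   finally show ?thesis unfolding R using False rc by (simp add: plucker_matrix_def)
  qed
 qed (simp_all add: plucker_matrix_def)
 then have "plucker m k i (g * q) = plucker m k i g * det ?B"
  unfolding plucker_def by (subst det_mult[of _ m, symmetric]) (simp_all add: plucker_matrix_def)
 moreover have "det ?B = character k ?B * det (mat (m - k) (m - k) (\<lambda>(i, j). ?B $$ (i + k, j + k)))"
  by (rule det_block_upper) (use k q in \<open>auto simp: parabolic_def\<close>)
 moreover have "mat (m - k) (m - k) (\<lambda>(i, j). ?B $$ (i + k, j + k)) = 1\<^sub>m (m - k)" by (intro eq_matI) auto
 moreover have "character k ?B = character k q"
  unfolding character_def using k by (intro arg_cong[where f = det] eq_matI) auto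
 ultimately show ?thesis by (simp add: mult.commute)
qed

text \<open>Starting with an invertible matrix, the last columns are replaced by unit vectors one after the other; expanding the
 determinant along the column shows that some unit vector keeps it nonzero.\<close>

lemma plucker_nonvanishing:
 assumes g: "g \<in> carrier (SL m)" and k: "k \<le> m"
 shows "\<exists>i. plucker m k i g \<noteq> 0"
proof -
 have "\<exists>l. det (plucker_matrix m k l g) \<noteq> 0"
  using k
 proof (induction k rule: inc_induct)
  case base
  have "plucker_matrix m m l g = g" for l using g by (intro eq_matI) (auto simp: plucker_matrix_def SL_iff)
  then show ?case using g by (simp add: SL_iff)
 next
  case (step s)
  then obtain l where l: "det (plucker_matrix m (Suc s) l g) \<noteq> 0" by (elim exE)
  let ?N = "plucker_matrix m (Suc s) l g"
  have car: "plucker_matrix m t l' g \<in> carrier_mat m m" for t l' by (simp add: plucker_matrix_def)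
  have "det ?N = (\<Sum>i<m. ?N $$ (i, s) * cofactor ?N i s)"
   by (rule laplace_expansion_column[OF car step(2)])
  then obtain i where i: "i < m" "cofactor ?N i s \<noteq> 0"
   using l by (metis (no_types, lifting) lessThan_iff mult_zero_right sum.neutral)
  let ?N' = "plucker_matrix m s (l(s := i)) g"
  have cof: "cofactor ?N' r s = cofactor ?N r s" if "r < m" for r
   unfolding cofactor_def mat_delete_def using that step(2)
   by (intro arg_cong2[where f = "(*)"] arg_cong[where f = det] eq_matI) (auto simp: plucker_matrix_def)
  have "det ?N' = (\<Sum>r<m. ?N' $$ (r, s) * cofactor ?N' r s)"
   by (rule laplace_expansion_column[OF car step(2)])
  also have "\<dots> = (\<Sum>r<m. if r = i then cofactor ?N i s else 0)"
   using step(2) by (intro sum.cong) (auto simp: cof, auto simp: plucker_matrix_def)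
  also have "\<dots> = cofactor ?N i s" using i by simp
  finally have eq: "det ?N' = cofactor ?N i s" .
  have "det ?N' \<noteq> 0" unfolding eq by (rule i(2))
  then show ?case by - (rule exI)
 qed
 then obtain l where l: "det (plucker_matrix m k l g) \<noteq> 0" by (elim exE)
 have "plucker_matrix m k (\<lambda>c. list_decode (list_encode (map l [0..<m])) ! c) g = plucker_matrix m k l g"
  by (intro eq_matI) (auto simp: plucker_matrix_def)
 then have "plucker m k (list_encode (map l [0..<m])) g \<noteq> 0" using l by (simp add: plucker_def)
 then show ?thesis by blast
qed

text \<open>The bundle \<open>O(1)\<close>: Pluecker coordinates have the same factor under translation by the parabolic subgroup, so
 their quotients are functions on the quotient.\<close>

definition plucker_bundle :: "nat => nat => (nat, 'a::field mat set, 'a) line_bundle" where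
 "plucker_bundle m k = \<lparr>
  chart = (\<lambda>i. (\<lambda>g. g <#\<^bsub>SL m\<^esub> parabolic m k) ` {g \<in> carrier (SL m). plucker m k i g \<noteq> 0}),
  transition = (\<lambda>i j C. let g = SOME g. g \<in> carrier (SL m) \<and> C = g <#\<^bsub>SL m\<^esub> parabolic m k
    in plucker m k j g / plucker m k i g)\<rparr>"

lemma plucker_bundle_chart:
 assumes g: "g \<in> carrier (SL m)" and k: "k \<le> m"
 shows "g <#\<^bsub>SL m\<^esub> parabolic m k \<in> chart (plucker_bundle m k) i \<longleftrightarrow> plucker m k i g \<noteq> 0"
proof
 assume "g <#\<^bsub>SL m\<^esub> parabolic m k \<in> chart (plucker_bundle m k) i"
 then obtain g' where g': "g <#\<^bsub>SL m\<^esub> parabolic m k = g' <#\<^bsub>SL m\<^esub> parabolic m k" "g' \<in> carrier (SL m)" "plucker m k i g' \<noteq> 0"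
  by (auto simp: plucker_bundle_def)
 then obtain q where q: "q \<in> parabolic m k" "g' = g * q"
  using coset_eq_iff[OF parabolic_subgroup[OF k] g g'(2)] by auto
 then show "plucker m k i g \<noteq> 0" using plucker_mult[OF _ q(1) k, of g i] g g'(3) by (auto simp: SL_iff)
qed (use g in \<open>auto simp: plucker_bundle_def\<close>)

lemma plucker_bundle_transition:
 assumes g: "g \<in> carrier (SL m)" and k: "k \<le> m"
 shows "transition (plucker_bundle m k) i j (g <#\<^bsub>SL m\<^esub> parabolic m k) = plucker m k j g / plucker m k i g"
proof -
 let ?C = "g <#\<^bsub>SL m\<^esub> parabolic m k"
 define g' where "g' = (SOME g'. g' \<in> carrier (SL m) \<and> ?C = g' <#\<^bsub>SL m\<^esub> parabolic m k)"
 have g': "g' \<in> carrier (SL m) \<and> ?C = g' <#\<^bsub>SL m\<^esub> parabolic m k"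
  unfolding g'_def by (rule someI[of _ g]) (use g in simp)
 then obtain q where q: "q \<in> parabolic m k" "g' = g * q"
  using coset_eq_iff[OF parabolic_subgroup[OF k] g, of g'] by auto
 have "transition (plucker_bundle m k) i j ?C = plucker m k j g' / plucker m k i g'"
  by (simp add: plucker_bundle_def g'_def Let_def)
 also have "\<dots> = (character k q * plucker m k j g) / (character k q * plucker m k i g)"
  using g by (simp add: q(2) plucker_mult[OF _ q(1) k] SL_iff)
 also have "\<dots> = plucker m k j g / plucker m k i g" using character_nonzero[OF q(1) k] by simp
 finally show ?thesis .
qed

lemma coset_preimage_Int: "coset_preimage m H (U \<inter> V) = coset_preimage m H U \<inter> coset_preimage m H V"
 by (auto simp: coset_preimage_def)

lemma coset_preimage_plucker_chart:
 "k \<le> m ==> coset_preimage m (parabolic m k) (chart (plucker_bundle m k) i) = {g \<in> carrier (SL m). plucker m k i g \<noteq> 0}"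
 using plucker_bundle_chart unfolding coset_preimage_def by blast

lemma plucker_open: "openin (zariski_topology (carrier (SL m)) (matrix_entries m)) {g \<in> carrier (SL m). plucker m k i g \<noteq> 0}"
 by (rule openin_basic[OF plucker_polynomial])

lemma plucker_bundle_is_line_bundle:
 assumes k: "k \<le> m"
 shows "is_line_bundle (SL_quotient m (parabolic m k)) (plucker_bundle m k :: (nat, 'a::field mat set, 'a) line_bundle)"
proof -
 let ?Y = "SL_quotient m (parabolic m k) :: ('a mat set, 'a) variety"
 let ?PB = "plucker_bundle m k :: (nat, 'a mat set, 'a) line_bundle"
 have sub: "chart ?PB i \<subseteq> (\<lambda>g. g <#\<^bsub>SL m\<^esub> parabolic m k) ` carrier (SL m)" for i
  by (auto simp: plucker_bundle_def)
 have "openin (zariski ?Y) (chart ?PB i)" for i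
  unfolding open_quotient_iff coset_preimage_plucker_chart[OF k] SL_open_def using sub plucker_open by blast
 moreover have "(\<Union>i. chart ?PB i) = topspace (zariski ?Y)"
  unfolding topspace_quotient
 proof
  show "(\<lambda>g. g <#\<^bsub>SL m\<^esub> parabolic m k) ` carrier (SL m) \<subseteq> (\<Union>i. chart ?PB i)"
   using plucker_nonvanishing[OF _ k] plucker_bundle_chart[OF _ k] by blast
 qed (use sub in blast)
 moreover have "transition ?PB i j \<in> regular ?Y (chart ?PB i \<inter> chart ?PB j)" for i j
 proof -
  let ?D = "\<lambda>i. {g \<in> carrier (SL m). plucker m k i g \<noteq> (0::'a)}"
  have "fractional (carrier (SL m)) (matrix_entries m) (?D j \<inter> ?D i) (\<lambda>g. plucker m k j g / plucker m k i g)"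
   by (rule fractional_divide[OF fractional_polynomial fractional_polynomial])
    (auto intro: plucker_open plucker_polynomial)
  then have "fractional (carrier (SL m)) (matrix_entries m) (?D j \<inter> ?D i) (\<lambda>g. transition ?PB i j (g <#\<^bsub>SL m\<^esub> parabolic m k))"
   by (rule fractional_cong[rotated]) (simp add: plucker_bundle_transition[OF _ k])
  then show ?thesis
   by (simp add: regular_quotient_iff coset_preimage_Int coset_preimage_plucker_chart[OF k] regular_on_def Int_commute)
 qed
 moreover have "transition ?PB i j x \<noteq> 0" if x: "x \<in> chart ?PB i \<inter> chart ?PB j" for i j x
 proof -
  have "x \<in> (\<lambda>g. g <#\<^bsub>SL m\<^esub> parabolic m k) ` carrier (SL m)" using sub[of i] x by blast
  then obtain g where "x = g <#\<^bsub>SL m\<^esub> parabolic m k" "g \<in> carrier (SL m)" by (rule imageE)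
  then show ?thesis using x by (simp add: plucker_bundle_transition[OF _ k] plucker_bundle_chart[OF _ k])
 qed
 moreover have "transition ?PB i j x * transition ?PB j l x = transition ?PB i l x"
  if x: "x \<in> chart ?PB i \<inter> chart ?PB j \<inter> chart ?PB l" for i j l x
 proof -
  have "x \<in> (\<lambda>g. g <#\<^bsub>SL m\<^esub> parabolic m k) ` carrier (SL m)" using sub[of i] x by blast
  then obtain g where "x = g <#\<^bsub>SL m\<^esub> parabolic m k" "g \<in> carrier (SL m)" by (rule imageE)
  then show ?thesis using x by (simp add: plucker_bundle_transition[OF _ k] plucker_bundle_chart[OF _ k])
 qed
 ultimately show ?thesis unfolding is_line_bundle_def by blast
qed

section \<open>Frames of line bundles pulled back to the special linear group\<close>

abbreviation chart_preimage :: "nat => nat => ('i, 'a::field mat set, 'a) line_bundle => 'i => 'a mat set" where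
 "chart_preimage m k L a \<equiv> coset_preimage m (parabolic m k) (chart L a)"

text \<open>The pullback to \<open>SL\<^sub>m\<close> of \<open>L\<^bsup>d\<^esup>\<close> is trivialised by \<open>\<theta>\<close>, and the parabolic subgroup acts on this
 trivialisation by the character of \<open>O(1)\<close>: a frame is an isomorphism of \<open>O(1)\<close> with \<open>L\<^bsup>d\<^esup>\<close>.\<close>

definition frame :: "nat => nat => (nat, 'a::field mat set, 'a) line_bundle => int => (nat => 'a mat => 'a) => bool" where
 "frame m k L d \<theta> \<longleftrightarrow>
  (\<forall>a. regular_on m (chart_preimage m k L a) (\<theta> a)) \<and>
  (\<forall>a. \<forall>g\<in>chart_preimage m k L a. \<theta> a g \<noteq> 0) \<and>
  (\<forall>a. \<forall>g\<in>chart_preimage m k L a. \<forall>q\<in>parabolic m k. \<theta> a (g * q) = character k q * \<theta> a g) \<and>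
  (\<forall>a b. \<forall>g\<in>chart_preimage m k L a \<inter> chart_preimage m k L b.
    \<theta> b g = transition L a b (g <#\<^bsub>SL m\<^esub> parabolic m k) powi d * \<theta> a g)"

lemma transition_self:
 assumes "is_line_bundle Y L" "x \<in> chart L a"
 shows "transition L a a x = 1"
proof -
 have "transition L a a x * transition L a a x = transition L a a x" "transition L a a x \<noteq> 0"
  using assms unfolding is_line_bundle_def by blast+
 then show ?thesis by simp
qed

lemma chart_preimage_cover:
 assumes "is_line_bundle (SL_quotient m (parabolic m k)) L" "g \<in> carrier (SL m)"
 shows "\<exists>a. g \<in> chart_preimage m k L a"
proof -
 have "g <#\<^bsub>SL m\<^esub> parabolic m k \<in> topspace (zariski (SL_quotient m (parabolic m k)))"
  using assms(2) unfolding topspace_quotient by (rule imageI)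
 then have "g <#\<^bsub>SL m\<^esub> parabolic m k \<in> (\<Union>a. chart L a)"
  using assms(1) unfolding is_line_bundle_def by simp
 then show ?thesis using assms(2) by (auto simp: coset_preimage_def)
qed

text \<open>An isomorphism \<open>h\<close> from \<open>O(1)\<close> to \<open>L\<^bsup>d\<^esup>\<close> turns the tautological frame of \<open>O(1)\<close>, the Pluecker coordinates,
 into a frame for \<open>L\<close>.\<close>

lemma exists_frame:
 assumes k: "k \<le> m" and L: "is_line_bundle (SL_quotient m (parabolic m k)) L"
  and gen: "generates_Pic (SL_quotient m (parabolic m k)) L"
 shows "\<exists>d \<theta>. frame m k L d \<theta>"
proof -
 let ?H = "parabolic m k :: 'a mat set"
 let ?Y = "SL_quotient m ?H" and ?PB = "plucker_bundle m k :: (nat, 'a mat set, 'a) line_bundle"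
 obtain d where "isomorphic_bundles ?Y ?PB (bundle_power L d)"
  using gen plucker_bundle_is_line_bundle[OF k] unfolding generates_Pic_def by blast
 then obtain h where hall: "(\<forall>i a. h i a \<in> regular ?Y (chart ?PB i \<inter> chart (bundle_power L d) a)) \<and>
     (\<forall>i a. \<forall>x\<in>chart ?PB i \<inter> chart (bundle_power L d) a. h i a x \<noteq> 0) \<and>
     (\<forall>i j a b. \<forall>x\<in>chart ?PB i \<inter> chart ?PB j \<inter> chart (bundle_power L d) a \<inter> chart (bundle_power L d) b.
      h i a x * transition (bundle_power L d) a b x = transition ?PB i j x * h j b x)"
  unfolding isomorphic_bundles_def by (elim exE)
 have h1: "h i a \<in> regular ?Y (chart ?PB i \<inter> chart L a)" for i a using hall by (simp add: bundle_power_def)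
 have h2: "h i a x \<noteq> 0" if "x \<in> chart ?PB i" "x \<in> chart L a" for i a x using hall that by (simp add: bundle_power_def)
 have h3: "h i a x * transition L a b x powi d = transition ?PB i j x * h j b x"
  if "x \<in> chart ?PB i" "x \<in> chart ?PB j" "x \<in> chart L a" "x \<in> chart L b" for i j a b x
 proof -
  have "\<forall>x\<in>chart ?PB i \<inter> chart ?PB j \<inter> chart (bundle_power L d) a \<inter> chart (bundle_power L d) b.
    h i a x * transition (bundle_power L d) a b x = transition ?PB i j x * h j b x"
   using hall by (elim conjE allE)
  then show ?thesis using that by (auto simp: bundle_power_def)
 qed
 let ?U = "chart_preimage m k L" and ?D = "\<lambda>i. {g \<in> carrier (SL m). plucker m k i g \<noteq> (0::'a)}"
 define idx where "idx g = (SOME i. plucker m k i g \<noteq> (0::'a))" for g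
 have idx: "plucker m k (idx g) g \<noteq> 0" if "g \<in> carrier (SL m)" for g
  unfolding idx_def using plucker_nonvanishing[OF that k] by (rule someI_ex)
 define \<theta> where "\<theta> a g = plucker m k (idx g) g * h (idx g) a (g <#\<^bsub>SL m\<^esub> ?H)" for a g
 have U: "g \<in> carrier (SL m)" "g <#\<^bsub>SL m\<^esub> ?H \<in> chart L a" if "g \<in> ?U a" for g a
  using that by (auto simp: coset_preimage_def)
 have \<theta>: "\<theta> a g = plucker m k i g * h i a (g <#\<^bsub>SL m\<^esub> ?H)" if g: "g \<in> ?U a" and i: "plucker m k i g \<noteq> 0" for a g i
 proof -
  let ?x = "g <#\<^bsub>SL m\<^esub> ?H" and ?j = "idx g"
  have "h i a ?x * transition L a a ?x powi d = transition ?PB i ?j ?x * h ?j a ?x"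
   using U[OF g] i idx plucker_bundle_chart[OF _ k] by (intro h3) blast+
  then have "h i a ?x = plucker m k ?j g / plucker m k i g * h ?j a ?x"
   using transition_self[OF L U(2)[OF g]] plucker_bundle_transition[OF U(1)[OF g] k] by simp
  then show ?thesis using i by (simp add: \<theta>_def)
 qed
 have "regular_on m (?U a) (\<theta> a)" for a
  unfolding regular_on_def
 proof (rule fractional_local)
  fix x assume x: "x \<in> ?U a"
  let ?i = "idx x"
  have hr: "fractional (carrier (SL m)) (matrix_entries m) (?D ?i \<inter> ?U a) (\<lambda>g. h ?i a (g <#\<^bsub>SL m\<^esub> ?H))"
   using h1[of ?i a] by (simp add: regular_quotient_iff coset_preimage_Int coset_preimage_plucker_chart[OF k] regular_on_def)
  have "fractional (carrier (SL m)) (matrix_entries m) (?D ?i \<inter> (?D ?i \<inter> ?U a)) (\<lambda>g. plucker m k ?i g * h ?i a (g <#\<^bsub>SL m\<^esub> ?H))"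
   by (rule fractional_mult[OF fractional_polynomial[OF plucker_open plucker_polynomial] hr]) auto
  then have "fractional (carrier (SL m)) (matrix_entries m) (?D ?i \<inter> (?D ?i \<inter> ?U a)) (\<theta> a)"
   by (rule fractional_cong[rotated]) (auto intro!: \<theta>[symmetric])
  then show "\<exists>V. x \<in> V \<and> V \<subseteq> ?U a \<and> fractional (carrier (SL m)) (matrix_entries m) V (\<theta> a)"
   using x U[OF x] idx by (intro exI[of _ "?D ?i \<inter> (?D ?i \<inter> ?U a)"]) auto
 qed
 moreover have "\<theta> a g \<noteq> 0" if g: "g \<in> ?U a" for a g
  using idx[OF U(1)[OF g]] h2[OF _ U(2)[OF g], of "idx g"] plucker_bundle_chart[OF U(1)[OF g] k]
  by (simp add: \<theta>_def)
 moreover have "\<theta> a (g * q) = character k q * \<theta> a g" if g: "g \<in> ?U a" and q: "q \<in> ?H" for a g q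
 proof -
  note c = coset_mult[OF parabolic_subgroup[OF k] U(1)[OF g] q]
  have gq: "g * q \<in> ?U a" using c U(2)[OF g] by (simp add: coset_preimage_def)
  have pm: "plucker m k (idx g) (g * q) = character k q * plucker m k (idx g) g"
   using U(1)[OF g] by (intro plucker_mult[OF _ q k]) (simp add: SL_iff)
  then have "plucker m k (idx g) (g * q) \<noteq> 0" using idx[OF U(1)[OF g]] character_nonzero[OF q k] by simp
  from \<theta>[OF gq this] \<theta>[OF g idx[OF U(1)[OF g]]] show ?thesis by (simp add: pm c(1))
 qed
 moreover have "\<theta> b g = transition L a b (g <#\<^bsub>SL m\<^esub> ?H) powi d * \<theta> a g" if g: "g \<in> ?U a" "g \<in> ?U b" for a b g
 proof -
  let ?x = "g <#\<^bsub>SL m\<^esub> ?H" and ?i = "idx g"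
  have nz: "plucker m k ?i g \<noteq> 0" by (rule idx[OF U(1)[OF g(1)]])
  have "?x \<in> chart ?PB ?i" using nz plucker_bundle_chart[OF U(1)[OF g(1)] k] by blast
  then have "h ?i a ?x * transition L a b ?x powi d = transition ?PB ?i ?i ?x * h ?i b ?x"
   using U(2)[OF g(1)] U(2)[OF g(2)] by (intro h3)
  then have "h ?i a ?x * transition L a b ?x powi d = h ?i b ?x"
   using plucker_bundle_transition[OF U(1)[OF g(1)] k] nz by simp
  then show ?thesis unfolding \<theta>_def by (metis mult.assoc mult.commute)
 qed
 ultimately have "frame m k L d \<theta>" unfolding frame_def by blast
 then show ?thesis by blast
qed

section \<open>Curves in the special linear group\<close>

definition polynomial_curve :: "nat => ('a::field => 'a mat) => bool" where
 "polynomial_curve m c \<longleftrightarrow> (\<forall>t. c t \<in> carrier (SL m)) \<and> (\<forall>i<m. \<forall>j<m. \<exists>p. \<forall>t. c t $$ (i, j) = poly p t)"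

lemma polynomial_functions_curve:
 assumes c: "polynomial_curve m c" and p: "p \<in> polynomial_functions (matrix_entries m)"
 shows "\<exists>P. \<forall>t. p (c t) = poly P t"
 using p
proof induction
 case (const b)
 show ?case by (intro exI[of _ "[:b:]"]) simp
next
 case (coord f)
 then show ?case using c by (auto simp: matrix_entries_def polynomial_curve_def)
next
 case (add f g)
 then obtain P Q where "\<forall>t. f (c t) = poly P t" "\<forall>t. g (c t) = poly Q t" by (elim exE)
 then show ?case by (intro exI[of _ "P + Q"]) simp
next
 case (mult f g)
 then obtain P Q where "\<forall>t. f (c t) = poly P t" "\<forall>t. g (c t) = poly Q t" by (elim exE)
 then show ?case by (intro exI[of _ "P * Q"]) simp
qed

lemma regular_on_curve:
 assumes c: "polynomial_curve m c" and f: "regular_on m U f"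
 shows "locally_rational1 {t. c t \<in> U} (\<lambda>t. f (c t))"
 unfolding locally_rational1_def
proof
 fix t assume "t \<in> {t. c t \<in> U}"
 then have t: "c t \<in> U" by simp
 obtain p q where pq: "p \<in> polynomial_functions (matrix_entries m)" "q \<in> polynomial_functions (matrix_entries m)" "q (c t) \<noteq> 0"
  and val: "\<And>y. y \<in> carrier (SL m) ==> q y \<noteq> 0 ==> y \<in> U \<and> f y = p y / q y"
  by (rule fractionalE[OF f[unfolded regular_on_def] t]) (rule that)
 obtain P where P: "\<forall>t. p (c t) = poly P t" using polynomial_functions_curve[OF c pq(1)] by (elim exE)
 obtain Q where Q: "\<forall>t. q (c t) = poly Q t" using polynomial_functions_curve[OF c pq(2)] by (elim exE)
 have "c y \<in> U \<and> f (c y) * poly Q y = poly P y" if "poly Q y \<noteq> 0" for y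
  using val[of "c y"] that P Q c by (auto simp: polynomial_curve_def)
 then show "\<exists>p q. poly q t \<noteq> 0 \<and> (\<forall>y. poly q y \<noteq> 0 --> y \<in> {t. c t \<in> U} \<and> f (c y) * poly q y = poly p y)"
  using pq(3) Q by (intro exI[of _ P] exI[of _ Q]) auto
qed

lemma locally_rational1_open:
 assumes "locally_rational1 V f" "V \<noteq> {}"
 shows "\<exists>r. r \<noteq> 0 \<and> (\<forall>t. poly r t \<noteq> 0 --> t \<in> V)"
proof -
 obtain x where "x \<in> V" using assms(2) by blast
 then obtain p q where "poly q x \<noteq> 0" "\<forall>y. poly q y \<noteq> 0 --> y \<in> V \<and> f y * poly q y = poly p y"
  using assms(1) unfolding locally_rational1_def by (auto dest!: bspec)
 then show ?thesis by (intro exI[of _ q]) auto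
qed

lemma poly_nonroot: "r \<noteq> 0 ==> \<exists>t. poly r t \<noteq> (0::'a::field_char_0)"
 using poly_all_0_iff_0 by blast

lemma degree_sum_order:
 fixes p :: "'a::alg_closed_field poly"
 assumes "p \<noteq> 0" "finite S" "{t. poly p t = 0} \<subseteq> S"
 shows "degree p = (\<Sum>t\<in>S. order t p)"
 using assms(1,3)
proof (induction "degree p" arbitrary: p)
 case 0
 then obtain c where "p = [:c:]" "c \<noteq> 0" by (metis degree_eq_zeroE pCons_0_0)
 then show ?case using 0 by (simp add: order_0I)
next
 case (Suc d)
 then obtain r where r: "poly p r = 0" using alg_closed_imp_poly_has_root[of p] by auto
 then obtain p' where p': "p = [:- r, 1:] * p'" by (auto simp: poly_eq_0_iff_dvd elim: dvdE)
 then have nz: "p' \<noteq> 0" using Suc by auto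
 have lnz: "[:- r, 1:] \<noteq> 0" by simp
 have "degree p = degree [:- r, 1:] + degree p'" unfolding p' by (rule degree_mult_eq[OF lnz nz])
 then have "degree p = Suc (degree p')" by simp
 then have "degree p' = (\<Sum>t\<in>S. order t p')"
  using Suc by (intro Suc(1)) (auto simp: nz p')
 moreover have "order t p = (if t = r then 1 else 0) + order t p'" for t
 proof -
  have "order t [:- r, 1:] = (if t = r then 1 else 0)"
   using order_power_n_n[of r 1] by (auto simp: order_0I)
  then show ?thesis unfolding p' using order_mult[OF no_zero_divisors[OF lnz nz], of t] by simp
 qed
 moreover have "r \<in> S" using r Suc by auto
 ultimately show ?case using \<open>degree p = Suc (degree p')\<close> assms(2) by (simp add: sum.distrib)
qed

lemma order_power_eq: "p \<noteq> 0 ==> order t (p ^ D) = D * order t (p :: 'a::field poly)"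
 by (induction D) (auto simp: order_mult order_0I)

text \<open>Near \<open>t0\<close> some \<open>\<theta> b\<close> is regular without zeros, and it differs from \<open>\<theta> a\<close> by the \<open>d\<close>-th power of a transition
 function.\<close>

lemma frame_orders:
 fixes L :: "(nat, 'a::field_char_0 mat set, 'a) line_bundle"
 assumes L: "is_line_bundle (SL_quotient m (parabolic m k)) L" and fr: "frame m k L d \<theta>" and c: "polynomial_curve m c"
  and a: "\<exists>t. c t \<in> chart_preimage m k L a" and nz: "p \<noteq> 0" "q \<noteq> 0"
  and pq: "\<And>t. c t \<in> chart_preimage m k L a ==> \<theta> a (c t) * poly q t = poly p t"
 shows "d dvd int (order t0 p) - int (order t0 q)"
proof -
 let ?U = "chart_preimage m k L" and ?H = "parabolic m k :: 'a mat set"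
 have reg: "regular_on m (?U a) (\<theta> a)" for a using fr unfolding frame_def by blast
 have \<theta>nz: "\<theta> a g \<noteq> 0" if "g \<in> ?U a" for a g using fr that unfolding frame_def by blast
 have tr: "\<theta> b g = transition L a b (g <#\<^bsub>SL m\<^esub> ?H) powi d * \<theta> a g" if "g \<in> ?U a" "g \<in> ?U b" for a b g
  using fr that unfolding frame_def by blast
 have "c t0 \<in> carrier (SL m)" using c by (simp add: polynomial_curve_def)
 from chart_preimage_cover[OF L this] obtain b where b: "c t0 \<in> ?U b" by (elim exE)
 have lb: "locally_rational1 {t. c t \<in> ?U b} (\<lambda>t. \<theta> b (c t))" by (rule regular_on_curve[OF c reg])
 have la: "locally_rational1 {t. c t \<in> ?U a} (\<lambda>t. \<theta> a (c t))" by (rule regular_on_curve[OF c reg])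
 have bne: "{t. c t \<in> ?U b} \<noteq> {}" using b by auto
 obtain p1 q1 where 1: "q1 \<noteq> 0" "\<And>t. t \<in> {t. c t \<in> ?U b} ==> poly q1 t \<noteq> 0"
  "\<And>t. t \<in> {t. c t \<in> ?U b} ==> \<theta> b (c t) * poly q1 t = poly p1 t"
  by (rule locally_rational1_quotient[OF lb bne]) (rule that)
 obtain ra where ra: "ra \<noteq> 0" "\<And>t. poly ra t \<noteq> 0 ==> c t \<in> ?U a"
  using locally_rational1_open[OF la] a by auto
 obtain rb where rb: "rb \<noteq> 0" "\<And>t. poly rb t \<noteq> 0 ==> c t \<in> ?U b"
  using locally_rational1_open[OF lb bne] by auto
 obtain t1 where t1: "poly (ra * rb) t1 \<noteq> 0" using poly_nonroot[of "ra * rb"] ra rb by auto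
 let ?T = "\<lambda>t. transition L a b (c t <#\<^bsub>SL m\<^esub> ?H)"
 have "transition L a b \<in> regular (SL_quotient m ?H) (chart L a \<inter> chart L b)"
  using L unfolding is_line_bundle_def by blast
 then have "regular_on m (?U a \<inter> ?U b) (\<lambda>g. transition L a b (g <#\<^bsub>SL m\<^esub> ?H))"
  by (simp add: regular_quotient_iff coset_preimage_Int)
 from regular_on_curve[OF c this] have lt: "locally_rational1 {t. c t \<in> ?U a \<inter> ?U b} ?T" .
 have t1m: "t1 \<in> {t. c t \<in> ?U a \<inter> ?U b}" using t1 ra(2)[of t1] rb(2)[of t1] by auto
 then have tne: "{t. c t \<in> ?U a \<inter> ?U b} \<noteq> {}" by auto
 obtain u v where uv: "v \<noteq> 0" "\<And>t. t \<in> {t. c t \<in> ?U a \<inter> ?U b} ==> poly v t \<noteq> 0"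
  "\<And>t. t \<in> {t. c t \<in> ?U a \<inter> ?U b} ==> ?T t * poly v t = poly u t"
  by (rule locally_rational1_quotient[OF lt tne]) (rule that)
 have Tnz: "?T t \<noteq> 0" if "t \<in> {t. c t \<in> ?U a \<inter> ?U b}" for t
  using L that unfolding is_line_bundle_def by (simp add: coset_preimage_def)
 have unz: "poly u t \<noteq> 0" if "t \<in> {t. c t \<in> ?U a \<inter> ?U b}" for t
  using Tnz[OF that] uv(2)[OF that] uv(3)[OF that] by auto
 define D where "D = nat \<bar>d\<bar>"
 define A where "A = (if 0 \<le> d then u else v)"
 define B where "B = (if 0 \<le> d then v else u)"
 have AB: "?T t powi d * poly B t ^ D = poly A t ^ D" if t: "t \<in> {t. c t \<in> ?U a \<inter> ?U b}" for t
 proof -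
  have T: "?T t = poly u t / poly v t" using uv(2)[OF t] uv(3)[OF t] by (simp add: field_simps)
  show ?thesis
  proof (cases "0 \<le> d")
   case True
   then show ?thesis unfolding T using uv(2)[OF t]
    by (simp add: power_int_def A_def B_def D_def power_divide)
  next
   case False
   then show ?thesis unfolding T using uv(2)[OF t] unz[OF t]
    by (simp add: power_int_def A_def B_def D_def power_divide)
  qed
 qed
 have prod_eq: "p1 * B ^ D * q = A ^ D * p * q1"
 proof (rule poly_eq_on_dense[of "ra * rb"])
  show "ra * rb \<noteq> 0" using ra rb by simp
  fix t assume "poly (ra * rb) t \<noteq> 0"
  then have t: "c t \<in> ?U a" "c t \<in> ?U b" using ra(2)[of t] rb(2)[of t] by auto
  then have tm: "t \<in> {t. c t \<in> ?U a \<inter> ?U b}" by simp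
  have "poly (p1 * B ^ D * q) t = \<theta> b (c t) * poly q1 t * poly B t ^ D * poly q t"
   using 1(3)[of t] t by simp
  also have "\<dots> = (?T t powi d * poly B t ^ D) * (\<theta> a (c t) * poly q t) * poly q1 t"
   by (simp add: tr[OF t])
  also have "\<dots> = poly (A ^ D * p * q1) t" unfolding AB[OF tm] pq[OF t(1)] by simp
  finally show "poly (p1 * B ^ D * q) t = poly (A ^ D * p * q1) t" .
 qed
 have ord: "order t0 p1 = 0" "order t0 q1 = 0" "p1 \<noteq> 0"
 proof -
  have "poly p1 t0 \<noteq> 0" "poly q1 t0 \<noteq> 0" using 1(2)[of t0] 1(3)[of t0] b \<theta>nz[OF b] by auto
  then show "order t0 p1 = 0" "order t0 q1 = 0" "p1 \<noteq> 0" by (auto simp: order_0I)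
 qed
 have ABnz: "A \<noteq> 0" "B \<noteq> 0" using unz[OF t1m] uv(1) by (auto simp: A_def B_def)
 have "order t0 (p1 * B ^ D * q) = D * order t0 B + order t0 q"
  using nz 1(1) ord ABnz by (simp add: order_mult order_power_eq)
 moreover have "order t0 (A ^ D * p * q1) = D * order t0 A + order t0 p"
  using nz 1(1) ord ABnz by (simp add: order_mult order_power_eq)
 ultimately have "D * order t0 B + order t0 q = D * order t0 A + order t0 p"
  unfolding prod_eq by simp
 then have "int D * int (order t0 B) + int (order t0 q) = int D * int (order t0 A) + int (order t0 p)"
  by (metis of_nat_add of_nat_mult)
 then have "int (order t0 p) - int (order t0 q) = int D * (int (order t0 B) - int (order t0 A))"
  by (simp add: algebra_simps)
 moreover have "d dvd int D" by (simp add: D_def)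
 ultimately show ?thesis by simp
qed

text \<open>The images in \<open>SL\<^sub>m / P\<^bsub>l+1\<^esub>\<close> of the next two curves are the two affine charts of a projective line; for
 \<open>t \<noteq> 0\<close> the points \<open>t\<close> and \<open>s = 1/t\<close> agree, with \<open>change_of_line\<close> as the transition matrix and the character
 \<open>t\<close>.  The second curve has the block with rows \<open>(s, -1)\<close> and \<open>(1, 0)\<close>.\<close>

definition affine_line :: "nat => nat => 'a::field => 'a mat" where
 "affine_line m l t = add_column_matrix m (Suc l) l t"

definition line_at_infinity :: "nat => nat => 'a::field => 'a mat" where
 "line_at_infinity m l s = 1\<^sub>m m * add_column_matrix m l (Suc l) (- 1) * add_column_matrix m (Suc l) l 1 *
  add_column_matrix m l (Suc l) (- 1) * add_column_matrix m (Suc l) l (- s)"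

definition change_of_line :: "nat => nat => 'a::field => 'a mat" where
 "change_of_line m l t = add_column_matrix m l (Suc l) t *
  scale_columns_matrix m (\<lambda>i. if i = l then t else if i = Suc l then 1 / t else 1)"

lemma affine_line_SL: "Suc l < m ==> affine_line m l t \<in> carrier (SL m)"
 by (simp add: affine_line_def SL_iff det_add_column_matrix)

lemma line_at_infinity_SL: "Suc l < m ==> line_at_infinity m l s \<in> carrier (SL m)"
 unfolding line_at_infinity_def by (intro SL_mult) (auto simp: SL_iff det_add_column_matrix)

lemma line_at_infinity_entry:
 assumes l: "Suc l < m" and ij: "i < m" "j < m"
 shows "line_at_infinity m l s $$ (i, j) = (if i = l then if j = l then s else if j = Suc l then - 1 else 0
  else if i = Suc l then if j = l then 1 else 0 else if i = j then 1 else 0)"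
proof -
 have E: "(A * add_column_matrix m a b c) $$ (i, j) = A $$ (i, j) + (if j = b then c * A $$ (i, a) else 0)"
  if "A \<in> carrier_mat m m" "i < m" "j < m" "a < m" "a \<noteq> b" for A a b c i j
  using mult_add_column_matrix[OF that] .
 have car: "A * add_column_matrix m a b c \<in> carrier_mat m m" if "A \<in> carrier_mat m m" for A :: "'a mat" and a b c
  by (rule mult_carrier_mat[OF that elementary_carrier(1)])
 show ?thesis unfolding line_at_infinity_def using l ij
  by (simp add: E car del: left_mult_one_mat)
qed

lemma affine_line_change:
 assumes l: "Suc l < m" and t: "t \<noteq> 0"
 shows "affine_line m l t = line_at_infinity m l (1 / t) * change_of_line m l t"
proof (rule eq_matI)
 have car: "line_at_infinity m l (1 / t) \<in> carrier_mat m m" using line_at_infinity_SL[OF l, of "1/t"] by (simp add: SL_iff)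
 fix i j assume "i < dim_row (line_at_infinity m l (1 / t) * change_of_line m l t)"
  "j < dim_col (line_at_infinity m l (1 / t) * change_of_line m l t)"
 then have ij: "i < m" "j < m" using car by (auto simp: change_of_line_def scale_columns_matrix_def)
 let ?N = "line_at_infinity m l (1 / t)" and ?E = "add_column_matrix m l (Suc l) t"
  and ?S = "scale_columns_matrix m (\<lambda>i. if i = l then t else if i = Suc l then 1 / t else 1)"
 have "?N * change_of_line m l t = ?N * ?E * ?S"
  unfolding change_of_line_def using car by (simp add: assoc_mult_mat[of _ m m _ m _ m])
 then have "(?N * change_of_line m l t) $$ (i, j) = (?N * ?E * ?S) $$ (i, j)" by simp
 also have "\<dots> = (?N * ?E) $$ (i, j) * (if j = l then t else if j = Suc l then 1 / t else 1)"
  by (rule mult_scale_columns_matrix[OF _ ij]) (use car in \<open>auto simp: mult_carrier_mat[of _ m m]\<close>)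
 also have "(?N * ?E) $$ (i, j) = ?N $$ (i, j) + (if j = Suc l then t * ?N $$ (i, l) else 0)"
  by (rule mult_add_column_matrix[OF car ij]) (use l in auto)
 finally show "affine_line m l t $$ (i, j) = (?N * change_of_line m l t) $$ (i, j)"
  using l ij t by (simp add: line_at_infinity_entry affine_line_def add_column_matrix_def)
qed (use line_at_infinity_SL[OF l, of "1/t"] in \<open>auto simp: affine_line_def add_column_matrix_def change_of_line_def scale_columns_matrix_def SL_iff\<close>)

lemma change_of_line:
 assumes l: "Suc l < m" and t: "t \<noteq> 0"
 shows "change_of_line m l t \<in> parabolic m (Suc l)" "character (Suc l) (change_of_line m l t) = t"
proof -
 let ?d = "\<lambda>i. if i = l then t else if i = Suc l then 1 / t else 1"
 have entry: "change_of_line m l t $$ (i, j) = add_column_matrix m l (Suc l) t $$ (i, j) * ?d j" if "i < m" "j < m" for i j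
  unfolding change_of_line_def by (rule mult_scale_columns_matrix[OF _ that]) simp
 have "(\<Prod>i<m. ?d i) = (\<Prod>i<m. if i = l then t else 1) * (\<Prod>i<m. if i = Suc l then 1 / t else 1)"
  unfolding prod.distrib[symmetric] by (intro prod.cong) auto
 also have "\<dots> = 1" using l t by (subst (1 2) prod.delta) auto
 finally have "det (change_of_line m l t) = 1"
  unfolding change_of_line_def by (simp add: det_mult[of _ m] det_add_column_matrix det_scale_columns_matrix)
 then have "change_of_line m l t \<in> carrier (SL m)"
  by (simp add: SL_iff change_of_line_def mult_carrier_mat[of _ m m])
 then show "change_of_line m l t \<in> parabolic m (Suc l)"
  using l by (auto simp: parabolic_def entry add_column_matrix_def)
 have "mat (Suc l) (Suc l) (\<lambda>(i, j). change_of_line m l t $$ (i, j)) = scale_columns_matrix (Suc l) ?d"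
  using l by (intro eq_matI) (auto simp: entry add_column_matrix_def scale_columns_matrix_def)
 then have "character (Suc l) (change_of_line m l t) = (\<Prod>i<Suc l. ?d i)"
  by (simp only: character_def det_scale_columns_matrix)
 also have "\<dots> = (\<Prod>i<Suc l. if i = l then t else 1)" by (intro prod.cong) auto
 also have "\<dots> = t" by (subst prod.delta) auto
 finally show "character (Suc l) (change_of_line m l t) = t" .
qed

lemma affine_line_curve: "Suc l < m ==> polynomial_curve m (affine_line m l)"
 unfolding polynomial_curve_def
proof (intro conjI allI impI)
 fix i j assume ij: "i < m" "j < m"
 show "\<exists>p. \<forall>t. affine_line m l t $$ (i, j) = poly p t"
  by (intro exI[of _ "if i = j then 1 else if i = Suc l \<and> j = l then [:0, 1:] else 0"])
   (use ij in \<open>auto simp: affine_line_def add_column_matrix_def\<close>)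
qed (rule affine_line_SL)

lemma line_at_infinity_curve: "Suc l < m ==> polynomial_curve m (line_at_infinity m l)"
 unfolding polynomial_curve_def
proof (intro conjI allI impI)
 fix i j assume ij: "i < m" "j < m" "Suc l < m"
 show "\<exists>p. \<forall>s. line_at_infinity m l s $$ (i, j) = poly p s"
  by (intro exI[of _ "if i = l then if j = l then [:0, 1:] else if j = Suc l then - 1 else 0
   else if i = Suc l then if j = l then 1 else 0 else if i = j then 1 else 0"])
   (use ij in \<open>auto simp: line_at_infinity_entry\<close>)
qed (rule line_at_infinity_SL)

text \<open>The orders of \<open>\<theta> a\<close> along the affine line add up to \<open>deg p - deg q\<close>, and its order at infinity is
 \<open>1 + deg q - deg p\<close>, where 1 comes from the character.  All of them are divisible by \<open>d\<close>, hence so is their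
 sum 1.\<close>

lemma frame_unit:
 fixes L :: "(nat, 'a::{alg_closed_field, field_char_0} mat set, 'a) line_bundle"
 assumes l: "Suc l < m" and L: "is_line_bundle (SL_quotient m (parabolic m (Suc l))) L" and fr: "frame m (Suc l) L d \<theta>"
 shows "d dvd 1"
proof -
 let ?U = "chart_preimage m (Suc l) L" and ?H = "parabolic m (Suc l) :: 'a mat set"
 have reg: "regular_on m (?U a) (\<theta> a)" for a using fr unfolding frame_def by blast
 have \<theta>nz: "\<theta> a g \<noteq> 0" if "g \<in> ?U a" for a g using fr that unfolding frame_def by blast
 have \<theta>q: "\<theta> a (g * q) = character (Suc l) q * \<theta> a g" if "g \<in> ?U a" "q \<in> ?H" for a g q
  using fr that unfolding frame_def by blast
 let ?c = "affine_line m l" and ?e = "line_at_infinity m l"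
 note c = affine_line_curve[OF l] and e = line_at_infinity_curve[OF l]
 have ch: "?c t \<in> ?U a \<longleftrightarrow> ?e (1 / t) \<in> ?U a" if "t \<noteq> 0" for t a
  using coset_mult(1)[OF parabolic_subgroup line_at_infinity_SL[OF l] change_of_line(1)[OF l that], of "1 / t"]
   l affine_line_SL[OF l, of t] line_at_infinity_SL[OF l, of "1 / t"]
  by (simp add: coset_preimage_def flip: affine_line_change[OF l that])
 obtain a where a: "?c 0 \<in> ?U a" using chart_preimage_cover[OF L affine_line_SL[OF l, of 0]] by (elim exE)
 have lc: "locally_rational1 {t. ?c t \<in> ?U a} (\<lambda>t. \<theta> a (?c t))" by (rule regular_on_curve[OF c reg])
 have cne: "{t. ?c t \<in> ?U a} \<noteq> {}" using a by auto
 obtain r where r: "r \<noteq> 0" "\<And>t. poly r t \<noteq> 0 ==> ?c t \<in> ?U a"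
  using locally_rational1_open[OF lc cne] by auto
 obtain t1 where t1: "poly (r * [:0, 1:]) t1 \<noteq> 0" using poly_nonroot[of "r * [:0, 1:]"] r by auto
 then have ene: "?e (1 / t1) \<in> ?U a" using ch[of t1 a] r(2)[of t1] by auto
 have le: "locally_rational1 {s. ?e s \<in> ?U a} (\<lambda>s. \<theta> a (?e s))" by (rule regular_on_curve[OF e reg])
 have ene': "{s. ?e s \<in> ?U a} \<noteq> {}" using ene by auto
 obtain re where re: "re \<noteq> 0" "\<And>s. poly re s \<noteq> 0 ==> ?e s \<in> ?U a"
  using locally_rational1_open[OF le ene'] by auto
 obtain p q where pq: "q \<noteq> 0" "\<And>t. t \<in> {t. ?c t \<in> ?U a} ==> poly q t \<noteq> 0"
  "\<And>t. t \<in> {t. ?c t \<in> ?U a} ==> \<theta> a (?c t) * poly q t = poly p t"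
  by (rule locally_rational1_quotient[OF lc cne]) (rule that)
 obtain p' q' where pq': "q' \<noteq> 0" "\<And>t. t \<in> {s. ?e s \<in> ?U a} ==> poly q' t \<noteq> 0"
  "\<And>t. t \<in> {s. ?e s \<in> ?U a} ==> \<theta> a (?e t) * poly q' t = poly p' t"
  by (rule locally_rational1_quotient[OF le ene']) (rule that)
 have "poly p 0 \<noteq> 0" using pq(2)[of 0] pq(3)[of 0] a \<theta>nz[OF a] by auto
 then have p0: "p \<noteq> 0" by auto
 have "poly p' (1 / t1) \<noteq> 0" using pq'(2)[of "1 / t1"] pq'(3)[of "1 / t1"] ene \<theta>nz[OF ene] by auto
 then have p'0: "p' \<noteq> 0" by auto
 have ord: "d dvd int (order t0 p) - int (order t0 q)" for t0
  by (rule frame_orders[OF L fr c, of a]) (use a p0 pq in auto)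
 let ?S = "{t. poly p t = 0} \<union> {t. poly q t = 0}"
 have fin: "finite ?S" using poly_roots_finite p0 pq(1) by blast
 have "int (degree p) - int (degree q) = (\<Sum>t\<in>?S. int (order t p) - int (order t q))"
  using degree_sum_order[OF p0 fin] degree_sum_order[OF pq(1) fin] by (simp add: sum_subtractf)
 then have deg: "d dvd int (degree p) - int (degree q)" using ord by (simp add: dvd_sum)
 have ord': "d dvd int (order 0 p') - int (order 0 q')"
  by (rule frame_orders[OF L fr e, of a]) (use ene p'0 pq' in auto)
 have "reflect_poly p * q' * monom 1 (1 + degree q) = p' * reflect_poly q * monom 1 (degree p)"
 proof (rule poly_eq_on_dense[of "re * [:0, 1:]"])
  show "re * [:0, 1:] \<noteq> 0" using re by simp
  fix s assume "poly (re * [:0, 1:]) s \<noteq> 0"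
  then have s: "s \<noteq> 0" "?e s \<in> ?U a" using re(2)[of s] by auto
  have is0: "1 / s \<noteq> 0" "1 / (1 / s) = s" using s by auto
  then have cs: "?c (1 / s) \<in> ?U a" using ch[OF is0(1), of a] s(2) by simp
  have "\<theta> a (?c (1 / s)) = (1 / s) * \<theta> a (?e s)"
   using \<theta>q[OF s(2) change_of_line(1)[OF l is0(1)]] change_of_line(2)[OF l is0(1)]
    affine_line_change[OF l is0(1)] is0(2) by simp
  then have th: "\<theta> a (?e s) = s * \<theta> a (?c (1 / s))" using s by simp
  have "poly p (1 / s) * poly q' s * s = poly p' s * poly q (1 / s)"
  proof -
   have "\<theta> a (?c (1 / s)) * poly q (1 / s) = poly p (1 / s)" using pq(3)[of "1 / s"] cs by simp
   moreover have "s * \<theta> a (?c (1 / s)) * poly q' s = poly p' s" using pq'(3)[of s] s(2) unfolding th[symmetric] by simp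
   ultimately show ?thesis by (simp only: mult_ac flip: \<open>\<theta> a (?c (1 / s)) * poly q (1 / s) = poly p (1 / s)\<close> \<open>s * \<theta> a (?c (1 / s)) * poly q' s = poly p' s\<close>)
  qed
  then have "(s ^ degree p * poly p (1 / s)) * poly q' s * (s * s ^ degree q) = poly p' s * (s ^ degree q * poly q (1 / s)) * s ^ degree p"
   by (simp add: mult_ac)
  then show "poly (reflect_poly p * q' * monom 1 (1 + degree q)) s = poly (p' * reflect_poly q * monom 1 (degree p)) s"
   using s by (simp add: poly_reflect_poly_nz poly_monom inverse_eq_divide)
 qed
 then have "order 0 (reflect_poly p * q' * monom 1 (1 + degree q)) = order 0 (p' * reflect_poly q * monom 1 (degree p))"
  by simp
 moreover have "order 0 (reflect_poly p) = 0" "order 0 (reflect_poly q) = 0"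
  using p0 pq(1) by (auto intro!: order_0I simp: poly_0_coeff_0)
 moreover have mon: "order 0 (monom 1 N :: 'a poly) = N" for N
  using order_power_n_n[of "0::'a" N] by (simp add: monom_altdef)
 moreover have "reflect_poly p \<noteq> 0" "reflect_poly q \<noteq> 0" using p0 pq(1) by auto
 ultimately have "order 0 q' + (1 + degree q) = order 0 p' + degree p"
  using pq'(1) p'0 by (simp add: order_mult)
 then have "(1::int) = (int (order 0 p') - int (order 0 q')) + (int (degree p) - int (degree q))" by linarith
 then show ?thesis using dvd_add[OF ord' deg] by simp
qed

lemma global_sectionsD:
 assumes "s \<in> global_sections Y L"
 shows "s i \<in> regular Y (chart L i)" "x \<notin> chart L i ==> s i x = 0"
  "x \<in> chart L i ==> x \<in> chart L j ==> s i x = transition L i j x * s j x"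
proof -
 have s: "(\<forall>i. s i \<in> regular Y (chart L i)) \<and> (\<forall>i x. x \<notin> chart L i --> s i x = 0) \<and>
  (\<forall>i j. \<forall>x\<in>chart L i \<inter> chart L j. s i x = transition L i j x * s j x)"
  using assms unfolding global_sections_def by (rule CollectD)
 from s[THEN conjunct1] show "s i \<in> regular Y (chart L i)" by (rule spec)
 from s[THEN conjunct2, THEN conjunct1] show "s i x = 0" if "x \<notin> chart L i" using that by (elim allE impE)
 from s[THEN conjunct2, THEN conjunct2] show "s i x = transition L i j x * s j x" if "x \<in> chart L i" "x \<in> chart L j"
  using that by (elim allE ballE) auto
qed

text \<open>For \<open>d = -1\<close>, a section of \<open>L\<^bsup>d'\<^esup>\<close> with \<open>d' > 0\<close> divided by \<open>\<theta>\<^bsup>d'\<^esup>\<close> would be a regular function \<open>f\<close> on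
 \<open>SL\<^sub>m\<close> of negative weight.  On the projective line it gives polynomials with \<open>t\<^bsup>d'\<^esup> P0(t) = P1(1/t)\<close>, which
 vanish.  Ampleness provides a section that does not vanish at the point \<open>t = 0\<close>.\<close>

lemma frame_not_minus_one:
 fixes L :: "(nat, 'a::{alg_closed_field, field_char_0} mat set, 'a) line_bundle"
 assumes l: "Suc l < m" and L: "is_line_bundle (SL_quotient m (parabolic m (Suc l))) L"
  and amp: "ample (SL_quotient m (parabolic m (Suc l))) L"
 shows "\<not> frame m (Suc l) L (- 1) \<theta>"
proof
 assume fr: "frame m (Suc l) L (- 1) \<theta>"
 let ?U = "chart_preimage m (Suc l) L" and ?H = "parabolic m (Suc l) :: 'a mat set"
 let ?Y = "SL_quotient m ?H"
 have reg: "regular_on m (?U a) (\<theta> a)" for a using fr unfolding frame_def by blast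
 have \<theta>nz: "\<theta> a g \<noteq> 0" if "g \<in> ?U a" for a g using fr that unfolding frame_def by blast
 have \<theta>q: "\<theta> a (g * q) = character (Suc l) q * \<theta> a g" if "g \<in> ?U a" "q \<in> ?H" for a g q
  using fr that unfolding frame_def by blast
 have tr: "\<theta> b g = transition L a b (g <#\<^bsub>SL m\<^esub> ?H) powi (- 1) * \<theta> a g" if "g \<in> ?U a" "g \<in> ?U b" for a b g
  using fr that unfolding frame_def by blast
 let ?c = "affine_line m l" and ?e = "line_at_infinity m l"
 let ?x = "?c 0 <#\<^bsub>SL m\<^esub> ?H"
 have "?x \<in> topspace (zariski ?Y)" unfolding topspace_quotient using affine_line_SL[OF l] by (rule imageI)
 then obtain d s where d: "0 < d" "s \<in> global_sections ?Y (bundle_power L d)" "?x \<in> nonvanishing_locus (bundle_power L d) s"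
  using amp unfolding ample_def by blast
 have s1: "regular_on m (?U a) (\<lambda>g. s a (g <#\<^bsub>SL m\<^esub> ?H))" for a
  using global_sectionsD(1)[OF d(2), of a] by (simp add: bundle_power_def regular_quotient_iff)
 have s2: "s a x = transition L a b x powi d * s b x" if "x \<in> chart L a" "x \<in> chart L b" for a b x
  using global_sectionsD(3)[OF d(2), of x a b] that by (simp add: bundle_power_def)
 obtain a0 where a0: "?x \<in> chart L a0" "s a0 ?x \<noteq> 0"
  using d(3) by (auto simp: nonvanishing_locus_def bundle_power_def)
 define N where "N = nat d"
 have N: "0 < N" "T powi d = T ^ N" for T :: 'a using d(1) by (auto simp: N_def power_int_def)
 define f where "f g = (let a = SOME a. g \<in> ?U a in s a (g <#\<^bsub>SL m\<^esub> ?H) / \<theta> a g ^ N)" for g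
 have f: "f g = s a (g <#\<^bsub>SL m\<^esub> ?H) / \<theta> a g ^ N" if g: "g \<in> ?U a" for a g
 proof -
  define b where "b = (SOME a. g \<in> ?U a)"
  have b: "g \<in> ?U b" unfolding b_def by (rule someI[of _ a]) (rule g)
  let ?y = "g <#\<^bsub>SL m\<^esub> ?H"
  have y: "?y \<in> chart L a" "?y \<in> chart L b" using g b by (auto simp: coset_preimage_def)
  have T: "transition L a b ?y \<noteq> 0" using L y unfolding is_line_bundle_def by blast
  have "\<theta> a g = transition L a b ?y * \<theta> b g" using tr[OF g b] T by (simp add: field_simps)
  then have "s a ?y / \<theta> a g ^ N = s b ?y / \<theta> b g ^ N"
   using s2[OF y] T by (simp add: N(2) power_mult_distrib)
  then show ?thesis by (simp add: f_def Let_def flip: b_def)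
 qed
 have freg: "regular_on m (carrier (SL m)) f"
  unfolding regular_on_def
 proof (rule fractional_local)
  fix x :: "'a mat" assume "x \<in> carrier (SL m)"
  from chart_preimage_cover[OF L this] obtain a where a: "x \<in> ?U a" by (elim exE)
  have sub: "?U a \<subseteq> carrier (SL m)" by (auto simp: coset_preimage_def)
  have "fractional (carrier (SL m)) (matrix_entries m) (?U a \<inter> ?U a) (\<lambda>g. s a (g <#\<^bsub>SL m\<^esub> ?H) / \<theta> a g ^ N)"
   by (rule fractional_divide[OF s1[unfolded regular_on_def] fractional_power[OF reg[unfolded regular_on_def] sub] sub]) (simp add: \<theta>nz)
  then have "fractional (carrier (SL m)) (matrix_entries m) (?U a \<inter> ?U a) f"
   by (rule fractional_cong[rotated]) (simp add: f)
  then show "\<exists>V. x \<in> V \<and> V \<subseteq> carrier (SL m) \<and> fractional (carrier (SL m)) (matrix_entries m) V f"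
   using a sub by (intro exI[of _ "?U a"]) simp
 qed
 have UC: "{t. ?c t \<in> carrier (SL m)} = UNIV" "{t. ?e t \<in> carrier (SL m)} = UNIV"
  using affine_line_SL[OF l] line_at_infinity_SL[OF l] by auto
 obtain P0 where P0: "\<And>t. f (?c t) = poly P0 t"
  by (rule locally_rational1_UNIV[OF regular_on_curve[OF affine_line_curve[OF l] freg, unfolded UC]]) (rule that)
 obtain P1 where P1: "\<And>t. f (?e t) = poly P1 t"
  by (rule locally_rational1_UNIV[OF regular_on_curve[OF line_at_infinity_curve[OF l] freg, unfolded UC]]) (rule that)
 have "P0 * monom 1 (N + degree P1) = reflect_poly P1"
 proof (rule poly_eq_on_dense[of "[:0, 1:]"])
  fix t :: 'a assume "poly [:0, 1:] t \<noteq> 0"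
  then have t: "t \<noteq> 0" by simp
  obtain a where a: "?e (1 / t) \<in> ?U a" using chart_preimage_cover[OF L line_at_infinity_SL[OF l, of "1 / t"]] by (elim exE)
  note q = change_of_line[OF l t]
  have co: "(?e (1 / t) * change_of_line m l t) <#\<^bsub>SL m\<^esub> ?H = ?e (1 / t) <#\<^bsub>SL m\<^esub> ?H"
   "?e (1 / t) * change_of_line m l t \<in> carrier (SL m)"
   using coset_mult[OF parabolic_subgroup line_at_infinity_SL[OF l] q(1)] l by auto
  then have "?e (1 / t) * change_of_line m l t \<in> ?U a" using a by (simp add: coset_preimage_def)
  then have "f (?c t) = s a (?e (1 / t) <#\<^bsub>SL m\<^esub> ?H) / (t * \<theta> a (?e (1 / t))) ^ N"
   unfolding affine_line_change[OF l t] using co(1) \<theta>q[OF a q(1)] q(2) by (simp add: f)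
  also have "\<dots> = f (?e (1 / t)) / t ^ N" by (simp add: f[OF a] power_mult_distrib)
  finally have "poly P0 t * t ^ N = poly P1 (1 / t)" using t by (simp add: P0 P1)
  then have "poly P0 t * t ^ N * t ^ degree P1 = t ^ degree P1 * poly P1 (1 / t)" by simp
  then show "poly (P0 * monom 1 (N + degree P1)) t = poly (reflect_poly P1) t"
   using t by (simp add: poly_reflect_poly_nz poly_monom inverse_eq_divide power_add mult_ac)
 qed simp
 moreover have "P0 \<noteq> 0"
 proof -
  have "?c 0 \<in> ?U a0" using a0(1) affine_line_SL[OF l] by (simp add: coset_preimage_def)
  then have "f (?c 0) \<noteq> 0" using a0(2) \<theta>nz by (simp add: f)
  then show ?thesis using P0[of 0] by auto
 qed
 ultimately have "degree P0 + (N + degree P1) = degree (reflect_poly P1)"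
  by (metis degree_monom_eq degree_mult_eq monom_eq_0_iff one_neq_zero)
 moreover have "degree (reflect_poly P1) \<le> degree P1" by (rule degree_reflect_poly_le)
 ultimately show False using N(1) by simp
qed

theorem ample_generator_frame:
 fixes L :: "(nat, 'a::{alg_closed_field, field_char_0} mat set, 'a) line_bundle"
 assumes k: "0 < k" "k < m" and L: "ample_generator (SL_quotient m (parabolic m k)) L"
 shows "\<exists>\<theta>. frame m k L 1 \<theta>"
proof -
 obtain l where l: "k = Suc l" using k(1) by (cases k) auto
 have lb: "is_line_bundle (SL_quotient m (parabolic m k)) L" "ample (SL_quotient m (parabolic m k)) L"
  "generates_Pic (SL_quotient m (parabolic m k)) L"
  using L by (auto simp: ample_generator_def)
 obtain d \<theta> where fr: "frame m k L d \<theta>"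
  using exists_frame[OF _ lb(1,3)] k by auto
 have "d dvd 1" using frame_unit[of l m L d \<theta>] fr lb(1) k l by simp
 moreover have "d \<noteq> - 1" using frame_not_minus_one[of l m L \<theta>] fr lb(1,2) k l by auto
 ultimately have "d = 1" by (auto simp: zdvd1_eq abs_if split: if_splits)
 then show ?thesis using fr by blast
qed

section \<open>The grading by multidegrees\<close>

definition entry_polys :: "nat => nat => 'a::field mpoly set" where
 "entry_polys m n = {P. \<forall>\<beta>\<in>keys P. keys \<beta> \<subseteq> entry_vars m n}"

lemma entry_polys_mult:
 assumes "P \<in> entry_polys m n" "Q \<in> entry_polys m n"
 shows "P * Q \<in> entry_polys m n"
 unfolding entry_polys_def mem_Collect_eq
proof
 fix \<beta> assume "\<beta> \<in> keys (P * Q)"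
 then obtain \<gamma> \<delta> where "\<beta> = \<gamma> + \<delta>" "\<gamma> \<in> keys P" "\<delta> \<in> keys Q" using keys_mult[of P Q] by blast
 then show "keys \<beta> \<subseteq> entry_vars m n"
  using assms Poly_Mapping.keys_add[of \<gamma> \<delta>] unfolding entry_polys_def by blast
qed

lemma entry_polys_add:
 assumes "P \<in> entry_polys m n" "Q \<in> entry_polys m n"
 shows "P + Q \<in> entry_polys m n"
 using assms Poly_Mapping.keys_add[of P Q] unfolding entry_polys_def by blast

lemma entry_polys_Const: "Const c \<in> entry_polys m n"
 by (auto simp: entry_polys_def Const_def)

lemma entry_polys_sum: "(\<And>i. i \<in> I ==> f i \<in> entry_polys m n) ==> sum f I \<in> entry_polys m n"
 using entry_polys_Const[of 0] by (induction I rule: infinite_finite_induct) (auto intro: entry_polys_add)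

text \<open>Generic values of the entries occur as the first columns of elements of \<open>SL\<^sub>m\<close>.\<close>

lemma entry_polys_eqI:
 fixes P Q :: "'a::field_char_0 mpoly"
 assumes nm: "n < m" and PQ: "P \<in> entry_polys m n" "Q \<in> entry_polys m n"
  and eq: "\<And>g. g \<in> carrier (SL m) ==> eval (entries m n g) P = eval (entries m n g) Q"
 shows "P = Q"
proof (rule eval_eq_on_dense)
 show "completion_det m n (1\<^sub>m m) \<noteq> (0 :: 'a mpoly)" by (rule completion_det_nonzero) auto
 fix x :: "nat => 'a" assume x: "eval x (completion_det m n (1\<^sub>m m)) \<noteq> 0"
 let ?g = "normalised_completion m n (1\<^sub>m m) x"
 have e: "entries m n ?g v = x v" if "v \<in> entry_vars m n" for v
  using that nm by (auto simp: entry_vars_def entries_entry_var normalised_completion_columns)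
 have "eval (entries m n ?g) R = eval x R" if "R \<in> entry_polys m n" for R
  by (rule eval_cong, rule e) (use that in \<open>auto simp: entry_polys_def\<close>)
 then show "eval x P = eval x Q" using eq[OF normalised_completion_SL[OF nm x]] PQ by simp
qed

text \<open>The multidegree is read off from the column degrees, so polynomials of different multidegrees have no monomials
 in common.\<close>

definition exponent_multidegree :: "nat => nat => (nat \<Rightarrow>\<^sub>0 nat) => nat => nat" where
 "exponent_multidegree m n \<beta> k = (if k \<in> {1..n}
  then column_degree m n \<beta> (k - 1) - (if k < n then column_degree m n \<beta> k else 0) else 0)"

lemma tableau_poly_keys:
 assumes T: "T \<in> SSYT n m" and \<beta>: "\<beta> \<in> keys (tableau_poly m n T :: 'a::comm_ring_1 mpoly)"
 shows "keys \<beta> \<subseteq> entry_vars m n" "exponent_multidegree m n \<beta> = column_lengths T"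
proof -
 have 1: "keys \<beta> \<subseteq> entry_vars m n \<and> (\<forall>j<n. column_degree m n \<beta> j = shape T j)"
  using tableau_poly_flag_invariant[OF T, where 'a = 'a] \<beta> unfolding flag_invariants_def by blast
 then show "keys \<beta> \<subseteq> entry_vars m n" by simp
 show "exponent_multidegree m n \<beta> = column_lengths T"
 proof
  fix k
  show "exponent_multidegree m n \<beta> k = column_lengths T k"
   using 1 shape_beyond[OF T] by (auto simp: exponent_multidegree_def column_lengths_def not_less)
 qed
qed

definition graded_span :: "nat => nat => (nat => nat) => 'a::field mpoly set" where
 "graded_span m n a = mpoly.span (tableau_poly m n ` {T \<in> SSYT n m. column_lengths T = a})"

lemma graded_span_keys:
 assumes P: "P \<in> graded_span m n a" and \<beta>: "\<beta> \<in> keys P"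
 shows "keys \<beta> \<subseteq> entry_vars m n" "exponent_multidegree m n \<beta> = a"
proof -
 let ?C = "{P :: 'a mpoly. \<forall>\<beta>\<in>keys P. keys \<beta> \<subseteq> entry_vars m n \<and> exponent_multidegree m n \<beta> = a}"
 have "mpoly.subspace ?C"
 proof (rule mpoly.subspaceI)
  fix P Q :: "'a mpoly" and c assume PQ: "P \<in> ?C"
  then show "Const c * P \<in> ?C" using keys_Const_mult[of c P] by blast
  assume "Q \<in> ?C"
  then show "P + Q \<in> ?C" using PQ Poly_Mapping.keys_add[of P Q] by blast
 qed simp
 moreover have "tableau_poly m n ` {T \<in> SSYT n m. column_lengths T = a} \<subseteq> ?C"
 proof (rule image_subsetI)
  fix T assume "T \<in> {T \<in> SSYT n m. column_lengths T = a}"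
  then have T: "T \<in> SSYT n m" "column_lengths T = a" by simp_all
  then show "tableau_poly m n T \<in> ?C" using tableau_poly_keys[OF T(1), where 'a = 'a] by simp
 qed
 ultimately have "graded_span m n a \<subseteq> ?C"
  unfolding graded_span_def by (rule mpoly.span_minimal[rotated])
 then show "keys \<beta> \<subseteq> entry_vars m n" "exponent_multidegree m n \<beta> = a" using P \<beta> by blast+
qed

lemma graded_span_entry_polys: "graded_span m n a \<subseteq> entry_polys m n"
 using graded_span_keys(1) unfolding entry_polys_def by blast

lemma graded_span_independent:
 fixes p :: "(nat => nat) => 'a::field mpoly"
 assumes "finite S" and p: "\<And>a. a \<in> S ==> p a \<in> graded_span m n a" and zero: "(\<Sum>a\<in>S. p a) = 0" and a: "a \<in> S"
 shows "p a = 0"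
proof (rule ccontr)
 assume "p a \<noteq> 0"
 then obtain \<beta> where \<beta>: "\<beta> \<in> keys (p a)" using keys_nonempty by blast
 have "lookup (p b) \<beta> = 0" if "b \<in> S - {a}" for b
  using graded_span_keys(2)[OF p[OF a] \<beta>] graded_span_keys(2)[OF p, of b \<beta>] that by (auto simp: in_keys_iff)
 then have "(\<Sum>b\<in>S - {a}. lookup (p b) \<beta>) = 0" by simp
 moreover have "lookup (\<Sum>b\<in>S. p b) \<beta> = lookup (p a) \<beta> + (\<Sum>b\<in>S - {a}. lookup (p b) \<beta>)"
  using assms(1) a by (simp add: lookup_add lookup_sum sum.remove)
 ultimately show False using zero \<beta> by (simp add: in_keys_iff)
qed

section \<open>Sections as semi-invariant functions\<close>

text \<open>Line bundles with frames \<open>\<theta> k\<close>; below, \<open>W \<iota>\<close> is the preimage in \<open>SL\<^sub>m\<close> of a chart of the monomial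
 bundles, and \<open>\<Theta> a \<iota>\<close> is the frame of \<open>L\<^bsup>a\<^esup>\<close> on it.\<close>

locale flag_bundles =
 fixes n m :: nat and L :: "nat => (nat, 'a::{alg_closed_field, field_char_0} mat set, 'a) line_bundle"
  and \<theta> :: "nat => nat => 'a mat => 'a"
 assumes nm: "0 < n" "n < m"
  and line_bundle: "\<And>k. k \<in> {1..n} ==> is_line_bundle (SL_quotient m (parabolic m k)) (L k)"
  and frame: "\<And>k. k \<in> {1..n} ==> frame m k (L k) 1 (\<theta> k)"
begin

abbreviation Q :: "'a mat set" where "Q \<equiv> flag_parabolic n m"
abbreviation Y :: "('a mat set, 'a) variety" where "Y \<equiv> SL_quotient m Q"
abbreviation coset :: "'a mat => 'a mat set" where "coset g \<equiv> g <#\<^bsub>SL m\<^esub> Q"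

definition pulled_back :: "nat => (nat, 'a mat set, 'a) line_bundle" where
 "pulled_back k = bundle_pullback Y (\<lambda>C. C <#>\<^bsub>SL m\<^esub> parabolic m k) (L k)"

definition monomial_bundle :: "(nat => nat) => (nat => nat, 'a mat set, 'a) line_bundle" where
 "monomial_bundle a = bundle_monomial n pulled_back a"

definition W :: "(nat => nat) => 'a mat set" where
 "W \<iota> = {g \<in> carrier (SL m). \<forall>k\<in>{1..n}. g \<in> chart_preimage m k (L k) (\<iota> k)}"

definition \<Theta> :: "(nat => nat) => (nat => nat) => 'a mat => 'a" where
 "\<Theta> a \<iota> g = (\<Prod>k\<in>{1..n}. \<theta> k (\<iota> k) g ^ a k)"

lemma Q_subgroup: "subgroup Q (SL m)" by (rule flag_parabolic_subgroup) (use nm in auto)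

lemma Q_parabolic: "q \<in> Q ==> k \<in> {1..n} ==> q \<in> parabolic m k" by (auto simp: flag_parabolic_def)

lemma coset_parabolic:
 assumes g: "g \<in> carrier (SL m)" and k: "k \<in> {1..n}"
 shows "coset g <#>\<^bsub>SL m\<^esub> parabolic m k = g <#\<^bsub>SL m\<^esub> parabolic m k"
proof -
 interpret group "SL m :: 'a mat monoid" by (rule SL_group)
 have P: "subgroup (parabolic m k :: 'a mat set) (SL m)" by (rule parabolic_subgroup) (use k nm in auto)
 have "Q <#>\<^bsub>SL m\<^esub> parabolic m k = parabolic m k"
 proof
  show "Q <#>\<^bsub>SL m\<^esub> parabolic m k \<subseteq> parabolic m k"
   using subgroup.m_closed[OF P Q_parabolic[OF _ k]] by (auto simp: set_mult_def)
  show "parabolic m k \<subseteq> Q <#>\<^bsub>SL m\<^esub> parabolic m k"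
  proof
   fix q :: "'a mat" assume q: "q \<in> parabolic m k"
   have "q = \<one>\<^bsub>SL m\<^esub> \<otimes>\<^bsub>SL m\<^esub> q" using l_one[of q] subgroup.mem_carrier[OF P q] by simp
   then show "q \<in> Q <#>\<^bsub>SL m\<^esub> parabolic m k"
    using q subgroup.one_closed[OF Q_subgroup] unfolding set_mult_def by blast
  qed
 qed
 then show ?thesis
  using setmult_lcos_assoc[OF subgroup.subset[OF Q_subgroup] subgroup.subset[OF P] g] by simp
qed

lemma coset_in_chart:
 assumes g: "g \<in> carrier (SL m)"
 shows "coset g \<in> chart (monomial_bundle a) \<iota> \<longleftrightarrow> g \<in> W \<iota>"
proof -
 have "coset g \<in> topspace (zariski Y)" unfolding topspace_quotient using g by (rule imageI)
 then show ?thesis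
  using g by (auto simp: monomial_bundle_def bundle_monomial_def pulled_back_def bundle_pullback_def W_def
    coset_preimage_def coset_parabolic)
qed

lemma chart_coset:
 assumes "x \<in> chart (monomial_bundle a) \<iota>"
 shows "\<exists>g\<in>W \<iota>. x = coset g"
proof -
 have "x \<in> chart (pulled_back 1) (\<iota> 1)"
  using assms nm by (auto simp: monomial_bundle_def bundle_monomial_def)
 then have "x \<in> topspace (zariski Y)" by (simp add: pulled_back_def bundle_pullback_def)
 then have "x \<in> (\<lambda>g. coset g) ` carrier (SL m)" by (simp only: topspace_quotient)
 then obtain g where g: "x = coset g" "g \<in> carrier (SL m)" by (rule imageE)
 then show ?thesis using coset_in_chart[OF g(2)] assms by auto
qed

lemma coset_preimage_chart: "coset_preimage m Q (chart (monomial_bundle a) \<iota>) = W \<iota>"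
proof -
 have "W \<iota> \<subseteq> carrier (SL m)" by (auto simp: W_def)
 then show ?thesis using coset_in_chart unfolding coset_preimage_def by blast
qed

lemma W_carrier: "g \<in> W \<iota> ==> g \<in> carrier (SL m)" by (simp add: W_def)

lemma W_cover:
 assumes g: "g \<in> carrier (SL m)"
 shows "\<exists>\<iota>. g \<in> W \<iota>"
proof -
 have "\<forall>k\<in>{1..n}. \<exists>i. g \<in> chart_preimage m k (L k) i" using chart_preimage_cover[OF line_bundle g] by blast
 then have "\<exists>\<iota>. \<forall>k\<in>{1..n}. g \<in> chart_preimage m k (L k) (\<iota> k)" by (rule bchoice)
 then show ?thesis using g by (auto simp: W_def)
qed

lemma W_mult:
 assumes g: "g \<in> W \<iota>" and q: "q \<in> Q"
 shows "g * q \<in> W \<iota>" "coset (g * q) = coset g"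
proof -
 note c = coset_mult[OF Q_subgroup W_carrier[OF g] q]
 show "coset (g * q) = coset g" by (rule c(1))
 then show "g * q \<in> W \<iota>" using coset_in_chart[OF W_carrier[OF g]] coset_in_chart[OF c(2)] g by simp
qed

lemma \<Theta>_nonzero: "g \<in> W \<iota> ==> \<Theta> a \<iota> g \<noteq> 0"
 using frame by (auto simp: \<Theta>_def W_def frame_def)

lemma \<Theta>_mult:
 assumes g: "g \<in> W \<iota>" and q: "q \<in> Q"
 shows "\<Theta> a \<iota> (g * q) = (\<Prod>k\<in>{1..n}. character k q ^ a k) * \<Theta> a \<iota> g"
proof -
 have "\<theta> k (\<iota> k) (g * q) = character k q * \<theta> k (\<iota> k) g" if k: "k \<in> {1..n}" for k
  using frame[OF k] g Q_parabolic[OF q k] k unfolding frame_def W_def by blast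
 then show ?thesis by (simp add: \<Theta>_def power_mult_distrib prod.distrib)
qed

lemma \<Theta>_transition:
 assumes g: "g \<in> W \<iota>" "g \<in> W \<kappa>"
 shows "\<Theta> a \<kappa> g = transition (monomial_bundle a) \<iota> \<kappa> (coset g) * \<Theta> a \<iota> g"
proof -
 have "\<theta> k (\<kappa> k) g = transition (L k) (\<iota> k) (\<kappa> k) (g <#\<^bsub>SL m\<^esub> parabolic m k) powi 1 * \<theta> k (\<iota> k) g" if k: "k \<in> {1..n}" for k
  using frame[OF k] g k unfolding frame_def W_def by blast
 then have "\<theta> k (\<kappa> k) g = transition (L k) (\<iota> k) (\<kappa> k) (coset g <#>\<^bsub>SL m\<^esub> parabolic m k) * \<theta> k (\<iota> k) g" if "k \<in> {1..n}" for k
  using that coset_parabolic[OF W_carrier[OF g(1)] that] by simp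
 then show ?thesis
  by (simp add: \<Theta>_def monomial_bundle_def bundle_monomial_def pulled_back_def bundle_pullback_def
    power_mult_distrib prod.distrib)
qed

lemma \<Theta>_add: "\<Theta> (\<lambda>k. a k + b k) \<iota> g = \<Theta> a \<iota> g * \<Theta> b \<iota> g"
 by (simp add: \<Theta>_def power_add prod.distrib)

lemma SL_fractional_polynomial:
 "p \<in> polynomial_functions (matrix_entries m) ==> fractional (carrier (SL m)) (matrix_entries m) (carrier (SL m)) p"
 using openin_topspace[of "zariski_topology (carrier (SL m)) (matrix_entries m)"]
 by (intro fractional_polynomial) (simp_all add: topspace_zariski)

lemma \<Theta>_fractional: "fractional (carrier (SL m)) (matrix_entries m) (W \<iota>) (\<Theta> a \<iota>)"
proof -
 let ?W = "\<lambda>K. {g \<in> carrier (SL m). \<forall>k\<in>K. g \<in> chart_preimage m k (L k) (\<iota> k)}"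
 have "fractional (carrier (SL m)) (matrix_entries m) (?W K) (\<lambda>g. \<Prod>k\<in>K. \<theta> k (\<iota> k) g ^ a k)"
  if "finite K" "K \<subseteq> {1..n}" for K
  using that
 proof (induction K)
  case empty
  show ?case using SL_fractional_polynomial[OF polynomial_functions.const[of 1]] by simp
 next
  case (insert k K)
  let ?U = "chart_preimage m k (L k) (\<iota> k)"
  have sub: "?U \<subseteq> carrier (SL m)" by (auto simp: coset_preimage_def)
  have "fractional (carrier (SL m)) (matrix_entries m) ?U (\<theta> k (\<iota> k))"
   using frame[of k] insert unfolding frame_def regular_on_def by simp
  from fractional_mult[OF fractional_power[OF this sub, of "a k"] insert.IH sub]
  have "fractional (carrier (SL m)) (matrix_entries m) (?U \<inter> ?W K) (\<lambda>g. \<theta> k (\<iota> k) g ^ a k * (\<Prod>k\<in>K. \<theta> k (\<iota> k) g ^ a k))"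
   using insert by simp
  moreover have "?U \<inter> ?W K = ?W (insert k K)" using sub by auto
  ultimately show ?case using insert by simp
 qed
 from this[of "{1..n}"] show ?thesis unfolding W_def \<Theta>_def[abs_def] by simp
qed

text \<open>A section corresponds to its coefficient with respect to the frame, a global semi-invariant function \<open>f\<close>.\<close>

definition represents :: "(nat => nat) => ((nat => nat) => 'a mat set => 'a) => ('a mat => 'a) => bool" where
 "represents a s f \<longleftrightarrow> (\<forall>\<iota> x. x \<notin> chart (monomial_bundle a) \<iota> --> s \<iota> x = 0) \<and>
  regular_on m (carrier (SL m)) f \<and> semi_invariant n m a f \<and>
  (\<forall>\<iota>. \<forall>g\<in>W \<iota>. s \<iota> (coset g) * \<Theta> a \<iota> g = f g)"

lemma section_represents:
 assumes s: "s \<in> global_sections Y (monomial_bundle a)"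
 shows "\<exists>f. represents a s f"
proof -
 define f where "f g = (let \<iota> = SOME \<iota>. g \<in> W \<iota> in s \<iota> (coset g) * \<Theta> a \<iota> g)" for g
 have f: "f g = s \<iota> (coset g) * \<Theta> a \<iota> g" if g: "g \<in> W \<iota>" for g \<iota>
 proof -
  define \<kappa> where "\<kappa> = (SOME \<iota>. g \<in> W \<iota>)"
  have \<kappa>: "g \<in> W \<kappa>" unfolding \<kappa>_def by (rule someI[of _ \<iota>]) (rule g)
  have "s \<iota> (coset g) = transition (monomial_bundle a) \<iota> \<kappa> (coset g) * s \<kappa> (coset g)"
   using global_sectionsD(3)[OF s] g \<kappa> coset_in_chart[OF W_carrier[OF g]] by blast
  then show ?thesis by (simp add: f_def Let_def \<Theta>_transition[OF g \<kappa>] flip: \<kappa>_def)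
 qed
 have "regular_on m (carrier (SL m)) f"
  unfolding regular_on_def
 proof (rule fractional_local)
  fix x :: "'a mat" assume "x \<in> carrier (SL m)"
  from W_cover[OF this] obtain \<iota> where \<iota>: "x \<in> W \<iota>" by (elim exE)
  have sub: "W \<iota> \<subseteq> carrier (SL m)" by (auto simp: W_def)
  have "s \<iota> \<in> regular Y (chart (monomial_bundle a) \<iota>)" by (rule global_sectionsD(1)[OF s])
  then have "fractional (carrier (SL m)) (matrix_entries m) (W \<iota>) (\<lambda>g. s \<iota> (coset g))"
   by (simp add: regular_quotient_iff coset_preimage_chart regular_on_def)
  from fractional_mult[OF this \<Theta>_fractional sub, of \<iota> a]
  have "fractional (carrier (SL m)) (matrix_entries m) (W \<iota>) (\<lambda>g. s \<iota> (coset g) * \<Theta> a \<iota> g)" by simp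
  then have "fractional (carrier (SL m)) (matrix_entries m) (W \<iota>) f"
   by (rule fractional_cong[rotated]) (simp add: f)
  then show "\<exists>V. x \<in> V \<and> V \<subseteq> carrier (SL m) \<and> fractional (carrier (SL m)) (matrix_entries m) V f"
   using \<iota> sub by (intro exI[of _ "W \<iota>"]) simp
 qed
 moreover have "semi_invariant n m a f"
  unfolding semi_invariant_def
 proof (intro ballI)
  fix g q :: "'a mat" assume g: "g \<in> carrier (SL m)" and q: "q \<in> Q"
  obtain \<iota> where \<iota>: "g \<in> W \<iota>" using W_cover[OF g] by (elim exE)
  show "f (g * q) = (\<Prod>k\<in>{1..n}. character k q ^ a k) * f g"
   by (simp add: f[OF W_mult(1)[OF \<iota> q]] f[OF \<iota>] W_mult(2)[OF \<iota> q] \<Theta>_mult[OF \<iota> q])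
 qed
 moreover have "s \<iota> x = 0" if "x \<notin> chart (monomial_bundle a) \<iota>" for \<iota> x
  by (rule global_sectionsD(2)[OF s that])
 ultimately have "represents a s f" unfolding represents_def using f by simp
 then show ?thesis by blast
qed

lemma represents_section:
 assumes r: "represents a s f"
 shows "s \<in> global_sections Y (monomial_bundle a)"
 unfolding global_sections_def mem_Collect_eq
proof (intro conjI allI ballI)
 have eq: "s \<iota> (coset g) = f g / \<Theta> a \<iota> g" if "g \<in> W \<iota>" for g \<iota>
  using r \<Theta>_nonzero[OF that] that by (simp add: represents_def field_simps)
 fix \<iota>
 have "fractional (carrier (SL m)) (matrix_entries m) (carrier (SL m) \<inter> W \<iota>) (\<lambda>g. f g / \<Theta> a \<iota> g)"
  by (rule fractional_divide[OF _ \<Theta>_fractional]) (use r \<Theta>_nonzero in \<open>auto simp: represents_def regular_on_def\<close>)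
 moreover have "carrier (SL m) \<inter> W \<iota> = W \<iota>" by (auto simp: W_def)
 ultimately have "fractional (carrier (SL m)) (matrix_entries m) (W \<iota>) (\<lambda>g. f g / \<Theta> a \<iota> g)" by simp
 then have "fractional (carrier (SL m)) (matrix_entries m) (W \<iota>) (\<lambda>g. s \<iota> (coset g))"
  by (rule fractional_cong[rotated]) (simp add: eq)
 then show "s \<iota> \<in> regular Y (chart (monomial_bundle a) \<iota>)"
  by (simp add: regular_quotient_iff coset_preimage_chart regular_on_def)
 fix \<kappa> x assume x: "x \<in> chart (monomial_bundle a) \<iota> \<inter> chart (monomial_bundle a) \<kappa>"
 then obtain g where g: "g \<in> W \<iota>" "x = coset g" using chart_coset[of x a \<iota>] by blast
 then have \<kappa>: "g \<in> W \<kappa>" using x coset_in_chart[OF W_carrier[OF g(1)]] by simp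
 have "s \<iota> x * \<Theta> a \<iota> g = s \<kappa> x * \<Theta> a \<kappa> g" using r g \<kappa> by (simp add: represents_def)
 then show "s \<iota> x = transition (monomial_bundle a) \<iota> \<kappa> x * s \<kappa> x"
  using \<Theta>_nonzero[OF g(1), of a] g(2) by (simp add: \<Theta>_transition[OF g(1) \<kappa>])
qed (use r in \<open>simp add: represents_def\<close>)

lemma represents_function_unique:
 assumes "represents a s f" "represents a s f'" "g \<in> carrier (SL m)"
 shows "f g = f' g"
proof -
 obtain \<iota> where "g \<in> W \<iota>" using W_cover[OF assms(3)] by (elim exE)
 then show ?thesis using assms(1,2) by (metis represents_def)
qed

lemma represents_section_unique:
 assumes r: "represents a s f" "represents a s' f'" and eq: "\<And>g. g \<in> carrier (SL m) ==> f g = f' g"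
 shows "s = s'"
proof (intro ext)
 fix \<iota> x
 show "s \<iota> x = s' \<iota> x"
 proof (cases "x \<in> chart (monomial_bundle a) \<iota>")
  case True
  then obtain g where g: "g \<in> W \<iota>" "x = coset g" using chart_coset by blast
  then have "s \<iota> x * \<Theta> a \<iota> g = s' \<iota> x * \<Theta> a \<iota> g"
   using r eq[OF W_carrier[OF g(1)]] by (simp add: represents_def)
  then show ?thesis using \<Theta>_nonzero[OF g(1)] by simp
 qed (use r in \<open>simp add: represents_def\<close>)
qed

lemma represents_exists:
 assumes f: "regular_on m (carrier (SL m)) f" "semi_invariant n m a f"
 shows "\<exists>s. represents a s f"
proof -
 define rep where "rep x = (SOME g. g \<in> carrier (SL m) \<and> x = coset g)" for x
 define s where "s \<iota> x = (if x \<in> chart (monomial_bundle a) \<iota> then f (rep x) / \<Theta> a \<iota> (rep x) else 0)" for \<iota> x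
 have "s \<iota> (coset g) * \<Theta> a \<iota> g = f g" if g: "g \<in> W \<iota>" for \<iota> g
 proof -
  let ?g = "rep (coset g)"
  have "?g \<in> carrier (SL m) \<and> coset g = coset ?g"
   unfolding rep_def by (rule someI[of _ g]) (use W_carrier[OF g] in simp)
  then obtain q where q: "q \<in> Q" "?g = g * q" using coset_eq_iff[OF Q_subgroup W_carrier[OF g]] by auto
  define \<chi> where "\<chi> = (\<Prod>k\<in>{1..n}. character k q ^ a k)"
  have nz: "\<chi> \<noteq> 0" using character_nonzero[OF Q_parabolic[OF q(1)]] nm by (simp add: \<chi>_def)
  have "f ?g = \<chi> * f g" using f(2) W_carrier[OF g] q unfolding semi_invariant_def \<chi>_def by simp
  moreover have "\<Theta> a \<iota> ?g = \<chi> * \<Theta> a \<iota> g" using \<Theta>_mult[OF g q(1)] q(2) by (simp add: \<chi>_def)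
  moreover have "s \<iota> (coset g) = f ?g / \<Theta> a \<iota> ?g" using coset_in_chart[OF W_carrier[OF g]] g by (simp add: s_def)
  ultimately show ?thesis using \<Theta>_nonzero[OF g] nz by simp
 qed
 then have "represents a s f" using f by (simp add: represents_def s_def)
 then show ?thesis by blast
qed

lemma chart_monomial_bundle: "chart (monomial_bundle a) = chart (monomial_bundle b)"
 by (simp add: monomial_bundle_def bundle_monomial_def)

lemma represents_add:
 assumes "represents a s f" "represents a t h"
 shows "represents a (\<lambda>\<iota> x. s \<iota> x + t \<iota> x) (\<lambda>g. f g + h g)"
 using assms fractional_add[of "carrier (SL m)" "matrix_entries m" "carrier (SL m)" f "carrier (SL m)" h]
 by (simp add: represents_def semi_invariant_def distrib_left distrib_right regular_on_def)

lemma represents_mult: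
 assumes s: "represents a s f" and t: "represents b t h"
 shows "represents (\<lambda>k. a k + b k) (\<lambda>\<iota> x. s \<iota> x * t \<iota> x) (\<lambda>g. f g * h g)"
 unfolding represents_def
proof (intro conjI allI ballI impI)
 fix \<iota> x assume "x \<notin> chart (monomial_bundle (\<lambda>k. a k + b k)) \<iota>"
 then show "s \<iota> x * t \<iota> x = 0"
  using s chart_monomial_bundle[of "\<lambda>k. a k + b k" a] by (simp add: represents_def)
next
 show "regular_on m (carrier (SL m)) (\<lambda>g. f g * h g)"
  using s t fractional_mult[of "carrier (SL m)" "matrix_entries m" "carrier (SL m)" f "carrier (SL m)" h]
  by (simp add: represents_def regular_on_def)
 show "semi_invariant n m (\<lambda>k. a k + b k) (\<lambda>g. f g * h g)"
  using s t by (simp add: represents_def semi_invariant_def power_add prod.distrib mult_ac)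
 fix \<iota> g assume "g \<in> W \<iota>"
 then have "s \<iota> (coset g) * \<Theta> a \<iota> g = f g" "t \<iota> (coset g) * \<Theta> b \<iota> g = h g"
  using s t by (simp_all add: represents_def)
 then show "s \<iota> (coset g) * t \<iota> (coset g) * \<Theta> (\<lambda>k. a k + b k) \<iota> g = f g * h g"
  by (simp add: \<Theta>_add mult_ac flip: \<open>s \<iota> (coset g) * \<Theta> a \<iota> g = f g\<close> \<open>t \<iota> (coset g) * \<Theta> b \<iota> g = h g\<close>)
qed

lemma represents_zero: "represents a (\<lambda>_ _. 0) (\<lambda>_. 0)"
 using SL_fractional_polynomial[OF polynomial_functions.const[of 0]]
 by (simp add: represents_def regular_on_def semi_invariant_def)

lemma represents_one:
 "represents (\<lambda>_. 0) (\<lambda>\<iota> x. if x \<in> chart (monomial_bundle (\<lambda>_. 0)) \<iota> then 1 else 0) (\<lambda>_. 1)"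
 using SL_fractional_polynomial[OF polynomial_functions.const[of 1]]
 by (simp add: represents_def regular_on_def semi_invariant_def \<Theta>_def coset_in_chart W_carrier)

lemma represents_scale:
 assumes "represents a s f"
 shows "represents a (\<lambda>\<iota> x. c * s \<iota> x) (\<lambda>g. c * f g)"
 using assms fractional_mult[OF SL_fractional_polynomial[OF polynomial_functions.const[of c]], of "carrier (SL m)" f]
 by (simp add: represents_def semi_invariant_def regular_on_def mult_ac)

lemma represents_sum:
 assumes "\<And>i. i \<in> I ==> represents a (s i) (f i)"
 shows "represents a (\<lambda>\<iota> x. \<Sum>i\<in>I. s i \<iota> x) (\<lambda>g. \<Sum>i\<in>I. f i g)"
 using assms
proof (induction I rule: infinite_finite_induct)
 case (insert i I)
 then show ?case using represents_add[of a "s i" "f i" "\<lambda>\<iota> x. \<Sum>i\<in>I. s i \<iota> x" "\<lambda>g. \<Sum>i\<in>I. f i g"] by simp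
qed (simp_all add: represents_zero)

text \<open>This is where the determination of all semi-invariants enters.\<close>

lemma represents_polynomial:
 assumes r: "represents a s f" and a: "a \<in> multidegrees n"
 shows "\<exists>p\<in>graded_span m n a. represents a s (\<lambda>g. eval (entries m n g) p)"
proof -
 obtain p where p: "p \<in> graded_span m n a" "\<forall>g\<in>carrier (SL m). f g = eval (entries m n g) p"
  using semi_invariant_spanned[OF nm _ _ a, of f] r unfolding represents_def graded_span_def by blast
 have "regular_on m (carrier (SL m)) (\<lambda>g. eval (entries m n g) p)"
  unfolding regular_on_def
  by (rule SL_fractional_polynomial, rule polynomial_functions_eval, rule entries_polynomial) (use nm in auto)
 moreover have "semi_invariant n m a (\<lambda>g. eval (entries m n g) p)"
  using r p(2) SL_mult Q_subgroup subgroup.mem_carrier[OF Q_subgroup]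
  unfolding represents_def semi_invariant_def by metis
 ultimately have "represents a s (\<lambda>g. eval (entries m n g) p)"
  using r p(2) W_carrier by (simp add: represents_def)
 then show ?thesis using p(1) by blast
qed

lemma represents_polynomial_unique:
 assumes "represents a s (\<lambda>g. eval (entries m n g) p)" "represents a s (\<lambda>g. eval (entries m n g) p')"
  and "p \<in> entry_polys m n" "p' \<in> entry_polys m n"
 shows "p = p'"
 by (rule entry_polys_eqI[OF nm(2) assms(3,4)]) (rule represents_function_unique[OF assms(1,2)])

section \<open>The section algebra as an algebra of polynomials\<close>

abbreviation A :: "('a, (nat => nat) => (nat => nat) => 'a mat set => 'a) module" where
 "A \<equiv> flag_section_algebra n m L"

abbreviation support :: "((nat => nat) => (nat => nat) => 'a mat set => 'a) => (nat => nat) set" where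
 "support F \<equiv> {a. F a \<noteq> (\<lambda>_ _. 0)}"

lemma A_eq: "A = section_algebra Y n pulled_back"
 by (simp add: flag_section_algebra_def pulled_back_def[abs_def])

lemma carrier_A: "F \<in> carrier A \<longleftrightarrow> (\<forall>a\<in>multidegrees n. \<exists>f. represents a (F a) f) \<and>
  (\<forall>a. a \<notin> multidegrees n --> F a = (\<lambda>_ _. 0)) \<and> finite (support F)"
 unfolding A_eq section_algebra_def
 using section_represents represents_section by (auto simp: monomial_bundle_def[symmetric])

lemma A_ops:
 "F \<otimes>\<^bsub>A\<^esub> G = (\<lambda>c \<iota> x. \<Sum>a | \<forall>k. a k \<le> c k. F a \<iota> x * G (\<lambda>k. c k - a k) \<iota> x)"
 "\<one>\<^bsub>A\<^esub> = (\<lambda>a \<iota> x. if (\<forall>k. a k = 0) \<and> x \<in> chart (monomial_bundle a) \<iota> then 1 else 0)"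
 "\<zero>\<^bsub>A\<^esub> = (\<lambda>_ _ _. 0)" "F \<oplus>\<^bsub>A\<^esub> G = (\<lambda>a \<iota> x. F a \<iota> x + G a \<iota> x)" "c \<odot>\<^bsub>A\<^esub> F = (\<lambda>a \<iota> x. c * F a \<iota> x)"
 by (simp_all add: A_eq section_algebra_def monomial_bundle_def)

text \<open>The polynomial that represents the part of multidegree \<open>a\<close>; it is unique because a polynomial in the entries is
 determined by its values on \<open>SL\<^sub>m\<close>.\<close>

definition component :: "((nat => nat) => (nat => nat) => 'a mat set => 'a) => (nat => nat) => 'a mpoly" where
 "component F a = (if a \<in> multidegrees n
  then SOME p. p \<in> graded_span m n a \<and> represents a (F a) (\<lambda>g. eval (entries m n g) p) else 0)"

definition \<Psi> :: "((nat => nat) => (nat => nat) => 'a mat set => 'a) => 'a mpoly" where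
 "\<Psi> F = (\<Sum>a\<in>support F. component F a)"

lemma component:
 assumes F: "F \<in> carrier A" and a: "a \<in> multidegrees n"
 shows "component F a \<in> graded_span m n a" "represents a (F a) (\<lambda>g. eval (entries m n g) (component F a))"
proof -
 obtain f where "represents a (F a) f" using F a carrier_A by blast
 from represents_polynomial[OF this a]
 obtain p where "p \<in> graded_span m n a \<and> represents a (F a) (\<lambda>g. eval (entries m n g) p)" by blast
 from someI[of "\<lambda>p. p \<in> graded_span m n a \<and> represents a (F a) (\<lambda>g. eval (entries m n g) p)", OF this]
 show "component F a \<in> graded_span m n a" "represents a (F a) (\<lambda>g. eval (entries m n g) (component F a))"
  using a by (simp_all add: component_def)
qed

lemma component_entry_polys: "F \<in> carrier A ==> component F a \<in> entry_polys m n"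
 using component(1)[of F a] graded_span_entry_polys[of m n a] entry_polys_Const[of 0]
 by (cases "a \<in> multidegrees n") (auto simp: component_def[of F a])

lemma component_graded: "F \<in> carrier A ==> component F a \<in> graded_span m n a"
 using component(1)[of F a] mpoly.span_zero by (cases "a \<in> multidegrees n") (auto simp: component_def[of F a] graded_span_def)

lemma component_eqI:
 assumes "F \<in> carrier A" "a \<in> multidegrees n" "p \<in> entry_polys m n"
  and "represents a (F a) (\<lambda>g. eval (entries m n g) p)"
 shows "component F a = p"
 using represents_polynomial_unique[OF component(2)[OF assms(1,2)] assms(4) component_entry_polys[OF assms(1)] assms(3)] .

lemma component_zero: "F \<in> carrier A ==> F a = (\<lambda>_ _. 0) ==> component F a = 0"
 using component_eqI[of F a 0] represents_zero[of a] entry_polys_Const[of 0]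
 by (cases "a \<in> multidegrees n") (auto simp: component_def[of F a])

lemma \<Psi>_superset:
 assumes F: "F \<in> carrier A" and S: "finite S" "support F \<subseteq> S"
 shows "\<Psi> F = (\<Sum>a\<in>S. component F a)"
 unfolding \<Psi>_def by (rule sum.mono_neutral_left[OF S]) (use component_zero[OF F] in auto)

lemma finite_support: "F \<in> carrier A ==> finite (support F)"
 by (simp add: carrier_A)

lemma support_add: "support (F \<oplus>\<^bsub>A\<^esub> G) \<subseteq> support F \<union> support G"
proof -
 have "(F \<oplus>\<^bsub>A\<^esub> G) a = (\<lambda>_ _. 0)" if "F a = (\<lambda>_ _. 0)" "G a = (\<lambda>_ _. 0)" for a
  using that by (simp add: A_ops)
 then show ?thesis by blast
qed

lemma carrier_add:
 assumes F: "F \<in> carrier A" and G: "G \<in> carrier A"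
 shows "F \<oplus>\<^bsub>A\<^esub> G \<in> carrier A"
 unfolding carrier_A
proof (intro conjI ballI allI impI)
 fix a assume "a \<in> multidegrees n"
 then obtain f h where "represents a (F a) f" "represents a (G a) h" using F G unfolding carrier_A by blast
 from represents_add[OF this] show "\<exists>f. represents a ((F \<oplus>\<^bsub>A\<^esub> G) a) f" by (auto simp: A_ops)
next
 fix a assume "a \<notin> multidegrees n"
 then show "(F \<oplus>\<^bsub>A\<^esub> G) a = (\<lambda>_ _. 0)" using F G by (simp add: carrier_A A_ops)
next
 show "finite (support (F \<oplus>\<^bsub>A\<^esub> G))"
  by (rule finite_subset[OF support_add]) (use finite_support[OF F] finite_support[OF G] in simp)
qed

lemma carrier_scale:
 assumes F: "F \<in> carrier A"
 shows "c \<odot>\<^bsub>A\<^esub> F \<in> carrier A"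
 unfolding carrier_A
proof (intro conjI ballI allI impI)
 fix a assume "a \<in> multidegrees n"
 then obtain f where "represents a (F a) f" using F unfolding carrier_A by blast
 from represents_scale[OF this] show "\<exists>f. represents a ((c \<odot>\<^bsub>A\<^esub> F) a) f" by (auto simp: A_ops)
next
 fix a assume "a \<notin> multidegrees n"
 then show "(c \<odot>\<^bsub>A\<^esub> F) a = (\<lambda>_ _. 0)" using F by (simp add: carrier_A A_ops)
next
 have "support (c \<odot>\<^bsub>A\<^esub> F) \<subseteq> support F" by (auto simp: A_ops fun_eq_iff)
 then show "finite (support (c \<odot>\<^bsub>A\<^esub> F))" using finite_support[OF F] finite_subset by blast
qed

lemma zero_multidegree: "(\<lambda>_. 0) \<in> multidegrees n" by (simp add: multidegrees_def)

lemma carrier_zero_one: "\<zero>\<^bsub>A\<^esub> \<in> carrier A" "\<one>\<^bsub>A\<^esub> \<in> carrier A"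
proof -
 show "\<zero>\<^bsub>A\<^esub> \<in> carrier A" using represents_zero by (auto simp: carrier_A A_ops)
 have one: "\<one>\<^bsub>A\<^esub> a = (if a = (\<lambda>_. 0) then \<lambda>\<iota> x. if x \<in> chart (monomial_bundle (\<lambda>_. 0)) \<iota> then 1 else 0 else (\<lambda>_ _. 0))" for a
  by (auto simp: A_ops fun_eq_iff chart_monomial_bundle[of a "\<lambda>_. 0"])
 show "\<one>\<^bsub>A\<^esub> \<in> carrier A"
  unfolding carrier_A
 proof (intro conjI ballI allI impI)
  fix a assume "a \<in> multidegrees n"
  show "\<exists>f. represents a (\<one>\<^bsub>A\<^esub> a) f"
   using represents_one represents_zero[of a] by (cases "a = (\<lambda>_. 0)") (auto simp: one)
 next
  fix a assume "a \<notin> multidegrees n"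
  then show "\<one>\<^bsub>A\<^esub> a = (\<lambda>_ _. 0)" using zero_multidegree by (auto simp: one)
 next
  have "support \<one>\<^bsub>A\<^esub> \<subseteq> {\<lambda>_. 0}" by (auto simp: one split: if_splits)
  then show "finite (support \<one>\<^bsub>A\<^esub>)" using finite_subset by blast
 qed
qed

lemma multidegree_split:
 assumes "\<forall>k. a k \<le> c k"
 shows "c \<in> multidegrees n \<longleftrightarrow> a \<in> multidegrees n \<and> (\<lambda>k. c k - a k) \<in> multidegrees n"
proof -
 have "c k = 0 \<longleftrightarrow> a k = 0 \<and> c k - a k = 0" for k using assms[rule_format, of k] by arith
 then show ?thesis unfolding multidegrees_def by blast
qed

lemma product_represents:
 assumes F: "F \<in> carrier A" and G: "G \<in> carrier A" and c: "c \<in> multidegrees n"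
 shows "represents c ((F \<otimes>\<^bsub>A\<^esub> G) c)
  (\<lambda>g. eval (entries m n g) (\<Sum>a | \<forall>k. a k \<le> c k. component F a * component G (\<lambda>k. c k - a k)))"
proof -
 have "represents c (\<lambda>\<iota> x. F a \<iota> x * G (\<lambda>k. c k - a k) \<iota> x)
   (\<lambda>g. eval (entries m n g) (component F a) * eval (entries m n g) (component G (\<lambda>k. c k - a k)))"
  if "a \<in> {a. \<forall>k. a k \<le> c k}" for a
 proof -
  have le: "\<forall>k. a k \<le> c k" using that by simp
  then have "a \<in> multidegrees n" "(\<lambda>k. c k - a k) \<in> multidegrees n" using multidegree_split[OF le] c by blast+
  from represents_mult[OF component(2)[OF F this(1)] component(2)[OF G this(2)]]
  show ?thesis using le by simp
 qed
 then have "represents c (\<lambda>\<iota> x. \<Sum>a | \<forall>k. a k \<le> c k. F a \<iota> x * G (\<lambda>k. c k - a k) \<iota> x)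
   (\<lambda>g. \<Sum>a | \<forall>k. a k \<le> c k. eval (entries m n g) (component F a) * eval (entries m n g) (component G (\<lambda>k. c k - a k)))"
  by (rule represents_sum)
 then show ?thesis by (simp add: A_ops eval_sum)
qed

lemma carrier_mult:
 assumes F: "F \<in> carrier A" and G: "G \<in> carrier A"
 shows "F \<otimes>\<^bsub>A\<^esub> G \<in> carrier A" "support (F \<otimes>\<^bsub>A\<^esub> G) \<subseteq> (\<lambda>(a, b) k. a k + b k) ` (support F \<times> support G)"
proof -
 show sup: "support (F \<otimes>\<^bsub>A\<^esub> G) \<subseteq> (\<lambda>(a, b) k. a k + b k) ` (support F \<times> support G)"
 proof
  fix c assume c: "c \<in> support (F \<otimes>\<^bsub>A\<^esub> G)"
  have "\<exists>a. (\<forall>k. a k \<le> c k) \<and> F a \<noteq> (\<lambda>_ _. 0) \<and> G (\<lambda>k. c k - a k) \<noteq> (\<lambda>_ _. 0)"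
  proof (rule ccontr)
   assume n: "\<not> ?thesis"
   have z: "F a \<iota> x * G (\<lambda>k. c k - a k) \<iota> x = 0" if "\<forall>k. a k \<le> c k" for a \<iota> x
   proof -
    have "F a = (\<lambda>_ _. 0) \<or> G (\<lambda>k. c k - a k) = (\<lambda>_ _. 0)" using n that by blast
    then show ?thesis by auto
   qed
   have "(F \<otimes>\<^bsub>A\<^esub> G) c = (\<lambda>_ _. 0)" unfolding A_ops by (intro ext sum.neutral ballI, rule z) simp
   then show False using c by simp
  qed
  then obtain a where a: "\<forall>k. a k \<le> c k" "F a \<noteq> (\<lambda>_ _. 0)" "G (\<lambda>k. c k - a k) \<noteq> (\<lambda>_ _. 0)" by (elim exE conjE)
  show "c \<in> (\<lambda>(a, b) k. a k + b k) ` (support F \<times> support G)"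
   by (rule image_eqI[of _ _ "(a, \<lambda>k. c k - a k)"]) (use a in auto)
 qed
 have fin: "finite (support (F \<otimes>\<^bsub>A\<^esub> G))"
  using finite_subset[OF sup] finite_support[OF F] finite_support[OF G] by simp
 have "(F \<otimes>\<^bsub>A\<^esub> G) c = (\<lambda>_ _. 0)" if "c \<notin> multidegrees n" for c
 proof -
  have z: "F a \<iota> x * G (\<lambda>k. c k - a k) \<iota> x = 0" if "\<forall>k. a k \<le> c k" for a \<iota> x
  proof -
   have "a \<notin> multidegrees n \<or> (\<lambda>k. c k - a k) \<notin> multidegrees n"
    using multidegree_split[OF that] \<open>c \<notin> multidegrees n\<close> by blast
   then have "F a = (\<lambda>_ _. 0) \<or> G (\<lambda>k. c k - a k) = (\<lambda>_ _. 0)" using F G carrier_A by blast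
   then show ?thesis by auto
  qed
  show ?thesis unfolding A_ops by (intro ext sum.neutral ballI, rule z) simp
 qed
 then show "F \<otimes>\<^bsub>A\<^esub> G \<in> carrier A" unfolding carrier_A using product_represents[OF F G] fin by blast
qed

lemma component_add:
 assumes F: "F \<in> carrier A" and G: "G \<in> carrier A"
 shows "component (F \<oplus>\<^bsub>A\<^esub> G) a = component F a + component G a"
proof (cases "a \<in> multidegrees n")
 case True
 show ?thesis
  by (rule component_eqI[OF carrier_add[OF F G] True entry_polys_add[OF component_entry_polys[OF F] component_entry_polys[OF G]]])
   (use represents_add[OF component(2)[OF F True] component(2)[OF G True]] in \<open>simp add: A_ops\<close>)
qed (simp add: component_def)

lemma component_scale:
 assumes F: "F \<in> carrier A"
 shows "component (c \<odot>\<^bsub>A\<^esub> F) a = Const c * component F a"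
proof (cases "a \<in> multidegrees n")
 case True
 show ?thesis
  by (rule component_eqI[OF carrier_scale[OF F] True entry_polys_mult[OF entry_polys_Const component_entry_polys[OF F]]])
   (use represents_scale[OF component(2)[OF F True]] in \<open>simp add: A_ops\<close>)
qed (simp add: component_def)

lemma component_mult:
 assumes F: "F \<in> carrier A" and G: "G \<in> carrier A" and c: "c \<in> multidegrees n"
 shows "component (F \<otimes>\<^bsub>A\<^esub> G) c = (\<Sum>a | \<forall>k. a k \<le> c k. component F a * component G (\<lambda>k. c k - a k))"
 by (rule component_eqI[OF carrier_mult(1)[OF F G] c _ product_represents[OF F G c]])
  (intro entry_polys_sum entry_polys_mult component_entry_polys F G)

lemma \<Psi>_add:
 assumes F: "F \<in> carrier A" and G: "G \<in> carrier A"
 shows "\<Psi> (F \<oplus>\<^bsub>A\<^esub> G) = \<Psi> F + \<Psi> G"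
proof -
 let ?S = "support F \<union> support G"
 have S: "finite ?S" using finite_support F G by simp
 show ?thesis
  using \<Psi>_superset[OF carrier_add[OF F G] S support_add] \<Psi>_superset[OF F S] \<Psi>_superset[OF G S]
  by (simp add: component_add[OF F G] sum.distrib)
qed

lemma \<Psi>_scale:
 assumes F: "F \<in> carrier A"
 shows "\<Psi> (c \<odot>\<^bsub>A\<^esub> F) = Const c * \<Psi> F"
proof -
 have "support (c \<odot>\<^bsub>A\<^esub> F) \<subseteq> support F" by (auto simp: A_ops fun_eq_iff)
 then show ?thesis
  using \<Psi>_superset[OF carrier_scale[OF F] finite_support[OF F]]
  by (simp add: component_scale[OF F] \<Psi>_def sum_distrib_left)
qed

lemma finite_below:
 assumes "c \<in> multidegrees n"
 shows "finite {a. \<forall>k. a k \<le> c k}"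
proof -
 have "{a. \<forall>k. a k \<le> c k} \<subseteq> {a. \<forall>k. (k \<in> {1..n} --> a k \<in> {..Max (c ` {1..n})}) \<and> (k \<notin> {1..n} --> a k = 0)}"
 proof
  fix a assume "a \<in> {a. \<forall>k. a k \<le> c k}"
  then have a: "a k \<le> c k" for k by simp
  have "a k \<le> Max (c ` {1..n})" if "k \<in> {1..n}" for k
   by (rule order_trans[OF a Max_ge]) (use that in auto)
  moreover have "a k = 0" if "k \<notin> {1..n}" for k
  proof -
   have "c k = 0" using assms that unfolding multidegrees_def by blast
   then show ?thesis using a[of k] by simp
  qed
  ultimately show "a \<in> {a. \<forall>k. (k \<in> {1..n} --> a k \<in> {..Max (c ` {1..n})}) \<and> (k \<notin> {1..n} --> a k = 0)}" by blast
 qed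
 moreover have "finite {a. \<forall>k. (k \<in> {1..n} --> a k \<in> {..Max (c ` {1..n})}) \<and> (k \<notin> {1..n} --> a k = 0)}"
  by (rule finite_set_of_finite_funs) auto
 ultimately show ?thesis by (rule finite_subset)
qed

lemma \<Psi>_mult:
 assumes F: "F \<in> carrier A" and G: "G \<in> carrier A"
 shows "\<Psi> (F \<otimes>\<^bsub>A\<^esub> G) = \<Psi> F * \<Psi> G"
proof -
 let ?f = "component F" and ?g = "component G"
 let ?add = "\<lambda>(a, b) k. a k + b k :: nat"
 let ?P = "support F \<times> support G"
 have fin: "finite ?P" using finite_support F G by simp
 have md: "a \<in> multidegrees n" if "a \<in> support H" "H \<in> carrier A" for a H
  using that carrier_A by blast
 have inner: "component (F \<otimes>\<^bsub>A\<^esub> G) c = (\<Sum>p | p \<in> ?P \<and> ?add p = c. ?f (fst p) * ?g (snd p))" if c: "c \<in> ?add ` ?P" for c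
 proof -
  obtain a0 b0 where ab: "a0 \<in> support F" "b0 \<in> support G" "c = (\<lambda>k. a0 k + b0 k)" using c by auto
  have "c \<in> multidegrees n"
   using md[OF ab(1) F] md[OF ab(2) G] ab(3) by (simp add: multidegrees_def)
  note cm = this
  let ?B = "{a. (\<forall>k. a k \<le> c k) \<and> a \<in> support F \<and> (\<lambda>k. c k - a k) \<in> support G}"
  have "component (F \<otimes>\<^bsub>A\<^esub> G) c = (\<Sum>a | \<forall>k. a k \<le> c k. ?f a * ?g (\<lambda>k. c k - a k))"
   by (rule component_mult[OF F G cm])
  also have "\<dots> = (\<Sum>a\<in>?B. ?f a * ?g (\<lambda>k. c k - a k))"
  proof (rule sum.mono_neutral_right[OF finite_below[OF cm]])
   show "\<forall>a\<in>{a. \<forall>k. a k \<le> c k} - ?B. ?f a * ?g (\<lambda>k. c k - a k) = 0"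
   proof
    fix a assume "a \<in> {a. \<forall>k. a k \<le> c k} - ?B"
    then have "F a = (\<lambda>_ _. 0) \<or> G (\<lambda>k. c k - a k) = (\<lambda>_ _. 0)" by blast
    then show "?f a * ?g (\<lambda>k. c k - a k) = 0" using component_zero[OF F] component_zero[OF G] by auto
   qed
  qed blast
  also have "\<dots> = (\<Sum>p | p \<in> ?P \<and> ?add p = c. ?f (fst p) * ?g (snd p))"
  proof (rule sum.reindex_bij_witness[of _ fst "\<lambda>a. (a, \<lambda>k. c k - a k)"])
   fix a assume "a \<in> ?B"
   then show "(a, \<lambda>k. c k - a k) \<in> {p. p \<in> ?P \<and> ?add p = c}" by (auto simp: fun_eq_iff)
  next
   fix p assume "p \<in> {p. p \<in> ?P \<and> ?add p = c}"
   then have p: "fst p \<in> support F" "snd p \<in> support G" "c = (\<lambda>k. fst p k + snd p k)" by (auto simp: case_prod_beta)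
   then have e: "(\<lambda>k. c k - fst p k) = snd p" by simp
   show "(fst p, \<lambda>k. c k - fst p k) = p" unfolding e by simp
   show "fst p \<in> ?B" unfolding mem_Collect_eq e using p by simp
  qed simp_all
  finally show ?thesis .
 qed
 have "\<Psi> (F \<otimes>\<^bsub>A\<^esub> G) = (\<Sum>c\<in>?add ` ?P. component (F \<otimes>\<^bsub>A\<^esub> G) c)"
  by (rule \<Psi>_superset[OF carrier_mult(1)[OF F G] finite_imageI[OF fin] carrier_mult(2)[OF F G]])
 also have "\<dots> = (\<Sum>c\<in>?add ` ?P. \<Sum>p | p \<in> ?P \<and> ?add p = c. ?f (fst p) * ?g (snd p))"
  by (rule sum.cong[OF refl inner])
 also have "\<dots> = (\<Sum>p\<in>?P. ?f (fst p) * ?g (snd p))"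
  by (rule sum.group[OF fin finite_imageI[OF fin] subset_refl])
 also have "\<dots> = \<Psi> F * \<Psi> G"
  unfolding \<Psi>_def sum_product by (simp add: sum.cartesian_product case_prod_beta)
 finally show ?thesis .
qed

lemma \<Psi>_zero: "\<Psi> \<zero>\<^bsub>A\<^esub> = 0"
 by (simp add: \<Psi>_def A_ops)

lemma \<Psi>_one: "\<Psi> \<one>\<^bsub>A\<^esub> = 1"
proof -
 have sup: "support \<one>\<^bsub>A\<^esub> \<subseteq> {\<lambda>_. 0}" by (auto simp: A_ops fun_eq_iff)
 have "\<one>\<^bsub>A\<^esub> (\<lambda>_. 0) = (\<lambda>\<iota> x. if x \<in> chart (monomial_bundle (\<lambda>_. 0)) \<iota> then 1 else 0)"
  by (simp add: A_ops)
 then have "component \<one>\<^bsub>A\<^esub> (\<lambda>_. 0) = 1"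
  using component_eqI[OF carrier_zero_one(2) zero_multidegree, of 1] represents_one entry_polys_Const[of "1::'a" m n] by simp
 then show ?thesis using \<Psi>_superset[OF carrier_zero_one(2) _ sup] by simp
qed

text \<open>Polynomials of different multidegrees are linearly independent, and each represents only one section.\<close>

lemma \<Psi>_inj: "inj_on \<Psi> (carrier A)"
proof (rule inj_onI)
 fix F G assume F: "F \<in> carrier A" and G: "G \<in> carrier A" and eq: "\<Psi> F = \<Psi> G"
 let ?S = "support F \<union> support G"
 have S: "finite ?S" using finite_support F G by simp
 have "(\<Sum>a\<in>?S. component F a - component G a) = 0"
  using eq \<Psi>_superset[OF F S] \<Psi>_superset[OF G S] by (simp add: sum_subtractf)
 moreover have "component F a - component G a \<in> graded_span m n a" for a
  using component_graded[OF F, of a] component_graded[OF G, of a] unfolding graded_span_def by (rule mpoly.span_diff)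
 ultimately have comp: "component F a - component G a = 0" if "a \<in> ?S" for a
  using graded_span_independent[OF S, of "\<lambda>a. component F a - component G a" m n a] that by blast
 show "F = G"
 proof
  fix a
  show "F a = G a"
  proof (cases "a \<in> ?S")
   case True
   then have a: "a \<in> multidegrees n" using F G carrier_A by blast
   show ?thesis
    by (rule represents_section_unique[OF component(2)[OF F a] component(2)[OF G a]]) (use comp[OF True] in simp)
  qed simp
 qed
qed

lemma \<Psi>_embedding: "algebra_embedding A Const \<Psi>"
 by (unfold_locales)
  (use Const_hom \<Psi>_inj carrier_zero_one carrier_add carrier_mult(1) carrier_scale \<Psi>_zero \<Psi>_one \<Psi>_add \<Psi>_mult \<Psi>_scale in
   \<open>auto simp: comm_ring_hom_def\<close>)

lemma tableau_poly_in_range: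
 assumes T: "T \<in> SSYT n m"
 shows "tableau_poly m n T \<in> \<Psi> ` carrier A"
proof -
 let ?a = "column_lengths T" and ?p = "tableau_poly m n T :: 'a mpoly"
 have a: "?a \<in> multidegrees n" by (rule column_lengths_multidegree[OF T])
 have "regular_on m (carrier (SL m)) (\<lambda>g. eval (entries m n g) ?p)"
  unfolding regular_on_def
  by (rule SL_fractional_polynomial, rule polynomial_functions_eval, rule entries_polynomial) (use nm in auto)
 from represents_exists[OF this tableau_poly_semi_invariant[OF nm T]]
 obtain s where s: "represents ?a s (\<lambda>g. eval (entries m n g) ?p)" by (elim exE)
 define F where "F = (\<lambda>b. if b = ?a then s else (\<lambda>_ _. 0))"
 have sup: "support F \<subseteq> {?a}" by (auto simp: F_def split: if_splits)
 have F: "F \<in> carrier A"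
  unfolding carrier_A
 proof (intro conjI ballI allI impI)
  fix b
  show "\<exists>f. represents b (F b) f" using s represents_zero[of b] by (cases "b = ?a") (auto simp: F_def)
 next
  fix b assume "b \<notin> multidegrees n"
  then show "F b = (\<lambda>_ _. 0)" using a by (auto simp: F_def)
 qed (rule finite_subset[OF sup], simp)
 have "?p \<in> entry_polys m n" using tableau_poly_keys(1)[OF T, where 'a = 'a] by (auto simp: entry_polys_def)
 then have "component F ?a = ?p" using component_eqI[OF F a] s by (simp add: F_def)
 then have "?p = \<Psi> F" using \<Psi>_superset[OF F _ sup] by simp
 then show ?thesis using F by (rule image_eqI)
qed

text \<open>Every product of minors is semi-invariant and therefore comes from a section.\<close>

lemma \<Psi>_range: "\<Psi> ` carrier A = mpoly.span (tableau_poly m n ` SSYT n m)"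
proof
 show "\<Psi> ` carrier A \<subseteq> mpoly.span (tableau_poly m n ` SSYT n m)"
 proof (rule image_subsetI)
  fix F assume F: "F \<in> carrier A"
  have "graded_span m n a \<subseteq> mpoly.span (tableau_poly m n ` SSYT n m)" for a
   unfolding graded_span_def by (rule mpoly.span_mono) blast
  then show "\<Psi> F \<in> mpoly.span (tableau_poly m n ` SSYT n m)"
   unfolding \<Psi>_def using component_graded[OF F] by (intro mpoly.span_sum) blast
 qed
 have "mpoly.subspace (\<Psi> ` carrier A)"
 proof (rule mpoly.subspaceI)
  show "0 \<in> \<Psi> ` carrier A" using \<Psi>_zero carrier_zero_one(1) by (metis image_eqI)
  fix P R assume P: "P \<in> \<Psi> ` carrier A"
  then obtain F where F: "P = \<Psi> F" "F \<in> carrier A" by (rule imageE)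
  show "Const c * P \<in> \<Psi> ` carrier A" for c
   unfolding F(1) \<Psi>_scale[OF F(2), symmetric] by (rule imageI[OF carrier_scale[OF F(2)]])
  assume "R \<in> \<Psi> ` carrier A"
  then obtain G where G: "R = \<Psi> G" "G \<in> carrier A" by (rule imageE)
  show "P + R \<in> \<Psi> ` carrier A"
   unfolding F(1) G(1) \<Psi>_add[OF F(2) G(2), symmetric] by (rule imageI[OF carrier_add[OF F(2) G(2)]])
 qed
 then show "mpoly.span (tableau_poly m n ` SSYT n m) \<subseteq> \<Psi> ` carrier A"
  using tableau_poly_in_range by (intro mpoly.span_minimal) auto
qed

text \<open>A tableau polynomial is the product of the minors of its columns; the finitely many tableaux with one column
 serve as generators.\<close>

theorem sections_degenerate: "flat_degeneration A (monoid_algebra (SSYT_monoid n m) :: ('a, nat list list \<Rightarrow>\<^sub>0 'a) module)"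
proof (rule topped_basis.rees_flat_degeneration[where \<Psi> = \<Psi> and b = "tableau_poly m n" and \<alpha> = "tableau_exponent m n"
   and w = "exponent_weight m n" and gens = "(\<lambda>l. map (\<lambda>e. [e]) l) ` (columns n m - {[]})"])
 have monoid: "carrier (SSYT_monoid n m) = SSYT n m" "\<one>\<^bsub>SSYT_monoid n m\<^esub> = []" "T \<otimes>\<^bsub>SSYT_monoid n m\<^esub> T' = star T T'" for T T'
  by (simp_all add: SSYT_monoid_def)
 let ?single = "\<lambda>l :: nat list. map (\<lambda>e. [e]) l"
 have single: "tableau_poly m n (?single l) = (minor m n l :: 'a mpoly)" "tableau_exponent m n (?single l) = column_exponent m n l"
  if "l \<in> columns n m" "l \<noteq> []" for l
  using column_tableau[OF that] by (simp_all add: tableau_poly_def tableau_exponent_columns)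
 show "topped_basis A \<Psi> (SSYT_monoid n m) (tableau_poly m n) (tableau_exponent m n) (exponent_weight m n) (?single ` (columns n m - {[]}))"
 proof (rule topped_basis.intro)
  show "algebra_embedding A Const \<Psi>" by (rule \<Psi>_embedding)
  show "\<Psi> ` carrier A = mpoly.span (tableau_poly m n ` carrier (SSYT_monoid n m))" by (simp add: \<Psi>_range monoid)
  show "exponent_weight m n (\<beta> + \<gamma>) = exponent_weight m n \<beta> + exponent_weight m n \<gamma>" for \<beta> \<gamma>
   by (rule exponent_weight_add)
  show "\<one>\<^bsub>SSYT_monoid n m\<^esub> \<in> carrier (SSYT_monoid n m)" by (simp add: monoid SSYT_def)
  show "tableau_exponent m n \<one>\<^bsub>SSYT_monoid n m\<^esub> = 0" by (simp add: monoid tableau_exponent_Nil)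
  show "finite (?single ` (columns n m - {[]}))" using finite_columns by simp
  show "?single ` (columns n m - {[]}) \<subseteq> carrier (SSYT_monoid n m)" using column_tableau(1) by (auto simp: monoid)
  fix T assume "T \<in> carrier (SSYT_monoid n m)"
  then have T: "T \<in> SSYT n m" by (simp add: monoid)
  show "topped (\<lambda>\<beta> \<gamma>. exponent_weight m n \<beta> < exponent_weight m n \<gamma>) (tableau_exponent m n T) (tableau_poly m n T :: 'a mpoly)"
   using topped_tableau_poly(1)[OF T, where 'a = 'a] by (simp add: weight_less_def[abs_def])
  let ?xs = "map (\<lambda>c. ?single (tableau_column T c)) [0..<width T]"
  have col: "tableau_column T c \<in> columns n m" "tableau_column T c \<noteq> []" if "c < width T" for c
  proof -
   show "tableau_column T c \<in> columns n m" by (rule tableau_column_in_columns[OF T])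
   have "0 < length (tableau_column T c)"
    using that length_tableau_column[OF T, of 0 c] by (auto simp: width_def tableau_row_def split: if_splits)
   then show "tableau_column T c \<noteq> []" by simp
  qed
  have "set ?xs \<subseteq> ?single ` (columns n m - {[]})" using col by auto
  moreover have "tableau_poly m n T = prod_list (map (tableau_poly m n) ?xs :: 'a mpoly list)"
  proof -
   have "map (tableau_poly m n) ?xs = map (\<lambda>c. minor m n (tableau_column T c) :: 'a mpoly) [0..<width T]"
    using single(1)[OF col] by simp
   then show ?thesis
    by (simp add: tableau_poly_def atLeast0LessThan flip: prod.distinct_set_conv_list)
  qed
  moreover have "tableau_exponent m n T = sum_list (map (tableau_exponent m n) ?xs)"
  proof -
   have "map (tableau_exponent m n) ?xs = map (\<lambda>c. column_exponent m n (tableau_column T c)) [0..<width T]"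
    using single(2)[OF col] by simp
   then show ?thesis
    by (simp add: tableau_exponent_columns[OF T] atLeast0LessThan flip: sum.distinct_set_conv_list)
  qed
  ultimately show "\<exists>xs. set xs \<subseteq> ?single ` (columns n m - {[]}) \<and> tableau_poly m n T = prod_list (map (tableau_poly m n) xs :: 'a mpoly list) \<and>
    tableau_exponent m n T = sum_list (map (tableau_exponent m n) xs)" by blast
  fix T' assume "T' \<in> carrier (SSYT_monoid n m)"
  then have T': "T' \<in> SSYT n m" by (simp add: monoid)
  show "T \<otimes>\<^bsub>SSYT_monoid n m\<^esub> T' \<in> carrier (SSYT_monoid n m)" using star_closed[OF T T'] by (simp add: monoid)
  show "tableau_exponent m n (T \<otimes>\<^bsub>SSYT_monoid n m\<^esub> T') = tableau_exponent m n T + tableau_exponent m n T'"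
   by (simp add: monoid tableau_exponent_star)
  show "T = T'" if "tableau_exponent m n T = tableau_exponent m n T'" by (rule tableau_exponent_inj[OF T T' that])
 qed
qed

end

section \<open>The degeneration of the flag variety\<close>

theorem theorem5p5:
  fixes n m :: nat
    and L :: "nat \<Rightarrow> (nat, 'a::{alg_closed_field, field_char_0} mat set, 'a) line_bundle"
  assumes "0 < n" and "n < m"
    and "\<And>k. k \<in> {1..n} \<Longrightarrow> ample_generator (SL_quotient m (parabolic m k)) (L k)"
  shows "flat_degeneration (flag_section_algebra n m L)
           (tableaux_algebra n m :: ('a, nat list list \<Rightarrow>\<^sub>0 'a) module)"
proof -
  have "\<forall>k\<in>{1..n}. \<exists>\<theta>. frame m k (L k) 1 \<theta>"
  proof
    fix k assume k: "k \<in> {1..n}"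
    show "\<exists>\<theta>. frame m k (L k) 1 \<theta>" by (rule ample_generator_frame[OF _ _ assms(3)[OF k]]) (use k assms(2) in auto)
  qed
  then have "\<exists>\<theta>. \<forall>k\<in>{1..n}. frame m k (L k) 1 (\<theta> k)" by (rule bchoice)
  then obtain \<theta> where \<theta>: "\<forall>k\<in>{1..n}. frame m k (L k) 1 (\<theta> k)" by (elim exE)
  interpret flag_bundles n m L \<theta>
    by unfold_locales (use assms \<theta> in \<open>auto simp: ample_generator_def\<close>)
  show ?thesis unfolding tableaux_algebra_def by (rule sections_degenerate)
qed

end
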